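(* For every (unoriented) anchored $SL(3)$ foam $F$, the evaluation $\langle F\rangle$ lies in the polynomial ring $R_x'=\Bbbk[x_1,x_2,x_3]$.
   Context: $\Bbbk$ is a field of characteristic $2$, and $L=\{(0,0)\}\times\mathbb{R}\subset\mathbb{R}^3$. A (closed, unoriented) $SL(3)$ foam is a compact 2-dimensional CW complex with PL structure, PL-embedded in $\mathbb{R}^3$, in which each point has a neighborhood that is an open disk (regular point), the product of a tripod and an open interval (seam point), or the cone over the 1-skeleton of a tetrahedron (seam vertex). The singular graph $s(F)$ is the set of seam points and seam vertices; facets are the connected components of $F\setminus s(F)$; facets may carry finitely many dots. An anchored foam $F$ is such a foam meeting $L$ transversely in a finite set $p(F)$ of points (anchor points) lying on facets, away from $s(F)$ and from dots, together with a labeling $\ell:p(F)\to\{1,2,3\}$. An admissible coloring $c\in\operatorname{adm}(F)$ is a map from facets to $\{1,2,3\}$ such that the three facets meeting along each seam have distinct colors and each anchor point $p$ lies on a facet of color $\ell(p)$. For $i\ne j$, $F_{ij}(c)$ is the union of (closures of) facets colored $i$ or $j$, a closed surface in $\mathbb{R}^3$ (hence of even Euler characteristic). Let $d_i(c)$ be the number of dots on facets colored $i$. Define, in $\Bbbk[\sqrt{x_1},\sqrt{x_2},\sqrt{x_3},(x_1+x_2)^{-1},(x_1+x_3)^{-1},(x_2+x_3)^{-1}]$, $$\langle F,c\rangle=\frac{\prod_{i=1}^3x_i^{d_i(c)}\Big(\prod_{p\in p(F)}\prod_{j\ne\ell(p)}(x_{\ell(p)}+x_j)\Big)^{1/2}}{\prod_{1\le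 i<j\le3}(x_i+x_j)^{\chi(F_{ij}(c))/2}},\qquad \langle F\rangle=\sum_{c\in\operatorname{adm}(F)}\langle F,c\rangle .$$ (In characteristic 2 square roots are unique, $\sqrt{x+y}=\sqrt x+\sqrt y$.) *)

theory Defs
  imports
    "HOL-Analysis.Analysis"
    "HOL-Computational_Algebra.Polynomial"
    "HOL-Computational_Algebra.Fraction_Field"
begin

section \<open>Piecewise linear topology in \<open>\<real>\<^sup>3\<close>\<close>

text \<open>
  A PL homeomorphism between compact polyhedra is a bijection that is affine on every simplex
  of some finite triangulation of its domain.
\<close>

definition pl_homeomorphism ::
  "(real^3) set \<Rightarrow> (real^3) set \<Rightarrow> (real^3 \<Rightarrow> real^3) \<Rightarrow> bool" where
  "pl_homeomorphism N N' f \<longleftrightarrow>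
     (\<exists>T. simplicial_complex T \<and> \<Union>T = N \<and>
          (\<forall>\<sigma>\<in>T. \<exists>A b. linear A \<and> (\<forall>x\<in>\<sigma>. f x = A x + b))) \<and>
     bij_betw f N N'"

text \<open>
  A neighborhood of \<open>p\<close> in \<open>X\<close> is PL homeomorphic to a neighborhood of the origin in \<open>M\<close>, with
  \<open>p\<close> going to the origin. All models \<open>M\<close> below are invariant under positive scaling, so that
  arbitrarily small neighborhoods of the origin in \<open>M\<close> are PL copies of \<open>M\<close> itself.
\<close>

definition pl_locally_like :: "(real^3) set \<Rightarrow> real^3 \<Rightarrow> (real^3) set \<Rightarrow> bool" where
  "pl_locally_like X p M \<longleftrightarrow>
     (\<exists>N N' f. N \<subseteq> X \<and> p \<in> top_of_set X interior_of N \<and>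
               N' \<subseteq> M \<and> 0 \<in> top_of_set M interior_of N' \<and>
               pl_homeomorphism N N' f \<and> f p = 0)"

text \<open>Open disk.\<close>

definition disk_model :: "(real^3) set" where
  "disk_model = {x. x $ 3 = 0}"

text \<open>Product of a tripod in the horizontal plane and a vertical open interval.\<close>

definition tripod_model :: "(real^3) set" where
  "tripod_model = {r *\<^sub>R v + s *\<^sub>R axis 3 1 | r s v.
     0 \<le> r \<and> v \<in> {axis 1 1, axis 2 1, - axis 1 1 - axis 2 1}}"

text \<open>
  Open cone, with apex at the origin, over the 1-skeleton of a tetrahedron that contains the
  origin in its interior.
\<close>

definition tetrahedron_vertices :: "(real^3) set" where
  "tetrahedron_vertices =
     {axis 1 1, axis 2 1, axis 3 1, - axis 1 1 - axis 2 1 - axis 3 1}"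

definition tetrahedron_cone_model :: "(real^3) set" where
  "tetrahedron_cone_model = {r *\<^sub>R x | r x u v.
     0 \<le> r \<and> u \<in> tetrahedron_vertices \<and> v \<in> tetrahedron_vertices \<and> u \<noteq> v \<and>
     x \<in> closed_segment u v}"

text \<open>
  The PL structure of a compact polyhedron is carried by a finite simplicial complex
  triangulating it; the empty simplex, which belongs to every nonempty
  \<^const>\<open>simplicial_complex\<close>, does not count in the Euler characteristic.
\<close>

definition euler_characteristic :: "(real^3) set set \<Rightarrow> int" where
  "euler_characteristic T = (\<Sum>\<sigma>\<in>T - {{}}. (-1) ^ nat (aff_dim \<sigma>))"

definition subcomplex_of :: "(real^3) set set \<Rightarrow> (real^3) set \<Rightarrow> (real^3) set set" where
  "subcomplex_of K X = {\<sigma>\<in>K. \<sigma> \<subseteq> X}"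


section \<open>Foams\<close>

definition regular_point :: "(real^3) set \<Rightarrow> real^3 \<Rightarrow> bool" where
  "regular_point F p \<longleftrightarrow> p \<in> F \<and> pl_locally_like F p disk_model"

definition seam_point :: "(real^3) set \<Rightarrow> real^3 \<Rightarrow> bool" where
  "seam_point F p \<longleftrightarrow> p \<in> F \<and> pl_locally_like F p tripod_model"

definition seam_vertex :: "(real^3) set \<Rightarrow> real^3 \<Rightarrow> bool" where
  "seam_vertex F p \<longleftrightarrow> p \<in> F \<and> pl_locally_like F p tetrahedron_cone_model"

definition singular_graph :: "(real^3) set \<Rightarrow> (real^3) set" where
  "singular_graph F = {p. seam_point F p \<or> seam_vertex F p}"

definition facets :: "(real^3) set \<Rightarrow> (real^3) set set" where
  "facets F = components (F - singular_graph F)"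

definition facet_containing :: "(real^3) set \<Rightarrow> real^3 \<Rightarrow> (real^3) set" where
  "facet_containing F p = connected_component_set (F - singular_graph F) p"

definition SL3_foam :: "(real^3) set set \<Rightarrow> bool" where
  "SL3_foam K \<longleftrightarrow> simplicial_complex K \<and>
     (\<forall>p\<in>\<Union>K. regular_point (\<Union>K) p \<or> seam_point (\<Union>K) p \<or> seam_vertex (\<Union>K) p)"

definition anchor_line :: "(real^3) set" where
  "anchor_line = {x. x $ 1 = 0 \<and> x $ 2 = 0}"

definition anchor_points :: "(real^3) set \<Rightarrow> (real^3) set" where
  "anchor_points F = F \<inter> anchor_line"

text \<open>
  PL transversality of a surface and the anchor line at a common point: some local PL chart of
  the ambient space straightens both simultaneously to a plane and a line meeting it in a point.
\<close>

definition transverse_to_anchor_line_at :: "(real^3) set \<Rightarrow> real^3 \<Rightarrow> bool" where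
  "transverse_to_anchor_line_at F p \<longleftrightarrow>
     (\<exists>N N' f. p \<in> interior N \<and> 0 \<in> interior N' \<and> pl_homeomorphism N N' f \<and> f p = 0 \<and>
               f ` (N \<inter> F) = N' \<inter> {x. x $ 3 = 0} \<and>
               f ` (N \<inter> anchor_line) = N' \<inter> {x. x $ 1 = 0 \<and> x $ 2 = 0})"

text \<open>
  An anchored foam consists of a triangulated foam \<open>F = \<Union>K\<close>, its finite set \<open>D\<close> of dots, and
  the labeling \<open>l\<close> of the anchor points; only the values of \<open>l\<close> on anchor points matter.
\<close>

definition anchored_foam ::
  "(real^3) set set \<Rightarrow> (real^3) set \<Rightarrow> (real^3 \<Rightarrow> nat) \<Rightarrow> bool" where
  "anchored_foam K D l \<longleftrightarrow> SL3_foam K \<and>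
     finite D \<and> D \<subseteq> \<Union>K - singular_graph (\<Union>K) \<and>
     finite (anchor_points (\<Union>K)) \<and>
     anchor_points (\<Union>K) \<inter> (singular_graph (\<Union>K) \<union> D) = {} \<and>
     (\<forall>p\<in>anchor_points (\<Union>K). transverse_to_anchor_line_at (\<Union>K) p) \<and>
     l ` anchor_points (\<Union>K) \<subseteq> {1,2,3}"


section \<open>Admissible colorings\<close>

text \<open>
  The seam condition includes that three different facets meet at every seam point: if one facet
  occupies two of the three sheets there, the colors of the sheets are not distinct.
\<close>

definition admissible_colorings ::
  "(real^3) set \<Rightarrow> (real^3 \<Rightarrow> nat) \<Rightarrow> ((real^3) set \<Rightarrow> nat) set" where
  "admissible_colorings F l = {c \<in> facets F \<rightarrow>\<^sub>E {1,2,3}.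
     (\<forall>p. seam_point F p \<longrightarrow> bij_betw c {f \<in> facets F. p \<in> closure f} {1,2,3}) \<and>
     (\<forall>p\<in>anchor_points F. c (facet_containing F p) = l p)}"

definition bicolored_surface ::
  "(real^3) set \<Rightarrow> ((real^3) set \<Rightarrow> nat) \<Rightarrow> nat \<Rightarrow> nat \<Rightarrow> (real^3) set" where
  "bicolored_surface F c i j = \<Union> {closure f | f. f \<in> facets F \<and> c f \<in> {i, j}}"

definition dots_of_color ::
  "(real^3) set \<Rightarrow> (real^3) set \<Rightarrow> ((real^3) set \<Rightarrow> nat) \<Rightarrow> nat \<Rightarrow> nat" where
  "dots_of_color F D c i = card {q\<in>D. c (facet_containing F q) = i}"


section \<open>Evaluation\<close>

text \<open>
  The ring \<open>k[\<surd>x\<^sub>1, \<surd>x\<^sub>2, \<surd>x\<^sub>3, (x\<^sub>1+x\<^sub>2)\<inverse>, (x\<^sub>1+x\<^sub>3)\<inverse>, (x\<^sub>2+x\<^sub>3)\<inverse>]\<close> is viewed inside the fraction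
  field of the polynomial ring in the three indeterminates \<open>\<surd>x\<^sub>1, \<surd>x\<^sub>2, \<surd>x\<^sub>3\<close>. That polynomial
  ring is the iterated \<open>k[\<surd>x\<^sub>1][\<surd>x\<^sub>2][\<surd>x\<^sub>3]\<close>.
\<close>

type_synonym 'k ratfun = "'k poly poly poly fract"

definition sqrt_x :: "nat \<Rightarrow> 'k::field ratfun" where
  "sqrt_x i = (if i = 1 then Fract [:[:[:0, 1:]:]:] 1
               else if i = 2 then Fract [:[:0, 1:]:] 1
               else Fract [:0, 1:] 1)"

definition var_x :: "nat \<Rightarrow> 'k::field ratfun" where
  "var_x i = (sqrt_x i)\<^sup>2"

text \<open>In a field of characteristic 2 a square root is unique if it exists.\<close>

definition sqrt_char2 :: "'a::field \<Rightarrow> 'a" where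
  "sqrt_char2 a = (THE r. r\<^sup>2 = a)"

text \<open>
  The closed surface \<open>F\<^sub>i\<^sub>j(c)\<close> is a union of simplices of \<open>K\<close>, so that its Euler characteristic is the
  one of the subcomplex of \<open>K\<close> it carries, for every triangulation \<open>K\<close> of the foam. As a closed
  surface embedded in \<open>\<real>\<^sup>3\<close> it has even Euler characteristic, so the integer division is exact.
\<close>

definition colored_evaluation ::
  "(real^3) set set \<Rightarrow> (real^3) set \<Rightarrow> (real^3 \<Rightarrow> nat) \<Rightarrow> ((real^3) set \<Rightarrow> nat) \<Rightarrow> 'k::field ratfun" where
  "colored_evaluation K D l c =
     (\<Prod>i\<in>{1,2,3}. var_x i ^ dots_of_color (\<Union>K) D c i) *
     sqrt_char2 (\<Prod>p\<in>anchor_points (\<Union>K). \<Prod>j\<in>{1,2,3} - {l p}. var_x (l p) + var_x j) /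
     (\<Prod>(i, j)\<in>{(1,2), (1,3), (2,3)}. (var_x i + var_x j) powi
        (euler_characteristic (subcomplex_of K (bicolored_surface (\<Union>K) c i j)) div 2))"

definition evaluation ::
  "(real^3) set set \<Rightarrow> (real^3) set \<Rightarrow> (real^3 \<Rightarrow> nat) \<Rightarrow> 'k::field ratfun" where
  "evaluation K D l = (\<Sum>c\<in>admissible_colorings (\<Union>K) l. colored_evaluation K D l c)"

text \<open>The polynomial ring \<open>k[x\<^sub>1, x\<^sub>2, x\<^sub>3]\<close>, as a subring of the fraction field.\<close>

inductive_set polynomial_ring_x :: "'k::field ratfun set" where
  const: "Fract [:[:[:a:]:]:] 1 \<in> polynomial_ring_x"
| indet: "i \<in> {1,2,3} \<Longrightarrow> var_x i \<in> polynomial_ring_x"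
| add: "P \<in> polynomial_ring_x \<Longrightarrow> Q \<in> polynomial_ring_x \<Longrightarrow> P + Q \<in> polynomial_ring_x"
| mult: "P \<in> polynomial_ring_x \<Longrightarrow> Q \<in> polynomial_ring_x \<Longrightarrow> P * Q \<in> polynomial_ring_x"

end

(*
  Fix two colors i, j. In an admissible coloring c the facets colored i or j form a closed surface, and
  exchanging i and j on one of its components gives another proper coloring of the triangles. Summed over all
  exchanges on components without anchor points, the denominators (x_i + x_j)^(chi/2) cancel: each such component
  contributes a factor u + u', where u' is u with x_i and x_j exchanged (u is the part of the product that the
  exchange affects), and u + u' is divisible by x_i + x_j. A component has
  Euler characteristic at most 2 and meets the anchor line in an even number of points, so a component with
  anchor points contributes a nonnegative power of x_i + x_j by itself. Hence the sum has no pole along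
  x_i + x_j for any pair, and it is a polynomial since the three linear forms are coprime.

  The parity statements come from the indicator function of the inside of a mod 2 cycle of triangles. The link
  between facets and triangles uses invariance of domain: the points with a planar neighborhood are the regular
  ones, so an edge has degree 2 or 3, and the three models are told apart by counting sectors.
*)
theory Submission
 imports Defs "HOL-Combinatorics.Permutations"
begin

text \<open>The half Euler characteristics in the exponents shape the proof. Cancellation between
  colorings needs integral exponents for every coloring reached by an exchange, so evenness is
  established for all proper colorings, not only for those compatible with the labels. The exchange
  of a component C then moves an integer \<open>\<delta>\<close> from the exponent of x_j + x_l to
  that of x_i + x_l, and this is what makes u' the image of u under the interchange of x_i and x_j.
  Negative exponents are cleared by one common power of the three linear forms, so that divisibility
  can be argued for a single numerator in a polynomial ring.

  The triangulation is arbitrary: regular points, seam points and seam vertices can all be vertices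
  of \<open>K\<close>, and a chart need not respect \<open>K\<close>. Facet colorings are therefore
  replaced by triangle colorings governed by edge degrees. That the sheets of a bicolored surface do
  not merely touch at a vertex has to come from the local models; it makes the Euler characteristic
  split over components.\<close>

abbreviation conv :: "'a::real_vector set => 'a set" where "conv S == convex hull S"

abbreviation relint :: "'a::euclidean_space set => 'a set" where "relint S == rel_interior (conv S)"

section \<open>Combinatorial surfaces\<close>

text \<open>The last two hypotheses say that the fibres of \<open>f\<close> on \<open>S\<close> are
  exactly the cycles of \<open>p\<close>. A cycle of length m has sign (-1)^(m-1), so the exponent
  is, mod 2, the size of \<open>S\<close> minus the number of cycles. The induction cuts
  \<open>x\<close> out of its cycle by a transposition; the set of labels changes only if
  \<open>x\<close> is a fixed point.\<close>

lemma sign_eq_card_fibres: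
 assumes "finite S" "p permutes S"
  and "!!y. y : S ==> f (p y) = f y"
  and "!!A y. A \<subseteq> S ==> p ` A \<subseteq> A ==> y : A ==> {z:S. f z = f y} \<subseteq> A"
 shows "sign p = (-1) ^ (card S + card (f ` S))"
 using assms
proof (induction S arbitrary: p rule: finite_induct)
 case empty
 then show ?case by simp
next
 case (insert x S)
 note perm = insert.prems(1) and lab = insert.prems(2) and trans = insert.prems(3)
 show ?case
 proof (cases "p x = x")
  case True
  have q: "p permutes S"
   using perm True by (metis insert_iff permutes_def)
  have "{z:insert x S. f z = f x} \<subseteq> {x}"
   by (rule trans) (auto simp: True)
  then have fx: "f x ~: f ` S"
   using insert.hyps by auto
  have "sign p = (-1) ^ (card S + card (f ` S))"
  proof (rule insert.IH[OF q])
   fix y assume "y : S" then show "f (p y) = f y" using lab by auto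
  next
   fix A y assume "A \<subseteq> S" "p ` A \<subseteq> A" "y : A"
   then have "{z:insert x S. f z = f y} \<subseteq> A" by (intro trans) auto
   then show "{z:S. f z = f y} \<subseteq> A" by auto
  qed
  then show ?thesis using fx insert.hyps by simp
 next
  case False
  define q where "q = Transposition.transpose x (p x) \<circ> p"
  have px: "p x : S" using perm False by (metis insertE insertI1 permutes_in_image)
  have "q permutes insert x S"
   unfolding q_def using perm px by (intro permutes_compose permutes_swap_id) auto
  moreover have qx: "q x = x" by (simp add: q_def)
  ultimately have q: "q permutes S" by (metis insert_iff permutes_def)
  have inj: "inj p" using perm permutes_inj by blast
  have q1: "q y = p y" if "y ~= x" "p y ~= x" for y
   using that inj by (auto simp: q_def Transposition.transpose_def inj_eq)
  have q2: "q y = p x" if "y ~= x" "p y = x" for y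
   using that by (auto simp: q_def Transposition.transpose_def)
  have sq: "sign q = (-1) ^ (card S + card (f ` S))"
  proof (rule insert.IH[OF q])
   fix y assume y: "y : S"
   then have ne: "y ~= x" using insert.hyps by auto
   show "f (q y) = f y"
    using lab[of y] lab[of x] y q1[OF ne] q2[OF ne] by (cases "p y = x") auto
  next
   fix A y assume A: "A \<subseteq> S" "q ` A \<subseteq> A" "y : A"
   \<comment> \<open>A set stable under the shortened permutation becomes stable under
     \<open>p\<close> once \<open>x\<close> is added, and \<open>x\<close> is added exactly if
     \<open>p\<close> sends one of its elements there.\<close>
   define A' where "A' = (if EX a:A. p a = x then insert x A else A)"
   have "p ` A' \<subseteq> A'"
   proof
    fix w assume "w : p ` A'"
    then obtain a where a: "a : A'" "w = p a" by auto
    show "w : A'"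
    proof (cases "a = x")
     case True
     then obtain b where b: "b : A" "p b = x"
      using a A(1) insert.hyps by (auto simp: A'_def split: if_splits)
     then have "b ~= x" using A(1) insert.hyps by auto
     then have "q b = p x" "q b : A" using q2[of b] b A(2) by (blast, metis image_subset_iff b(1) A(2))
     then have "p x : A" by simp
     then show ?thesis using True a by (auto simp: A'_def)
    next
     case F: False
     then have aA: "a : A" using a by (auto simp: A'_def split: if_splits)
     show ?thesis
     proof (cases "p a = x")
      case True then show ?thesis using aA a by (auto simp: A'_def)
     next
      case False
      then have "p a : A" using q1[OF F False] aA A(2) by (metis image_subset_iff)
      then show ?thesis using a(2) by (simp add: A'_def)
     qed
    qed
   qed
   then have "{z:insert x S. f z = f y} \<subseteq> A'"
    using A by (intro trans) (auto simp: A'_def)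
   then show "{z:S. f z = f y} \<subseteq> A"
    using insert.hyps by (auto simp: A'_def split: if_splits)
  qed
  have pq: "p = Transposition.transpose x (p x) \<circ> q"
   by (simp add: q_def o_assoc[symmetric] comp_assoc[symmetric])
  have "sign p = sign (Transposition.transpose x (p x)) * sign q"
   using pq sign_compose[of "Transposition.transpose x (p x)" q] q insert.hyps
   by (metis permutation_permutes permutation_swap_id)
  then have "sign p = - sign q" using False by (simp add: sign_swap_id)
  moreover have "f ` insert x S = f ` S"
   using lab[OF insertI1] px by (metis image_eqI image_insert insert_absorb)
  ultimately show ?thesis using sq insert.hyps by simp
 qed
qed

definition edges_of :: "'v set set => 'v set set" where
 "edges_of S = {e. card e = 2 & (EX t:S. e \<subseteq> t)}"

definition chi :: "'v set set => int" where
 "chi S = int (card (\<Union>S)) - int (card (edges_of S)) + int (card S)"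

text \<open>Only the edge condition of a surface is imposed; several sheets may still touch at a
  vertex. That defect is excluded separately by \<open>vertex_linked\<close>.\<close>

definition closed_surface :: "'v set set => bool" where
 "closed_surface S \<longleftrightarrow> finite S & (ALL t:S. card t = 3) &
  (ALL e:edges_of S. card {t:S. e \<subseteq> t} = 2)"

text \<open>Connectedness of the link of \<open>v\<close>, phrased through partitions so that no
  path or cyclic order has to be chosen. For a vertex of a closed surface it makes the link a single
  cycle.\<close>

definition vertex_linked :: "'v set set => 'v => bool" where
 "vertex_linked S v \<longleftrightarrow> (ALL A B. A Un B = {t:S. v : t} --> A ~= {} --> B ~= {} --> A Int B = {} -->
   (EX t:A. EX t':B. card (t Int t') = 2 & v : t Int t'))"

lemma finite_edges_of:
 assumes "finite S" "ALL t:S. card t = 3"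
 shows "finite (edges_of S)"
proof (rule finite_subset)
 show "edges_of S \<subseteq> (\<Union>t\<in>S. Pow t)" by (auto simp: edges_of_def)
 show "finite (\<Union>t\<in>S. Pow t)"
  using assms by (auto intro!: finite_UN_I) (metis card.infinite finite_Pow_iff zero_neq_numeral)
qed

lemma card_3_elem:
 assumes "card t = 3" "v : t"
 shows "EX b c. t = {v,b,c}"
proof -
 have "card (t - {v}) = 2" using assms by (simp add: card_Diff_singleton)
 then obtain b c where "t - {v} = {b,c}" by (auto simp: card_2_iff)
 then have "t = {v,b,c}" using assms by blast
 then show ?thesis by blast
qed

lemma double_count:
 assumes "finite A" "finite B"
 shows "(\<Sum>a\<in>A. card {b:B. R a b}) = (\<Sum>b\<in>B. card {a:A. R a b})"
proof -
 have "(\<Sum>a\<in>A. card {b:B. R a b}) = (\<Sum>a\<in>A. \<Sum>b\<in>B. if R a b then 1 else 0)"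
  using assms by (intro sum.cong refl) (simp flip: sum.inter_filter)
 also have "\<dots> = (\<Sum>b\<in>B. \<Sum>a\<in>A. if R a b then 1 else 0)" by (rule sum.swap)
 also have "\<dots> = (\<Sum>b\<in>B. card {a:A. R a b})"
  using assms by (intro sum.cong refl) (simp flip: sum.inter_filter)
 finally show ?thesis .
qed

lemma card_edges_of_triangle:
 assumes "card t = 3"
 shows "card {e. e \<subseteq> t & card e = 2} = 3"
proof -
 have "finite t" using assms by (metis card.infinite zero_neq_numeral)
 then have "card {e. e \<subseteq> t & card e = 2} = 3 choose 2"
  using n_subsets[of t 2] assms by simp
 then show ?thesis by (simp add: choose_two)
qed

lemma closed_surface_3F_2E:
 assumes "closed_surface S"
 shows "3 * card S = 2 * card (edges_of S)"
proof -
 have fin: "finite S" "finite (edges_of S)" and c3: "ALL t:S. card t = 3"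
  using assms finite_edges_of by (auto simp: closed_surface_def)
 have "(\<Sum>t\<in>S. card {e:edges_of S. e \<subseteq> t}) = (\<Sum>e\<in>edges_of S. card {t:S. e \<subseteq> t})"
  by (rule double_count[OF fin])
 also have "\<dots> = (\<Sum>e\<in>edges_of S. 2)"
  using assms by (intro sum.cong) (auto simp: closed_surface_def)
 finally have 1: "(\<Sum>t\<in>S. card {e:edges_of S. e \<subseteq> t}) = 2 * card (edges_of S)" by simp
 have "{e:edges_of S. e \<subseteq> t} = {e. e \<subseteq> t & card e = 2}" if "t : S" for t
  using that by (auto simp: edges_of_def)
 then have "(\<Sum>t\<in>S. card {e:edges_of S. e \<subseteq> t}) = (\<Sum>t\<in>S. 3)"
  using c3 by (intro sum.cong) (auto simp: card_edges_of_triangle)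
 with 1 show ?thesis by simp
qed

lemma card_3_distinct: "card {a, b, c} = 3 \<longleftrightarrow> a ~= b & a ~= c & b ~= c"
proof -
 have "card (set [a,b,c]) = length [a,b,c] \<longleftrightarrow> distinct [a,b,c]"
  using card_distinct distinct_card by blast
 then show ?thesis by (simp add: numeral_3_eq_3)
qed

text \<open>
  The darts of an oriented surface carry the permutations \<open>\<sigma>\<close> (rotation about the initial vertex),
  \<open>\<alpha>\<close> (reversal) and \<open>\<phi>\<close> (rotation around a triangle) with \<open>\<phi> \<circ> \<alpha> \<circ> \<sigma> = id\<close>; comparing signs
  yields the parity of the Euler characteristic.
\<close>

locale oriented_surface =
 fixes S :: "'v set set" and P :: "'v => 'v => 'v => bool"
 assumes closed: "closed_surface S"
  and links: "!!v. v : \<Union>S ==> vertex_linked S v"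
  and P_rot: "!!a b c. {a,b,c} : S ==> P a b c ==> P b c a"
  and P_flip: "!!a b c. {a,b,c} : S ==> P b a c \<longleftrightarrow> ~ P a b c"
  and P_coh: "!!a b c d. {a,b,c} : S ==> {a,b,d} : S ==> c ~= d ==> P a b c \<longleftrightarrow> ~ P a b d"
begin

lemma finS: "finite S" and card3: "t : S ==> card t = 3"
 using closed by (auto simp: closed_surface_def)

lemma finV: "finite (\<Union>S)"
 using finS card3 by (metis card.infinite finite_Union zero_neq_numeral)

lemma distinct3: "{a,b,c} : S ==> a ~= b & a ~= c & b ~= c"
 using card3 card_3_distinct by metis

lemma perm3:
 assumes "{a,b,c} : S"
 shows "{b,c,a} : S" "{c,a,b} : S" "{b,a,c} : S" "{a,c,b} : S" "{c,b,a} : S"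
proof -
 have "{b,c,a} = {a,b,c}" "{c,a,b} = {a,b,c}" "{b,a,c} = {a,b,c}" "{a,c,b} = {a,b,c}" "{c,b,a} = {a,b,c}"
  by blast+
 then show "{b,c,a} : S" "{c,a,b} : S" "{b,a,c} : S" "{a,c,b} : S" "{c,b,a} : S"
  using assms by simp_all
qed

lemma thirds:
 assumes "{a,b} : edges_of S" "a ~= b"
 obtains c d where "c ~= d" "{t:S. {a,b} \<subseteq> t} = {{a,b,c},{a,b,d}}" "{a,b,c} : S" "{a,b,d} : S"
proof -
 have "card {t:S. {a,b} \<subseteq> t} = 2" using closed assms by (auto simp: closed_surface_def)
 then obtain t1 t2 where t: "{t:S. {a,b} \<subseteq> t} = {t1,t2}" "t1 ~= t2"
  by (auto simp: card_2_iff)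
 have third: "EX c. t = {a,b,c}" if ab: "t : S" "{a,b} \<subseteq> t" for t
 proof -
  have "card (t - {a,b}) = 1" using card3[OF ab(1)] ab(2) assms(2)
   by (subst card_Diff_subset) auto
  then obtain c where "t - {a,b} = {c}" by (auto simp: card_1_singleton_iff)
  then have "t = {a,b,c}" using ab by blast
  then show ?thesis ..
 qed
 have "t1 : {t:S. {a,b} \<subseteq> t}" "t2 : {t:S. {a,b} \<subseteq> t}" unfolding t(1) by simp_all
 then have t12: "t1 : S" "t2 : S" "{a,b} \<subseteq> t1" "{a,b} \<subseteq> t2" by simp_all
 obtain c where c: "t1 = {a,b,c}" using third t12(1,3) by blast
 obtain d where d: "t2 = {a,b,d}" using third t12(2,4) by blast
 have "c ~= d" using t(2) c d by blast
 then show ?thesis using that[of c d] t(1) t12(1,2) unfolding c d by blast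
qed

text \<open>Here coherence enters: of the two triangles on an edge exactly one is positive for a
  given direction of the edge, so \<open>nxt\<close> is well defined on darts.\<close>

lemma ex1_third:
 assumes "{a,b} : edges_of S" "a ~= b"
 shows "EX! c. {a,b,c} : S & P a b c"
proof -
 obtain c d where cd: "c ~= d" "{t:S. {a,b} \<subseteq> t} = {{a,b,c},{a,b,d}}" "{a,b,c} : S" "{a,b,d} : S"
  using thirds[OF assms] by blast
 have other: "x = c \<or> x = d" if "{a,b,x} : S" for x
 proof -
  have "{a,b,x} : {t:S. {a,b} \<subseteq> t}" using that by simp
  then have "{a,b,x} : {{a,b,c},{a,b,d}}" unfolding cd(2) .
  then show ?thesis using distinct3[OF that] distinct3[OF cd(3)] distinct3[OF cd(4)]
   by (auto simp: doubleton_eq_iff insert_eq_iff)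
 qed
 show ?thesis using P_coh[OF cd(3,4,1)] cd other by metis
qed

definition nxt :: "'v => 'v => 'v" where
 "nxt a b = (THE c. {a,b,c} : S & P a b c)"

definition darts :: "('v \<times> 'v) set" where
 "darts = {(a,b). a ~= b & {a,b} : edges_of S}"

lemma nxt: "(a,b) : darts ==> {a,b,nxt a b} : S & P a b (nxt a b)"
proof -
 assume "(a,b) : darts"
 then have "EX! c. {a,b,c} : S & P a b c" using ex1_third by (simp add: darts_def)
 from theI'[OF this] show ?thesis unfolding nxt_def .
qed

lemma nxt_eq: "{a,b,c} : S ==> P a b c ==> nxt a b = c"
proof -
 assume c: "{a,b,c} : S" "P a b c"
 have "{a,b} : edges_of S" "a ~= b"
  using c distinct3[OF c(1)] by (auto simp: edges_of_def card_insert_if)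
 then show ?thesis unfolding nxt_def using ex1_third c by (intro the1_equality) auto
qed

lemma dartI: "{a,b,c} : S ==> (a,b) : darts"
proof -
 assume t: "{a,b,c} : S"
 then have "a ~= b" using distinct3 by blast
 moreover have "EX t:S. {a,b} \<subseteq> t" using t by blast
 ultimately show ?thesis by (simp add: darts_def edges_of_def)
qed

lemma fin_darts: "finite darts"
proof (rule finite_subset)
 show "darts \<subseteq> \<Union>S \<times> \<Union>S" by (auto simp: darts_def edges_of_def)
 show "finite (\<Union>S \<times> \<Union>S)" using finV by simp
qed

text \<open>The three maps are the identity outside \<open>darts\<close>, as \<open>permutes\<close>
  requires.\<close>

definition sg where "sg = (%d. if d : darts then (fst d, nxt (fst d) (snd d)) else d)"
definition al where "al = (%d. if d : darts then (snd d, fst d) else d)"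
definition ph where "ph = (%d. if d : darts then (snd d, nxt (fst d) (snd d)) else d)"

lemma al_in: "d : darts ==> al d : darts"
 by (auto simp: al_def darts_def insert_commute)

lemma sg_in: "d : darts ==> sg d : darts"
 using nxt[of "fst d" "snd d"] dartI[OF perm3(4), of "fst d" "snd d" "nxt (fst d) (snd d)"]
 by (simp add: sg_def)

lemma ph_in: "d : darts ==> ph d : darts"
 using nxt[of "fst d" "snd d"] dartI[OF perm3(1), of "fst d" "snd d" "nxt (fst d) (snd d)"]
 by (simp add: ph_def)

lemma ph3: "ph (ph (ph d)) = d"
proof (cases "d : darts")
 case True
 obtain a b where d: "d = (a,b)" by force
 define c where "c = nxt a b"
 have c: "{a,b,c} : S" "P a b c" using nxt True d by (auto simp: c_def)
 have c2: "{b,c,a} : S" "P b c a" using perm3(1)[OF c(1)] P_rot[OF c] .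
 have c3: "{c,a,b} : S" "P c a b" using perm3(1)[OF c2(1)] P_rot[OF c2] .
 have "ph d = (b,c)" using True d by (simp add: ph_def c_def)
 moreover have "ph (b,c) = (c,a)" using dartI[OF c2(1)] nxt_eq[OF c2] by (simp add: ph_def)
 moreover have "ph (c,a) = (a,b)" using dartI[OF c3(1)] nxt_eq[OF c3] by (simp add: ph_def)
 ultimately show ?thesis using d by simp
qed (simp add: ph_def)

lemma ph_al_sg: "ph (al (sg d)) = d"
proof (cases "d : darts")
 case True
 obtain a b where d: "d = (a,b)" by force
 define c where "c = nxt a b"
 have c: "{a,b,c} : S" "P a b c" using nxt True d by (auto simp: c_def)
 have c2: "{b,c,a} : S" "P b c a" using perm3(1)[OF c(1)] P_rot[OF c] .
 have c3: "{c,a,b} : S" "P c a b" using perm3(1)[OF c2(1)] P_rot[OF c2] .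
 have "sg d = (a,c)" using True d by (simp add: sg_def c_def)
 moreover have "al (a,c) = (c,a)" using dartI[OF perm3(4)[OF c(1)]] by (simp add: al_def)
 moreover have "ph (c,a) = (a,b)" using dartI[OF c3(1)] nxt_eq[OF c3] by (simp add: ph_def)
 ultimately show ?thesis using d by simp
next
 case False
 then have "sg d = d" "al d = d" "ph d = d" by (simp_all add: sg_def al_def ph_def)
 then show ?thesis by simp
qed

lemma permutes_dartsI:
 assumes "!!d. d : darts ==> g d : darts" "!!d. d ~: darts ==> g d = d" "inj_on g darts"
 shows "g permutes darts"
proof -
 have "g ` darts = darts" using assms(1,3) fin_darts
  by (metis card_image card_subset_eq image_subsetI)
 then show ?thesis using assms by (intro bij_imp_permutes) (auto simp: bij_betw_def)
qed

lemma sg_perm: "sg permutes darts"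
proof (rule permutes_dartsI)
 show "inj_on sg darts" by (rule inj_on_inverseI[where g = "%d. ph (al d)"]) (rule ph_al_sg)
next
 show "!!d. d ~: darts ==> sg d = d" by (simp add: sg_def)
 show "!!d. d : darts ==> sg d : darts" by (rule sg_in)
qed

lemma al_perm: "al permutes darts"
proof (rule permutes_dartsI)
 show "inj_on al darts" by (auto simp: inj_on_def al_def)
 show "!!d. d ~: darts ==> al d = d" by (simp add: al_def)
 show "!!d. d : darts ==> al d : darts" by (rule al_in)
qed

lemma ph_perm: "ph permutes darts"
proof (rule permutes_dartsI)
 show "inj_on ph darts" by (rule inj_on_inverseI[where g = "%d. ph (ph d)"]) (rule ph3)
next
 show "!!d. d ~: darts ==> ph d = d" by (simp add: ph_def)
 show "!!d. d : darts ==> ph d : darts" by (rule ph_in)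
qed

text \<open>Since \<open>ph\<close> has order three, the cube of its sign is 1, and a sign is its
  own cube.\<close>

lemma sign_ph: "sign ph = 1"
proof -
 have per: "permutation ph" using ph_perm fin_darts by (auto simp: permutation_permutes)
 have "ph \<circ> (ph \<circ> ph) = id" by (auto simp: ph3)
 then have "sign ph * (sign ph * sign ph) = 1"
  using per by (metis permutation_compose sign_compose sign_id)
 then show ?thesis by simp
qed

text \<open>The cycles of the reversal are the pairs of opposite darts, one pair for each
  edge.\<close>

lemma sign_al: "sign al = (-1) ^ (card darts + card (edges_of S))"
proof -
 let ?f = "%(a,b). {a,b}"
 have img: "?f ` darts = edges_of S"
  by (auto simp: darts_def image_iff) (auto simp: edges_of_def card_2_iff)
 have "sign al = (-1) ^ (card darts + card (?f ` darts))"
 proof (rule sign_eq_card_fibres[OF fin_darts al_perm])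
  fix y assume "y : darts" then show "?f (al y) = ?f y" by (auto simp: al_def split: prod.splits)
 next
  fix A y assume A: "A \<subseteq> darts" "al ` A \<subseteq> A" "y : A"
  obtain a b where y: "y = (a,b)" by force
  have "al y : A" "y : darts" using A by auto
  then have "(b,a) : A" using y by (simp add: al_def)
  then show "{z:darts. ?f z = ?f y} \<subseteq> A" using A y by (auto simp: doubleton_eq_iff)
 qed
 then show ?thesis using img by simp
qed

text \<open>The cycles of the rotation correspond to vertices only because links are connected. Two
  triangles that share an edge at \<open>v\<close> are consecutive in the rotation, so a stable set
  of darts at \<open>v\<close> cannot contain the dart of one and miss that of the other;
  \<open>vertex_linked\<close> then spreads the set over all triangles at \<open>v\<close>.\<close>

lemma sign_sg: "sign sg = (-1) ^ (card darts + card (\<Union>S))"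
proof -
 have "fst ` darts = \<Union>S"
 proof
  show "fst ` darts \<subseteq> \<Union>S" by (auto simp: darts_def edges_of_def)
  show "\<Union>S \<subseteq> fst ` darts"
  proof
   fix a assume "a : \<Union>S"
   then obtain t where t: "t : S" "a : t" by auto
   obtain b c where "t = {a,b,c}" using card_3_elem[OF card3[OF t(1)] t(2)] by auto
   then have "(a,b) : darts" using dartI t(1) by blast
   then show "a : fst ` darts" by force
  qed
 qed
 moreover have "sign sg = (-1) ^ (card darts + card (fst ` darts))"
 proof (rule sign_eq_card_fibres[OF fin_darts sg_perm])
  fix y assume "y : darts" then show "fst (sg y) = fst y" by (auto simp: sg_def)
 next
  fix C y assume C: "C \<subseteq> darts" "sg ` C \<subseteq> C" "y : C"
  obtain v b0 where y: "y = (v,b0)" by force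
  let ?st = "{t:S. v : t}"
  define A where "A = {t:?st. EX b c. t = {v,b,c} & P v b c & (v,b) : C}"
  define B where "B = ?st - A"
  have step: "(v, nxt v b) : C" if "(v,b) : C" for b
   using C that by (force simp: sg_def)
  have vS: "v : \<Union>S" using C y by (auto simp: darts_def edges_of_def)
  have orient: "EX b c. t = {v,b,c} & P v b c" if tv: "t : ?st" for t
  proof -
   obtain b c where bc: "t = {v,b,c}" using card_3_elem[of t v] card3[of t] tv by auto
   show ?thesis
   proof (cases "P v b c")
    case False
    have vbc: "{v,b,c} : S" using tv bc by simp
    have "P b v c" using P_flip[OF vbc] False by simp
    from P_rot[OF perm3(3)[OF vbc] this] have "P v c b" .
    moreover have "t = {v,c,b}" using bc by blast
    ultimately show ?thesis by blast
   qed (use bc in blast)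
  qed
  have "A ~= {}"
  proof -
   have d: "(v,b0) : darts" using C y by auto
   show ?thesis unfolding A_def using nxt[OF d] C(3) y by blast
  qed
  have no: "~ (card (t Int t') = 2 & v : t Int t')" if tA: "t : A" and tB: "t' : B" for t t'
  proof
   assume as: "card (t Int t') = 2 & v : t Int t'"
   obtain b c where bc: "t = {v,b,c}" "P v b c" "(v,b) : C" "t : S" using tA by (auto simp: A_def)
   have t'S: "t' : S" "v : t'" "t' ~: A" using tB by (auto simp: B_def)
   obtain b' c' where bc': "t' = {v,b',c'}" "P v b' c'" using orient t'S by blast
   have ndC: "(v,b') ~: C" using t'S bc' by (auto simp: A_def)
   have nb: "nxt v b = c" "nxt v b' = c'"
    using nxt_eq[of v b c] nxt_eq[of v b' c'] bc(1,2,4) bc' t'S(1) by simp_all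
   have cC: "(v,c) : C" using step[OF bc(3)] nb(1) by simp
   have dist: "v ~= b" "v ~= c" "b ~= c" "v ~= b'" "v ~= c'" "b' ~= c'"
    using distinct3 bc bc' t'S by auto
   obtain w where w: "w ~= v" "w : t" "w : t'"
   proof -
    have "card (t Int t' - {v}) = 1" using as by (simp add: card_Diff_singleton)
    then obtain w where "t Int t' - {v} = {w}" by (auto simp: card_1_singleton_iff)
    then have "w ~= v & w : t & w : t'" by blast
    then show ?thesis using that by blast
   qed
   have "b' ~= b" "b' ~= c" using ndC bc cC by auto
   then have wc': "w = c'" using w bc(1) bc'(1) by (metis insertE singletonD)
   have "t ~= t'" using tA t'S by auto
   show False
   proof (cases "w = b")
    case True
    \<comment> \<open>Here \<open>t'\<close> precedes \<open>t\<close> in the rotation. A finite set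
      stable under an injective map is also closed under predecessors.\<close>
    have "sg (v,b') = (v,b)" using True wc' nb dartI[of v b' c'] bc' t'S by (simp add: sg_def)
    moreover have "sg ` C = C"
     by (meson C(1,2) sg_perm fin_darts endo_inj_surj finite_subset permutes_inj_on)
    then obtain d where "d : C" "sg d = (v,b)" using bc(3) by (metis imageE)
    ultimately have "(v,b') : C" using permutes_inj[OF sg_perm] by (metis injD)
    then show False using ndC by simp
   next
    case False
    then have "w = c" using w bc by auto
    then have "sg (v,b') = sg (v,b)" using wc' nb dartI[of v b' c'] dartI[of v b c] bc bc' t'S by (simp add: sg_def)
    then show False using sg_perm permutes_inj bc ndC by (metis injD)
   qed
  qed
  have "B = {}"
  proof (rule ccontr)
   assume "B ~= {}"
   moreover have "A Un B = ?st" "A Int B = {}" by (auto simp: A_def B_def)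
   ultimately have "EX t:A. EX t':B. card (t Int t') = 2 & v : t Int t'"
    using links[OF vS, unfolded vertex_linked_def, rule_format, of A B] \<open>A ~= {}\<close> by simp
   then show False using no by blast
  qed
  then have all: "?st = A" by (auto simp: B_def A_def)
  show "{z:darts. fst z = fst y} \<subseteq> C"
  proof clarify
   fix v' b assume d: "(v',b) : darts" "fst (v',b) = fst y"
   then have d: "(v,b) : darts" and v': "v' = v" using y by auto
   have n: "{v,b,nxt v b} : S" "P v b (nxt v b)" using nxt[OF d] by auto
   then have "{v,b,nxt v b} : A" using all by auto
   then obtain b1 c1 where b1: "{v,b,nxt v b} = {v,b1,c1}" "P v b1 c1" "(v,b1) : C"
    by (auto simp: A_def)
   have "b1 = b"
   proof (rule ccontr)
    assume "b1 ~= b"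
    then have "b1 = nxt v b & c1 = b" using b1(1) distinct3[OF n(1)] distinct3[of v b1 c1] n(1) by auto
    then have "P v (nxt v b) b" using b1 by simp
    from P_rot[OF perm3(1)[OF perm3(4)[OF n(1)]] P_rot[OF perm3(4)[OF n(1)] this]]
    have "P b v (nxt v b)" .
    then show False using P_flip[OF n(1)] n(2) by simp
   qed
   then show "(v',b) : C" using b1 v' by simp
  qed
 qed
 ultimately show ?thesis by simp
qed

text \<open>The three signs multiply to 1, which makes the number of edges plus the number of
  vertices even; the number of triangles is even because 3F = 2E.\<close>

lemma chi_even: "even (chi S)"
proof -
 have per: "permutation ph" "permutation al" "permutation sg"
  using ph_perm al_perm sg_perm fin_darts by (auto simp: permutation_permutes)
 have "ph \<circ> (al \<circ> sg) = id" by (auto simp: ph_al_sg)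
 then have "sign ph * (sign al * sign sg) = 1"
  using per by (metis permutation_compose sign_compose sign_id)
 then have "(-1::int) ^ (card darts + card (edges_of S) + (card darts + card (\<Union>S))) = 1"
  by (simp add: sign_ph sign_al sign_sg power_add)
 then have "even (card darts + card (edges_of S) + (card darts + card (\<Union>S)))"
  by (metis neg_one_odd_power one_neq_neg_one)
 then have "even (card (edges_of S) + card (\<Union>S))" by auto
 moreover have "even (card S)" using closed_surface_3F_2E[OF closed]
  by presburger
 ultimately show ?thesis by (simp add: chi_def)
qed

end

section \<open>Euler characteristic of a connected closed surface\<close>

definition adjacent_linked :: "'v set set => bool" where
 "adjacent_linked S \<longleftrightarrow> (ALL A B. A Un B = S --> A ~= {} --> B ~= {} --> A Int B = {} -->
   (EX t:A. EX t':B. card (t Int t') = 2))"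

lemma minus_one_card:
 assumes "finite A"
 shows "(-1::int) ^ card {a:A. Q a} = (\<Prod>a\<in>A. if Q a then -1 else 1)"
proof -
 have "card {a:A. Q a} = (\<Sum>a\<in>A. if Q a then 1 else 0)"
  using assms by (simp flip: sum.inter_filter)
 then have "(-1::int) ^ card {a:A. Q a} = (\<Prod>a\<in>A. (-1) ^ (if Q a then 1 else 0))"
  by (simp add: power_sum)
 also have "\<dots> = (\<Prod>a\<in>A. if Q a then -1 else 1)" by (intro prod.cong) auto
 finally show ?thesis .
qed

text \<open>The distributive law in the form used twice below: for the sign characters of the cycle
  count and for sums over all sets of exchanged components.\<close>

lemma sum_Pow_prod:
 fixes g :: "'a => 'b::comm_semiring_1"
 assumes "finite A"
 shows "(\<Sum>B\<in>Pow A. \<Prod>a\<in>A. if a : B then g a else h a) = (\<Prod>a\<in>A. g a + h a)"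
proof -
 have "(\<Sum>B\<in>Pow A. \<Prod>a\<in>A. if a : B then g a else h a) =
    (\<Sum>B\<in>Pow A. (\<Prod>a\<in>B. g a) * (\<Prod>a\<in>A - B. h a))"
 proof (rule sum.cong[OF refl])
  fix B assume "B : Pow A"
  then have "B \<subseteq> A" by simp
  then have "(\<Prod>a\<in>A. if a : B then g a else h a) =
    (\<Prod>a\<in>B. if a : B then g a else h a) * (\<Prod>a\<in>A - B. if a : B then g a else h a)"
   using assms by (subst prod.subset_diff[of B A]) (simp_all add: mult.commute)
  also have "\<dots> = (\<Prod>a\<in>B. g a) * (\<Prod>a\<in>A - B. h a)"
   by (intro arg_cong2[where f = "(*)"] prod.cong) auto
  finally show "(\<Prod>a\<in>A. if a : B then g a else h a) = (\<Prod>a\<in>B. g a) * (\<Prod>a\<in>A - B. h a)" .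
 qed
 also have "\<dots> = (\<Prod>a\<in>A. g a + h a)" using prod_add[OF assms, of g h] by simp
 finally show ?thesis .
qed

text \<open>
  The sum of \<open>(-1)\<close> to the number of edges in \<open>B\<close> that leave \<open>U\<close>, over all \<open>B\<close> and \<open>U\<close>, counts
  on the one hand the cuts that are empty and on the other hand the cycles; the mod 2 boundaries
  of sets of triangles are cycles.
\<close>

lemma graph_cycle_count:
 fixes V :: "'v set" and E :: "'v set set"
 assumes fin: "finite V" "finite E"
  and E: "!!e. e : E ==> e \<subseteq> V & card e = 2"
  and conn: "!!U. U \<subseteq> V ==> (ALL e:E. card (e Int U) ~= 1) ==> U = {} \<or> U = V"
 shows "card {B. B \<subseteq> E & (ALL v:V. even (card {e:B. v : e}))} * 2 ^ card V <= 2 ^ (card E + 1)"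
proof -
 let ?c = "%B U. (-1::int) ^ card {e:B. card (e Int U) = 1}"
 let ?C = "{B. B \<subseteq> E & (ALL v:V. even (card {e:B. v : e}))}"
 have finC: "finite ?C" using fin by (auto intro: finite_subset[OF _ finite_Pow_iff[THEN iffD2, OF fin(2)]])
 \<comment> \<open>Summing the degrees over \<open>U\<close> counts an edge of \<open>B\<close>
   inside \<open>U\<close> twice and an edge leaving \<open>U\<close> once, so the sign depends only
   on the parities of the degrees.\<close>
 have deg: "?c B U = (\<Prod>v\<in>V. if v : U then (-1) ^ card {e:B. v : e} else 1)"
  if B: "B \<subseteq> E" and U: "U \<subseteq> V" for B U
 proof -
  have fB: "finite B" and fU: "finite U" using fin B U finite_subset by auto
  have "(\<Prod>v\<in>V. if v : U then (-1::int) ^ card {e:B. v : e} else 1) = (\<Prod>v\<in>U. (-1) ^ card {e:B. v : e})"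
   using U fin by (simp add: prod.If_cases Int_absorb1)
  also have "\<dots> = (-1) ^ (\<Sum>v\<in>U. card {e:B. v : e})" by (simp add: power_sum)
  also have "(\<Sum>v\<in>U. card {e:B. v : e}) = (\<Sum>e\<in>B. card {v:U. v : e})"
   by (rule double_count[OF fU fB])
  also have "(-1::int) ^ \<dots> = (\<Prod>e\<in>B. (-1) ^ card {v:U. v : e})" by (simp add: power_sum)
  also have "\<dots> = (\<Prod>e\<in>B. if card (e Int U) = 1 then -1 else 1)"
  proof (rule prod.cong[OF refl])
   fix e assume e: "e : B"
   have "{v:U. v : e} = e Int U" by auto
   moreover have "finite e" "card e = 2" using E[of e] B e fin(1) finite_subset by auto
   moreover have "card (e Int U) <= card e" using \<open>finite e\<close> by (intro card_mono) auto
   ultimately have c: "card (e Int U) <= 2" and eq: "{v:U. v : e} = e Int U"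
    by simp_all
   from c have "card (e Int U) = 0 \<or> card (e Int U) = 1 \<or> card (e Int U) = 2" by linarith
   then show "(-1::int) ^ card {v:U. v : e} = (if card (e Int U) = 1 then -1 else 1)"
    unfolding eq by (elim disjE) simp_all
  qed
  also have "\<dots> = ?c B U" using minus_one_card[OF fB, of "%e. card (e Int U) = 1"] by simp
  finally show ?thesis by simp
 qed
 \<comment> \<open>The sum over \<open>U\<close> detects cycles: a vertex of odd degree makes one
   factor vanish.\<close>
 have 1: "(\<Sum>U\<in>Pow V. ?c B U) = (if B : ?C then 2 ^ card V else 0)" if B: "B \<subseteq> E" for B
 proof -
  have "(\<Sum>U\<in>Pow V. ?c B U) = (\<Sum>U\<in>Pow V. \<Prod>v\<in>V. if v : U then (-1) ^ card {e:B. v : e} else 1)"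
   using deg[OF B] by (intro sum.cong) auto
  also have "\<dots> = (\<Prod>v\<in>V. (-1) ^ card {e:B. v : e} + 1)" by (rule sum_Pow_prod[OF fin(1)])
  also have "\<dots> = (if B : ?C then 2 ^ card V else 0)"
  proof (cases "B : ?C")
   case True
   then have "(\<Prod>v\<in>V. (-1::int) ^ card {e:B. v : e} + 1) = (\<Prod>v\<in>V. 2)"
    by (intro prod.cong) auto
   then show ?thesis using True by simp
  next
   case False
   then obtain v where v: "v : V" "odd (card {e:B. v : e})" using B by auto
   then have "(-1::int) ^ card {e:B. v : e} + 1 = 0" by simp
   then have "(\<Prod>v\<in>V. (-1::int) ^ card {e:B. v : e} + 1) = 0"
    using v(1) by (intro prod_zero[OF fin(1)] bexI[of _ v])
   then show ?thesis using False by simp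
  qed
  finally show ?thesis .
 qed
 have "(\<Sum>B\<in>Pow E. \<Sum>U\<in>Pow V. ?c B U) = (\<Sum>B\<in>Pow E. if B : ?C then 2 ^ card V else 0)"
  using 1 by (intro sum.cong) auto
 also have "\<dots> = (\<Sum>B\<in>?C. 2 ^ card V)"
  using fin by (intro sum.mono_neutral_cong_right) auto
 also have "\<dots> = int (card ?C) * 2 ^ card V" by simp
 finally have L: "(\<Sum>B\<in>Pow E. \<Sum>U\<in>Pow V. ?c B U) = int (card ?C) * 2 ^ card V" .
 \<comment> \<open>The sum over \<open>B\<close> detects connectedness: an edge that leaves
   \<open>U\<close> makes one factor vanish.\<close>
 have 2: "(\<Sum>B\<in>Pow E. ?c B U) = (if U = {} \<or> U = V then 2 ^ card E else 0)" if U: "U \<subseteq> V" for U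
 proof -
  have "?c B U = (\<Prod>e\<in>E. if e : B then (if card (e Int U) = 1 then -1 else 1) else 1)" if B: "B \<subseteq> E" for B
  proof -
   have fB: "finite B" using fin B finite_subset by auto
   have "?c B U = (\<Prod>e\<in>B. if card (e Int U) = 1 then -1 else 1)"
    using minus_one_card[OF fB, of "%e. card (e Int U) = 1"] by simp
   also have "\<dots> = (\<Prod>e\<in>E. if e : B then (if card (e Int U) = 1 then -1 else 1) else 1)"
    using B fin by (simp add: prod.If_cases[of E "%e. e : B"] Int_absorb1)
   finally show ?thesis .
  qed
  then have "(\<Sum>B\<in>Pow E. ?c B U) =
    (\<Sum>B\<in>Pow E. \<Prod>e\<in>E. if e : B then (if card (e Int U) = 1 then -1 else 1) else 1)"
   by (intro sum.cong) auto
  also have "\<dots> = (\<Prod>e\<in>E. (if card (e Int U) = 1 then -1 else 1) + 1)" by (rule sum_Pow_prod[OF fin(2)])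
  also have "\<dots> = (if U = {} \<or> U = V then 2 ^ card E else 0)"
  proof (cases "U = {} \<or> U = V")
   case True
   have "card (e Int U) ~= 1" if "e : E" for e
   proof -
    have "e Int U = {} \<or> e Int U = e" using True E[OF that] by auto
    then show ?thesis using E[OF that] by auto
   qed
   then have "(\<Prod>e\<in>E. (if card (e Int U) = 1 then -1 else 1) + (1::int)) = (\<Prod>e\<in>E. 2)"
    by (intro prod.cong) auto
   then show ?thesis using True by simp
  next
   case False
   then obtain e where e: "e : E" "card (e Int U) = 1" using conn[OF U] by blast
   then have "(\<Prod>e\<in>E. (if card (e Int U) = 1 then -1 else 1) + (1::int)) = 0"
    by (intro prod_zero[OF fin(2)] bexI[of _ e]) simp_all
   then show ?thesis using False by simp
  qed
  finally show ?thesis .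
 qed
 have "(\<Sum>B\<in>Pow E. \<Sum>U\<in>Pow V. ?c B U) = (\<Sum>U\<in>Pow V. \<Sum>B\<in>Pow E. ?c B U)" by (rule sum.swap)
 also have "\<dots> = (\<Sum>U\<in>Pow V. if U : {{},V} then 2 ^ card E else 0)"
  using 2 by (intro sum.cong) auto
 also have "\<dots> = (\<Sum>U\<in>{{},V}. 2 ^ card E)"
  using fin by (intro sum.mono_neutral_cong_right) auto
 also have "\<dots> <= 2 ^ (card E + 1)" by (cases "V = {}") auto
 finally have "int (card ?C) * 2 ^ card V <= 2 ^ (card E + 1)" using L by simp
 then show ?thesis by (metis (mono_tags, lifting) of_nat_le_iff of_nat_mult of_nat_numeral of_nat_power)
qed

text \<open>The mod 2 boundary map from sets of triangles to cycles identifies at most a set with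
  its complement, so there are at least 2^(F-1) cycles. The cycle count allows at most 2^(E-V+1) of
  them, and comparison of the exponents gives V - E + F at most 2.\<close>

lemma chi_le_2:
 assumes cl: "closed_surface S" and con: "adjacent_linked S"
 shows "chi S <= 2"
proof (cases "S = {}")
 case True
 then show ?thesis by (simp add: chi_def edges_of_def)
next
 case False
 have fin: "finite S" and c3: "!!t. t : S ==> card t = 3" using cl by (auto simp: closed_surface_def)
 let ?E = "edges_of S" and ?V = "\<Union>S"
 have finE: "finite ?E" using finite_edges_of fin c3 by blast
 have finV: "finite ?V" using fin c3 by (metis card.infinite finite_Union zero_neq_numeral)
 have ft: "finite t" if "t : S" for t using c3[OF that] by (metis card.infinite zero_neq_numeral)
 let ?C = "{B. B \<subseteq> ?E & (ALL v:?V. even (card {e:B. v : e}))}"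
 have "card ?C * 2 ^ card ?V <= 2 ^ (card ?E + 1)"
 proof (rule graph_cycle_count[OF finV finE])
  fix e assume "e : ?E" then show "e \<subseteq> ?V & card e = 2" by (auto simp: edges_of_def)
 next
  fix U assume U: "U \<subseteq> ?V" "ALL e:?E. card (e Int U) ~= 1"
  define A where "A = {t:S. t \<subseteq> U}"
  have dich: "t \<subseteq> U \<or> t Int U = {}" if t: "t : S" for t
  proof (rule ccontr)
   assume "~ ?thesis"
   then obtain a b where "a : t" "b : t" "a ~: U" "b : U" by auto
   then have "{a,b} : ?E" "{a,b} Int U = {b}" using t by (auto simp: edges_of_def card_insert_if)
   then show False using U(2) by force
  qed
  have "A = {} \<or> S - A = {}"
  proof (rule ccontr)
   assume "~ ?thesis"
   moreover have "A Un (S - A) = S" by (auto simp: A_def)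
   ultimately obtain t t' where tt: "t : A" "t' : S - A" "card (t Int t') = 2"
    using con[unfolded adjacent_linked_def, rule_format, of A "S - A"] by auto
   then have "t Int t' ~= {}" by (metis card.empty zero_neq_numeral)
   then show False using tt dich[of t'] by (auto simp: A_def)
  qed
  then show "U = {} \<or> U = ?V" using dich U(1) by (fastforce simp: A_def)
 qed
 define bd where "bd A = {e:?E. odd (card {t:A. e \<subseteq> t})}" for A
 have bdC: "bd A : ?C" if A: "A \<subseteq> S" for A
 proof -
  have fA: "finite A" using A fin finite_subset by blast
  have "even (card {e:bd A. v : e})" if v: "v : ?V" for v
  proof -
   let ?Ev = "{e:?E. v : e}"
   have fEv: "finite ?Ev" using finE by simp
   have "even (\<Sum>t\<in>A. card {e:?Ev. e \<subseteq> t})"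
   proof (rule dvd_sum)
    fix t assume t: "t : A"
    then have tS: "t : S" using A by auto
    show "even (card {e:?Ev. e \<subseteq> t})"
    proof (cases "v : t")
     case True
     then obtain b c where bc: "t = {v,b,c}" using card_3_elem c3[OF tS] by metis
     then have ne: "v ~= b" "v ~= c" "b ~= c" using c3[OF tS] card_3_distinct[of v b c] by auto
     have "{e:?Ev. e \<subseteq> t} = {{v,b},{v,c}}"
     proof
      show "{e:?Ev. e \<subseteq> t} \<subseteq> {{v,b},{v,c}}"
      proof
       fix e assume e: "e : {e:?Ev. e \<subseteq> t}"
       then obtain w where "e = {v,w}" "w ~= v" by (auto simp: edges_of_def card_2_iff)
       then show "e : {{v,b},{v,c}}" using e bc by auto
      qed
      show "{{v,b},{v,c}} \<subseteq> {e:?Ev. e \<subseteq> t}" using tS bc ne by (auto simp: edges_of_def intro!: bexI[of _ t])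
     qed
     moreover have "{v,b} ~= {v,c}" using ne by (auto simp: doubleton_eq_iff)
     ultimately show ?thesis by simp
    next
     case False
     then have none: "{e:?Ev. e \<subseteq> t} = {}" by blast
     show ?thesis unfolding none by simp
    qed
   qed
   also have "(\<Sum>t\<in>A. card {e:?Ev. e \<subseteq> t}) = (\<Sum>e\<in>?Ev. card {t:A. e \<subseteq> t})"
    by (rule double_count[OF fA fEv])
   finally have "even (card {e:?Ev. odd (card {t:A. e \<subseteq> t})})"
    using fEv by (simp add: even_sum_iff)
   moreover have "{e:?Ev. odd (card {t:A. e \<subseteq> t})} = {e:bd A. v : e}" by (auto simp: bd_def)
   ultimately show ?thesis by simp
  qed
  then show ?thesis by (auto simp: bd_def)
 qed
 have pair: "EX t1 t2. t1 ~= t2 & {t:S. e \<subseteq> t} = {t1,t2}" if "e : ?E" for e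
 proof -
  have "card {t:S. e \<subseteq> t} = 2" using cl that by (simp add: closed_surface_def)
  then show ?thesis unfolding card_2_iff by blast
 qed
 \<comment> \<open>Equal boundaries mean that the symmetric difference has empty boundary; then no
   edge separates it from its complement, and connectedness leaves only the two trivial
   cases.\<close>
 have bdeq: "A' = A \<or> A' = S - A" if A: "A \<subseteq> S" "A' \<subseteq> S" "bd A = bd A'" for A A'
 proof (rule ccontr)
  assume neg: "~ ?thesis"
  let ?D = "(A - A') Un (A' - A)"
  have "?D ~= {}" "S - ?D ~= {}" "?D Un (S - ?D) = S" using neg A by auto
  then obtain t t' where tt: "t : ?D" "t' : S - ?D" "card (t Int t') = 2"
   using con[unfolded adjacent_linked_def, rule_format, of ?D "S - ?D"] by blast
  have tS: "t : S" "t' : S" "t ~= t'" using tt A by auto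
  let ?e = "t Int t'"
  have eE: "?e : ?E" using tt tS by (auto simp: edges_of_def)
  obtain t1 t2 where t12: "t1 ~= t2" "{s:S. ?e \<subseteq> s} = {t1,t2}" using pair[OF eE] by blast
  have "t : {t1,t2}" "t' : {t1,t2}" unfolding t12(2)[symmetric] using tS by auto
  then have two: "{s:S. ?e \<subseteq> s} = {t,t'}" using t12 tS(3) by auto
  have cnt: "card {s:X. ?e \<subseteq> s} = (if t : X then 1 else 0) + (if t' : X then 1 else 0)" if "X \<subseteq> S" for X
  proof -
   have "{s:X. ?e \<subseteq> s} = {s:S. ?e \<subseteq> s} Int X" using that by auto
   then have eq: "{s:X. ?e \<subseteq> s} = {t,t'} Int X" using two by simp
   show ?thesis unfolding eq using tS(3) by (cases "t : X"; cases "t' : X") auto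
  qed
  have "?e : bd A \<longleftrightarrow> ?e : bd A'" using A(3) by simp
  then have "odd (card {s:A. ?e \<subseteq> s}) \<longleftrightarrow> odd (card {s:A'. ?e \<subseteq> s})" using eE by (simp add: bd_def)
  then show False using cnt[OF A(1)] cnt[OF A(2)] tt by (auto split: if_splits)
 qed
 have "2 ^ card S <= 2 * card ?C"
 proof -
  have finC: "finite ?C" using finite_subset[of ?C "Pow ?E"] finE by auto
  have "2 ^ card S = card (Pow S)" using fin by (simp add: card_Pow)
  also have "Pow S = (\<Union>B\<in>bd ` Pow S. {A:Pow S. bd A = B})" by auto
  also have "card \<dots> <= (\<Sum>B\<in>bd ` Pow S. card {A:Pow S. bd A = B})"
   using fin by (intro card_UN_le) auto
  also have "\<dots> <= (\<Sum>B\<in>bd ` Pow S. 2)"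
  proof (rule sum_mono)
   fix B assume "B : bd ` Pow S"
   then obtain A where A: "A \<subseteq> S" "B = bd A" by auto
   have "{A':Pow S. bd A' = B} \<subseteq> {A, S - A}" using bdeq A by auto
   then have "card {A':Pow S. bd A' = B} <= card {A, S - A}" by (intro card_mono) auto
   also have "\<dots> <= 2" by (simp add: card_insert_if)
   finally show "card {A':Pow S. bd A' = B} <= 2" .
  qed
  also have "\<dots> = 2 * card (bd ` Pow S)" by simp
  also have "card (bd ` Pow S) <= card ?C" using bdC finC by (intro card_mono) auto
  finally show ?thesis by simp
 qed
 then have "2 ^ card S * 2 ^ card ?V <= 2 * (card ?C * 2 ^ card ?V)" by simp
 also have "\<dots> <= 2 * 2 ^ (card ?E + 1)"
  using \<open>card ?C * 2 ^ card ?V <= 2 ^ (card ?E + 1)\<close> by (intro mult_left_mono) auto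
 finally have "(2::nat) ^ (card S + card ?V) <= 2 ^ (card ?E + 2)" by (simp add: power_add)
 then have "card S + card ?V <= card ?E + 2" by (rule power_le_imp_le_exp[rotated]) simp
 then show ?thesis by (simp add: chi_def)
qed

section \<open>Algebra in characteristic 2\<close>

text \<open>Evaluation at \<open>x\<close> with the coefficients pushed through \<open>h\<close>, so
  that coefficients and values may live in different rings. Three nested copies give the
  substitution homomorphism out of the iterated polynomial ring.\<close>

definition poly_eval :: "('a::comm_ring_1 => 'b::comm_ring_1) => 'b => 'a poly => 'b" where
 "poly_eval h x p = fold_coeffs (%a b. h a + x * b) p 0"

definition ring_homo :: "('a::comm_ring_1 => 'b::comm_ring_1) => bool" where
 "ring_homo h \<longleftrightarrow> h 0 = 0 & h 1 = 1 & (ALL a b. h (a + b) = h a + h b) & (ALL a b. h (a * b) = h a * h b)"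

lemma poly_eval_0 [simp]: "poly_eval h x 0 = 0"
 by (simp add: poly_eval_def)

lemma poly_eval_pCons:
 assumes "h 0 = 0"
 shows "poly_eval h x (pCons a p) = h a + x * poly_eval h x p"
 using assms by (cases "p = 0 & a = 0") (auto simp: poly_eval_def)

lemma ring_homo_poly_eval:
 assumes h: "ring_homo h"
 shows "ring_homo (poly_eval h x)"
proof -
 have h0: "h 0 = 0" and h1: "h 1 = 1" and ha: "!!a b. h (a + b) = h a + h b"
  and hm: "!!a b. h (a * b) = h a * h b" using h by (auto simp: ring_homo_def)
 note pC = poly_eval_pCons[of h, OF h0]
 have add: "poly_eval h x (p + q) = poly_eval h x p + poly_eval h x q" for p q
  by (induction p q rule: poly_induct2) (simp_all add: pC ha algebra_simps)
 have sm: "poly_eval h x (smult a q) = h a * poly_eval h x q" for a q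
  by (induction q) (simp_all add: pC hm algebra_simps)
 have mul: "poly_eval h x (p * q) = poly_eval h x p * poly_eval h x q" for p q
  by (induction p) (simp_all add: pC add sm h0 algebra_simps)
 show ?thesis using add mul by (simp add: ring_homo_def pC h1 one_pCons)
qed

lemma ring_homo_power: "ring_homo h ==> h (a ^ n) = h a ^ n"
 by (induction n) (auto simp: ring_homo_def)

lemma ring_homo_sum: "ring_homo h ==> h (\<Sum>i\<in>A. f i) = (\<Sum>i\<in>A. h (f i))"
 by (induction A rule: infinite_finite_induct) (auto simp: ring_homo_def)

definition poly_X :: "nat => 'k::field poly poly poly" where
 "poly_X i = (if i = 1 then [:[:[:0, 1:]:]:] else if i = 2 then [:[:0, 1:]:] else [:0, 1:])"

text \<open>Substitutes the squares \<open>var_x i\<close> for three independent indeterminates.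
  Divisibility is argued in the ring of the \<open>poly_X i\<close>, where x_i itself is an
  indeterminate, and this homomorphism carries the quotient into
  \<open>polynomial_ring_x\<close>.\<close>

definition to_ratfun :: "'k::field poly poly poly => 'k ratfun" where
 "to_ratfun = poly_eval (poly_eval (poly_eval (%a. Fract [:[:[:a:]:]:] 1) (var_x 1)) (var_x 2)) (var_x 3)"

lemma ring_homo_const: "ring_homo (%a::'k::field. Fract [:[:[:a:]:]:] 1)"
 by (simp add: ring_homo_def Zero_fract_def One_fract_def one_pCons mult.commute)

lemma ring_homo_to_ratfun: "ring_homo to_ratfun"
 unfolding to_ratfun_def by (intro ring_homo_poly_eval ring_homo_const)

lemma to_ratfun_poly_X:
 assumes "i : {1,2,3}"
 shows "to_ratfun (poly_X i) = (var_x i :: 'k::field ratfun)"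
proof -
 define h0 where "h0 = (%a::'k. Fract [:[:[:a:]:]:] 1 :: 'k ratfun)"
 define h1 where "h1 = poly_eval h0 (var_x 1)"
 define h2 where "h2 = poly_eval h1 (var_x 2)"
 have h: "ring_homo h0" "ring_homo h1" "ring_homo h2"
  unfolding h0_def h1_def h2_def by (intro ring_homo_poly_eval ring_homo_const)+
 have z: "h0 0 = 0" "h1 0 = 0" "h2 0 = 0" and o: "h0 1 = 1" "h1 1 = 1" "h2 1 = 1"
  using h by (auto simp: ring_homo_def)
 have pC: "h1 (pCons a p) = h0 a + var_x 1 * h1 p" "h2 (pCons b q) = h1 b + var_x 2 * h2 q"
  "poly_eval h2 (var_x 3) (pCons c r) = h2 c + var_x 3 * poly_eval h2 (var_x 3) r" for a p b q c r
  by (metis h1_def poly_eval_pCons z(1), metis h2_def poly_eval_pCons z(2), metis poly_eval_pCons z(3))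
 have t: "to_ratfun = poly_eval h2 (var_x 3)" by (simp add: to_ratfun_def h0_def h1_def h2_def)
 have "to_ratfun (poly_X 1) = (var_x 1 :: 'k ratfun)" "to_ratfun (poly_X 2) = (var_x 2 :: 'k ratfun)"
  "to_ratfun (poly_X 3) = (var_x 3 :: 'k ratfun)"
  unfolding t by (simp_all add: poly_X_def pC z o)
 then show ?thesis using assms by auto
qed

lemma poly_eval_closed:
 fixes h :: "'a::comm_ring_1 => 'k::field ratfun"
 assumes "h 0 = 0" "!!a. h a : polynomial_ring_x" "x : polynomial_ring_x" "(0::'k::field ratfun) : polynomial_ring_x"
 shows "poly_eval h x p : polynomial_ring_x"
 by (induction p) (auto simp: assms poly_eval_pCons[of h, OF assms(1)] intro!: polynomial_ring_x.add polynomial_ring_x.mult)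

lemma zero_in_polynomial_ring_x: "(0::'k::field ratfun) : polynomial_ring_x"
 using polynomial_ring_x.const[of 0] by (simp add: Zero_fract_def)

lemma to_ratfun_in: "to_ratfun p : polynomial_ring_x"
proof -
 define h0 where "h0 = (%a::'a. Fract [:[:[:a:]:]:] 1 :: 'a ratfun)"
 define h1 where "h1 = poly_eval h0 (var_x 1)"
 define h2 where "h2 = poly_eval h1 (var_x 2)"
 have h: "ring_homo h0" "ring_homo h1" "ring_homo h2"
  unfolding h0_def h1_def h2_def by (intro ring_homo_poly_eval ring_homo_const)+
 have z: "h0 0 = 0" "h1 0 = 0" "h2 0 = 0" using h by (auto simp: ring_homo_def)
 have 0: "h0 a : polynomial_ring_x" for a unfolding h0_def by (rule polynomial_ring_x.const)
 have 1: "h1 a : polynomial_ring_x" for a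
  unfolding h1_def using z 0 zero_in_polynomial_ring_x by (intro poly_eval_closed polynomial_ring_x.indet) auto
 have 2: "h2 a : polynomial_ring_x" for a
  unfolding h2_def using z 1 zero_in_polynomial_ring_x by (intro poly_eval_closed polynomial_ring_x.indet) auto
 have t: "to_ratfun = poly_eval h2 (var_x 3)" by (simp add: to_ratfun_def h0_def h1_def h2_def)
 show ?thesis unfolding t
  using z 2 zero_in_polynomial_ring_x by (intro poly_eval_closed polynomial_ring_x.indet) auto
qed

lemma two_eq_0_field: "CHAR('k::field) = 2 ==> (1::'k) + 1 = 0"
 by (metis of_nat_CHAR of_nat_numeral one_add_one)

lemma poly_two: "(1::'a::comm_ring_1) + 1 = 0 ==> (1::'a poly) + 1 = 0"
 by (simp add: one_pCons)

lemma char2_minus: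
 assumes "(1::'a::comm_ring_1) + 1 = 0"
 shows "- x = (x::'a)" "x + x = 0"
proof -
 have "x + x = (1 + 1) * x" by (simp add: algebra_simps)
 then show "x + x = 0" using assms by simp
 then show "- x = x" by (simp add: minus_unique)
qed

text \<open>The multiplicity of the root \<open>a\<close> is additive over products, and
  \<open>g\<close> contributes none.\<close>

lemma linear_power_dvd_cancel:
 fixes f :: "'a::idom poly"
 assumes "[:-a,1:] ^ n dvd g * f" "poly g a ~= 0"
 shows "[:-a,1:] ^ n dvd f"
proof (cases "f = 0")
 case False
 have "g ~= 0" using assms(2) by auto
 then have ne: "g * f ~= 0" using False by simp
 have "n <= order a (g * f)" using assms(1) ne by (simp add: order_divides)
 also have "\<dots> = order a f" using ne assms(2) by (simp add: order_mult order_0I)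
 finally show ?thesis by (simp add: order_divides)
qed simp

text \<open>Coprimality by multiplicities of roots in the outermost variable: X_1 + X_2 is a
  constant there, and the other two forms are, in characteristic 2, monic linear with the distinct
  roots X_1 and X_2. The successive cofactors do not vanish at these roots because X_1 + X_2 is
  nonzero.\<close>

lemma X_powers_dvd:
 fixes f :: "'k::field poly poly poly"
 assumes two: "(1::'k) + 1 = 0"
  and A: "(poly_X 1 + poly_X 2) ^ n dvd f" and B: "(poly_X 1 + poly_X 3) ^ n dvd f"
  and C: "(poly_X 2 + poly_X 3) ^ n dvd f"
 shows "(poly_X 1 + poly_X 2) ^ n * (poly_X 1 + poly_X 3) ^ n * (poly_X 2 + poly_X 3) ^ n dvd f"
proof -
 have two2: "(1::'k poly poly) + 1 = 0" by (intro poly_two two)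
 let ?x1 = "[:[:0,1:]:] :: 'k poly poly" and ?x2 = "[:0,1:] :: 'k poly poly"
 let ?A = "poly_X 1 + poly_X 2 :: 'k poly poly poly"
 have Bq: "poly_X 1 + poly_X 3 = [:-?x1,1:]" and Cq: "poly_X 2 + poly_X 3 = [:-?x2,1:]"
  by (simp_all add: poly_X_def char2_minus[OF two2] del: minus_pCons)
 have Aq: "?A = [:?x1 + ?x2:]" by (simp add: poly_X_def)
 have ne: "?x1 + ?x2 ~= 0" by simp
 obtain h where h: "f = ?A ^ n * h" using A by (elim dvdE)
 have "[:-?x1,1:] ^ n dvd h"
 proof (rule linear_power_dvd_cancel)
  show "[:-?x1,1:] ^ n dvd ?A ^ n * h" using B h Bq by simp
  show "poly (?A ^ n) ?x1 ~= 0" unfolding Aq poly_power using ne by simp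
 qed
 then obtain g where g: "h = [:-?x1,1:] ^ n * g" by (elim dvdE)
 have "[:-?x2,1:] ^ n dvd g"
 proof (rule linear_power_dvd_cancel)
  show "[:-?x2,1:] ^ n dvd (?A ^ n * [:-?x1,1:] ^ n) * g" using C h g Cq by (simp add: mult.assoc)
  have "poly [:-?x1,1:] ?x2 = ?x1 + ?x2" by (simp add: char2_minus[OF two2] del: minus_pCons)
  then show "poly (?A ^ n * [:-?x1,1:] ^ n) ?x2 ~= 0"
   unfolding Aq poly_power poly_mult using ne by simp
 qed
 then obtain g' where "g = [:-?x2,1:] ^ n * g'" by (elim dvdE)
 then show ?thesis unfolding Bq Cq h g by (simp add: mult.assoc)
qed

lemma var_x_sum_nonzero:
 assumes "(1::'k::field) + 1 = 0" "i : {1,2,3}" "j : {1,2,3}" "i ~= j"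
 shows "(var_x i + var_x j :: 'k ratfun) ~= 0"
proof -
 have two: "(1::'k ratfun) + 1 = 0"
  using poly_two[OF poly_two[OF poly_two[OF assms(1)]]] by (simp add: One_fract_def Zero_fract_def)
 have "var_x i + var_x j = (sqrt_x i + sqrt_x j :: 'k ratfun)\<^sup>2"
  using char2_minus(2)[OF two] unfolding var_x_def power2_sum
  by (metis (no_types, lifting) add.right_neutral distrib_right mult_2)
 moreover have "sqrt_x i + sqrt_x j ~= (0 :: 'k ratfun)"
  using assms(2-4) by (auto simp: sqrt_x_def Zero_fract_def eq_fract)
 ultimately show ?thesis by simp
qed

lemma sqrt_char2_square:
 assumes "(1::'a::field) + 1 = 0"
 shows "sqrt_char2 ((r::'a)\<^sup>2) = r"
 unfolding sqrt_char2_def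
proof (rule the_equality)
 fix s assume "s\<^sup>2 = r\<^sup>2"
 then have "s = r \<or> s = - r" by (simp add: power2_eq_iff)
 then show "s = r" using char2_minus(1)[OF assms] by simp
qed simp

text \<open>Modulo \<open>a + b\<close> the elements \<open>a\<close> and \<open>b\<close> agree,
  since signs do not matter; the two summands become equal and cancel. The relation \<open>E\<close>
  below is this congruence.\<close>

lemma swap_sum_dvd:
 fixes a b x :: "'a::comm_ring_1"
 assumes two: "(1::'a) + 1 = 0"
 shows "a + b dvd a ^ \<alpha> * b ^ \<beta> * (a + x) ^ q * (b + x) ^ p + a ^ \<beta> * b ^ \<alpha> * (a + x) ^ p * (b + x) ^ q"
proof -
 have ab: "a + b = a - b" using char2_minus(1)[OF two, of b] by (simp only: diff_conv_add_uminus)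
 define E where "E = (%u v. a + b dvd u - v)"
 have trans: "E u w" if "E u v" "E v w" for u v w
 proof -
  have "u - w = (u - v) + (v - w)" by simp
  then show ?thesis using that unfolding E_def by (metis dvd_add)
 qed
 have refl: "E u u" for u by (simp add: E_def)
 have mult: "E (u * v) (u' * v')" if "E u u'" "E v v'" for u v u' v'
 proof -
  have "u * v - u' * v' = (u - u') * v + u' * (v - v')" by (simp add: algebra_simps)
  then show ?thesis using that unfolding E_def by simp
 qed
 have pow: "E (u ^ n) (v ^ n)" if "E u v" for u v n
  by (induction n) (auto simp: refl intro!: mult that)
 have e1: "E a b" by (simp add: E_def ab)
 have e2: "E (a + x) (b + x)" by (simp add: E_def ab)
 have e1': "E b a" using e1 unfolding E_def by (metis dvd_minus_iff minus_diff_eq)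
 have e2': "E (b + x) (a + x)" using e2 unfolding E_def by (metis dvd_minus_iff minus_diff_eq)
 have "E (a ^ \<alpha> * b ^ \<beta> * (a + x) ^ q * (b + x) ^ p) (b ^ \<alpha> * a ^ \<beta> * (b + x) ^ q * (a + x) ^ p)"
  by (intro mult pow e1 e2 e1' e2')
 then have "a + b dvd a ^ \<alpha> * b ^ \<beta> * (a + x) ^ q * (b + x) ^ p + - (a ^ \<beta> * b ^ \<alpha> * (a + x) ^ p * (b + x) ^ q)"
  by (simp add: E_def algebra_simps)
 then show ?thesis unfolding char2_minus(1)[OF two] .
qed

section \<open>Colored triangulations and Kempe moves\<close>

definition cells :: "'v set set => 'v set set" where
 "cells S = {c. c ~= {} & (EX t:S. c \<subseteq> t)}"

lemma finite_cells:
 assumes "finite S" "!!t. t : S ==> card t = 3"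
 shows "finite (cells S)"
proof (rule finite_subset)
 show "cells S \<subseteq> (\<Union>t\<in>S. Pow t)" by (auto simp: cells_def)
 show "finite (\<Union>t\<in>S. Pow t)"
  using assms by (auto intro!: finite_UN_I) (metis card.infinite finite_Pow_iff zero_neq_numeral)
qed

text \<open>As a sum over all nonempty faces the Euler characteristic is additive along any
  partition of the cells, which is how the effect of an exchange is tracked.\<close>

lemma chi_eq_sum_cells:
 assumes "finite S" "!!t. t : S ==> card t = 3"
 shows "chi S = (\<Sum>c\<in>cells S. (-1) ^ (card c + 1))"
proof -
 let ?f = "%c. (-1::int) ^ (card c + 1)"
 have ft: "finite t" if "t : S" for t using assms(2)[OF that] by (metis card.infinite zero_neq_numeral)
 have fV: "finite (\<Union>S)" using assms ft by auto
 have fE: "finite (edges_of S)" using finite_edges_of assms by blast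
 have sub: "c : (%v. {v}) ` (\<Union>S) \<or> c \<in> edges_of S \<or> c : S" if c: "c : cells S" for c
 proof -
  from c obtain t where t: "t : S" "c \<subseteq> t" "c ~= {}" by (auto simp: cells_def)
  have fc: "finite c" using t ft finite_subset by blast
  have "card c <= 3" using card_mono[OF ft[OF t(1)] t(2)] assms(2)[OF t(1)] by simp
  moreover have "card c ~= 0" using fc t by simp
  ultimately consider "card c = 1" | "card c = 2" | "card c = 3" by linarith
  then show ?thesis
  proof cases
   case 1
   then obtain v where "c = {v}" by (auto simp: card_1_singleton_iff)
   then show ?thesis using t by auto
  next
   case 2 then show ?thesis using t by (auto simp: edges_of_def)
  next
   case 3
   then have "c = t" using t ft assms by (metis card_subset_eq)
   then show ?thesis using t by simp
  qed
 qed
 have "cells S = ((%v. {v}) ` (\<Union>S) Un edges_of S) Un S"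
 proof
  show "cells S \<subseteq> ((%v. {v}) ` (\<Union>S) Un edges_of S) Un S" using sub by blast
  have "c ~= {}" if "card c = 2 \<or> card c = 3" for c :: "'a set" using that by auto
  then show "((%v. {v}) ` (\<Union>S) Un edges_of S) Un S \<subseteq> cells S"
   using assms(2) by (force simp: cells_def edges_of_def)
 qed
 moreover have "((%v. {v}) ` (\<Union>S) Un edges_of S) Int S = {}"
  using assms(2) by (force simp: edges_of_def)
 moreover have "(%v. {v}) ` (\<Union>S) Int edges_of S = {}" by (auto simp: edges_of_def)
 ultimately have "(\<Sum>c\<in>cells S. ?f c) = (\<Sum>c\<in>(%v. {v}) ` (\<Union>S). ?f c) + (\<Sum>c\<in>edges_of S. ?f c) + (\<Sum>c\<in>S. ?f c)"
  using assms fV fE by (simp add: sum.union_disjoint)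
 also have "(\<Sum>c\<in>(%v. {v}) ` (\<Union>S). ?f c) = int (card (\<Union>S))"
  by (subst sum.reindex) (auto simp: inj_on_def)
 also have "(\<Sum>c\<in>edges_of S. ?f c) = - int (card (edges_of S))" by (simp add: edges_of_def)
 also have "(\<Sum>c\<in>S. ?f c) = int (card S)" using assms(2) by simp
 finally show ?thesis by (simp add: chi_def)
qed

text \<open>The coloring condition on triangles: equality across edges of degree 2 makes the color
  constant along a facet, and inequality across the remaining edges is the seam condition. The
  restriction to extensional functions makes the colorings a finite set in which equality can be
  tested on \<open>T\<close>.\<close>

definition proper_coloring :: "'v set set => ('v set => nat) => bool" where
 "proper_coloring T k \<longleftrightarrow> k : T \<rightarrow>\<^sub>E {1,2,3} &
  (ALL e:edges_of T. ALL t:T. ALL t':T. e \<subseteq> t --> e \<subseteq> t' --> t ~= t' -->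
    (k t = k t' \<longleftrightarrow> card {t:T. e \<subseteq> t} = 2))"

text \<open>Combinatorial abstraction of an anchored foam: \<open>A\<close> and \<open>Q\<close>
  stand for anchor points and dots, and \<open>carr\<close>, \<open>dcarr\<close> for the smallest
  simplices containing them. The geometric inputs \<open>linked\<close>, \<open>chi_even\<close> and
  \<open>anchor_even\<close> are required for every proper coloring, because exchanges lead from one
  coloring to others.\<close>

locale colored_complex =
 fixes T :: "'v set set" and A :: "'p set" and carr :: "'p => 'v set" and lab :: "'p => nat"
  and Q :: "'q set" and dcarr :: "'q => 'v set"
 assumes finT: "finite T" and card3: "!!t. t : T ==> card t = 3"
  and deg: "!!e. e : edges_of T ==> card {t:T. e \<subseteq> t} : {2,3}"
  and linked: "!!k i j v. proper_coloring T k ==> i : {1,2,3} ==> j : {1,2,3} ==> i ~= j ==>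
   vertex_linked {t:T. k t : {i,j}} v"
  and chi_even: "!!k i j. proper_coloring T k ==> i : {1,2,3} ==> j : {1,2,3} ==> i ~= j ==>
   even (chi {t:T. k t : {i,j}})"
  and finA: "finite A" and finQ: "finite Q"
  and carr: "!!p. p : A ==> carr p : cells T" and dcarr: "!!q. q : Q ==> dcarr q : cells T"
  and carr_mono: "!!p k. p : A ==> proper_coloring T k ==> card (k ` {t:T. carr p \<subseteq> t}) = 1"
  and dcarr_mono: "!!q k. q : Q ==> proper_coloring T k ==> card (k ` {t:T. dcarr q \<subseteq> t}) = 1"
  and anchor_even: "!!k i j C. proper_coloring T k ==> i : {1,2,3} ==> j : {1,2,3} ==> i ~= j ==>
   C \<subseteq> {t:T. k t : {i,j}} ==> closed_surface C ==>
   even (card {p:A. carr p : cells C})"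
  and lab: "!!p. p : A ==> lab p : {1,2,3}"
begin

abbreviation adm :: "('v set => nat) => bool" where "adm \<equiv> proper_coloring T"

definition colorings :: "('v set => nat) set" where
 "colorings = {k. adm k & (ALL p:A. k ` {t:T. carr p \<subseteq> t} = {lab p})}"

definition surf :: "('v set => nat) => nat => nat => 'v set set" where
 "surf k i j = {t:T. k t : {i,j}}"

definition dots :: "('v set => nat) => nat => nat" where
 "dots k i = card {q:Q. k ` {t:T. dcarr q \<subseteq> t} = {i}}"

text \<open>The exponent of x_i + x_j under the square root: this factor occurs once for each anchor
  point labelled i and once for each labelled j.\<close>

definition nlab :: "nat => nat => nat" where
 "nlab i j = card {p:A. lab p : {i,j}}"

text \<open>The net exponent of x_i + x_j in the evaluation of \<open>k\<close>. For
  \<open>k\<close> in \<open>colorings\<close> and distinct colors both divisions are exact, by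
  \<open>nlab_even\<close> and \<open>surf_even\<close>.\<close>

definition expo :: "('v set => nat) => nat => nat => int" where
 "expo k i j = int (nlab i j) div 2 - chi (surf k i j) div 2"

lemma fin_surf: "finite (surf k i j)" and card3_surf: "t : surf k i j ==> card t = 3"
 using finT card3 by (auto simp: surf_def)

lemma adm_range: "adm k ==> t : T ==> k t : {1,2,3}"
 by (auto simp: proper_coloring_def PiE_iff)

lemma edge_cols:
 assumes k: "adm k" and e: "e : edges_of T"
 obtains (two) t t' where "{t:T. e \<subseteq> t} = {t,t'}" "t ~= t'" "k t = k t'"
 | (three) "inj_on k {t:T. e \<subseteq> t}" "k ` {t:T. e \<subseteq> t} = {1,2,3}" "card {t:T. e \<subseteq> t} = 3"
proof -
 have c: "card {t:T. e \<subseteq> t} = 2 \<or> card {t:T. e \<subseteq> t} = 3" using deg[OF e] by simp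
 have ek: "k t = k t' \<longleftrightarrow> card {t:T. e \<subseteq> t} = 2"
  if "t : {t:T. e \<subseteq> t}" "t' : {t:T. e \<subseteq> t}" "t ~= t'" for t t'
  using k e that unfolding proper_coloring_def by blast
 show thesis
 proof (cases "card {t:T. e \<subseteq> t} = 2")
  case True
  then obtain t t' where tt: "{t:T. e \<subseteq> t} = {t,t'}" "t ~= t'" unfolding card_2_iff by blast
  have "t : {t:T. e \<subseteq> t}" "t' : {t:T. e \<subseteq> t}" unfolding tt(1) by simp_all
  then have "k t = k t'" using ek tt(2) True by blast
  then show ?thesis using tt two by blast
 next
  case False
  then have c3: "card {t:T. e \<subseteq> t} = 3" using c by simp
  have inj: "inj_on k {t:T. e \<subseteq> t}" using ek False by (auto intro!: inj_onI)
  have "card (k ` {t:T. e \<subseteq> t}) = 3" using card_image[OF inj] c3 by simp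
  moreover have "k ` {t:T. e \<subseteq> t} \<subseteq> {1,2,3}" using adm_range[OF k] by blast
  ultimately have "k ` {t:T. e \<subseteq> t} = {1,2,3}" by (intro card_subset_eq) auto
  then show ?thesis using three c3 inj by blast
 qed
qed

text \<open>Both triangles of an edge of degree 2 have the same color, and an edge of degree 3 has
  one triangle of each color; either way two triangles remain in the bicolored surface.\<close>

lemma edge_pair:
 assumes k: "adm k" and ij: "i : {1,2,3}" "j : {1,2,3}" "i ~= j" and e: "e : edges_of (surf k i j)"
 obtains t t' where "{t:surf k i j. e \<subseteq> t} = {t,t'}" "t ~= t'"
  "k t = k t' \<or> (k t = i & k t' = j)"
proof -
 have eT: "e : edges_of T" using e by (auto simp: edges_of_def surf_def)
 have flt: "{t:surf k i j. e \<subseteq> t} = {t:{t:T. e \<subseteq> t}. k t : {i,j}}" by (auto simp: surf_def)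
 from k eT show ?thesis
 proof (cases rule: edge_cols)
  case (two t t')
  obtain s where "s : {t:T. e \<subseteq> t}" and ks: "k s : {i,j}"
   using e unfolding edges_of_def surf_def by blast
  then have "s : {t,t'}" unfolding two(1) by simp
  then have "k t : {i,j}" "k t' : {i,j}" using two(3) ks by auto
  then have "{t:surf k i j. e \<subseteq> t} = {t,t'}" unfolding flt two(1) by auto
  then show ?thesis using that two by blast
 next
  case three
  have "i : k ` {t:T. e \<subseteq> t}" "j : k ` {t:T. e \<subseteq> t}" unfolding three(2) using ij by auto
  then obtain t t' where t: "t : {t:T. e \<subseteq> t}" "k t = i" "t' : {t:T. e \<subseteq> t}" "k t' = j" by blast
  have "{t:surf k i j. e \<subseteq> t} = {t,t'}"
  proof
   show "{t:surf k i j. e \<subseteq> t} \<subseteq> {t,t'}"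
   proof
    fix s assume s: "s : {t:surf k i j. e \<subseteq> t}"
    then have sT: "s : {t:T. e \<subseteq> t}" "k s : {i,j}" by (auto simp: surf_def)
    then consider "k s = k t" | "k s = k t'" using t by auto
    then show "s : {t,t'}" using inj_onD[OF three(1)] sT t by cases blast+
   qed
   show "{t,t'} \<subseteq> {t:surf k i j. e \<subseteq> t}" using t unfolding flt by auto
  qed
  then show ?thesis using that t ij by blast
 qed
qed

lemma closed_surface_surf:
 assumes "adm k" "i : {1,2,3}" "j : {1,2,3}" "i ~= j"
 shows "closed_surface (surf k i j)"
 unfolding closed_surface_def
proof (intro conjI ballI)
 fix e assume "e : edges_of (surf k i j)"
 from edge_pair[OF assms this] obtain t t' where "{t:surf k i j. e \<subseteq> t} = {t,t'}" "t ~= t'" by metis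
 then show "card {t:surf k i j. e \<subseteq> t} = 2" by simp
qed (use fin_surf card3_surf in auto)

definition adj :: "'v set set => ('v set \<times> 'v set) set" where
 "adj S = {(t,t'). t : S & t' : S & card (t Int t') = 2}"

definition comp :: "'v set set => 'v set => 'v set set" where
 "comp S t = {t'. (t,t') : (adj S)\<^sup>*}"

definition comps :: "'v set set => 'v set set set" where
 "comps S = comp S ` S"

lemma adj_sym: "sym ((adj S)\<^sup>*)"
 by (intro sym_rtrancl) (auto simp: sym_def adj_def Int_commute)

lemma comp_refl: "t : comp S t" by (simp add: comp_def)

lemma comp_sub: "t : S ==> comp S t \<subseteq> S"
proof
 fix t' assume "t : S" "t' : comp S t"
 then have "(t,t') : (adj S)\<^sup>*" "t : S" by (auto simp: comp_def)
 then show "t' : S" by (induction rule: rtrancl_induct) (auto simp: adj_def)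
qed

lemma comp_eq: "t' : comp S t ==> comp S t' = comp S t"
 using adj_sym[of S] by (auto simp: comp_def sym_def intro: rtrancl_trans)

lemma comps_eq: "C : comps S ==> t : C ==> comp S t = C"
 by (auto simp: comps_def comp_eq)

lemma comps_sub: "C : comps S ==> C \<subseteq> S"
 by (auto simp: comps_def dest: comp_sub)

lemma comp_step: "C : comps S ==> t : C ==> t' : S ==> card (t Int t') = 2 ==> t' : C"
proof -
 assume C: "C : comps S" and t: "t : C" "t' : S" "card (t Int t') = 2"
 have "(t,t') : adj S" using t comps_sub[OF C] by (auto simp: adj_def)
 then have "t' : comp S t" by (auto simp: comp_def)
 then show "t' : C" using comps_eq[OF C t(1)] by simp
qed

lemma comp_adjacent_linked:
 assumes "C : comps S"
 shows "adjacent_linked C"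
 unfolding adjacent_linked_def
proof (intro allI impI)
 fix X Y assume XY: "X Un Y = C" "X ~= {}" "Y ~= {}" "X Int Y = {}"
 obtain t u where t: "t : X" "u : Y" using XY by auto
 have "u : comp S t" using comps_eq[OF assms, of t] t XY by auto
 then have "(t,u) : (adj S)\<^sup>*" by (simp add: comp_def)
 then have "u : X \<or> (EX t:X. EX t':Y. card (t Int t') = 2)"
 proof (induction rule: rtrancl_induct)
  case base then show ?case using t by simp
 next
  case (step y z)
  show ?case
  proof (cases "y : X")
   case True
   then have "z : C" using comp_step[OF assms, of y z] step.hyps XY by (auto simp: adj_def)
   then show ?thesis using True step.hyps XY by (auto simp: adj_def)
  qed (use step.IH in blast)
 qed
 then show "EX t:X. EX t':Y. card (t Int t') = 2" using t XY by blast
qed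

lemma inter_card_2:
 assumes "t : T" "t' : T" "t ~= t'" "e \<subseteq> t" "e \<subseteq> t'" "card e = 2"
 shows "t Int t' = e"
proof -
 have fin: "finite t" "finite t'" using card3 assms by (metis card.infinite zero_neq_numeral)+
 have "card (t Int t') ~= 3"
 proof
  assume "card (t Int t') = 3"
  then have "card (t Int t') = card t" "card (t Int t') = card t'" using card3 assms(1,2) by simp_all
  then have "t Int t' = t" "t Int t' = t'"
   using card_subset_eq[OF fin(1) Int_lower1] card_subset_eq[OF fin(2) Int_lower2] by blast+
  then show False using assms by simp
 qed
 moreover have "card (t Int t') <= 3" using card_mono[of t "t Int t'"] fin card3[OF assms(1)] by simp
 moreover have "2 <= card (t Int t')" using card_mono[of "t Int t'" e] fin assms by simp
 ultimately have "card e = card (t Int t')" using assms by simp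
 then show ?thesis using card_subset_eq[of "t Int t'" e] fin assms by auto
qed

lemma surf_sub: "surf k i j \<subseteq> T" by (auto simp: surf_def)

lemma comp_edge_star:
 assumes S: "S \<subseteq> T" and C: "C : comps S" and e: "e : edges_of C"
 shows "{t:C. e \<subseteq> t} = {t:S. e \<subseteq> t}"
proof
 show "{t:C. e \<subseteq> t} \<subseteq> {t:S. e \<subseteq> t}" using comps_sub[OF C] by auto
 obtain t where t: "t : C" "e \<subseteq> t" "card e = 2" using e by (auto simp: edges_of_def)
 show "{t:S. e \<subseteq> t} \<subseteq> {t:C. e \<subseteq> t}"
 proof clarify
  fix t' assume t': "t' : S" "e \<subseteq> t'"
  show "t' : C"
  proof (cases "t' = t")
   case False
   then have "t Int t' = e" using inter_card_2[of t t' e] t t' S comps_sub[OF C] by auto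
   then show ?thesis using comp_step[OF C t(1) t'(1)] t by simp
  qed (use t in simp)
 qed
qed

lemma closed_surface_comp:
 assumes S: "S \<subseteq> T" "closed_surface S" and C: "C : comps S"
 shows "closed_surface C"
 unfolding closed_surface_def
proof (intro conjI ballI)
 have CS: "C \<subseteq> S" by (rule comps_sub[OF C])
 show "finite C" using CS S finT by (meson finite_subset)
 show "card t = 3" if "t : C" for t using that CS S card3 by auto
 fix e assume e: "e : edges_of C"
 then have "e : edges_of S" using CS by (auto simp: edges_of_def)
 then show "card {t:C. e \<subseteq> t} = 2"
  using comp_edge_star[OF S(1) C e] S(2) by (simp add: closed_surface_def)
qed

text \<open>All triangles of the surface around a cell lie in one component.\<close>

lemma cell_star_comp:
 assumes k: "adm k" and ij: "i : {1,2,3}" "j : {1,2,3}" "i ~= j"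
  and c: "c ~= {}" "t : surf k i j" "t' : surf k i j" "c \<subseteq> t" "c \<subseteq> t'"
 shows "comp (surf k i j) t = comp (surf k i j) t'"
proof (rule ccontr)
 let ?S = "surf k i j"
 assume ne: "comp ?S t ~= comp ?S t'"
 obtain v where v: "v : c" using c by auto
 define X where "X = {s:?S. v : s & comp ?S s = comp ?S t}"
 define Y where "Y = {s:?S. v : s & comp ?S s ~= comp ?S t}"
 have "X Un Y = {s:?S. v : s}" "X Int Y = {}" by (auto simp: X_def Y_def)
 moreover have "X ~= {}" "Y ~= {}" using c v ne unfolding X_def Y_def by blast+
 moreover have "vertex_linked ?S v" using linked[OF k ij] by (simp add: surf_def)
 ultimately have "EX s:X. EX s':Y. card (s Int s') = 2 & v : s Int s'"
  unfolding vertex_linked_def by simp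
 then obtain s s' where s: "s : X" "s' : Y" "card (s Int s') = 2" by blast
 then have "s' : comp ?S s" by (auto simp: X_def Y_def comp_def adj_def)
 then show False using comp_eq[of s' ?S s] s by (auto simp: X_def Y_def)
qed

text \<open>A vertex that sees the colors \<open>i\<close> and \<open>j\<close> lies, by
  connectedness of its link in the bicolored surface, on an edge where these colors meet, and such
  an edge has degree 3 and sees every color. For an edge this is immediate, and a triangle sees only
  itself.\<close>

lemma cell_cols:
 assumes k: "adm k" and c: "c : cells T"
 shows "(EX i:{1,2,3}. k ` {t:T. c \<subseteq> t} = {i}) \<or> k ` {t:T. c \<subseteq> t} = {1,2,3}"
proof (cases "EX t t'. t : T & t' : T & c \<subseteq> t & c \<subseteq> t' & k t ~= k t'")
 case False
 obtain t where t: "t : T" "c \<subseteq> t" using c by (auto simp: cells_def)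
 then have "k ` {t:T. c \<subseteq> t} = {k t}" using False by blast
 then show ?thesis using adm_range[OF k t(1)] by blast
next
 case True
 then obtain t t' where t: "t : T" "t' : T" "c \<subseteq> t" "c \<subseteq> t'" "k t ~= k t'" by blast
 define i j where "i = k t" and "j = k t'"
 have ij: "i : {1,2,3}" "j : {1,2,3}" "i ~= j" using adm_range[OF k] t by (auto simp: i_def j_def)
 let ?S = "surf k i j"
 show ?thesis
 proof (cases "card c = 1")
  case True
  then obtain v where v: "c = {v}" by (auto simp: card_1_singleton_iff)
  define X where "X = {s:?S. v : s & k s = i}"
  define Y where "Y = {s:?S. v : s & k s = j}"
  have "X Un Y = {s:?S. v : s}" "X Int Y = {}" using ij by (auto simp: X_def Y_def surf_def)
  moreover have "t : X" "t' : Y" using t v by (auto simp: X_def Y_def i_def j_def surf_def)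
  moreover have "vertex_linked ?S v" using linked[OF k ij] by (simp add: surf_def)
  ultimately have "EX s:X. EX s':Y. card (s Int s') = 2 & v : s Int s'"
   unfolding vertex_linked_def by (metis empty_iff)
  then obtain s s' where s: "s : X" "s' : Y" "card (s Int s') = 2" "v : s Int s'" by blast
  define e where "e = s Int s'"
  have e: "e : edges_of T" "s : {t:T. e \<subseteq> t}" "s' : {t:T. e \<subseteq> t}" "k s ~= k s'"
   using s ij surf_sub by (auto simp: e_def X_def Y_def surf_def edges_of_def)
  from k e(1) have "k ` {t:T. e \<subseteq> t} = {1,2,3}"
  proof (cases rule: edge_cols)
   case (two t t')
   then have "s : {t,t'}" "s' : {t,t'}" using e(2,3) by (simp_all only: two(1))
   then show ?thesis using e(4) two(3) by auto
  qed
  moreover have "k ` {t:T. e \<subseteq> t} \<subseteq> k ` {t:T. c \<subseteq> t}" using s(4) v by (intro image_mono) (auto simp: e_def)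
  moreover have "k ` {t:T. c \<subseteq> t} \<subseteq> {1,2,3}" using adm_range[OF k] by auto
  ultimately show ?thesis by auto
 next
  case F: False
  have fin: "finite t" using card3 t by (metis card.infinite zero_neq_numeral)
  have "card c ~= 0" using c finite_subset[OF t(3) fin] by (simp add: cells_def)
  moreover have "card c <= 3" using card_mono[OF fin t(3)] card3[OF t(1)] by simp
  moreover have "card c ~= 3"
  proof
   assume "card c = 3"
   then have "c = t" "c = t'" using t fin card3 card_subset_eq
    by (metis card.infinite zero_neq_numeral)+
   then show False using t by simp
  qed
  ultimately have "card c = 2" using F by linarith
  then have e: "c : edges_of T" using t by (auto simp: edges_of_def)
  from k e show ?thesis
  proof (cases rule: edge_cols)
   case (two s s')
   have "t : {t:T. c \<subseteq> t}" "t' : {t:T. c \<subseteq> t}" using t by auto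
   then have "t : {s,s'}" "t' : {s,s'}" by (simp_all only: two(1))
   then show ?thesis using t(5) two(3) by auto
  qed simp
 qed
qed

definition swap :: "nat => nat => 'v set set set => ('v set => nat) => 'v set => nat" where
 "swap i j B k = (%t. if t : \<Union>B then (if k t = i then j else i) else k t)"

lemma swap_surf:
 assumes "B \<subseteq> comps (surf k i j)"
 shows "surf (swap i j B k) i j = surf k i j"
  and "i ~= l ==> j ~= l ==> swap i j B k t = l \<longleftrightarrow> k t = l"
proof -
 have "\<Union>B \<subseteq> surf k i j" using assms comps_sub by blast
 then show "surf (swap i j B k) i j = surf k i j" by (auto simp: swap_def surf_def)
 show "swap i j B k t = l \<longleftrightarrow> k t = l" if "i ~= l" "j ~= l"
  using \<open>\<Union>B \<subseteq> surf k i j\<close> that by (auto simp: swap_def surf_def)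
qed

text \<open>Two triangles of the bicolored surface with a common edge lie in the same component, so
  an exchange affects both or neither. If at most one of them belongs to that surface, their colors
  differ before and after, or are both untouched.\<close>

lemma adm_swap:
 assumes k: "adm k" and ij: "i : {1,2,3}" "j : {1,2,3}" "i ~= j" and B: "B \<subseteq> comps (surf k i j)"
 shows "adm (swap i j B k)"
 unfolding proper_coloring_def
proof (intro conjI ballI impI)
 let ?S = "surf k i j"
 have BS: "\<Union>B \<subseteq> ?S" using B comps_sub by blast
 have kR: "k : T \<rightarrow>\<^sub>E {1,2,3}" using k by (simp add: proper_coloring_def)
 show "swap i j B k : T \<rightarrow>\<^sub>E {1,2,3}"
 proof
  show "swap i j B k t : {1,2,3}" if "t : T" for t
   using adm_range[OF k that] ij by (auto simp: swap_def)
  show "swap i j B k t = undefined" if "t ~: T" for t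
   using that kR BS surf_sub[of k i j] by (auto simp: swap_def PiE_iff extensional_def)
 qed
 fix e t t' assume a: "e : edges_of T" "t : T" "t' : T" "e \<subseteq> t" "e \<subseteq> t'" "t ~= t'"
 have old: "k t = k t' \<longleftrightarrow> card {t:T. e \<subseteq> t} = 2" using k a unfolding proper_coloring_def by blast
 have "swap i j B k t = swap i j B k t' \<longleftrightarrow> k t = k t'"
 proof (cases "t : ?S & t' : ?S")
  case True
  have ce: "card e = 2" using a(1) by (simp add: edges_of_def)
  then have "card (t Int t') = 2" using inter_card_2[of t t' e] a by simp
  then have "t : C \<longleftrightarrow> t' : C" if "C : comps ?S" for C
   using comp_step[OF that] True by (metis Int_commute)
  then have "t : \<Union>B \<longleftrightarrow> t' : \<Union>B" using B by blast
  then show ?thesis using True ij by (auto simp: swap_def surf_def)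
 next
  case False
  have "swap i j B k s = k s" if "s ~: ?S" for s using that BS by (auto simp: swap_def)
  moreover have "swap i j B k s : {i,j}" if "s : ?S" for s using that by (auto simp: swap_def surf_def)
  moreover have "k s ~: {i,j}" if "s : T" "s ~: ?S" for s using that by (auto simp: surf_def)
  moreover have "k s : {i,j}" if "s : ?S" for s using that by (auto simp: surf_def)
  ultimately show ?thesis using False a(2,3) by metis
 qed
 then show "swap i j B k t = swap i j B k t' \<longleftrightarrow> card {t:T. e \<subseteq> t} = 2" using old by simp
qed

end

section \<open>Effect of exchanges on colorings, Euler characteristics and dots\<close>

context colored_complex
begin

definition cols :: "('v set => nat) => 'v set => nat set" where
 "cols k c = k ` {t:T. c \<subseteq> t}"

text \<open>The components that may be exchanged without violating the labels of the anchor
  points.\<close>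

definition free :: "('v set => nat) => nat => nat => 'v set set set" where
 "free k i j = {C:comps (surf k i j). ALL p:A. carr p ~: cells C}"

lemma adm_edge:
 assumes "adm k" "e : edges_of T" "t : T" "t' : T" "e \<subseteq> t" "e \<subseteq> t'" "t ~= t'"
 shows "k t = k t' \<longleftrightarrow> card {t:T. e \<subseteq> t} = 2"
 using assms by (simp add: proper_coloring_def)

lemma surf_commute: "surf k i j = surf k j i" by (auto simp: surf_def)

lemma finite_comps: "finite (comps (surf k i j))"
 using fin_surf by (simp add: comps_def)

lemma finite_free: "finite (free k i j)"
 using finite_comps by (simp add: free_def)

lemma mem_comp: "t : surf k i j ==> comp (surf k i j) t : comps (surf k i j)"
 by (simp add: comps_def)

lemma mem_Union_comps:
 assumes "B \<subseteq> comps S" "t : S"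
 shows "t : \<Union>B \<longleftrightarrow> comp S t : B"
proof
 assume "t : \<Union>B"
 then obtain C where C: "C : B" "t : C" by auto
 then have "comp S t = C" using comps_eq assms by blast
 then show "comp S t : B" using C by simp
qed (use comp_refl in auto)

lemma cells_comp_unique:
 assumes k: "adm k" and ij: "i : {1,2,3}" "j : {1,2,3}" "i ~= j"
  and C: "C : comps (surf k i j)" "C' : comps (surf k i j)" "c : cells C" "c : cells C'"
 shows "C = C'"
proof -
 obtain t t' where t: "t : C" "t' : C'" "c \<subseteq> t" "c \<subseteq> t'" "c ~= {}" using C by (auto simp: cells_def)
 have "t : surf k i j" "t' : surf k i j" using t comps_sub C(1,2) by blast+
 then have "comp (surf k i j) t = comp (surf k i j) t'" using cell_star_comp[OF k ij] t by blast
 then show ?thesis using comps_eq C(1,2) t by blast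
qed

lemma swap_commute:
 assumes "B \<subseteq> comps (surf k i j)" "i ~= j"
 shows "swap i j B k = swap j i B k"
proof
 fix t
 have "\<Union>B \<subseteq> surf k i j" using assms comps_sub by blast
 then show "swap i j B k t = swap j i B k t" using assms(2) by (auto simp: swap_def surf_def)
qed

lemma swap_in_colorings:
 assumes k: "k : colorings" and ij: "i : {1,2,3}" "j : {1,2,3}" "i ~= j" and B: "B \<subseteq> free k i j"
 shows "swap i j B k : colorings"
proof -
 have Bc: "B \<subseteq> comps (surf k i j)" using B by (auto simp: free_def)
 have "swap i j B k ` {t:T. carr p \<subseteq> t} = k ` {t:T. carr p \<subseteq> t}" if p: "p : A" for p
 proof (rule image_cong[OF refl])
  fix t assume t: "t : {t:T. carr p \<subseteq> t}"
  have "t ~: \<Union>B"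
  proof
   assume "t : \<Union>B"
   then obtain C where C: "C : B" "t : C" by auto
   then have "carr p : cells C" using t carr[OF p] by (auto simp: cells_def)
   then show False using C(1) B p by (auto simp: free_def)
  qed
  then show "swap i j B k t = k t" by (simp add: swap_def)
 qed
 then show ?thesis using k adm_swap[OF _ ij Bc] by (simp add: colorings_def)
qed

lemma swap_empty: "swap i j {} k = k" by (simp add: swap_def)

lemma swap_inj:
 assumes ij: "i ~= j"
 shows "inj_on (%B. swap i j B k) (Pow (comps (surf k i j)))"
proof (rule inj_onI)
 fix B B' assume B: "B : Pow (comps (surf k i j))" "B' : Pow (comps (surf k i j))"
  and eq: "swap i j B k = swap i j B' k"
 have ne: "swap i j D k t ~= k t \<longleftrightarrow> t : \<Union>D" if "D \<subseteq> comps (surf k i j)" for D t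
 proof -
  have "\<Union>D \<subseteq> surf k i j" using that comps_sub by blast
  then show ?thesis using ij by (auto simp: swap_def surf_def)
 qed
 have "t : \<Union>B \<longleftrightarrow> t : \<Union>B'" for t using ne[of B t] ne[of B' t] B eq by simp
 then have U: "\<Union>B = \<Union>B'" by blast
 have mem: "C : D'" if cd: "C : D" "\<Union>D = \<Union>D'" "D \<subseteq> comps (surf k i j)" "D' \<subseteq> comps (surf k i j)" for C D D'
 proof -
  have C: "C : comps (surf k i j)" using cd by auto
  then obtain t where t: "t : C" using comp_refl by (auto simp: comps_def)
  have "t : \<Union>D'" using t cd(1) unfolding cd(2)[symmetric] by blast
  then obtain C' where C': "C' : D'" "t : C'" by blast
  then have "C' : comps (surf k i j)" using cd(4) by blast
  then show ?thesis using comps_eq[OF C t] comps_eq[of C' _ t] C' by simp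
 qed
 show "B = B'"
  using mem[OF _ U] mem[OF _ U[symmetric]] B by (intro equalityI subsetI) simp_all
qed

text \<open>The triangles of color \<open>l\<close> determine the i,j surface. On each of its
  components a coloring by \<open>i\<close> and \<open>j\<close> is determined up to exchange by the
  edges across which the color changes, that is, by the edge degrees. On a component with an anchor
  point the label fixes the choice, so the class is parametrized by the sets of free
  components.\<close>

lemma class_eq:
 assumes k: "k : colorings" and ij: "i : {1,2,3}" "j : {1,2,3}" "l : {1,2,3}" "i ~= j" "i ~= l" "j ~= l"
 shows "{k':colorings. {t:T. k' t = l} = {t:T. k t = l}} = (%B. swap i j B k) ` Pow (free k i j)"
proof
 show "(%B. swap i j B k) ` Pow (free k i j) \<subseteq> {k':colorings. {t:T. k' t = l} = {t:T. k t = l}}"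
 proof clarify
  fix B assume B: "B \<subseteq> free k i j"
  then have "B \<subseteq> comps (surf k i j)" by (auto simp: free_def)
  then have "swap i j B k t = l \<longleftrightarrow> k t = l" for t using swap_surf(2) ij by blast
  then show "swap i j B k : colorings & {t:T. swap i j B k t = l} = {t:T. k t = l}"
   using swap_in_colorings[OF k ij(1,2,4) B] by simp
 qed
 show "{k':colorings. {t:T. k' t = l} = {t:T. k t = l}} \<subseteq> (%B. swap i j B k) ` Pow (free k i j)"
 proof clarify
  fix k' assume k': "k' : colorings" and eq: "{t:T. k' t = l} = {t:T. k t = l}"
  let ?S = "surf k i j"
  have ak: "adm k" "adm k'" using k k' by (auto simp: colorings_def)
  have three: "{1,2,3} = {i,j,l}" using ij by auto
  have S: "t : ?S \<longleftrightarrow> t : T & k t ~= l" for t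
   using adm_range[OF ak(1), of t] ij three by (auto simp: surf_def)
  have eql: "k' t = l \<longleftrightarrow> k t = l" if "t : T" for t using eq that by blast
  have S': "k' t : {i,j}" if "t : ?S" for t
  proof -
   have "t : T" "k' t ~= l" using that S eql by auto
   then show ?thesis using adm_range[OF ak(2) \<open>t : T\<close>] unfolding three by blast
  qed
  have Sk: "k t : {i,j}" if "t : ?S" for t using that by (simp add: surf_def)
  \<comment> \<open>Agreement of \<open>k'\<close> with \<open>k\<close> passes across every edge,
    since both change color at the same edges; hence it is constant on a component.\<close>
  have const: "k' t = k t \<longleftrightarrow> k' t' = k t'" if C: "C : comps ?S" and t: "t : C" "t' : C" for C t t'
  proof (rule ccontr)
   assume neg: "~ ?thesis"
   define X where "X = {s:C. k' s = k s}"
   define Y where "Y = {s:C. k' s ~= k s}"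
   have "X ~= {}" "Y ~= {}" using neg t unfolding X_def Y_def by blast+
   moreover have "X Un Y = C" "X Int Y = {}" by (auto simp: X_def Y_def)
   ultimately have "EX s:X. EX s':Y. card (s Int s') = 2"
    using comp_adjacent_linked[OF C] unfolding adjacent_linked_def by simp
   then obtain s s' where s: "s : X" "s' : Y" "card (s Int s') = 2" by blast
   have sS: "s : ?S" "s' : ?S" using s comps_sub[OF C] by (auto simp: X_def Y_def)
   have sT: "s : T" "s' : T" using sS by (auto simp: surf_def)
   define e where "e = s Int s'"
   have e: "e : edges_of T" "e \<subseteq> s" "e \<subseteq> s'" using s sT by (auto simp: edges_of_def e_def)
   have ne: "s ~= s'" using s by (auto simp: X_def Y_def)
   have "k s = k s' \<longleftrightarrow> k' s = k' s'"
    using adm_edge[OF ak(1) e(1) sT e(2,3) ne] adm_edge[OF ak(2) e(1) sT e(2,3) ne] by simp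
   moreover have "k' s = k s" "k' s' ~= k s'" using s(1,2) by (simp_all add: X_def Y_def)
   ultimately show False using Sk[OF sS(1)] Sk[OF sS(2)] S'[OF sS(2)] by (metis insertE singletonD)
  qed
  define B where "B = {C:comps ?S. EX t:C. k' t ~= k t}"
  have Bc: "B \<subseteq> comps ?S" by (auto simp: B_def)
  have "B \<subseteq> free k i j"
  proof
   fix C assume C: "C : B"
   have "carr p ~: cells C" if p: "p : A" for p
   proof
    assume "carr p : cells C"
    then obtain t where t: "t : C" "carr p \<subseteq> t" by (auto simp: cells_def)
    have Cc: "C : comps ?S" using C by (simp add: B_def)
    obtain u where u: "u : C" "k' u ~= k u" using C by (auto simp: B_def)
    have tT: "t : T" using t comps_sub[OF Cc] surf_sub[of k i j] by blast
    have "k'' t = lab p" if "k'' : colorings" for k''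
    proof -
     have "k'' t : k'' ` {t:T. carr p \<subseteq> t}" using tT t by blast
     then show ?thesis using that p by (simp add: colorings_def)
    qed
    from this[OF k] this[OF k'] show False using const[OF Cc t(1) u(1)] u(2) by simp
   qed
   then show "C : free k i j" using C by (auto simp: free_def B_def)
  qed
  moreover have "k' = swap i j B k"
  proof
   fix t
   show "k' t = swap i j B k t"
   proof (cases "t : ?S")
    case True
    have "t : \<Union>B \<longleftrightarrow> (EX u:comp ?S t. k' u ~= k u)"
     using mem_Union_comps[OF Bc True] mem_comp[OF True] by (simp add: B_def)
    also have "\<dots> \<longleftrightarrow> k' t ~= k t"
     using const[OF mem_comp[OF True] comp_refl] comp_refl[of t ?S] by blast
    finally have "t : \<Union>B \<longleftrightarrow> k' t ~= k t" .
    then show ?thesis using S'[OF True] Sk[OF True] by (auto simp: swap_def)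
   next
    case False
    then have "t ~: \<Union>B" using comps_sub Bc by blast
    moreover have "k' t = k t"
    proof (cases "t : T")
     case True then show ?thesis using False S eql by auto
    next
     case False then show ?thesis using ak by (auto simp: proper_coloring_def PiE_iff extensional_def)
    qed
    ultimately show ?thesis by (simp add: swap_def)
   qed
  qed
  ultimately show "k' : (%B. swap i j B k) ` Pow (free k i j)" by blast
 qed
qed

lemma swap_color_i:
 assumes k: "adm k" and B: "B \<subseteq> comps (surf k i j)" and ij: "i ~= j"
 shows "swap i j B k t = i & t : T \<longleftrightarrow>
  (EX C:comps (surf k i j). t : C & k t = (if C : B then j else i))"
proof
 let ?S = "surf k i j"
 have US: "\<Union>B \<subseteq> ?S" using B comps_sub by blast
 {
  assume t: "swap i j B k t = i & t : T"
  then have tS: "t : ?S" using US by (auto simp: swap_def surf_def split: if_splits)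
  then have "k t = (if comp ?S t : B then j else i)"
   using t mem_Union_comps[OF B tS] by (auto simp: swap_def surf_def split: if_splits)
  then show "EX C:comps ?S. t : C & k t = (if C : B then j else i)"
   using mem_comp[OF tS] comp_refl by blast
 next
  assume "EX C:comps ?S. t : C & k t = (if C : B then j else i)"
  then obtain C where C: "C : comps ?S" "t : C" "k t = (if C : B then j else i)" by blast
  then have tS: "t : ?S" "comp ?S t = C" using comps_sub comps_eq by blast+
  then show "swap i j B k t = i & t : T"
   using C(3) mem_Union_comps[OF B tS(1)] ij by (auto simp: swap_def surf_def split: if_splits)
 }
qed

text \<open>Contribution to the Euler characteristic of the cells of \<open>C\<close> that see only
  the color \<open>i\<close>, where all of \<open>T\<close> is taken into account. Cells that also
  see the third color are left out; they are the same before and after an exchange.\<close>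

definition part :: "('v set => nat) => 'v set set => nat => int" where
 "part k C i = (\<Sum>c\<in>{c:cells C. cols k c = {i}}. (-1) ^ (card c + 1))"

text \<open>A cell of the new i,l surface either sees color \<open>l\<close>, which the exchange
  does not touch, or by \<open>cell_cols\<close> it sees a single color. In the second case it
  belongs to exactly one component of the old i,j surface, and its old color was \<open>j\<close> or
  \<open>i\<close> according to whether that component was exchanged.\<close>

lemma chi_swap:
 assumes k: "adm k" and ij: "i : {1,2,3}" "j : {1,2,3}" "l : {1,2,3}" "i ~= j" "i ~= l" "j ~= l"
  and B: "B \<subseteq> comps (surf k i j)"
 shows "chi (surf (swap i j B k) i l) = (\<Sum>c\<in>{c:cells T. l : cols k c}. (-1) ^ (card c + 1)) +
  (\<Sum>C\<in>comps (surf k i j). if C : B then part k C j else part k C i)"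
proof -
 let ?S = "surf k i j" and ?k = "swap i j B k" and ?f = "%c. (-1::int) ^ (card c + 1)"
 define Z where "Z C = {c:cells C. cols k c = {if C : B then j else i}}" for C
 define L where "L = {c:cells T. l : cols k c}"
 have sl: "?k t = l \<longleftrightarrow> k t = l" for t using swap_surf(2)[OF B] ij by blast
 have CT: "C \<subseteq> T" if "C : comps ?S" for C using comps_sub[OF that] surf_sub by blast
 have eq: "cells (surf ?k i l) = L Un (\<Union>C\<in>comps ?S. Z C)"
 proof
  show "cells (surf ?k i l) \<subseteq> L Un (\<Union>C\<in>comps ?S. Z C)"
  proof
   fix c assume "c : cells (surf ?k i l)"
   then obtain t where t: "t : T" "?k t = i \<or> ?k t = l" "c \<subseteq> t" "c ~= {}" by (auto simp: cells_def surf_def)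
   have cT: "c : cells T" using t by (auto simp: cells_def)
   show "c : L Un (\<Union>C\<in>comps ?S. Z C)"
   proof (cases "l : cols k c")
    case True then show ?thesis using cT by (simp add: L_def)
   next
    case False
    then have "k t ~= l" using t by (auto simp: cols_def)
    then have "?k t = i" using t sl by auto
    then obtain C where C: "C : comps ?S" "t : C" "k t = (if C : B then j else i)"
     using swap_color_i[OF k B ij(4)] t(1) by blast
    have "cols k c = {k t}"
    proof -
     have "k t : cols k c" using t by (auto simp: cols_def)
     moreover have "EX x. cols k c = {x}" using cell_cols[OF k cT] False ij by (auto simp: cols_def[symmetric])
     ultimately show ?thesis by auto
    qed
    then have "c : Z C" using C t by (auto simp: Z_def cells_def)
    then show ?thesis using C(1) by blast
   qed
  qed
  show "L Un (\<Union>C\<in>comps ?S. Z C) \<subseteq> cells (surf ?k i l)"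
  proof
   fix c assume "c : L Un (\<Union>C\<in>comps ?S. Z C)"
   then consider "c : L" | C where "C : comps ?S" "c : Z C" by blast
   then show "c : cells (surf ?k i l)"
   proof cases
    case 1
    then obtain t where "t : T" "c \<subseteq> t" "k t = l" "c ~= {}" by (auto simp: L_def cols_def cells_def)
    then show ?thesis using sl[of t] by (auto simp: cells_def surf_def)
   next
    case 2
    then obtain t where t: "t : C" "c \<subseteq> t" "c ~= {}" by (auto simp: Z_def cells_def)
    then have "k t : cols k c" using CT[OF 2(1)] by (auto simp: cols_def)
    then have "k t = (if C : B then j else i)" using 2 by (simp add: Z_def)
    then have "?k t = i & t : T" using swap_color_i[OF k B ij(4)] 2(1) t(1) by blast
    then show ?thesis using t by (auto simp: cells_def surf_def)
   qed
  qed
 qed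
 have finc: "finite (cells T)" using finite_cells finT card3 by blast
 have finZ: "finite (Z C)" if "C : comps ?S" for C
  using finite_cells[of C] CT[OF that] finT card3 by (auto simp: Z_def intro: finite_subset)
 have finL: "finite L" using finc by (simp add: L_def)
 have "chi (surf ?k i l) = (\<Sum>c\<in>L Un (\<Union>C\<in>comps ?S. Z C). ?f c)"
  using chi_eq_sum_cells[OF fin_surf card3_surf] eq by simp
 also have "\<dots> = (\<Sum>c\<in>L. ?f c) + (\<Sum>c\<in>(\<Union>C\<in>comps ?S. Z C). ?f c)"
  using finL finZ finite_comps ij by (intro sum.union_disjoint) (auto simp: L_def Z_def split: if_splits)
 also have "(\<Sum>c\<in>(\<Union>C\<in>comps ?S. Z C). ?f c) = (\<Sum>C\<in>comps ?S. \<Sum>c\<in>Z C. ?f c)"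
 proof (rule sum.UNION_disjoint)
  show "ALL C:comps ?S. ALL C':comps ?S. C ~= C' --> Z C Int Z C' = {}"
  proof (intro ballI impI)
   fix C C' assume C: "C : comps ?S" "C' : comps ?S" "C ~= C'"
   then show "Z C Int Z C' = {}" using cells_comp_unique[OF k ij(1,2,4)] unfolding Z_def by blast
  qed
 qed (use finite_comps finZ in auto)
 also have "\<dots> = (\<Sum>C\<in>comps ?S. if C : B then part k C j else part k C i)"
  by (intro sum.cong) (auto simp: Z_def part_def)
 finally show ?thesis by (simp add: L_def)
qed

text \<open>The same bookkeeping as for Euler characteristics, with dots in place of cells; a dot
  sees only one color, so no part for the third color appears.\<close>

lemma dots_swap:
 assumes k: "adm k" and ij: "i : {1,2,3}" "j : {1,2,3}" "i ~= j" and B: "B \<subseteq> comps (surf k i j)"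
 shows "dots (swap i j B k) i = (\<Sum>C\<in>comps (surf k i j).
  card {q:Q. dcarr q : cells C & cols k (dcarr q) = {if C : B then j else i}})"
proof -
 let ?S = "surf k i j" and ?k = "swap i j B k"
 define Z where "Z C = {q:Q. dcarr q : cells C & cols k (dcarr q) = {if C : B then j else i}}" for C
 have ak: "adm ?k" by (rule adm_swap[OF k ij B])
 have CT: "C \<subseteq> T" if "C : comps ?S" for C using comps_sub[OF that] surf_sub by blast
 have single: "EX x. cols k' (dcarr q) = {x}" if "adm k'" "q : Q" for k' q
  using dcarr_mono[OF that(2,1)] by (auto simp: cols_def card_1_singleton_iff)
 have "{q:Q. cols ?k (dcarr q) = {i}} = (\<Union>C\<in>comps ?S. Z C)"
 proof
  show "{q:Q. cols ?k (dcarr q) = {i}} \<subseteq> (\<Union>C\<in>comps ?S. Z C)"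
  proof clarify
   fix q assume q: "q : Q" "cols ?k (dcarr q) = {i}"
   obtain t where t: "t : T" "dcarr q \<subseteq> t" "dcarr q ~= {}" using dcarr[OF q(1)] by (auto simp: cells_def)
   then have "?k t : cols ?k (dcarr q)" by (auto simp: cols_def)
   then have "?k t = i" using q(2) by simp
   then obtain C where C: "C : comps ?S" "t : C" "k t = (if C : B then j else i)"
    using swap_color_i[OF k B ij(3)] t(1) by blast
   have "k t : cols k (dcarr q)" using t by (auto simp: cols_def)
   then have "cols k (dcarr q) = {k t}" using single[OF k q(1)] by auto
   then have "q : Z C" using q C t by (auto simp: Z_def cells_def)
   then show "q : (\<Union>C\<in>comps ?S. Z C)" using C(1) by blast
  qed
  show "(\<Union>C\<in>comps ?S. Z C) \<subseteq> {q:Q. cols ?k (dcarr q) = {i}}"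
  proof clarify
   fix C q assume C: "C : comps ?S" and q: "q : Z C"
   then obtain t where t: "t : C" "dcarr q \<subseteq> t" by (auto simp: Z_def cells_def)
   then have tT: "t : T" using CT[OF C] by auto
   have qQ: "q : Q" using q by (simp add: Z_def)
   have "k t : cols k (dcarr q)" using t tT by (auto simp: cols_def)
   then have "k t = (if C : B then j else i)" using q by (simp add: Z_def)
   then have "?k t = i" using swap_color_i[OF k B ij(3)] C t(1) by blast
   moreover have "?k t : cols ?k (dcarr q)" using t tT by (auto simp: cols_def)
   ultimately show "q : Q & cols ?k (dcarr q) = {i}" using single[OF ak qQ] qQ by auto
  qed
 qed
 then have "dots ?k i = card (\<Union>C\<in>comps ?S. Z C)" by (simp add: dots_def cols_def)
 also have "\<dots> = (\<Sum>C\<in>comps ?S. card (Z C))"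
 proof (rule card_UN_disjoint)
  show "ALL C:comps ?S. ALL C':comps ?S. C ~= C' --> Z C Int Z C' = {}"
  proof (intro ballI impI)
   fix C C' assume C: "C : comps ?S" "C' : comps ?S" "C ~= C'"
   then show "Z C Int Z C' = {}" using cells_comp_unique[OF k ij] unfolding Z_def by blast
  qed
 qed (use finite_comps finQ in \<open>auto simp: Z_def\<close>)
 finally show ?thesis by (simp add: Z_def)
qed

lemma dots_swap_third:
 assumes k: "adm k" and ij: "i : {1,2,3}" "j : {1,2,3}" "l : {1,2,3}" "i ~= j" "i ~= l" "j ~= l"
  and B: "B \<subseteq> comps (surf k i j)"
 shows "dots (swap i j B k) l = dots k l"
proof -
 let ?k = "swap i j B k"
 have ak: "adm ?k" by (rule adm_swap[OF k ij(1,2,4) B])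
 have sl: "?k t = l \<longleftrightarrow> k t = l" for t using swap_surf(2)[OF B] ij by blast
 have single: "cols k' (dcarr q) = {l} \<longleftrightarrow> (EX t:T. dcarr q \<subseteq> t & k' t = l)" if "adm k'" "q : Q" for k' q
 proof -
  have "EX x. cols k' (dcarr q) = {x}"
   using dcarr_mono[OF that(2,1)] by (auto simp: cols_def card_1_singleton_iff)
  moreover have "l : cols k' (dcarr q) \<longleftrightarrow> (EX t:T. dcarr q \<subseteq> t & k' t = l)" by (auto simp: cols_def)
  ultimately show ?thesis by auto
 qed
 have "cols ?k (dcarr q) = {l} \<longleftrightarrow> cols k (dcarr q) = {l}" if "q : Q" for q
  using single[OF ak that] single[OF k that] sl by simp
 then have "{q:Q. cols ?k (dcarr q) = {l}} = {q:Q. cols k (dcarr q) = {l}}" by blast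
 then show ?thesis by (simp add: dots_def cols_def)
qed

lemma surf_even: "adm k ==> i : {1,2,3} ==> j : {1,2,3} ==> i ~= j ==> even (chi (surf k i j))"
 using chi_even by (simp add: surf_def)

lemma anchors_of_comps:
 assumes k: "k : colorings" and ij: "i : {1,2,3}" "j : {1,2,3}" "i ~= j"
 shows "nlab i j = (\<Sum>C\<in>comps (surf k i j). card {p:A. carr p : cells C})"
proof -
 let ?S = "surf k i j"
 have ak: "adm k" using k by (simp add: colorings_def)
 have "{p:A. lab p : {i,j}} = (\<Union>C\<in>comps ?S. {p:A. carr p : cells C})"
 proof
  show "{p:A. lab p : {i,j}} \<subseteq> (\<Union>C\<in>comps ?S. {p:A. carr p : cells C})"
  proof
   fix p assume "p : {p:A. lab p : {i,j}}"
   then have p: "p : A" "lab p : {i,j}" by blast+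
   obtain t where t: "t : T" "carr p \<subseteq> t" "carr p ~= {}" using carr[OF p(1)] by (auto simp: cells_def)
   then have "k t : k ` {t:T. carr p \<subseteq> t}" by blast
   then have "k t = lab p" using k p(1) by (simp add: colorings_def)
   then have tS: "t : ?S" using t p by (simp add: surf_def)
   then have "carr p : cells (comp ?S t)" using t comp_refl by (auto simp: cells_def)
   then show "p : (\<Union>C\<in>comps ?S. {p:A. carr p : cells C})" using mem_comp[OF tS] p by blast
  qed
  show "(\<Union>C\<in>comps ?S. {p:A. carr p : cells C}) \<subseteq> {p:A. lab p : {i,j}}"
  proof
   fix p assume "p : (\<Union>C\<in>comps ?S. {p:A. carr p : cells C})"
   then obtain C where C: "C : comps ?S" and p: "p : A" "carr p : cells C" by blast
   obtain t where t: "t : C" "carr p \<subseteq> t" using p by (auto simp: cells_def)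
   then have tS: "t : ?S" using comps_sub[OF C] by auto
   then have "k t : k ` {t:T. carr p \<subseteq> t}" using t by (auto simp: surf_def)
   then have "k t = lab p" using k p(1) by (simp add: colorings_def)
   then show "p : {p:A. lab p : {i,j}}" using tS p(1) by (auto simp: surf_def)
  qed
 qed
 then have "nlab i j = card (\<Union>C\<in>comps ?S. {p:A. carr p : cells C})" by (simp add: nlab_def)
 also have "\<dots> = (\<Sum>C\<in>comps ?S. card {p:A. carr p : cells C})"
 proof (rule card_UN_disjoint)
  show "ALL C:comps ?S. ALL C':comps ?S. C ~= C' --> {p:A. carr p : cells C} Int {p:A. carr p : cells C'} = {}"
  proof (intro ballI impI)
   fix C C' assume C: "C : comps ?S" "C' : comps ?S" "C ~= C'"
   then show "{p:A. carr p : cells C} Int {p:A. carr p : cells C'} = {}"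
    using cells_comp_unique[OF ak ij] by blast
  qed
 qed (use finite_comps finA in auto)
 finally show ?thesis .
qed

lemma comp_anchor_even:
 assumes k: "adm k" and ij: "i : {1,2,3}" "j : {1,2,3}" "i ~= j" and C: "C : comps (surf k i j)"
 shows "even (card {p:A. carr p : cells C})"
proof (rule anchor_even[OF k ij])
 show "C \<subseteq> {t:T. k t : {i,j}}" using comps_sub[OF C] by (simp add: surf_def)
 show "closed_surface C"
  using closed_surface_comp[OF surf_sub closed_surface_surf[OF k ij] C] .
qed

lemma nlab_even:
 assumes "k : colorings" "i : {1,2,3}" "j : {1,2,3}" "i ~= j"
 shows "even (nlab i j)"
 unfolding anchors_of_comps[OF assms]
 using comp_anchor_even assms by (intro dvd_sum) (auto simp: colorings_def)

text \<open>Spheres are the only source of positive Euler characteristic, and an anchored component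
  carries at least two anchor points.\<close>

lemma expo_bound:
 assumes k: "k : colorings" and ij: "i : {1,2,3}" "j : {1,2,3}" "i ~= j"
 shows "- int (card (free k i j)) <= expo k i j"
proof -
 let ?S = "surf k i j" and ?f = "%c. (-1::int) ^ (card c + 1)"
 have ak: "adm k" using k by (simp add: colorings_def)
 have CT: "C \<subseteq> T" if "C : comps ?S" for C using comps_sub[OF that] surf_sub by blast
 have finC: "finite C" if "C : comps ?S" for C using CT[OF that] finT finite_subset by blast
 have cs: "cells ?S = (\<Union>C\<in>comps ?S. cells C)"
 proof
  show "cells ?S \<subseteq> (\<Union>C\<in>comps ?S. cells C)"
  proof
   fix c assume "c : cells ?S"
   then obtain t where t: "t : ?S" "c \<subseteq> t" "c ~= {}" unfolding cells_def by blast
   then have "c : cells (comp ?S t)" using comp_refl unfolding cells_def by blast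
   then show "c : (\<Union>C\<in>comps ?S. cells C)" using mem_comp[OF t(1)] by blast
  qed
  show "(\<Union>C\<in>comps ?S. cells C) \<subseteq> cells ?S"
  proof
   fix c assume "c : (\<Union>C\<in>comps ?S. cells C)"
   then obtain C where C: "C : comps ?S" "c : cells C" by blast
   then show "c : cells ?S" using comps_sub[OF C(1)] unfolding cells_def by blast
  qed
 qed
 have "chi ?S = (\<Sum>c\<in>(\<Union>C\<in>comps ?S. cells C). ?f c)"
  using chi_eq_sum_cells[OF fin_surf card3_surf] cs by simp
 also have "\<dots> = (\<Sum>C\<in>comps ?S. \<Sum>c\<in>cells C. ?f c)"
 proof (rule sum.UNION_disjoint)
  show "ALL C:comps ?S. finite (cells C)" using finite_cells finC CT card3 by (metis subsetD)
  show "ALL C:comps ?S. ALL C':comps ?S. C ~= C' --> cells C Int cells C' = {}"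
   using cells_comp_unique[OF ak ij] by blast
 qed (rule finite_comps)
 also have "\<dots> = (\<Sum>C\<in>comps ?S. chi C)"
 proof (rule sum.cong[OF refl])
  fix C assume C: "C : comps ?S"
  have "card t = 3" if "t : C" for t using that CT[OF C] card3 by blast
  from chi_eq_sum_cells[OF finC[OF C] this] show "(\<Sum>c\<in>cells C. ?f c) = chi C" by simp
 qed
 also have "\<dots> <= (\<Sum>C\<in>comps ?S. int (card {p:A. carr p : cells C}) + (if C : free k i j then 2 else 0))"
 proof (rule sum_mono)
  fix C assume C: "C : comps ?S"
  have "closed_surface C" by (rule closed_surface_comp[OF surf_sub closed_surface_surf[OF ak ij] C])
  then have chi: "chi C <= 2" using chi_le_2 comp_adjacent_linked[OF C] by blast
  show "chi C <= int (card {p:A. carr p : cells C}) + (if C : free k i j then 2 else 0)"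
  proof (cases "C : free k i j")
   case True then show ?thesis using chi by simp
  next
   case False
   then have "{p:A. carr p : cells C} ~= {}" using C by (auto simp: free_def)
   then have "card {p:A. carr p : cells C} ~= 0" using finA by simp
   moreover have "even (card {p:A. carr p : cells C})" by (rule comp_anchor_even[OF ak ij C])
   ultimately have "2 <= card {p:A. carr p : cells C}" by presburger
   then show ?thesis using chi False by simp
  qed
 qed
 also have "\<dots> = int (nlab i j) + (\<Sum>C\<in>comps ?S. if C : free k i j then 2 else 0)"
  using anchors_of_comps[OF k ij] by (simp add: sum.distrib)
 also have "(\<Sum>C\<in>comps ?S. if C : free k i j then 2 else 0) = (\<Sum>C\<in>free k i j. (2::int))"
  using finite_comps by (intro sum.mono_neutral_cong_right) (auto simp: free_def)
 finally have "chi ?S <= int (nlab i j) + 2 * int (card (free k i j))" by simp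
 moreover have "even (chi ?S)" "even (int (nlab i j))"
  using surf_even[OF ak ij] nlab_even[OF k ij] by simp_all
 ultimately show ?thesis unfolding expo_def by presburger
qed

text \<open>What the i,l surface gains from an exchange the j,l surface loses, so the exponents move
  in opposite directions by the same integer. The i,j surface is the same set of triangles
  throughout.\<close>

lemma expo_swap:
 assumes k: "k : colorings" and ij: "i : {1,2,3}" "j : {1,2,3}" "l : {1,2,3}" "i ~= j" "i ~= l" "j ~= l"
  and B: "B \<subseteq> free k i j"
 defines "\<delta> \<equiv> %C. (part k C i - part k C j) div 2"
 shows "expo (swap i j B k) i l = expo k i l + (\<Sum>C\<in>B. \<delta> C)"
  and "expo (swap i j B k) j l = expo k j l - (\<Sum>C\<in>B. \<delta> C)"
  and "expo (swap i j B k) i j = expo k i j"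
proof -
 let ?S = "surf k i j"
 have ak: "adm k" using k by (simp add: colorings_def)
 have Bc: "B \<subseteq> comps ?S" using B by (auto simp: free_def)
 have diff: "(\<Sum>C\<in>comps ?S. if C : D then g C else h C) = (\<Sum>C\<in>comps ?S. h C) + (\<Sum>C\<in>D. g C - h C)"
  if "D \<subseteq> comps ?S" for D and g h :: "'v set set => int"
 proof -
  have "(\<Sum>C\<in>comps ?S. if C : D then g C else h C) = (\<Sum>C\<in>comps ?S. h C + (if C : D then g C - h C else 0))"
   by (intro sum.cong) auto
  also have "\<dots> = (\<Sum>C\<in>comps ?S. h C) + (\<Sum>C\<in>comps ?S. if C : D then g C - h C else 0)"
   by (rule sum.distrib)
  also have "(\<Sum>C\<in>comps ?S. if C : D then g C - h C else 0) = (\<Sum>C\<in>D. g C - h C)"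
   using that finite_comps by (intro sum.mono_neutral_cong_right) auto
  finally show ?thesis .
 qed
 have il: "chi (surf (swap i j D k) i l) = chi (surf k i l) - (\<Sum>C\<in>D. part k C i - part k C j)"
  if D: "D \<subseteq> comps ?S" for D
  using chi_swap[OF ak ij D] chi_swap[OF ak ij, of "{}"] diff[OF D, of "%C. part k C j" "%C. part k C i"]
  by (simp add: swap_empty sum_subtractf)
 have jl: "chi (surf (swap i j D k) j l) = chi (surf k j l) + (\<Sum>C\<in>D. part k C i - part k C j)"
  if D: "D \<subseteq> comps ?S" for D
 proof -
  have D': "D \<subseteq> comps (surf k j i)" using D surf_commute by metis
  have sw: "swap i j D k = swap j i D k" using swap_commute[OF D ij(4)] .
  have eq: "comps (surf k j i) = comps ?S" using surf_commute by metis
  show ?thesis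
   using chi_swap[OF ak ij(2,1,3) ij(4)[symmetric] ij(6,5) D'] chi_swap[OF ak ij(2,1,3) ij(4)[symmetric] ij(6,5), of "{}"]
    diff[OF D, of "%C. part k C i" "%C. part k C j"]
   unfolding sw eq by (simp add: swap_empty sum_subtractf)
 qed
 \<comment> \<open>The halving in \<open>\<delta>\<close> is exact: exchanging the single component
   \<open>C\<close> gives another proper coloring, whose i,l surface again has even Euler
   characteristic.\<close>
 have ev: "part k C i - part k C j = 2 * \<delta> C" if "C : comps ?S" for C
 proof -
  have a: "adm (swap i j {C} k)" using adm_swap[OF ak ij(1,2,4)] that by blast
  have "part k C i - part k C j = chi (surf k i l) - chi (surf (swap i j {C} k) i l)"
   using il[of "{C}"] that by simp
  moreover have "even (chi (surf k i l) - chi (surf (swap i j {C} k) i l))"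
   using surf_even[OF ak ij(1,3,5)] surf_even[OF a ij(1,3,5)] by simp
  ultimately show ?thesis unfolding \<delta>_def by simp
 qed
 have tot: "(\<Sum>C\<in>B. part k C i - part k C j) = 2 * (\<Sum>C\<in>B. \<delta> C)"
  using ev Bc by (simp add: sum_distrib_left) (intro sum.cong, auto)
 have e: "even (chi (surf k i l))" "even (chi (surf k j l))" using surf_even ak ij by blast+
 show "expo (swap i j B k) i l = expo k i l + (\<Sum>C\<in>B. \<delta> C)"
  unfolding expo_def il[OF Bc] tot using e(1) by presburger
 show "expo (swap i j B k) j l = expo k j l - (\<Sum>C\<in>B. \<delta> C)"
  unfolding expo_def jl[OF Bc] tot using e(2) by presburger
 show "expo (swap i j B k) i j = expo k i j"
  unfolding expo_def swap_surf(1)[OF Bc] ..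
qed

end

section \<open>Divisibility of the sum by powers of the linear forms\<close>

context colored_complex
begin

text \<open>The summand of \<open>k\<close> multiplied by the N-th powers of the three linear forms.
  The truncation by \<open>nat\<close> is harmless once \<open>N\<close> bounds all negative
  exponents.\<close>

definition term3 :: "(nat => 'r::comm_ring_1) => int => ('v set => nat) => nat => nat => nat => 'r" where
 "term3 X N k i j l = X i ^ dots k i * X j ^ dots k j * X l ^ dots k l *
  (X i + X j) ^ nat (N + expo k i j) * (X i + X l) ^ nat (N + expo k i l) * (X j + X l) ^ nat (N + expo k j l)"

lemma expo_commute: "expo k i j = expo k j i"
 by (simp add: expo_def surf_commute[of k i j] nlab_def insert_commute disj_commute)

lemma sum_if_split:
 fixes g h :: "'c => nat"
 assumes "finite S" "W \<subseteq> S" "B \<subseteq> W"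
 shows "(\<Sum>C\<in>S. if C : B then g C else h C) = (\<Sum>C\<in>S - W. h C) + (\<Sum>C\<in>W. if C : B then g C else h C)"
proof -
 have "(\<Sum>C\<in>S. if C : B then g C else h C) =
   (\<Sum>C\<in>S - W. if C : B then g C else h C) + (\<Sum>C\<in>W. if C : B then g C else h C)"
  using assms by (intro sum.subset_diff)
 also have "(\<Sum>C\<in>S - W. if C : B then g C else h C) = (\<Sum>C\<in>S - W. h C)"
  using assms by (intro sum.cong) auto
 finally show ?thesis .
qed

text \<open>Splitting each \<open>\<delta> C\<close> into positive and negative part writes the
  exponent as a base that is the same for all \<open>B\<close> plus a nonnegative contribution of
  each component. The base is the least exponent attained by any \<open>B\<close>.\<close>

lemma nat_sum_split:
 fixes \<delta> :: "'c => int"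
 assumes "finite W" "B \<subseteq> W" "0 <= e - (\<Sum>C\<in>W. int (nat (- \<delta> C)))"
 shows "nat (e + (\<Sum>C\<in>B. \<delta> C)) =
  nat (e - (\<Sum>C\<in>W. int (nat (- \<delta> C)))) + (\<Sum>C\<in>W. if C : B then nat (\<delta> C) else nat (- \<delta> C))"
proof -
 have "int (\<Sum>C\<in>W. if C : B then nat (\<delta> C) else nat (- \<delta> C)) =
   (\<Sum>C\<in>W. int (nat (- \<delta> C)) + (if C : B then \<delta> C else 0))"
  unfolding of_nat_sum by (intro sum.cong) auto
 also have "\<dots> = (\<Sum>C\<in>W. int (nat (- \<delta> C))) + (\<Sum>C\<in>W. if C : B then \<delta> C else 0)"
  by (rule sum.distrib)
 also have "(\<Sum>C\<in>W. if C : B then \<delta> C else 0) = (\<Sum>C\<in>B. \<delta> C)"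
  using assms by (intro sum.mono_neutral_cong_right) auto
 finally have "int (nat (e - (\<Sum>C\<in>W. int (nat (- \<delta> C)))) + (\<Sum>C\<in>W. if C : B then nat (\<delta> C) else nat (- \<delta> C)))
   = e + (\<Sum>C\<in>B. \<delta> C)" using assms(3) by simp
 then show ?thesis by (metis nat_int)
qed

text \<open>With all exponents split into a base and contributions of components, the sum over sets
  of exchanged components becomes a product over the free components of \<open>u' C + u C\<close>,
  by \<open>sum_Pow_prod\<close>. Each factor is divisible by the linear form, and by
  \<open>expo_bound\<close> there are enough factors to make up for the missing part of the N-th
  power.\<close>

lemma class_sum_dvd:
 fixes X :: "nat => 'r::comm_ring_1"
 assumes two: "(1::'r) + 1 = 0"
  and N: "!!k i j. k : colorings ==> i : {1,2,3} ==> j : {1,2,3} ==> i ~= j ==> 0 <= N + expo k i j"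
  and k: "k : colorings" and ij: "i : {1,2,3}" "j : {1,2,3}" "l : {1,2,3}" "i ~= j" "i ~= l" "j ~= l"
 shows "(X i + X j) ^ nat N dvd
  (\<Sum>k'\<in>{k':colorings. {t:T. k' t = l} = {t:T. k t = l}}. term3 X N k' i j l)"
proof -
 let ?S = "surf k i j" and ?W = "free k i j"
 define \<delta> where "\<delta> C = (part k C i - part k C j) div 2" for C
 have ak: "adm k" using k by (simp add: colorings_def)
 have Wc: "?W \<subseteq> comps ?S" by (auto simp: free_def)
 have finW: "finite ?W" by (rule finite_free)
 define \<alpha> where "\<alpha> C = card {q:Q. dcarr q : cells C & cols k (dcarr q) = {i}}" for C
 define \<beta> where "\<beta> C = card {q:Q. dcarr q : cells C & cols k (dcarr q) = {j}}" for C
 have di: "dots (swap i j B k) i = (\<Sum>C\<in>comps ?S - ?W. \<alpha> C) + (\<Sum>C\<in>?W. if C : B then \<beta> C else \<alpha> C)"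
  if B: "B \<subseteq> ?W" for B
 proof -
  have Bc: "B \<subseteq> comps ?S" using B Wc by blast
  have "dots (swap i j B k) i = (\<Sum>C\<in>comps ?S. if C : B then \<beta> C else \<alpha> C)"
   unfolding dots_swap[OF ak ij(1,2,4) Bc] by (intro sum.cong) (auto simp: \<alpha>_def \<beta>_def)
  then show ?thesis using sum_if_split[OF finite_comps Wc B] by simp
 qed
 have dj: "dots (swap i j B k) j = (\<Sum>C\<in>comps ?S - ?W. \<beta> C) + (\<Sum>C\<in>?W. if C : B then \<alpha> C else \<beta> C)"
  if B: "B \<subseteq> ?W" for B
 proof -
  have Bc: "B \<subseteq> comps ?S" using B Wc by blast
  then have Bc': "B \<subseteq> comps (surf k j i)" using surf_commute by metis
  have eq: "comps (surf k j i) = comps ?S" using surf_commute by metis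
  have "dots (swap j i B k) j = (\<Sum>C\<in>comps ?S. if C : B then \<alpha> C else \<beta> C)"
   unfolding dots_swap[OF ak ij(2,1) ij(4)[symmetric] Bc'] eq by (intro sum.cong) (auto simp: \<alpha>_def \<beta>_def)
  then show ?thesis using sum_if_split[OF finite_comps Wc B] swap_commute[OF Bc ij(4)] by simp
 qed
 define q p where "q C = nat (- \<delta> C)" and "p C = nat (\<delta> C)" for C
 note es = expo_swap[OF k ij, folded \<delta>_def]
 have e0: "0 <= (N + expo k i l) - (\<Sum>C\<in>?W. int (nat (- \<delta> C)))"
 proof -
  \<comment> \<open>Exchanging exactly the components with negative \<open>\<delta>\<close>
    minimizes the i,l exponent; this coloring shows that the base is nonnegative.\<close>
  define B where "B = {C:?W. \<delta> C < 0}"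
  have B: "B \<subseteq> ?W" by (auto simp: B_def)
  have "0 <= N + expo (swap i j B k) i l" using N swap_in_colorings[OF k ij(1,2,4) B] ij by blast
  then have "0 <= N + expo k i l + (\<Sum>C\<in>B. \<delta> C)" using es(1)[OF B] by simp
  moreover have "(\<Sum>C\<in>?W. int (nat (- \<delta> C))) = (\<Sum>C\<in>B. - \<delta> C)"
   using finW by (intro sum.mono_neutral_cong_right) (auto simp: B_def)
  ultimately show ?thesis by (simp add: sum_negf)
 qed
 have e1: "0 <= (N + expo k j l) - (\<Sum>C\<in>?W. int (nat (- (- \<delta> C))))"
 proof -
  define B where "B = {C:?W. \<delta> C > 0}"
  have B: "B \<subseteq> ?W" by (auto simp: B_def)
  have "0 <= N + expo (swap i j B k) j l" using N swap_in_colorings[OF k ij(1,2,4) B] ij by blast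
  then have "0 <= N + expo k j l - (\<Sum>C\<in>B. \<delta> C)" using es(2)[OF B] by simp
  moreover have "(\<Sum>C\<in>?W. int (nat (- (- \<delta> C)))) = (\<Sum>C\<in>B. \<delta> C)"
   using finW by (intro sum.mono_neutral_cong_right) (auto simp: B_def)
  ultimately show ?thesis by simp
 qed
 define b1 where "b1 = nat ((N + expo k i l) - (\<Sum>C\<in>?W. int (nat (- \<delta> C))))"
 define b2 where "b2 = nat ((N + expo k j l) - (\<Sum>C\<in>?W. int (nat (- (- \<delta> C)))))"
 have nil: "nat (N + expo (swap i j B k) i l) = b1 + (\<Sum>C\<in>?W. if C : B then p C else q C)"
  if B: "B \<subseteq> ?W" for B
  using nat_sum_split[OF finW B e0] unfolding es(1)[OF B] b1_def p_def q_def by (simp only: add.assoc)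
 have njl: "nat (N + expo (swap i j B k) j l) = b2 + (\<Sum>C\<in>?W. if C : B then q C else p C)"
  if B: "B \<subseteq> ?W" for B
  using nat_sum_split[OF finW B e1] unfolding es(2)[OF B] b2_def p_def q_def
  by (simp only: sum_negf minus_minus diff_conv_add_uminus add.assoc)
 define u where "u C = X i ^ \<alpha> C * X j ^ \<beta> C * (X i + X l) ^ q C * (X j + X l) ^ p C" for C
 define u' where "u' C = X i ^ \<beta> C * X j ^ \<alpha> C * (X i + X l) ^ p C * (X j + X l) ^ q C" for C
 define E where "E = (X i + X j) ^ nat (N + expo k i j)"
 define G where "G = X i ^ (\<Sum>C\<in>comps ?S - ?W. \<alpha> C) * X j ^ (\<Sum>C\<in>comps ?S - ?W. \<beta> C) * X l ^ dots k l *
  (X i + X l) ^ b1 * (X j + X l) ^ b2"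
 have t3: "term3 X N (swap i j B k) i j l = E * G * (\<Prod>C\<in>?W. if C : B then u' C else u C)"
  if B: "B \<subseteq> ?W" for B
 proof -
  have Bc: "B \<subseteq> comps ?S" using B Wc by blast
  have pw: "(\<Prod>C\<in>?W. if C : B then u' C else u C) =
   X i ^ (\<Sum>C\<in>?W. if C : B then \<beta> C else \<alpha> C) * X j ^ (\<Sum>C\<in>?W. if C : B then \<alpha> C else \<beta> C) *
   (X i + X l) ^ (\<Sum>C\<in>?W. if C : B then p C else q C) * (X j + X l) ^ (\<Sum>C\<in>?W. if C : B then q C else p C)"
   unfolding power_sum prod.distrib[symmetric] by (intro prod.cong) (auto simp: u_def u'_def)
  show ?thesis
   unfolding term3_def di[OF B] dj[OF B] dots_swap_third[OF ak ij Bc] nil[OF B] njl[OF B] es(3)[OF B]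
    pw E_def G_def power_add by (simp add: mult_ac)
 qed
 have "(\<Sum>k'\<in>{k':colorings. {t:T. k' t = l} = {t:T. k t = l}}. term3 X N k' i j l) =
   (\<Sum>B\<in>Pow ?W. term3 X N (swap i j B k) i j l)"
  unfolding class_eq[OF k ij]
  using inj_on_subset[OF swap_inj[OF ij(4)] Pow_mono[OF Wc]] by (subst sum.reindex) auto
 also have "\<dots> = (\<Sum>B\<in>Pow ?W. E * G * (\<Prod>C\<in>?W. if C : B then u' C else u C))"
  using t3 by (intro sum.cong) auto
 also have "\<dots> = E * G * (\<Prod>C\<in>?W. u' C + u C)"
  unfolding sum_distrib_left[symmetric] by (subst sum_Pow_prod[OF finW]) simp
 finally have sum_eq: "(\<Sum>k'\<in>{k':colorings. {t:T. k' t = l} = {t:T. k t = l}}. term3 X N k' i j l) =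
  E * G * (\<Prod>C\<in>?W. u' C + u C)" .
 have "X i + X j dvd u' C + u C" for C
  using swap_sum_dvd[OF two, of "X i" "X j" "\<alpha> C" "\<beta> C" "X l" "q C" "p C"] unfolding u_def u'_def
  by (simp add: add.commute)
 then have "(\<Prod>C\<in>?W. X i + X j) dvd (\<Prod>C\<in>?W. u' C + u C)" by (intro prod_dvd_prod) auto
 then have "(X i + X j) ^ card ?W dvd (\<Prod>C\<in>?W. u' C + u C)" by simp
 then have "E * 1 * (X i + X j) ^ card ?W dvd E * G * (\<Prod>C\<in>?W. u' C + u C)"
  by (intro mult_dvd_mono) auto
 then have d: "(X i + X j) ^ (nat (N + expo k i j) + card ?W) dvd E * G * (\<Prod>C\<in>?W. u' C + u C)"
  by (simp add: E_def power_add)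
 have "nat N <= nat (N + expo k i j) + card ?W" using expo_bound[OF k ij(1,2,4)] by linarith
 from dvd_trans[OF le_imp_power_dvd[OF this] d] show ?thesis unfolding sum_eq .
qed

lemma finite_colorings: "finite colorings"
proof (rule finite_subset)
 show "colorings \<subseteq> T \<rightarrow>\<^sub>E {1,2,3}" by (auto simp: colorings_def proper_coloring_def)
 show "finite (T \<rightarrow>\<^sub>E {1,2,3::nat})" using finT by (intro finite_PiE) auto
qed

lemma total_sum_dvd:
 fixes X :: "nat => 'r::comm_ring_1"
 assumes two: "(1::'r) + 1 = 0"
  and N: "!!k i j. k : colorings ==> i : {1,2,3} ==> j : {1,2,3} ==> i ~= j ==> 0 <= N + expo k i j"
  and ij: "i : {1,2,3}" "j : {1,2,3}" "l : {1,2,3}" "i ~= j" "i ~= l" "j ~= l"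
 shows "(X i + X j) ^ nat N dvd (\<Sum>k\<in>colorings. term3 X N k i j l)"
proof -
 let ?g = "%k. {t:T. k t = l}"
 have "(\<Sum>k\<in>colorings. term3 X N k i j l) = (\<Sum>U\<in>?g ` colorings. \<Sum>k\<in>{k:colorings. ?g k = U}. term3 X N k i j l)"
  using finite_colorings by (intro sum.group[symmetric]) auto
 moreover have "(X i + X j) ^ nat N dvd (\<Sum>U\<in>?g ` colorings. \<Sum>k\<in>{k:colorings. ?g k = U}. term3 X N k i j l)"
 proof (rule dvd_sum)
  fix U assume "U : ?g ` colorings"
  then obtain k where "k : colorings" "U = ?g k" by blast
  then show "(X i + X j) ^ nat N dvd (\<Sum>k\<in>{k:colorings. ?g k = U}. term3 X N k i j l)"
   using class_sum_dvd[OF two N _ ij, of k] by simp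
 qed
 ultimately show ?thesis by simp
qed

theorem evaluation_polynomial:
 assumes two: "(1::'k::field) + 1 = 0"
 shows "(\<Sum>k\<in>colorings. (\<Prod>i\<in>{1,2,3}. var_x i ^ dots k i) *
  ((var_x 1 + var_x 2) powi expo k 1 2 * (var_x 1 + var_x 3) powi expo k 1 3 * (var_x 2 + var_x 3) powi expo k 2 3))
  : (polynomial_ring_x :: 'k ratfun set)"
proof -
 let ?P = "{(1,2),(1,3),(2,3)} :: (nat \<times> nat) set"
 \<comment> \<open>A crude common bound for all negative exponents of all colorings.\<close>
 define M where "M = (\<Sum>k\<in>colorings. \<Sum>(i,j)\<in>{1,2,3}\<times>{1,2,3}. nat (- expo k i j))"
 have N: "0 <= int M + expo k i j" if kk: "k : colorings" "i : {1,2,3}" "j : {1,2,3}" for k i j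
 proof -
  have "nat (- expo k i j) <= (\<Sum>(i,j)\<in>{1,2,3}\<times>{1,2,3}. nat (- expo k i j))"
   using kk member_le_sum[of "(i,j)" "{1,2,3}\<times>{1,2,3}" "%(i,j). nat (- expo k i j)"] by auto
  also have "\<dots> <= M" unfolding M_def
   using kk finite_colorings
    member_le_sum[of k colorings "%k. \<Sum>(i,j)\<in>{1,2,3}\<times>{1,2,3}. nat (- expo k i j)"] by simp
  finally show ?thesis by linarith
 qed
 define num where "num = (\<Sum>k\<in>colorings. term3 poly_X (int M) k 1 2 3 :: 'k poly poly poly)"
 have two3: "(1::'k poly poly poly) + 1 = 0" by (intro poly_two two)
 \<comment> \<open>The cleared summand is symmetric in the three colors, so one and the same
   numerator is divisible by the powers of all three linear forms.\<close>
 have num13: "num = (\<Sum>k\<in>colorings. term3 poly_X (int M) k 1 3 2)"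
  unfolding num_def by (intro sum.cong refl) (simp add: term3_def expo_commute[of _ 3 2] add.commute mult_ac)
 have num23: "num = (\<Sum>k\<in>colorings. term3 poly_X (int M) k 2 3 1)"
  unfolding num_def by (intro sum.cong refl)
   (simp add: term3_def expo_commute[of _ 2 1] expo_commute[of _ 2 "Suc 0"] expo_commute[of _ 3 "Suc 0"]
    expo_commute[of _ 3 1] add.commute mult_ac)
 have "(poly_X 1 + poly_X 2) ^ M dvd num" "(poly_X 1 + poly_X 3) ^ M dvd num" "(poly_X 2 + poly_X 3) ^ M dvd num"
  using total_sum_dvd[OF two3, of "int M" 1 2 3 poly_X] total_sum_dvd[OF two3, of "int M" 1 3 2 poly_X]
   total_sum_dvd[OF two3, of "int M" 2 3 1 poly_X] N
  unfolding num_def[symmetric] num13[symmetric] num23[symmetric] by simp_all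
 then obtain h where h: "num = (poly_X 1 + poly_X 2) ^ M * (poly_X 1 + poly_X 3) ^ M * (poly_X 2 + poly_X 3) ^ M * h"
  using X_powers_dvd[OF two] by (metis dvdE)
 have hom: "ring_homo (to_ratfun :: 'k poly poly poly => _)" by (rule ring_homo_to_ratfun)
 have hp: "to_ratfun (a + b) = to_ratfun a + to_ratfun b" "to_ratfun (a * b) = to_ratfun a * to_ratfun b"
  "to_ratfun (a ^ n) = to_ratfun a ^ n" for a b :: "'k poly poly poly" and n
  using hom ring_homo_power[OF hom] by (simp_all add: ring_homo_def)
 have hX: "to_ratfun (poly_X 1) = (var_x 1 :: 'k ratfun)" "to_ratfun (poly_X 2) = (var_x 2 :: 'k ratfun)"
  "to_ratfun (poly_X 3) = (var_x 3 :: 'k ratfun)" using to_ratfun_poly_X by blast+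
 define a b c where "a = (var_x 1 + var_x 2 :: 'k ratfun)" and "b = (var_x 1 + var_x 3 :: 'k ratfun)"
  and "c = (var_x 2 + var_x 3 :: 'k ratfun)"
 have nz: "a ~= 0" "b ~= 0" "c ~= 0" unfolding a_def b_def c_def using var_x_sum_nonzero[OF two] by simp_all
 have pw: "x ^ nat (int M + e) = x ^ M * (x powi e)" if "x ~= 0" "0 <= int M + e" for x :: "'k ratfun" and e
 proof -
  have "x ^ nat (int M + e) = x powi (int M + e)" using that by (simp add: power_int_def)
  also have "\<dots> = x ^ M * x powi e" using that by (simp add: power_int_add)
  finally show ?thesis .
 qed
 let ?t = "%k. (\<Prod>i\<in>{1,2,3}. var_x i ^ dots k i) * (a powi expo k 1 2 * b powi expo k 1 3 * c powi expo k 2 3)"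
 have "to_ratfun num = (\<Sum>k\<in>colorings. to_ratfun (term3 poly_X (int M) k 1 2 3))"
  unfolding num_def by (rule ring_homo_sum[OF hom])
 also have "\<dots> = (\<Sum>k\<in>colorings. a ^ M * b ^ M * c ^ M * ?t k)"
 proof (rule sum.cong[OF refl])
  fix k assume k: "k : colorings"
  have "to_ratfun (term3 poly_X (int M) k 1 2 3) =
   var_x 1 ^ dots k 1 * var_x 2 ^ dots k 2 * var_x 3 ^ dots k 3 *
   a ^ nat (int M + expo k 1 2) * b ^ nat (int M + expo k 1 3) * c ^ nat (int M + expo k 2 3)"
   unfolding term3_def hp hX a_def b_def c_def ..
  also have "\<dots> = a ^ M * b ^ M * c ^ M * ?t k"
   using pw[OF nz(1) N[OF k, of 1 2]] pw[OF nz(2) N[OF k, of 1 3]] pw[OF nz(3) N[OF k, of 2 3]]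
   by (simp add: mult_ac)
  finally show "to_ratfun (term3 poly_X (int M) k 1 2 3) = a ^ M * b ^ M * c ^ M * ?t k" .
 qed
 also have "\<dots> = a ^ M * b ^ M * c ^ M * (\<Sum>k\<in>colorings. ?t k)" by (simp add: sum_distrib_left)
 finally have t1: "to_ratfun num = a ^ M * b ^ M * c ^ M * (\<Sum>k\<in>colorings. ?t k)" .
 have t2: "to_ratfun num = a ^ M * b ^ M * c ^ M * to_ratfun h"
  unfolding h hp hX a_def b_def c_def ..
 have "a ^ M * b ^ M * c ^ M ~= 0" using nz by simp
 from mult_left_cancel[OF this, THEN iffD1, OF trans[OF t1[symmetric] t2]]
 show ?thesis unfolding a_def b_def c_def by (simp only: to_ratfun_in)
qed

end

section \<open>Sides of a closed polyhedral surface\<close>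

subsection \<open>Crossings of a segment with the faces of a simplex\<close>

text \<open>\<open>\<rho>\<close> is the zero of the affine function with the values
  \<open>a\<close> at 0 and \<open>b\<close> at 1.\<close>

lemma affine_root:
 fixes a b :: real
 assumes "a < 0 & 0 < b \<or> b < 0 & 0 < a"
 defines "\<rho> \<equiv> a / (a - b)"
 shows "0 < \<rho>" "\<rho> < 1" "(1 - r) * a + r * b = (b - a) * (r - \<rho>)"
proof -
 have ne: "a - b ~= 0" using assms(1) by auto
 show "0 < \<rho>" "\<rho> < 1"
  using assms(1) unfolding \<rho>_def
  by (elim disjE; simp add: zero_less_divide_iff divide_less_eq_1_neg divide_less_eq_1_pos)+
 have "(b - a) * \<rho> = - a" unfolding \<rho>_def using ne by (simp add: field_simps)
 then show "(1 - r) * a + r * b = (b - a) * (r - \<rho>)" by (simp add: algebra_simps)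
qed

lemma card_arg_extremum:
 fixes \<rho> :: "'v => real"
 assumes "finite A" "A ~= {}" "inj_on \<rho> A"
 shows "card {v:A. ALL w:A - {v}. \<rho> w < \<rho> v} = 1"
proof -
 have "Max (\<rho> ` A) : \<rho> ` A" using assms by simp
 then obtain m where m: "m : A" "\<rho> m = Max (\<rho> ` A)" by auto
 have lt: "\<rho> w < \<rho> m" if "w : A - {m}" for w
 proof -
  have "\<rho> w <= \<rho> m" using that m assms by simp
  moreover have "\<rho> w ~= \<rho> m" using that m assms(3) by (auto simp: inj_on_def)
  ultimately show ?thesis by simp
 qed
 have "{v:A. ALL w:A - {v}. \<rho> w < \<rho> v} = {m}"
 proof
  show "{v:A. ALL w:A - {v}. \<rho> w < \<rho> v} \<subseteq> {m}"
  proof clarify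
   fix v assume v: "v : A" "ALL w:A - {v}. \<rho> w < \<rho> v"
   show "v = m"
   proof (rule ccontr)
    assume ne: "v ~= m"
    have "\<rho> m < \<rho> v" using v(2) m(1) ne by blast
    moreover have "\<rho> v < \<rho> m" using lt[of v] v(1) ne by blast
    ultimately show False by simp
   qed
  qed
  show "{m} \<subseteq> {v:A. ALL w:A - {v}. \<rho> w < \<rho> v}" using m lt by auto
 qed
 then show ?thesis by simp
qed

text \<open>A segment in general position crosses the boundary of a simplex an even number of times,
  once its endpoints inside the simplex are added. Here \<open>f v r\<close> plays the role of the
  barycentric coordinate of \<open>v\<close> at parameter \<open>r\<close>, a crossing of the face
  opposite \<open>v\<close> is a zero of \<open>f v\<close> at which all others are positive, and
  general position means that no two coordinates vanish together.\<close>

lemma segment_crossings_even: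
 fixes a b :: "'v => real"
 defines "f \<equiv> %v r. (1 - r) * a v + r * b v"
 assumes fin: "finite I" and ends: "!!v. v : I ==> a v ~= 0 & b v ~= 0"
  and gen: "!!r v w. r : {0..1} ==> v : I ==> w : I ==> v ~= w ==> ~ (f v r = 0 & f w r = 0)"
 shows "even ((if ALL v:I. 0 < a v then 1 else 0) + (if ALL v:I. 0 < b v then 1 else 0) +
  card {v:I. EX r:{0..1}. f v r = 0 & (ALL w:I - {v}. 0 < f w r)})"
proof (cases "EX v:I. a v < 0 & b v < 0")
 case True
 then obtain u where u: "u : I" "a u < 0" "b u < 0" by blast
 have neg: "f u r < 0" if r: "r : {0..1}" for r
 proof (cases "r = 0")
  case False
  have "r * b u < 0" "(1 - r) * a u <= 0" using u r False by (auto simp: mult_pos_neg mult_nonneg_nonpos)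
  then show ?thesis by (simp add: f_def)
 qed (simp add: f_def u)
 have none: "{v:I. EX r:{0..1}. f v r = 0 & (ALL w:I - {v}. 0 < f w r)} = {}"
 proof (rule ccontr)
  assume "~ ?thesis"
  then obtain v r where v: "v : I" "r : {0..1}" "f v r = 0" "ALL w:I - {v}. 0 < f w r" by blast
  have "u = v \<or> u : I - {v}" using u by blast
  then have "0 <= f u r" using v(3,4) by (metis less_imp_le order_refl)
  then show False using neg[OF v(2)] by simp
 qed
 have "~ (ALL v:I. 0 < a v)" "~ (ALL v:I. 0 < b v)" using u by force+
 then show ?thesis unfolding none by simp
next
 case False
 \<comment> \<open>The coordinates in \<open>A\<close> turn positive along the segment and those in
   \<open>B\<close> turn negative, each exactly once. The segment is inside between the last root of
   \<open>A\<close> and the first root of \<open>B\<close>.\<close>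
 define A where "A = {v:I. a v < 0 & 0 < b v}"
 define B where "B = {v:I. b v < 0 & 0 < a v}"
 define \<rho> where "\<rho> v = a v / (a v - b v)" for v
 have part: "v : A \<or> v : B \<or> (0 < a v & 0 < b v)" if "v : I" for v
 proof -
  have "~ (a v < 0 & b v < 0)" using False that by blast
  then show ?thesis using ends[OF that] that by (auto simp: A_def B_def)
 qed
 have sgn: "a v < 0 & 0 < b v \<or> b v < 0 & 0 < a v" if "v : A Un B" for v
  using that unfolding A_def B_def by blast
 have \<rho>01: "\<rho> v : {0<..<1}" if "v : A Un B" for v
  using affine_root(1,2)[OF sgn[OF that]] unfolding \<rho>_def by simp
 have fA: "f v r = (b v - a v) * (r - \<rho> v)" if "v : A Un B" for v r
  using affine_root(3)[OF sgn[OF that], of r] unfolding \<rho>_def f_def .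
 have pA: "0 < f v r \<longleftrightarrow> \<rho> v < r" if "v : A" for v r
 proof -
  have "0 < b v - a v" using that by (simp add: A_def)
  then show ?thesis unfolding fA[OF UnI1[OF that]] by (simp add: zero_less_mult_iff)
 qed
 have pB: "0 < f v r \<longleftrightarrow> r < \<rho> v" if "v : B" for v r
 proof -
  have "b v - a v < 0" using that by (simp add: B_def)
  then show ?thesis unfolding fA[OF UnI2[OF that]] by (simp add: zero_less_mult_iff)
 qed
 have pO: "0 < f v r" if "0 < a v" "0 < b v" "r : {0..1}" for v r
 proof (cases "r = 0")
  case False
  then have "0 < r * b v" "0 <= (1 - r) * a v" using that by auto
  then show ?thesis by (simp add: f_def)
 qed (simp add: f_def that)
 have zAB: "f v r = 0 \<longleftrightarrow> r = \<rho> v" if "v : A Un B" for v r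
  using fA[OF that] sgn[OF that] by auto
 have inj: "v = w" if "v : A Un B" "w : A Un B" "\<rho> v = \<rho> w" for v w
 proof (rule ccontr)
  assume "v ~= w"
  moreover have "v : I" "w : I" "\<rho> v : {0..1}" using that \<rho>01[of v] by (auto simp: A_def B_def)
  ultimately show False using gen[of "\<rho> v" v w] zAB that by auto
 qed
 have finAB: "finite A" "finite B" using fin by (auto simp: A_def B_def)
 have AB: "A Int B = {}" by (auto simp: A_def B_def)
 have char: "(EX r:{0..1}. f v r = 0 & (ALL w:I - {v}. 0 < f w r)) \<longleftrightarrow>
   v : A Un B & (ALL w:A - {v}. \<rho> w < \<rho> v) & (ALL w:B - {v}. \<rho> v < \<rho> w)" if v: "v : I" for v
 proof
  assume "EX r:{0..1}. f v r = 0 & (ALL w:I - {v}. 0 < f w r)"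
  then obtain r where r: "r : {0..1}" "f v r = 0" "ALL w:I - {v}. 0 < f w r" by blast
  have vAB: "v : A Un B" using part[OF v] pO[of v r] r by auto
  then have rv: "r = \<rho> v" using zAB r by simp
  have "\<rho> w < \<rho> v" if "w : A - {v}" for w
  proof -
   have "w : I - {v}" "w : A" using that by (simp_all add: A_def)
   then show ?thesis using r(3) pA[of w r] rv by blast
  qed
  moreover have "\<rho> v < \<rho> w" if "w : B - {v}" for w
  proof -
   have "w : I - {v}" "w : B" using that by (simp_all add: B_def)
   then show ?thesis using r(3) pB[of w r] rv by blast
  qed
  ultimately show "v : A Un B & (ALL w:A - {v}. \<rho> w < \<rho> v) & (ALL w:B - {v}. \<rho> v < \<rho> w)"
   using vAB by blast
 next
  assume R: "v : A Un B & (ALL w:A - {v}. \<rho> w < \<rho> v) & (ALL w:B - {v}. \<rho> v < \<rho> w)"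
  have "0 < f w (\<rho> v)" if wI: "w : I - {v}" for w
  proof -
   have v01: "\<rho> v : {0..1}" using \<rho>01[of v] R by simp
   consider "w : A" | "w : B" | "0 < a w" "0 < b w" using part[of w] wI by blast
   then show ?thesis
   proof cases
    case 1 then show ?thesis using pA[OF 1] R wI by blast
   next
    case 2 then show ?thesis using pB[OF 2] R wI by blast
   next
    case 3 then show ?thesis using pO[OF 3 v01] by simp
   qed
  qed
  moreover have "\<rho> v : {0..1}" "f v (\<rho> v) = 0" using R \<rho>01[of v] zAB by auto
  ultimately show "EX r:{0..1}. f v r = 0 & (ALL w:I - {v}. 0 < f w r)" by blast
 qed
 \<comment> \<open>The faces through which the segment enters and leaves. If both \<open>A\<close>
   and \<open>B\<close> are nonempty, there is one of each or none at all, according to the order of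
   the two extremal roots.\<close>
 define CA where "CA = {v:A. (ALL w:A - {v}. \<rho> w < \<rho> v) & (ALL w:B. \<rho> v < \<rho> w)}"
 define CB where "CB = {v:B. (ALL w:B - {v}. \<rho> v < \<rho> w) & (ALL w:A. \<rho> w < \<rho> v)}"
 have "{v:I. EX r:{0..1}. f v r = 0 & (ALL w:I - {v}. 0 < f w r)} = CA Un CB"
 proof (rule set_eqI)
  fix v
  have "v : {v:I. EX r:{0..1}. f v r = 0 & (ALL w:I - {v}. 0 < f w r)} \<longleftrightarrow>
    v : I & v : A Un B & (ALL w:A - {v}. \<rho> w < \<rho> v) & (ALL w:B - {v}. \<rho> v < \<rho> w)"
   using char by blast
  also have "\<dots> \<longleftrightarrow> v : CA Un CB"
  proof -
   have "A \<subseteq> I" "B \<subseteq> I" by (auto simp: A_def B_def)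
   moreover have "B - {v} = B" if "v : A" using that AB by blast
   moreover have "A - {v} = A" if "v : B" using that AB by blast
   ultimately show ?thesis unfolding CA_def CB_def by auto
  qed
  finally show "v : {v:I. EX r:{0..1}. f v r = 0 & (ALL w:I - {v}. 0 < f w r)} \<longleftrightarrow> v : CA Un CB" .
 qed
 moreover have "card (CA Un CB) = card CA + card CB"
  using finAB AB by (intro card_Un_disjoint) (auto simp: CA_def CB_def)
 moreover have "(ALL v:I. 0 < a v) \<longleftrightarrow> A = {}" "(ALL v:I. 0 < b v) \<longleftrightarrow> B = {}"
  using part by (auto simp: A_def B_def)
 moreover have "even ((if A = {} then 1 else 0) + (if B = {} then 1 else 0) + (card CA + card CB))"
 proof -
  have "inj_on \<rho> A" "inj_on (%v. - \<rho> v) B" using inj by (auto intro!: inj_onI)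
  then have maxA: "A ~= {} ==> card {v:A. ALL w:A - {v}. \<rho> w < \<rho> v} = 1"
   and minB: "B ~= {} ==> card {v:B. ALL w:B - {v}. \<rho> v < \<rho> w} = 1"
   using card_arg_extremum[OF finAB(1), of \<rho>] card_arg_extremum[OF finAB(2), of "%v. - \<rho> v"] by simp_all
  show ?thesis
  proof (cases "A = {} \<or> B = {}")
   case True
   then show ?thesis using maxA minB by (auto simp: CA_def CB_def)
  next
   case F: False
   then have ne: "A ~= {}" "B ~= {}" by blast+
   obtain m where m: "{v:A. ALL w:A - {v}. \<rho> w < \<rho> v} = {m}" by (rule card_1_singletonE[OF maxA[OF ne(1)]])
   obtain n where n: "{v:B. ALL w:B - {v}. \<rho> v < \<rho> w} = {n}" by (rule card_1_singletonE[OF minB[OF ne(2)]])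
   have "m : {v:A. ALL w:A - {v}. \<rho> w < \<rho> v}" unfolding m by simp
   then have mA: "m : A" "ALL w:A. w = m \<or> \<rho> w < \<rho> m" by blast+
   have "n : {v:B. ALL w:B - {v}. \<rho> v < \<rho> w}" unfolding n by simp
   then have nB: "n : B" "ALL w:B. w = n \<or> \<rho> n < \<rho> w" by blast+
   have "CA = {v:{v:A. ALL w:A - {v}. \<rho> w < \<rho> v}. ALL w:B. \<rho> v < \<rho> w}"
    unfolding CA_def by blast
   then have "CA = {v:{m}. ALL w:B. \<rho> v < \<rho> w}" unfolding m .
   moreover have "(ALL w:B. \<rho> m < \<rho> w) \<longleftrightarrow> \<rho> m < \<rho> n" using nB by (metis less_trans)
   ultimately have cA: "CA = (if \<rho> m < \<rho> n then {m} else {})" by auto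
   have "CB = {v:{v:B. ALL w:B - {v}. \<rho> v < \<rho> w}. ALL w:A. \<rho> w < \<rho> v}"
    unfolding CB_def by blast
   then have "CB = {v:{n}. ALL w:A. \<rho> w < \<rho> v}" unfolding n .
   moreover have "(ALL w:A. \<rho> w < \<rho> n) \<longleftrightarrow> \<rho> m < \<rho> n" using mA by (metis less_trans)
   ultimately have cB: "CB = (if \<rho> m < \<rho> n then {n} else {})" by auto
   show ?thesis unfolding cA cB using ne by simp
  qed
 qed
 ultimately show ?thesis by simp
qed

subsection \<open>Barycentric coordinates and general position\<close>

definition bary :: "(real^3) set => real^3 => real^3 => real" where
 "bary F x = (SOME u. sum u F = 1 & (\<Sum>v\<in>F. u v *\<^sub>R v) = x)"

locale simplex3 =
 fixes F :: "(real^3) set"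
 assumes indep: "~ affine_dependent F" and card4: "card F = 4"
begin

lemma fin: "finite F" by (rule aff_independent_finite[OF indep])

lemma bary: "sum (bary F x) F = 1" "(\<Sum>v\<in>F. bary F x v *\<^sub>R v) = x"
proof -
 have "affine hull F = UNIV" using affine_independent_span_eq[OF indep] card4 by simp
 then have "EX u. sum u F = 1 & (\<Sum>v\<in>F. u v *\<^sub>R v) = x"
  using affine_hull_finite[OF fin] by blast
 from someI_ex[OF this] show "sum (bary F x) F = 1" "(\<Sum>v\<in>F. bary F x v *\<^sub>R v) = x"
  by (auto simp: bary_def)
qed

lemma bary_unique:
 assumes "sum u F = 1" "(\<Sum>v\<in>F. u v *\<^sub>R v) = x" "v : F"
 shows "bary F x v = u v"
proof (rule ccontr)
 assume ne: "bary F x v ~= u v"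
 let ?U = "%w. bary F x w - u w"
 have "sum ?U F = 0" "(\<Sum>w\<in>F. ?U w *\<^sub>R w) = 0" "EX v:F. ?U v ~= 0"
  using assms bary[of x] ne by (auto simp: sum_subtractf scaleR_left_diff_distrib)
 then have "affine_dependent F" unfolding affine_dependent_explicit_finite[OF fin] by blast
 then show False using indep by simp
qed

lemma bary_segment:
 assumes "v : F"
 shows "bary F ((1 - r) *\<^sub>R x + r *\<^sub>R y) v = (1 - r) * bary F x v + r * bary F y v"
proof (rule bary_unique[OF _ _ assms])
 let ?u = "%v. (1 - r) * bary F x v + r * bary F y v"
 have "sum ?u F = (1 - r) * sum (bary F x) F + r * sum (bary F y) F"
  by (simp add: sum.distrib sum_distrib_left)
 then show "sum ?u F = 1" using bary(1) by simp
 have "(\<Sum>v\<in>F. ?u v *\<^sub>R v) = (1 - r) *\<^sub>R (\<Sum>v\<in>F. bary F x v *\<^sub>R v) + r *\<^sub>R (\<Sum>v\<in>F. bary F y v *\<^sub>R v)"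
  by (simp add: sum.distrib scaleR_sum_right scaleR_left_distrib)
 then show "(\<Sum>v\<in>F. ?u v *\<^sub>R v) = (1 - r) *\<^sub>R x + r *\<^sub>R y" using bary(2) by simp
qed

lemma bary_face:
 assumes "G \<subseteq> F" "sum u G = 1" "(\<Sum>v\<in>G. u v *\<^sub>R v) = x" "v : F"
 shows "bary F x v = (if v : G then u v else 0)"
proof (rule bary_unique[OF _ _ assms(4)])
 show "(\<Sum>v\<in>F. if v : G then u v else 0) = 1"
  using assms(1,2) fin by (simp add: sum.If_cases Int_absorb1)
 have "(\<Sum>v\<in>F. (if v : G then u v else 0) *\<^sub>R v) = (\<Sum>v\<in>G. u v *\<^sub>R v)"
  using assms(1) fin by (intro sum.mono_neutral_cong_right) auto
 then show "(\<Sum>v\<in>F. (if v : G then u v else 0) *\<^sub>R v) = x" using assms(3) by simp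
qed

lemma bary_restrict:
 assumes "G \<subseteq> F" "!!v. v : F - G ==> bary F x v = 0"
 shows "sum (bary F x) G = 1" "(\<Sum>v\<in>G. bary F x v *\<^sub>R v) = x"
proof -
 have "sum (bary F x) G = sum (bary F x) F" "(\<Sum>v\<in>G. bary F x v *\<^sub>R v) = (\<Sum>v\<in>F. bary F x v *\<^sub>R v)"
  using assms fin by (auto intro!: sum.mono_neutral_left)
 then show "sum (bary F x) G = 1" "(\<Sum>v\<in>G. bary F x v *\<^sub>R v) = x" using bary by auto
qed

lemma in_affine_face:
 assumes "G \<subseteq> F"
 shows "x : affine hull G \<longleftrightarrow> (ALL v:F - G. bary F x v = 0)"
proof
 have fG: "finite G" using assms fin finite_subset by auto
 show "ALL v:F - G. bary F x v = 0" if "x : affine hull G"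
 proof -
  from that obtain u where "sum u G = 1" "(\<Sum>v\<in>G. u v *\<^sub>R v) = x"
   unfolding affine_hull_finite[OF fG] by blast
  then show ?thesis using bary_face[OF assms] by simp
 qed
 show "x : affine hull G" if "ALL v:F - G. bary F x v = 0"
  using bary_restrict[OF assms, of x] that unfolding affine_hull_finite[OF fG] by blast
qed

lemma in_hull: "x : conv F \<longleftrightarrow> (ALL v:F. 0 <= bary F x v)"
proof
 show "ALL v:F. 0 <= bary F x v" if "x : conv F"
 proof -
  from that obtain u where "ALL v:F. 0 <= u v" "sum u F = 1" "(\<Sum>v\<in>F. u v *\<^sub>R v) = x"
   unfolding convex_hull_finite[OF fin] by blast
  then show ?thesis using bary_unique by simp
 qed
 show "x : conv F" if "ALL v:F. 0 <= bary F x v"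
  using bary[of x] that unfolding convex_hull_finite[OF fin] by blast
qed

lemma in_rel_interior_face:
 assumes "G \<subseteq> F"
 shows "x : relint G \<longleftrightarrow> (ALL v:F - G. bary F x v = 0) & (ALL v:G. 0 < bary F x v)"
proof -
 have iG: "~ affine_dependent G" using indep assms affine_independent_subset by blast
 show ?thesis
 proof
  assume "x : relint G"
  then obtain u where u: "ALL v:G. 0 < u v" "sum u G = 1" "(\<Sum>v\<in>G. u v *\<^sub>R v) = x"
   unfolding rel_interior_convex_hull_explicit[OF iG] by blast
  then show "(ALL v:F - G. bary F x v = 0) & (ALL v:G. 0 < bary F x v)"
   using bary_face[OF assms u(2,3)] assms by auto
 next
  assume "(ALL v:F - G. bary F x v = 0) & (ALL v:G. 0 < bary F x v)"
  then show "x : relint G"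
   using bary_restrict[OF assms, of x] unfolding rel_interior_convex_hull_explicit[OF iG] by blast
 qed
qed

end

text \<open>At most three points have an affine hull with empty interior, and a finite union of
  closed sets with empty interior has empty interior. All choices in general position rest on
  this.\<close>

lemma avoid_planes:
 fixes U :: "(real^3) set"
 assumes "open U" "U ~= {}" "finite \<A>" "!!A. A : \<A> ==> finite A & card A <= 3"
 obtains y where "y : U" "!!A. A : \<A> ==> y ~: affine hull A"
proof -
 have "interior (\<Union>A\<in>\<A>. affine hull A) = {}"
  using assms(3,4)
 proof (induction \<A> rule: finite_induct)
  case (insert A \<A>)
  have "interior (affine hull A) = {}"
   using insert.prems[of A] by (intro empty_interior_affine_hull) auto
  then show ?case
   using insert.IH insert.prems interior_closed_Un_empty_interior[of "affine hull A" "\<Union>A\<in>\<A>. affine hull A"]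
   by simp
 qed simp
 then have "~ U \<subseteq> (\<Union>A\<in>\<A>. affine hull A)"
  using assms(1,2) interior_maximal[of U] by blast
 then show ?thesis using that by blast
qed

subsection \<open>The two sides of a mod 2 cycle\<close>

text \<open>Even degree at each edge is weaker than being a closed surface: sheets may touch at
  vertices and cross along edges. It suffices for a well-defined inside.\<close>

locale mod2_cycle =
 fixes S :: "(real^3) set set"
 assumes finS: "finite S" and card3: "!!t. t : S ==> card t = 3"
  and indep: "!!t. t : S ==> ~ affine_dependent t"
  and inter: "!!t t'. t : S ==> t' : S ==> conv t Int conv t' = conv (t Int t')"
  and even_edges: "!!e. e : edges_of S ==> even (card {t:S. e \<subseteq> t})"
begin

definition body :: "(real^3) set" where "body = (\<Union>t\<in>S. conv t)"

text \<open>Cone point of a filling: the mod 2 boundary of the sum of the tetrahedra spanned by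
  \<open>apex\<close> and the triangles is the cycle itself, because the cone over an edge occurs
  once for each triangle on it, hence an even number of times.\<close>

definition apex :: "real^3" where "apex = (SOME p. ALL t:S. p ~: affine hull t)"

lemma apex: "t : S ==> apex ~: affine hull t"
proof -
 assume t: "t : S"
 have "finite A & card A <= 3" if "A : S" for A
  using aff_independent_finite[OF indep[OF that]] card3[OF that] by simp
 then obtain y where "!!A. A : S ==> y ~: affine hull A"
  using avoid_planes[of UNIV S] finS by auto
 then have "EX p. ALL t:S. p ~: affine hull t" by blast
 from someI_ex[OF this] show ?thesis using t by (simp add: apex_def)
qed

lemma apex_notin: "t : S ==> apex ~: t"
 using apex[of t] hull_inc[of apex t affine] by blast

lemma fin_t: "t : S ==> finite t"
 by (rule aff_independent_finite[OF indep])

lemma simplex_cone: "t : S ==> simplex3 (insert apex t)"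
 using affine_independent_insert[OF indep apex] card3 apex_notin fin_t by unfold_locales auto

lemma compact_body: "compact body"
 unfolding body_def using finS fin_t by (intro compact_UN finite_imp_compact_convex_hull) auto

lemma closed_body: "closed body" by (rule compact_imp_closed[OF compact_body])

definition gen :: "real^3 => bool" where
 "gen x \<longleftrightarrow> (ALL t:S. ALL v:insert apex t. x ~: affine hull (insert apex t - {v}))"

text \<open>Keeps the segment from \<open>x\<close> to \<open>y\<close> away from the lines through
  the edges of the cone tetrahedra: for generic \<open>x\<close>, a segment meeting such a line
  would put \<open>y\<close> into the span of \<open>x\<close> and the line.\<close>

definition gen2 :: "real^3 => real^3 => bool" where
 "gen2 x y \<longleftrightarrow> (ALL t:S. ALL v:insert apex t. ALL w:insert apex t. v ~= w -->
  y ~: affine hull (insert x (insert apex t - {v,w})))"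

lemma ex_gen2:
 assumes "open U" "U ~= {}" "finite X"
 obtains y where "y : U" "gen y" "!!x. x : X ==> gen2 x y"
proof -
 let ?\<A>1 = "(\<Union>t\<in>S. (%v. insert apex t - {v}) ` (insert apex t))"
 let ?\<A>2 = "(\<Union>x\<in>X. \<Union>t\<in>S. (%(v,w). insert x (insert apex t - {v,w})) ` {(v,w). v : insert apex t & w : insert apex t & v ~= w})"
 have fin2: "finite {(v,w). v : insert apex t & w : insert apex t & v ~= w}" if "t : S" for t
  by (rule finite_subset[of _ "insert apex t \<times> insert apex t"]) (use fin_t[OF that] in auto)
 have c4: "card (insert apex t) = 4" "finite (insert apex t)" if "t : S" for t
  using card3 apex_notin fin_t that by auto
 have "finite (?\<A>1 Un ?\<A>2)" using finS fin_t assms(3) fin2 by auto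
 moreover have "finite A & card A <= 3" if "A : ?\<A>1 Un ?\<A>2" for A
 proof -
  from that consider (a) t v where "t : S" "v : insert apex t" "A = insert apex t - {v}"
   | (b) x t v w where "t : S" "v : insert apex t" "w : insert apex t" "v ~= w" "A = insert x (insert apex t - {v,w})"
   by blast
  then show ?thesis
  proof cases
   case a
   have "card (insert apex t - {v}) = 3" using c4[OF a(1)] a(2) by (simp only: card_Diff_singleton)
   then show ?thesis using a c4[OF a(1)] by simp
  next
   case b
   have "card (insert apex t - {v,w}) = card (insert apex t) - card {v,w}"
    using b by (intro card_Diff_subset) auto
   also have "\<dots> = 2" using b(4) c4[OF b(1)] by (simp only: card_2_iff) simp
   finally have "card A <= 3" using b(5) card_insert_le_m1[of 3 "insert apex t - {v,w}" x] by simp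
   moreover have "finite A" using b c4[OF b(1)] by auto
   ultimately show ?thesis by simp
  qed
 qed
 ultimately obtain y where y: "y : U" "!!A. A : ?\<A>1 Un ?\<A>2 ==> y ~: affine hull A"
  using avoid_planes[OF assms(1,2), of "?\<A>1 Un ?\<A>2"] by blast
 have "gen y" unfolding gen_def using y(2) by blast
 moreover have "gen2 x y" if "x : X" for x unfolding gen2_def
 proof (intro ballI impI)
  fix t v w assume "t : S" "v : insert apex t" "w : insert apex t" "v ~= w"
  then have "insert x (insert apex t - {v,w}) : ?\<A>2" using that by blast
  from y(2)[OF UnI2[OF this]] show "y ~: affine hull (insert x (insert apex t - {v,w}))" .
 qed
 ultimately show ?thesis using that y(1) by blast
qed

definition pcount :: "real^3 => nat" where
 "pcount x = card {t:S. x : conv (insert apex t)}"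

definition crosses :: "real^3 => real^3 => (real^3) set => bool" where
 "crosses x y G \<longleftrightarrow> (EX z:closed_segment x y. z : relint G)"

lemma tetrahedron_crossings:
 assumes t: "t : S" and g: "gen x" "gen y" "gen2 x y"
 shows "even ((if x : conv (insert apex t) then 1 else 0) +
  (if y : conv (insert apex t) then 1 else 0) +
  card {v:insert apex t. crosses x y (insert apex t - {v})})"
proof -
 let ?F = "insert apex t"
 interpret simplex3 ?F by (rule simplex_cone[OF t])
 have nz: "bary ?F z v ~= 0" if "gen z" "v : ?F" for z v
 proof
  assume "bary ?F z v = 0"
  then have "z : affine hull (?F - {v})" using in_affine_face[of "?F - {v}" z] that(2) by auto
  then show False using that t unfolding gen_def by blast
 qed
 have pos: "z : conv ?F \<longleftrightarrow> (ALL v:?F. 0 < bary ?F z v)" if "gen z" for z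
 proof -
  have "0 <= bary ?F z v \<longleftrightarrow> 0 < bary ?F z v" if v: "v : ?F" for v
   using nz[OF \<open>gen z\<close> v] by (simp add: less_le)
  then show ?thesis unfolding in_hull by blast
 qed
 have main: "even ((if ALL v:?F. 0 < bary ?F x v then 1 else 0) + (if ALL v:?F. 0 < bary ?F y v then 1 else 0) +
  card {v:?F. EX r:{0..1}. (1 - r) * bary ?F x v + r * bary ?F y v = 0 &
    (ALL w:?F - {v}. 0 < (1 - r) * bary ?F x w + r * bary ?F y w)})"
 proof (rule segment_crossings_even[OF fin])
  show "bary ?F x v ~= 0 & bary ?F y v ~= 0" if "v : ?F" for v using nz that g by blast
  fix r :: real and v w assume r: "r : {0..1}" and vw: "v : ?F" "w : ?F" "v ~= w"
  show "~ ((1 - r) * bary ?F x v + r * bary ?F y v = 0 & (1 - r) * bary ?F x w + r * bary ?F y w = 0)"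
  proof
   assume z: "(1 - r) * bary ?F x v + r * bary ?F y v = 0 & (1 - r) * bary ?F x w + r * bary ?F y w = 0"
   define z where "z = (1 - r) *\<^sub>R x + r *\<^sub>R y"
   let ?G = "?F - {v,w}"
   have "ALL u:?F - ?G. bary ?F z u = 0" using z bary_segment vw by (auto simp: z_def)
   then have zG: "z : affine hull ?G" using in_affine_face[of ?G z] by auto
   have r0: "r ~= 0" using z nz[OF g(1) vw(1)] by auto
   have "y = (1 / r) *\<^sub>R z + (1 - 1 / r) *\<^sub>R x"
    using r0 by (simp add: z_def scaleR_right_distrib scaleR_left_diff_distrib scaleR_right_diff_distrib)
   moreover have "z : affine hull (insert x ?G)" using zG hull_mono[of ?G "insert x ?G" affine] by auto
   moreover have "x : affine hull (insert x ?G)" by (simp add: hull_inc)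
   ultimately have "y : affine hull (insert x ?G)"
    using mem_affine[OF affine_affine_hull, of z "insert x ?G" x "1 / r" "1 - 1 / r"] by simp
   then show False using g(3) t vw unfolding gen2_def by blast
  qed
 qed
 have "(EX r:{0..1}. (1 - r) * bary ?F x v + r * bary ?F y v = 0 &
    (ALL w:?F - {v}. 0 < (1 - r) * bary ?F x w + r * bary ?F y w)) \<longleftrightarrow> crosses x y (?F - {v})"
  if v: "v : ?F" for v
 proof -
  have "crosses x y (?F - {v}) \<longleftrightarrow> (EX r:{0..1}. (1 - r) *\<^sub>R x + r *\<^sub>R y : rel_interior (conv (?F - {v})))"
   unfolding crosses_def closed_segment_image_interval by blast
  also have "\<dots> \<longleftrightarrow> (EX r:{0..1}. bary ?F ((1 - r) *\<^sub>R x + r *\<^sub>R y) v = 0 &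
    (ALL w:?F - {v}. 0 < bary ?F ((1 - r) *\<^sub>R x + r *\<^sub>R y) w))"
  proof -
   have "?F - (?F - {v}) = {v}" using v by blast
   then show ?thesis using in_rel_interior_face[of "?F - {v}"] by simp
  qed
  also have "\<dots> \<longleftrightarrow> (EX r:{0..1}. (1 - r) * bary ?F x v + r * bary ?F y v = 0 &
    (ALL w:?F - {v}. 0 < (1 - r) * bary ?F x w + r * bary ?F y w))"
   using bary_segment v by (intro bex_cong conj_cong ball_cong refl) (auto simp only: Diff_iff)
  finally show ?thesis by blast
 qed
 then have eq: "{v:?F. EX r:{0..1}. (1 - r) * bary ?F x v + r * bary ?F y v = 0 &
    (ALL w:?F - {v}. 0 < (1 - r) * bary ?F x w + r * bary ?F y w)} = {v:?F. crosses x y (?F - {v})}" by blast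
 show ?thesis using main unfolding eq pos[OF g(1)] pos[OF g(2)] .
qed

text \<open>The faces of a cone tetrahedron are the triangle itself, opposite \<open>apex\<close>,
  and the cones over its three edges. This separates the faces that survive mod 2 from those that
  cancel.\<close>

lemma face_count:
 assumes t: "t : S"
 shows "card {v:insert apex t. Q (insert apex t - {v})} =
  (if Q t then 1 else 0) + card {e:edges_of S. Q (insert apex e) & e \<subseteq> t}"
proof -
 have at: "apex ~: t" by (rule apex_notin[OF t])
 have ap: "insert apex t - {apex} = t" using at by blast
 have vt: "insert apex t - {v} = insert apex (t - {v})" if "v : t" for v using that at by blast
 have split: "{v:insert apex t. Q (insert apex t - {v})} =
   (if Q t then {apex} else {}) Un {v:t. Q (insert apex (t - {v}))}"
 proof (rule set_eqI)
  fix v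
  show "v : {v:insert apex t. Q (insert apex t - {v})} \<longleftrightarrow>
    v : (if Q t then {apex} else {}) Un {v:t. Q (insert apex (t - {v}))}"
  proof (cases "v = apex")
   case True
   have "v : {v:insert apex t. Q (insert apex t - {v})} \<longleftrightarrow> Q t" unfolding True mem_Collect_eq ap by simp
   then show ?thesis using True at by simp
  next
   case ne: False
   show ?thesis
   proof (cases "v : t")
    case True
    show ?thesis unfolding mem_Collect_eq vt[OF True] Un_iff using True ne by simp
   qed (use ne in simp)
  qed
 qed
 have "bij_betw (%v. t - {v}) {v:t. Q (insert apex (t - {v}))} {e:edges_of S. Q (insert apex e) & e \<subseteq> t}"
 proof (rule bij_betw_imageI)
  show "inj_on (%v. t - {v}) {v:t. Q (insert apex (t - {v}))}"
  proof (rule inj_onI)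
   fix v w assume "v : {v:t. Q (insert apex (t - {v}))}" and eq: "t - {v} = t - {w}"
   then have "v : t" by simp
   moreover have "v ~: t - {w}" unfolding eq[symmetric] by simp
   ultimately show "v = w" by simp
  qed
  show "(%v. t - {v}) ` {v:t. Q (insert apex (t - {v}))} = {e:edges_of S. Q (insert apex e) & e \<subseteq> t}"
  proof
   have "card (t - {v}) = 2" if "v : t" for v using card3[OF t] that by simp
   then show "(%v. t - {v}) ` {v:t. Q (insert apex (t - {v}))} \<subseteq> {e:edges_of S. Q (insert apex e) & e \<subseteq> t}"
    using t by (auto simp: edges_of_def)
   show "{e:edges_of S. Q (insert apex e) & e \<subseteq> t} \<subseteq> (%v. t - {v}) ` {v:t. Q (insert apex (t - {v}))}"
   proof clarify
    fix e assume e: "e : edges_of S" "Q (insert apex e)" "e \<subseteq> t"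
    have "card (t - e) = 1"
     using card_Diff_subset[of e t] card3[OF t] e finite_subset[OF e(3) fin_t[OF t]] by (simp add: edges_of_def)
    then obtain v where v: "t - e = {v}" by (rule card_1_singletonE)
    then have "v : t" "e = t - {v}" using e(3) by blast+
    then show "e : (%v. t - {v}) ` {v:t. Q (insert apex (t - {v}))}" using e(2) by blast
   qed
  qed
 qed
 then have "card {v:t. Q (insert apex (t - {v}))} = card {e:edges_of S. Q (insert apex e) & e \<subseteq> t}"
  by (rule bij_betw_same_card)
 moreover have "card ((if Q t then {apex} else {}) Un {v:t. Q (insert apex (t - {v}))}) =
   card (if Q t then {apex} else {}) + card {v:t. Q (insert apex (t - {v}))}"
  using at fin_t[OF t] by (intro card_Un_disjoint) auto
 ultimately show ?thesis unfolding split by simp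
qed

text \<open>Summed over all tetrahedra, a crossing with the cone over an edge is counted once per
  triangle on the edge, an even number of times. What remains are the crossings with the
  triangles.\<close>

lemma handshake:
 assumes g: "gen x" "gen y" "gen2 x y"
 shows "even (pcount x + pcount y + card {t:S. crosses x y t})"
proof -
 let ?E = "{e:edges_of S. crosses x y (insert apex e)}"
 have finE: "finite ?E" using finite_edges_of[OF finS] card3 by (intro finite_subset[of ?E "edges_of S"]) auto
 have eq: "{e:edges_of S. crosses x y (insert apex e) & e \<subseteq> t} = {e:?E. e \<subseteq> t}" for t by auto
 have "even (\<Sum>t\<in>S. (if x : conv (insert apex t) then 1 else 0) +
  (if y : conv (insert apex t) then 1 else 0) +
  ((if crosses x y t then 1 else 0) + card {e:?E. e \<subseteq> t}))"
 proof (rule dvd_sum)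
  fix t assume t: "t : S"
  show "even ((if x : conv (insert apex t) then 1 else 0) +
  (if y : conv (insert apex t) then 1 else 0) +
  ((if crosses x y t then 1 else 0) + card {e:?E. e \<subseteq> t}))"
   using tetrahedron_crossings[OF t g] unfolding face_count[OF t, of "crosses x y"] eq .
 qed
 also have "(\<Sum>t\<in>S. (if x : conv (insert apex t) then 1 else 0) +
  (if y : conv (insert apex t) then 1 else 0) +
  ((if crosses x y t then 1 else 0) + card {e:?E. e \<subseteq> t})) =
  pcount x + pcount y + (card {t:S. crosses x y t} + (\<Sum>t\<in>S. card {e:?E. e \<subseteq> t}))"
  unfolding sum.distrib pcount_def using finS by (simp flip: sum.inter_filter)
 finally have 1: "even (pcount x + pcount y + (card {t:S. crosses x y t} + (\<Sum>t\<in>S. card {e:?E. e \<subseteq> t})))" .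
 have "(\<Sum>t\<in>S. card {e:?E. e \<subseteq> t}) = (\<Sum>e\<in>?E. card {t:S. e \<subseteq> t})"
  by (rule double_count[OF finS finE])
 moreover have "even (\<Sum>e\<in>?E. card {t:S. e \<subseteq> t})" using even_edges by (intro dvd_sum) auto
 ultimately show ?thesis using 1 by simp
qed

text \<open>The parity of the filling at generic points close to \<open>x\<close>. Generic points
  are dense, and off the body this parity is locally constant, so the definition makes sense at
  nongeneric points as well.\<close>

definition inside :: "real^3 => bool" where
 "inside x \<longleftrightarrow> (EX eps>0. ALL y:ball x eps. gen y --> odd (pcount y))"

lemma no_cross_body:
 assumes "convex B" "x : B" "y : B" "B Int body = {}"
 shows "{t:S. crosses x y t} = {}"
proof -
 have "closed_segment x y \<subseteq> B" using assms closed_segment_subset by blast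
 moreover have "relint t \<subseteq> body" if "t : S" for t
  using rel_interior_subset that by (force simp: body_def)
 ultimately show ?thesis using assms(4) unfolding crosses_def by blast
qed

text \<open>The pair \<open>y\<close>, \<open>z\<close> itself may fail to be in general position,
  so both points are compared with a third one chosen generic for both.\<close>

lemma pcount_const:
 assumes B: "open B" "convex B" "B Int body = {}" and y: "y : B" "gen y" and z: "z : B" "gen z"
 shows "odd (pcount y) \<longleftrightarrow> odd (pcount z)"
proof -
 obtain w where w: "w : B" "gen w" "!!x. x : {y,z} ==> gen2 x w"
  using ex_gen2[of B "{y,z}"] B(1) y(1) by blast
 have "even (pcount y + pcount w)"
  using handshake[OF y(2) w(2) w(3)] no_cross_body[OF B(2) y(1) w(1) B(3)] by simp
 moreover have "even (pcount z + pcount w)"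
  using handshake[OF z(2) w(2) w(3)] no_cross_body[OF B(2) z(1) w(1) B(3)] by simp
 ultimately show ?thesis by auto
qed

lemma inside_eq:
 assumes B: "open B" "convex B" "B Int body = {}" and x: "x : B" and y: "y : B" "gen y"
 shows "inside x \<longleftrightarrow> odd (pcount y)"
proof
 assume "inside x"
 then obtain e where e: "e > 0" "ALL y:ball x e. gen y --> odd (pcount y)" by (auto simp: inside_def)
 have "open (ball x e Int B)" "ball x e Int B ~= {}" using B x e by (auto intro: centre_in_ball[THEN iffD2])
 then obtain z where "z : ball x e Int B" "gen z" using ex_gen2[of "ball x e Int B" "{}"] by blast
 then show "odd (pcount y)" using e pcount_const[OF B _ _ y] by blast
next
 assume o: "odd (pcount y)"
 obtain e where "e > 0" "ball x e \<subseteq> B" using B(1) x open_contains_ball by blast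
 then show "inside x" unfolding inside_def using pcount_const[OF B y] o by blast
qed

lemma inside_convex:
 assumes "open B" "convex B" "B Int body = {}" "x : B" "x' : B"
 shows "inside x \<longleftrightarrow> inside x'"
proof -
 have "B ~= {}" using assms(4) by blast
 from ex_gen2[OF assms(1) this finite.emptyI] obtain z where "z : B" "gen z" by blast
 then show ?thesis using inside_eq[OF assms(1-3)] assms(4,5) by blast
qed

lemma inside_connected:
 assumes "connected U" "U Int body = {}" "x : U" "y : U"
 shows "inside x \<longleftrightarrow> inside y"
proof (rule connected_local_const[OF assms(1,3,4)])
 show "ALL a:U. \<forall>\<^sub>F b in at a within U. inside a = inside b"
 proof
  fix a assume "a : U"
  then have "a : - body" using assms(2) by auto
  then obtain e where e: "e > 0" "ball a e \<subseteq> - body" using closed_body open_contains_ball open_Compl by blast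
  have "inside a = inside b" if "b : ball a e" for b
   using inside_convex[of "ball a e" a b] that e by auto
  then show "\<forall>\<^sub>F b in at a within U. inside a = inside b"
   unfolding eventually_at using e(1) by (auto simp: dist_commute intro!: exI[of _ e])
 qed
qed

lemma not_inside_far:
 obtains R where "!!x. norm x > R ==> ~ inside x"
proof -
 have "bounded (\<Union>t\<in>S. conv (insert apex t))"
  using finS fin_t by (intro bounded_UN ballI bounded_convex_hull finite_imp_bounded) auto
 then obtain R where R: "!!x. x : (\<Union>t\<in>S. conv (insert apex t)) ==> norm x <= R"
  unfolding bounded_iff by blast
 have "~ inside x" if x: "norm x > R" for x
 proof
  assume "inside x"
  then obtain e where e: "e > 0" "ALL y:ball x e. gen y --> odd (pcount y)" by (auto simp: inside_def)
  let ?U = "ball x e Int {y. norm y > R}"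
  have "open {y::real^3. norm y > R}" by (intro open_Collect_less continuous_intros)
  then have "open ?U" by blast
  moreover have "x : ?U" using x e by simp
  ultimately obtain y where y: "y : ?U" "gen y" using ex_gen2[of ?U "{}"] by blast
  have "{t:S. y : conv (insert apex t)} = {}" using R y(1) by force
  then have "pcount y = 0" unfolding pcount_def by (simp only: card.empty)
  then show False using e(2) y by auto
 qed
 then show ?thesis using that by blast
qed

lemma rel_interior_disjoint:
 assumes "t : S" "t' : S" "t ~= t'"
 shows "relint t Int conv t' = {}"
proof -
 have "card (t Int t') < card t"
  using assms card3 fin_t by (metis Int_lower1 card_subset_eq inf.absorb_iff2 le_neq_implies_less card_mono inf.commute)
 have face: "conv (t Int t') face_of conv t"
  using face_of_convex_hull_affine_independent[OF indep[OF assms(1)]] by blast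
 have "conv (t Int t') ~= conv t"
 proof
  assume eq: "conv (t Int t') = conv t"
  have "t \<subseteq> t Int t'"
  proof
   fix v assume "v : t"
   then have "v extreme_point_of conv t"
    using extreme_point_of_convex_hull_affine_independent[OF indep[OF assms(1)]] by blast
   then show "v : t Int t'" using extreme_point_of_convex_hull unfolding eq[symmetric] by blast
  qed
  then have "t Int t' = t" by blast
  then show False using \<open>card (t Int t') < card t\<close> by simp
 qed
 then have "relint t Int conv (t Int t') = {}"
  using face_of_disjoint_rel_interior[OF face] by blast
 then show ?thesis using inter[OF assms(1,2)] rel_interior_subset by blast
qed

text \<open>Near an interior point of a triangle the body lies in the plane of that triangle. A
  generic segment across this plane crosses that one triangle and nothing else, so the parity
  changes; a half ball misses the body, so on one side it does not.\<close>

lemma flip: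
 assumes t: "t : S" and q: "q : relint t"
  and n: "!!x. x : affine hull t \<longleftrightarrow> n \<bullet> (x - q) = 0"
 obtains \<rho> where "\<rho> > 0"
  "!!x y. x : ball q \<rho> ==> y : ball q \<rho> ==> 0 < n \<bullet> (x - q) ==> n \<bullet> (y - q) < 0 ==> inside x ~= inside y"
  "!!x y. x : ball q \<rho> ==> y : ball q \<rho> ==> 0 < n \<bullet> (x - q) ==> 0 < n \<bullet> (y - q) ==> inside x = inside y"
  "!!x y. x : ball q \<rho> ==> y : ball q \<rho> ==> n \<bullet> (x - q) < 0 ==> n \<bullet> (y - q) < 0 ==> inside x = inside y"
  "!!x. x : ball q \<rho> ==> n \<bullet> (x - q) ~= 0 ==> x ~: body"
proof -
 obtain r1 where r1: "r1 > 0" "ball q r1 Int affine hull (conv t) \<subseteq> relint t"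
 proof -
  from q obtain e where "e > 0" "ball q e Int affine hull (conv t) \<subseteq> conv t"
   unfolding mem_rel_interior_ball by blast
  have "openin (top_of_set (affine hull (conv t))) (relint t)"
   by (rule openin_rel_interior)
  then obtain T where T: "open T" "relint t = affine hull (conv t) Int T"
   unfolding openin_open by blast
  then obtain r where "r > 0" "ball q r \<subseteq> T" using q open_contains_ball by blast
  then show ?thesis using that T by blast
 qed
 have "closed (\<Union>t'\<in>S - {t}. conv t')"
  using finS fin_t by (intro closed_UN) (auto intro!: compact_imp_closed finite_imp_compact_convex_hull)
 moreover have "q ~: (\<Union>t'\<in>S - {t}. conv t')" using rel_interior_disjoint[OF t] q by blast
 ultimately have "open (- (\<Union>t'\<in>S - {t}. conv t'))" "q : - (\<Union>t'\<in>S - {t}. conv t')"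
  by (simp_all only: open_Compl Compl_iff not_False_eq_True)
 then obtain r2 where "r2 > 0" "ball q r2 \<subseteq> - (\<Union>t'\<in>S - {t}. conv t')"
  by (rule openE)
 then have r2: "r2 > 0" "ball q r2 Int (\<Union>t'\<in>S - {t}. conv t') = {}" by blast+
 define \<rho> where "\<rho> = min r1 r2"
 have \<rho>: "\<rho> > 0" "ball q \<rho> \<subseteq> ball q r1" "ball q \<rho> \<subseteq> ball q r2" using r1 r2 by (auto simp: \<rho>_def)
 have ahull: "affine hull (conv t) = affine hull t" by simp
 have bd: "x : affine hull t" if "x : body" "x : ball q \<rho>" for x
  using that r2(2) \<rho>(3) convex_hull_subset_affine_hull[of t] unfolding body_def by blast
 let ?U = "{x. 0 < n \<bullet> (x - q)} Int ball q \<rho>" and ?V = "{x. n \<bullet> (x - q) < 0} Int ball q \<rho>"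
 have half: "open {x. 0 < n \<bullet> (x - q)}" "convex {x. 0 < n \<bullet> (x - q)}"
  "open {x. n \<bullet> (x - q) < 0}" "convex {x. n \<bullet> (x - q) < 0}"
  using open_halfspace_gt[of "n \<bullet> q" n] convex_halfspace_gt[of "n \<bullet> q" n]
   open_halfspace_lt[of n "n \<bullet> q"] convex_halfspace_lt[of n "n \<bullet> q"] by (simp_all add: inner_diff_right)
 have U: "open ?U" "convex ?U" "?U Int body = {}" and V: "open ?V" "convex ?V" "?V Int body = {}"
  using half bd n by (auto intro!: convex_Int simp del: mem_ball)
 have diff: "inside x ~= inside y" if x: "x : ?U" and y: "y : ?V" for x y
 proof -
  obtain x' where x': "x' : ?U" "gen x'" using ex_gen2[OF U(1), of "{}"] x by blast
  obtain y' where y': "y' : ?V" "gen y'" "gen2 x' y'" using ex_gen2[OF V(1), of "{x'}"] y by blast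
  define p where "p = n \<bullet> (x' - q)"
  define m where "m = n \<bullet> (y' - q)"
  have pm: "0 < p" "m < 0" using x' y' by (auto simp: p_def m_def)
  \<comment> \<open>The parameter at which the segment from \<open>x'\<close> to \<open>y'\<close>
    meets the plane of \<open>t\<close>.\<close>
  define s where "s = p / (p - m)"
  have s: "0 <= s" "s <= 1" "(1 - s) * p + s * m = 0" using pm by (auto simp: s_def field_simps)
  define z where "z = (1 - s) *\<^sub>R x' + s *\<^sub>R y'"
  have zs: "z : closed_segment x' y'" unfolding z_def closed_segment_def using s by blast
  have seg: "closed_segment x' y' \<subseteq> ball q \<rho>" using x' y' by (intro closed_segment_subset) auto
  have zq: "z - q = (1 - s) *\<^sub>R (x' - q) + s *\<^sub>R (y' - q)"
   by (simp add: z_def algebra_simps)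
  have "n \<bullet> (z - q) = (1 - s) * p + s * m"
   unfolding zq p_def m_def by (simp add: inner_add_right)
  then have "z : affine hull t" using n s by simp
  then have "z : relint t" using r1(2) zs seg \<rho>(2) ahull by blast
  then have ct: "crosses x' y' t" using zs unfolding crosses_def by blast
  have "~ crosses x' y' t'" if "t' : S" "t' ~= t" for t'
   using that seg \<rho>(3) r2(2) rel_interior_subset[of "conv t'"] unfolding crosses_def by blast
  then have "{t:S. crosses x' y' t} = {t}" using t ct by blast
  then have "even (pcount x' + pcount y' + 1)" using handshake[OF x'(2) y'(2,3)] by simp
  then have "odd (pcount x') ~= odd (pcount y')" by auto
  then show ?thesis using inside_eq[OF U x x'] inside_eq[OF V y y'(1,2)] by simp
 qed
 show ?thesis
 proof (rule that[OF \<rho>(1)])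
  fix x y
  assume b: "x : ball q \<rho>" "y : ball q \<rho>"
  show "inside x ~= inside y" if "0 < n \<bullet> (x - q)" "n \<bullet> (y - q) < 0" using diff b that by blast
  show "inside x = inside y" if "0 < n \<bullet> (x - q)" "0 < n \<bullet> (y - q)" using inside_convex[OF U] b that by blast
  show "inside x = inside y" if "n \<bullet> (x - q) < 0" "n \<bullet> (y - q) < 0" using inside_convex[OF V] b that by blast
 next
  fix x assume "x : ball q \<rho>" "n \<bullet> (x - q) ~= 0"
  then show "x ~: body" using bd n by blast
 qed
qed

end

text \<open>Barycentric coordinates with respect to \<open>C\<close> are unique: those of
  \<open>x\<close> are positive on \<open>C'\<close> and vanish off \<open>G\<close>.\<close>

lemma carrier_subset:
 fixes C :: "'a::euclidean_space set"
 assumes C: "~ affine_dependent C" and sub: "C' \<subseteq> C" "G \<subseteq> C"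
  and x: "x : relint C'" "x : conv G"
 shows "C' \<subseteq> G"
proof
 fix v assume v: "v : C'"
 have fin: "finite C" "finite C'" "finite G" using aff_independent_finite[OF C] sub finite_subset by auto
 have iC': "~ affine_dependent C'" using C sub affine_independent_subset by blast
 obtain u where u: "ALL v:C'. 0 < u v" "sum u C' = 1" "(\<Sum>v\<in>C'. u v *\<^sub>R v) = x"
  using x(1) unfolding rel_interior_convex_hull_explicit[OF iC'] by blast
 obtain w where w: "ALL v:G. 0 <= w v" "sum w G = 1" "(\<Sum>v\<in>G. w v *\<^sub>R v) = x"
  using x(2) unfolding convex_hull_finite[OF fin(3)] by blast
 let ?U = "%v. (if v : C' then u v else 0) - (if v : G then w v else 0)"
 have ext: "(\<Sum>v\<in>C. if v : H then g v else 0) = sum g H"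
  "(\<Sum>v\<in>C. (if v : H then g v else 0) *\<^sub>R v) = (\<Sum>v\<in>H. g v *\<^sub>R v)" if "H \<subseteq> C" for H and g :: "'a => real"
  using that fin(1) by (auto intro!: sum.mono_neutral_cong_right)
 have "sum ?U C = 0" using ext(1)[OF sub(1), of u] ext(1)[OF sub(2), of w] u w by (simp add: sum_subtractf)
 moreover have "(\<Sum>v\<in>C. ?U v *\<^sub>R v) = 0"
  using ext(2)[OF sub(1), of u] ext(2)[OF sub(2), of w] u w
  by (simp add: scaleR_left_diff_distrib sum_subtractf)
 ultimately have "?U v = 0" using C v sub unfolding affine_dependent_explicit_finite[OF fin(1)] by blast
 then show "v : G" using u(1) v by (auto split: if_splits)
qed

lemma triangle_normal:
 fixes a b c :: "real^3"
 assumes "card {a,b,c} = 3" "~ affine_dependent {a,b,c}"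
 shows "cross3 (b - a) (c - a) ~= 0"
  and "x : affine hull {a,b,c} \<longleftrightarrow> cross3 (b - a) (c - a) \<bullet> (x - a) = 0"
proof -
 let ?n = "cross3 (b - a) (c - a)"
 have dist: "a ~= b" "a ~= c" "b ~= c" using assms(1) card_3_distinct[of a b c] by auto
 have "~ collinear {b,a,c}"
  using assms dist by (simp add: collinear_3_eq_affine_dependent insert_commute)
 then show n: "?n ~= 0" unfolding cross_eq_0 using collinear_3[of b a c] by simp
 have "affine hull {a,b,c} = {x. ?n \<bullet> x = ?n \<bullet> a}"
 proof (rule affine_dim_equal)
  show "affine hull {a,b,c} \<subseteq> {x. ?n \<bullet> x = ?n \<bullet> a}"
  proof (rule hull_minimal)
   have "?n \<bullet> (b - a) = 0" "?n \<bullet> (c - a) = 0" by (simp_all add: dot_cross_self)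
   then show "{a,b,c} \<subseteq> {x. ?n \<bullet> x = ?n \<bullet> a}" by (simp add: inner_diff_right)
  qed (rule affine_hyperplane)
  have "aff_dim (affine hull {a,b,c}) = 2"
   using aff_dim_affine_independent[OF assms(2)] assms(1) by simp
  then show "aff_dim (affine hull {a,b,c}) = aff_dim {x. ?n \<bullet> x = ?n \<bullet> a}"
   using aff_dim_hyperplane[OF n] by simp
 qed (auto simp: affine_hyperplane)
 then show "x : affine hull {a,b,c} \<longleftrightarrow> ?n \<bullet> (x - a) = 0" by (simp add: inner_diff_right)
qed

section \<open>Orientation of the triangles by their inner sides\<close>

context mod2_cycle
begin

lemma normal_at:
 assumes t: "{a,b,c} : S" and q: "q : rel_interior (conv {a,b,c})"
 shows "x : affine hull {a,b,c} \<longleftrightarrow> cross3 (b - a) (c - a) \<bullet> (x - q) = 0"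
proof -
 have "q : affine hull {a,b,c}"
  using q rel_interior_subset convex_hull_subset_affine_hull by blast
 then have "cross3 (b - a) (c - a) \<bullet> (q - a) = 0" using triangle_normal(2)[OF card3 indep] t by blast
 then have "cross3 (b - a) (c - a) \<bullet> (x - q) = cross3 (b - a) (c - a) \<bullet> (x - a)"
  by (simp add: inner_diff_right)
 then show ?thesis using triangle_normal(2)[OF card3 indep] t by simp
qed

lemma side_limit:
 assumes t: "t : S" and q: "q : relint t"
  and n: "!!x. x : affine hull t \<longleftrightarrow> n \<bullet> (x - q) = 0" "n ~= 0"
 obtains \<beta> where "\<forall>\<^sub>F eps in at_right 0. (inside (q + eps *\<^sub>R n) \<longleftrightarrow> \<beta>) & (inside (q - eps *\<^sub>R n) \<longleftrightarrow> ~ \<beta>)"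
proof -
 obtain \<rho> where \<rho>: "\<rho> > 0"
  "!!x y. x : ball q \<rho> ==> y : ball q \<rho> ==> 0 < n \<bullet> (x - q) ==> n \<bullet> (y - q) < 0 ==> inside x ~= inside y"
  "!!x y. x : ball q \<rho> ==> y : ball q \<rho> ==> 0 < n \<bullet> (x - q) ==> 0 < n \<bullet> (y - q) ==> inside x = inside y"
  using flip[OF t q n(1)] by metis
 define e0 where "e0 = \<rho> / norm n"
 have e0: "e0 > 0" using \<rho>(1) n(2) by (simp add: e0_def)
 have inb: "q + eps *\<^sub>R n : ball q \<rho>" "q - eps *\<^sub>R n : ball q \<rho>" "0 < n \<bullet> ((q + eps *\<^sub>R n) - q)" "n \<bullet> ((q - eps *\<^sub>R n) - q) < 0"
  if e: "0 < eps" "eps < e0" for eps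
 proof -
  have "eps * norm n < \<rho>" using e n(2) by (simp add: e0_def pos_less_divide_eq)
  then show "q + eps *\<^sub>R n : ball q \<rho>" "q - eps *\<^sub>R n : ball q \<rho>" using e by (simp_all add: dist_norm)
  have "0 < n \<bullet> n" using n(2) by simp
  then show "0 < n \<bullet> ((q + eps *\<^sub>R n) - q)" "n \<bullet> ((q - eps *\<^sub>R n) - q) < 0" using e by simp_all
 qed
 define \<beta> where "\<beta> = inside (q + (e0 / 2) *\<^sub>R n)"
 have "(inside (q + eps *\<^sub>R n) \<longleftrightarrow> \<beta>) & (inside (q - eps *\<^sub>R n) \<longleftrightarrow> ~ \<beta>)" if e: "0 < eps" "eps < e0" for eps
 proof -
  have h: "0 < e0 / 2" "e0 / 2 < e0" using e0 by simp_all
  have "inside (q + eps *\<^sub>R n) = inside (q + (e0 / 2) *\<^sub>R n)"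
   by (rule \<rho>(3)[OF inb(1)[OF e] inb(1)[OF h] inb(3)[OF e] inb(3)[OF h]])
  moreover have "inside (q + eps *\<^sub>R n) ~= inside (q - eps *\<^sub>R n)"
   by (rule \<rho>(2)[OF inb(1)[OF e] inb(2)[OF e] inb(3)[OF e] inb(4)[OF e]])
  ultimately show ?thesis unfolding \<beta>_def by blast
 qed
 then have "\<forall>\<^sub>F eps in at_right 0. (inside (q + eps *\<^sub>R n) \<longleftrightarrow> \<beta>) & (inside (q - eps *\<^sub>R n) \<longleftrightarrow> ~ \<beta>)"
  unfolding eventually_at_right_field using e0 by blast
 then show ?thesis using that by blast
qed

text \<open>The segment between two interior points of a triangle has positive distance from all
  other triangles. Its translates by small multiples of the normal therefore avoid the body, and
  \<open>inside\<close> is constant along them.\<close>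

lemma side_along:
 assumes t: "t : S" and q: "q : relint t" "q' : relint t"
  and n: "!!x. x : affine hull t \<longleftrightarrow> n \<bullet> (x - q) = 0" "n ~= 0"
 shows "\<forall>\<^sub>F eps in at_right 0. inside (q + eps *\<^sub>R n) \<longleftrightarrow> inside (q' + eps *\<^sub>R n)"
proof -
 let ?J = "closed_segment q q'" and ?Z = "\<Union>t'\<in>S - {t}. conv t'"
 have Jr: "?J \<subseteq> relint t"
  using q by (intro closed_segment_subset convex_rel_interior convex_convex_hull)
 have "?J Int ?Z = {}" using Jr rel_interior_disjoint[OF t] by blast
 moreover have "closed ?Z"
  using finS fin_t by (intro closed_UN ballI compact_imp_closed finite_imp_compact_convex_hull) auto
 ultimately obtain d where d: "d > 0" "!!x y. x : ?J ==> y : ?Z ==> d <= dist x y"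
  using separate_compact_closed[of ?J ?Z] by (metis compact_segment)
 have "inside (q + eps *\<^sub>R n) \<longleftrightarrow> inside (q' + eps *\<^sub>R n)" if e: "0 < eps" "eps < d / norm n" for eps
 proof (rule inside_connected)
  let ?U = "closed_segment (q + eps *\<^sub>R n) (q' + eps *\<^sub>R n)"
  show "connected ?U" by simp
  show "q + eps *\<^sub>R n : ?U" "q' + eps *\<^sub>R n : ?U" by simp_all
  have en: "norm (eps *\<^sub>R n) < d" using e n(2) by (simp add: pos_less_divide_eq)
  have "y ~: body" if yU: "y : ?U" for y
  proof -
   obtain u where u: "0 <= u" "u <= 1" "y = (1 - u) *\<^sub>R (q + eps *\<^sub>R n) + u *\<^sub>R (q' + eps *\<^sub>R n)"
    using yU by (auto simp: closed_segment_def)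
   define x where "x = (1 - u) *\<^sub>R q + u *\<^sub>R q'"
   have xJ: "x : ?J" using u by (auto simp: x_def closed_segment_def)
   have yx: "y = x + eps *\<^sub>R n" by (simp add: u(3) x_def algebra_simps)
   have "y ~: ?Z"
   proof
    assume "y : ?Z"
    from d(2)[OF xJ this] show False using en yx by (simp add: dist_norm)
   qed
   moreover have "y ~: conv t"
   proof
    assume "y : conv t"
    then have "n \<bullet> (y - q) = 0" using n(1) convex_hull_subset_affine_hull by blast
    moreover have "n \<bullet> (x - q) = 0"
     using n(1) xJ Jr rel_interior_subset convex_hull_subset_affine_hull by blast
    moreover have "n \<bullet> (y - q) = n \<bullet> (x - q) + eps * (n \<bullet> n)" by (simp add: yx inner_add_right inner_diff_right)
    ultimately show False using n(2) e(1) by simp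
   qed
   ultimately show ?thesis by (auto simp: body_def)
  qed
  then show "?U Int body = {}" by blast
 qed
 moreover have "0 < d / norm n" using d n by simp
 ultimately show ?thesis unfolding eventually_at_right_field by blast
qed

text \<open>The orientation that drives the sign argument: the normal determined by the order of the
  three vertices points inwards at the barycenter.\<close>

definition side :: "real^3 => real^3 => real^3 => bool" where
 "side a b c \<longleftrightarrow> (\<forall>\<^sub>F eps in at_right 0. inside ((1/3) *\<^sub>R (a + b + c) + eps *\<^sub>R cross3 (b - a) (c - a)))"

lemma triple_rel_interior:
 assumes t: "{a,b,c} : S" and "0 < \<alpha>" "0 < \<beta>" "0 < \<gamma>" "\<alpha> + \<beta> + \<gamma> = 1"
 shows "\<alpha> *\<^sub>R a + \<beta> *\<^sub>R b + \<gamma> *\<^sub>R c : rel_interior (conv {a,b,c})"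
proof -
 have dist: "a ~= b" "a ~= c" "b ~= c" using card3[OF t] card_3_distinct[of a b c] by auto
 let ?u = "%v. if v = a then \<alpha> else if v = b then \<beta> else \<gamma>"
 have "(ALL v:{a,b,c}. 0 < ?u v) & sum ?u {a,b,c} = 1 &
   (\<Sum>v\<in>{a,b,c}. ?u v *\<^sub>R v) = \<alpha> *\<^sub>R a + \<beta> *\<^sub>R b + \<gamma> *\<^sub>R c"
  using dist assms by (auto simp: add.assoc)
 then show ?thesis
  unfolding rel_interior_convex_hull_explicit[OF indep[OF t]] by (intro CollectI exI[of _ ?u])
qed

lemma bary_rel_interior:
 assumes "{a,b,c} : S"
 shows "(1/3) *\<^sub>R (a + b + c) : rel_interior (conv {a,b,c})"
 using triple_rel_interior[OF assms, of "1/3" "1/3" "1/3"] by (simp add: scaleR_right_distrib)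

lemma side_eventually:
 assumes t: "{a,b,c} : S" and q: "q : rel_interior (conv {a,b,c})"
 shows "\<forall>\<^sub>F eps in at_right 0. (inside (q + eps *\<^sub>R cross3 (b - a) (c - a)) \<longleftrightarrow> side a b c) &
  (inside (q - eps *\<^sub>R cross3 (b - a) (c - a)) \<longleftrightarrow> ~ side a b c)"
proof -
 let ?n = "cross3 (b - a) (c - a)" and ?m = "(1/3) *\<^sub>R (a + b + c)"
 have n0: "?n ~= 0" by (rule triangle_normal(1)[OF card3[OF t] indep[OF t]])
 obtain \<beta> where \<beta>: "\<forall>\<^sub>F eps in at_right 0. (inside (q + eps *\<^sub>R ?n) \<longleftrightarrow> \<beta>) & (inside (q - eps *\<^sub>R ?n) \<longleftrightarrow> ~ \<beta>)"
  using side_limit[OF t q normal_at[OF t q] n0] by blast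
 have al: "\<forall>\<^sub>F eps in at_right 0. inside (q + eps *\<^sub>R ?n) \<longleftrightarrow> inside (?m + eps *\<^sub>R ?n)"
  by (rule side_along[OF t q bary_rel_interior[OF t] normal_at[OF t q] n0])
 have ev: "\<forall>\<^sub>F eps in at_right 0. inside (?m + eps *\<^sub>R ?n) \<longleftrightarrow> \<beta>"
  using \<beta> al by eventually_elim blast
 have "side a b c \<longleftrightarrow> \<beta>"
 proof
  assume "side a b c"
  then have "\<forall>\<^sub>F eps in at_right 0. inside (?m + eps *\<^sub>R ?n)" by (simp add: side_def)
  then have "\<forall>\<^sub>F eps in at_right (0::real). \<beta>" using ev by eventually_elim blast
  then show \<beta> by simp
 next
  assume \<beta>
  then show "side a b c" using ev by (simp add: side_def)
 qed
 then show ?thesis using \<beta> by simp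
qed

lemma side_rot:
 assumes "side a b c"
 shows "side b c a"
proof -
 have "cross3 (c - b) (a - b) = cross3 (b - a) (c - a)"
  by (simp add: cross3_def vec_eq_iff forall_3 algebra_simps)
 moreover have "b + c + a = a + b + c" by (simp add: add_ac)
 ultimately have eqs: "cross3 (c - b) (a - b) = cross3 (b - a) (c - a)" "b + c + a = a + b + c"
  by blast+
 show ?thesis using assms unfolding side_def eqs .
qed

lemma side_flip:
 assumes t: "{a,b,c} : S"
 shows "side b a c \<longleftrightarrow> ~ side a b c"
proof -
 let ?n = "cross3 (b - a) (c - a)" and ?m = "(1/3) *\<^sub>R (a + b + c)"
 have n: "cross3 (a - b) (c - b) = - ?n"
  by (simp add: cross3_def vec_eq_iff forall_3 algebra_simps)
 have m: "b + a + c = a + b + c" by (simp add: add_ac)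
 have ev: "\<forall>\<^sub>F eps in at_right 0. (inside (?m - eps *\<^sub>R ?n) \<longleftrightarrow> ~ side a b c)"
  using side_eventually[OF t bary_rel_interior[OF t]] by eventually_elim blast
 have s: "side b a c \<longleftrightarrow> (\<forall>\<^sub>F eps in at_right 0. inside (?m - eps *\<^sub>R ?n))"
  unfolding side_def n m by simp
 show ?thesis
 proof
  assume "side b a c"
  then have "\<forall>\<^sub>F eps in at_right 0. inside (?m - eps *\<^sub>R ?n)" using s by simp
  then have "\<forall>\<^sub>F eps in at_right (0::real). ~ side a b c" using ev by eventually_elim blast
  then show "~ side a b c" by simp
 next
  assume "~ side a b c"
  then show "side b a c" using ev s by simp
 qed
qed

text \<open>Near the midpoint of the edge the body consists of two half planes. The two normals
  belong to the same direction of the edge, so one of the two regions lies on the positive side of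
  one triangle and on the negative side of the other; \<open>inside\<close> has a single value
  there.\<close>

lemma side_coherent:
 assumes t1: "{a,b,c} : S" and t2: "{a,b,d} : S" and cd: "c ~= d"
  and star: "card {t:S. {a,b} \<subseteq> t} = 2"
 shows "side a b c \<longleftrightarrow> ~ side a b d"
proof -
 have dist: "a ~= b" "a ~= c" "b ~= c" "a ~= d" "b ~= d"
  using card3[OF t1] card3[OF t2] card_3_distinct by metis+
 have tne: "{a,b,c} ~= {a,b,d}"
 proof
  assume "{a,b,c} = {a,b,d}"
  then have "c : {a,b,d}" by blast
  then show False using cd dist by auto
 qed
 have two: "{t:S. {a,b} \<subseteq> t} = {{a,b,c},{a,b,d}}"
 proof (rule card_subset_eq[symmetric])
  show "card {{a,b,c},{a,b,d}} = card {t:S. {a,b} \<subseteq> t}" using star tne by simp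
 qed (use t1 t2 finS in auto)
 define m where "m = (1/2) *\<^sub>R (a + b)"
 define e where "e = b - a"
 define n1 where "n1 = cross3 (b - a) (c - a)"
 define n2 where "n2 = cross3 (b - a) (d - a)"
 define w1 where "w1 = c - m"
 define w2 where "w2 = d - m"
 have nz: "n1 ~= 0" "n2 ~= 0"
  using triangle_normal(1)[OF card3[OF t1] indep[OF t1]] triangle_normal(1)[OF card3[OF t2] indep[OF t2]]
  by (simp_all add: n1_def n2_def)
 have ca: "c - a = w1 + (1/2) *\<^sub>R e" "d - a = w2 + (1/2) *\<^sub>R e"
  by (simp_all add: w1_def w2_def m_def e_def algebra_simps scaleR_2[symmetric])
   (simp_all add: vec_eq_iff)
 have n1w: "n1 = cross3 e w1" and n2w: "n2 = cross3 e w2"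
  unfolding n1_def n2_def ca e_def[symmetric]
  by (simp_all add: cross_add_right cross_mult_right)
 \<comment> \<open>The sign of \<open>D\<close> tells on which side of the plane of the first
   triangle the vertex \<open>d\<close> lies; with the roles exchanged the sign is reversed.\<close>
 define D where "D = n1 \<bullet> w2"
 have n1w1: "n1 \<bullet> w1 = 0" "n1 \<bullet> e = 0" and n2w2: "n2 \<bullet> w2 = 0" "n2 \<bullet> e = 0"
  unfolding n1w n2w by (simp_all add: dot_cross_self)
 have D2: "n2 \<bullet> w1 = - D"
  unfolding D_def n1w n2w by (simp add: cross3_def inner_vec_def sum_3 algebra_simps)
 \<comment> \<open>near the midpoint of the edge the surface consists of the two triangles\<close>
  have mr: "m : rel_interior (conv {a,b})"
 proof -
  have i: "~ affine_dependent {a,b}" by (rule affine_independent_2)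
  let ?u = "%v::real^3. 1/2 :: real"
  have "(ALL v:{a,b}. 0 < ?u v) & sum ?u {a,b} = 1 & (\<Sum>v\<in>{a,b}. ?u v *\<^sub>R v) = m"
   using dist(1) by (simp add: m_def scaleR_right_distrib)
  then show ?thesis
   unfolding rel_interior_convex_hull_explicit[OF i] by (intro CollectI exI[of _ ?u])
 qed
 let ?Z = "\<Union>t\<in>{t:S. ~ {a,b} \<subseteq> t}. conv t"
 have "closed ?Z"
  using finS fin_t by (intro closed_UN ballI compact_imp_closed finite_imp_compact_convex_hull) auto
 moreover have "m ~: ?Z"
 proof
  assume "m : ?Z"
  then obtain t where t: "t : S" "~ {a,b} \<subseteq> t" "m : conv t" by blast
  have "m : conv {a,b,c}"
   using mr rel_interior_subset hull_mono[of "{a,b}" "{a,b,c}" convex] by blast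
  then have mt: "m : conv (t Int {a,b,c})" using inter[OF t(1) t1] t(3) by blast
  have "{a,b} \<subseteq> {a,b,c}" by blast
  from carrier_subset[OF indep[OF t1] this Int_lower2 mr mt] show False using t(2) by (metis le_inf_iff)
 qed
 ultimately have "open (- ?Z)" "m : - ?Z" by (simp_all only: open_Compl Compl_iff not_False_eq_True)
 then obtain \<rho> where \<rho>: "\<rho> > 0" "ball m \<rho> \<subseteq> - ?Z" by (rule openE)
 have near: "x : affine hull {a,b,c} \<or> x : affine hull {a,b,d}" if x: "x : ball m \<rho>" "x : body" for x
 proof -
  obtain t where t: "t : S" "x : conv t" using x(2) by (auto simp: body_def)
  then have "{a,b} \<subseteq> t" using x(1) \<rho>(2) by blast
  then have "t : {t:S. {a,b} \<subseteq> t}" using t(1) by simp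
  then have "t : {{a,b,c},{a,b,d}}" unfolding two .
  then show ?thesis using t(2) convex_hull_subset_affine_hull by blast
 qed
 have ma: "m - a = (1/2) *\<^sub>R e" by (simp add: m_def e_def vec_eq_iff)
 have pl1: "x : affine hull {a,b,c} \<longleftrightarrow> n1 \<bullet> (x - m) = 0" for x
 proof -
  have xa: "x - a = (x - m) + (1/2) *\<^sub>R e" using ma by (simp add: algebra_simps)
  have "n1 \<bullet> (x - a) = n1 \<bullet> (x - m)" unfolding xa using n1w1 by (simp only: inner_add_right inner_scaleR_right mult_zero_right add_0_right)
  then show ?thesis using triangle_normal(2)[OF card3[OF t1] indep[OF t1]] by (simp add: n1_def)
 qed
 have pl2: "x : affine hull {a,b,d} \<longleftrightarrow> n2 \<bullet> (x - m) = 0" for x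
 proof -
  have xa: "x - a = (x - m) + (1/2) *\<^sub>R e" using ma by (simp add: algebra_simps)
  have "n2 \<bullet> (x - a) = n2 \<bullet> (x - m)" unfolding xa using n2w2 by (simp only: inner_add_right inner_scaleR_right mult_zero_right add_0_right)
  then show ?thesis using triangle_normal(2)[OF card3[OF t2] indep[OF t2]] by (simp add: n2_def)
 qed
 have avoid: "x ~: body" if "x : ball m \<rho>" "n1 \<bullet> (x - m) ~= 0" "n2 \<bullet> (x - m) ~= 0" for x
  using near[OF that(1)] pl1 pl2 that by blast
 \<comment> \<open>The weight of the third vertex in \<open>q1\<close> and \<open>q2\<close>: below
   1, so that both points are interior to their triangles, and small enough to keep them in the ball
   around the midpoint.\<close>
 define s where "s = min (1/2) (\<rho> / (2 * (norm w1 + norm w2 + 1)))"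
 have pos: "0 < 2 * (norm w1 + norm w2 + 1)" by (smt (verit) norm_ge_zero)
 have s: "0 < s" "s < 1" using \<rho>(1) pos by (auto simp: s_def)
 have "s <= \<rho> / (2 * (norm w1 + norm w2 + 1))" by (simp add: s_def)
 then have "s * (2 * (norm w1 + norm w2 + 1)) <= \<rho>" unfolding pos_le_divide_eq[OF pos] .
 then have s2: "s * (norm w1 + norm w2 + 1) <= \<rho> / 2" by (simp add: algebra_simps)
 have sn: "s * norm w1 < \<rho>" "s * norm w2 < \<rho>"
 proof -
  have "s * norm w1 <= s * (norm w1 + norm w2 + 1)" "s * norm w2 <= s * (norm w1 + norm w2 + 1)"
   using s by (intro mult_left_mono; simp)+
  then show "s * norm w1 < \<rho>" "s * norm w2 < \<rho>" using s2 \<rho>(1) by linarith+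
 qed
 define q1 where "q1 = m + s *\<^sub>R w1"
 define q2 where "q2 = m + s *\<^sub>R w2"
 have "q1 = ((1 - s)/2) *\<^sub>R a + ((1 - s)/2) *\<^sub>R b + s *\<^sub>R c" "q2 = ((1 - s)/2) *\<^sub>R a + ((1 - s)/2) *\<^sub>R b + s *\<^sub>R d"
  by (simp_all add: q1_def q2_def w1_def w2_def m_def vec_eq_iff field_simps)
 then have qr: "q1 : rel_interior (conv {a,b,c})" "q2 : rel_interior (conv {a,b,d})"
  using triple_rel_interior[OF t1, of "(1 - s)/2" "(1 - s)/2" s] triple_rel_interior[OF t2, of "(1 - s)/2" "(1 - s)/2" s] s
  by (simp_all add: field_simps)
 have S1: "\<forall>\<^sub>F eps in at_right 0. (inside (q1 + eps *\<^sub>R n1) \<longleftrightarrow> side a b c) & (inside (q1 - eps *\<^sub>R n1) \<longleftrightarrow> ~ side a b c)"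
  using side_eventually[OF t1 qr(1)] by (simp add: n1_def)
 have S2: "\<forall>\<^sub>F eps in at_right 0. (inside (q2 + eps *\<^sub>R n2) \<longleftrightarrow> side a b d) & (inside (q2 - eps *\<^sub>R n2) \<longleftrightarrow> ~ side a b d)"
  using side_eventually[OF t2 qr(2)] by (simp add: n2_def)
 have lim: "((%eps. f (q + eps *\<^sub>R v)) \<longlongrightarrow> f q) (at_right 0)"
  if "continuous_on UNIV f" for f :: "real^3 => real" and q v
 proof -
  have "((%eps. q + eps *\<^sub>R v) \<longlongrightarrow> q + 0 *\<^sub>R v) (at_right 0)" by (intro tendsto_intros)
  then have "((%eps. q + eps *\<^sub>R v) \<longlongrightarrow> q) (at_right 0)" by simp
  moreover have "isCont f q" using that by (simp add: continuous_on_eq_continuous_at)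
  ultimately show ?thesis by (rule isCont_tendsto_compose[rotated])
 qed
 have evlt: "\<forall>\<^sub>F eps in at_right 0. f (q + eps *\<^sub>R v) < r"
  if "continuous_on UNIV f" "f q < r" for f :: "real^3 => real" and q v r
  using order_tendstoD(2)[OF lim[OF that(1)] that(2)] .
 have evgt: "\<forall>\<^sub>F eps in at_right 0. r < f (q + eps *\<^sub>R v)"
  if "continuous_on UNIV f" "r < f q" for f :: "real^3 => real" and q v r
  using order_tendstoD(1)[OF lim[OF that(1)] that(2)] .
 have cd: "continuous_on UNIV (%x. dist m x)" and ci: "continuous_on UNIV (%x. n \<bullet> (x - m))" for n :: "real^3"
  by (intro continuous_intros)+
 have bq: "dist m q1 < \<rho>" "dist m q2 < \<rho>" using sn s by (simp_all add: q1_def q2_def dist_norm)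
 have ball: "\<forall>\<^sub>F eps in at_right 0. q1 + eps *\<^sub>R v : ball m \<rho>" "\<forall>\<^sub>F eps in at_right 0. q2 + eps *\<^sub>R v : ball m \<rho>" for v
  using evlt[OF cd bq(1)] evlt[OF cd bq(2)] by simp_all
 have iq: "n1 \<bullet> (q1 - m) = 0" "n2 \<bullet> (q2 - m) = 0" "n1 \<bullet> (q2 - m) = s * D" "n2 \<bullet> (q1 - m) = - (s * D)"
  using n1w1 n2w2 D2 by (simp_all add: q1_def q2_def D_def)
 have n11: "0 < n1 \<bullet> n1" "0 < n2 \<bullet> n2" using nz by simp_all
 have evpos: "\<forall>\<^sub>F eps in at_right (0::real). 0 < eps" by (simp add: eventually_at_right_less)
 have half: "open {x. 0 < n \<bullet> (x - m)}" "convex {x. 0 < n \<bullet> (x - m)}"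
  "open {x. n \<bullet> (x - m) < 0}" "convex {x. n \<bullet> (x - m) < 0}" for n :: "real^3"
  using open_halfspace_gt[of "n \<bullet> m" n] convex_halfspace_gt[of "n \<bullet> m" n]
   open_halfspace_lt[of n "n \<bullet> m"] convex_halfspace_lt[of n "n \<bullet> m"] by (simp_all add: inner_diff_right)
 consider "D > 0" | "D < 0" | "D = 0" by linarith
 then show ?thesis
 proof cases
  case 1
  \<comment> \<open>The convex wedge between the two triangles. It contains points slightly above
    the first one and slightly below the second one, as measured by \<open>n1\<close> and
    \<open>n2\<close>, and it avoids the body.\<close>
  let ?Q = "({x. 0 < n1 \<bullet> (x - m)} Int {x. n2 \<bullet> (x - m) < 0}) Int ball m \<rho>"
  have Q: "open ?Q" "convex ?Q" by (intro open_Int convex_Int half open_ball convex_ball)+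
  have Qb: "?Q Int body = {}"
  proof -
   have "x ~: body" if "x : ?Q" for x using avoid[of x] that by simp
   then show ?thesis by blast
  qed
  have "n2 \<bullet> (q1 - m) < 0" "0 < n1 \<bullet> (q2 - m)" using iq 1 s by simp_all
  then have "\<forall>\<^sub>F eps in at_right 0. n2 \<bullet> ((q1 + eps *\<^sub>R n1) - m) < 0" "\<forall>\<^sub>F eps in at_right 0. 0 < n1 \<bullet> ((q2 + eps *\<^sub>R (- n2)) - m)"
   using evlt[OF ci] evgt[OF ci] by blast+
  then have "\<forall>\<^sub>F eps in at_right (0::real). side a b c \<longleftrightarrow> ~ side a b d"
   using S1 S2 evpos ball(1)[of n1] ball(2)[of "- n2"]
  proof eventually_elim
   case (elim eps)
   have "n1 \<bullet> ((q1 + eps *\<^sub>R n1) - m) = eps * (n1 \<bullet> n1)" "n2 \<bullet> ((q2 - eps *\<^sub>R n2) - m) = - (eps * (n2 \<bullet> n2))"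
    using iq by (simp_all add: inner_diff_right inner_add_right)
   then have "0 < n1 \<bullet> ((q1 + eps *\<^sub>R n1) - m)" "n2 \<bullet> ((q2 - eps *\<^sub>R n2) - m) < 0"
    using n11 elim(5) by simp_all
   then have "q1 + eps *\<^sub>R n1 : ?Q" "q2 - eps *\<^sub>R n2 : ?Q" using elim by simp_all
   then have "inside (q1 + eps *\<^sub>R n1) \<longleftrightarrow> inside (q2 - eps *\<^sub>R n2)" by (rule inside_convex[OF Q Qb])
   then show ?case using elim(3,4) by blast
  qed
  then show ?thesis by simp
 next
  case 2
  let ?Q = "({x. n1 \<bullet> (x - m) < 0} Int {x. 0 < n2 \<bullet> (x - m)}) Int ball m \<rho>"
  have Q: "open ?Q" "convex ?Q" by (intro open_Int convex_Int half open_ball convex_ball)+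
  have Qb: "?Q Int body = {}"
  proof -
   have "x ~: body" if "x : ?Q" for x using avoid[of x] that by simp
   then show ?thesis by blast
  qed
  have "0 < n2 \<bullet> (q1 - m)" "n1 \<bullet> (q2 - m) < 0" using iq 2 s by (simp_all add: mult_pos_neg)
  then have "\<forall>\<^sub>F eps in at_right 0. 0 < n2 \<bullet> ((q1 + eps *\<^sub>R (- n1)) - m)" "\<forall>\<^sub>F eps in at_right 0. n1 \<bullet> ((q2 + eps *\<^sub>R n2) - m) < 0"
   using evlt[OF ci] evgt[OF ci] by blast+
  then have "\<forall>\<^sub>F eps in at_right (0::real). side a b c \<longleftrightarrow> ~ side a b d"
   using S1 S2 evpos ball(1)[of "- n1"] ball(2)[of n2]
  proof eventually_elim
   case (elim eps)
   have "n1 \<bullet> ((q1 - eps *\<^sub>R n1) - m) = - (eps * (n1 \<bullet> n1))" "n2 \<bullet> ((q2 + eps *\<^sub>R n2) - m) = eps * (n2 \<bullet> n2)"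
    using iq by (simp_all add: inner_diff_right inner_add_right)
   then have "n1 \<bullet> ((q1 - eps *\<^sub>R n1) - m) < 0" "0 < n2 \<bullet> ((q2 + eps *\<^sub>R n2) - m)"
    using n11 elim(5) by simp_all
   then have "q1 - eps *\<^sub>R n1 : ?Q" "q2 + eps *\<^sub>R n2 : ?Q" using elim by simp_all
   then have "inside (q1 - eps *\<^sub>R n1) \<longleftrightarrow> inside (q2 + eps *\<^sub>R n2)" by (rule inside_convex[OF Q Qb])
   then show ?case using elim(3,4) by blast
  qed
  then show ?thesis by simp
 next
  case 3
  have "cross3 n1 n2 = D *\<^sub>R e"
   unfolding D_def n1w n2w
   by (simp add: cross3_def inner_vec_def sum_3 vec_eq_iff forall_3) (simp add: algebra_simps)
  then have "collinear {0, n1, n2}" using 3 by (simp add: cross_eq_0[symmetric])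
  then obtain \<kappa> where \<kappa>: "n2 = \<kappa> *\<^sub>R n1" using nz by (auto simp: collinear_lemma)
  have \<kappa>0: "\<kappa> ~= 0" using \<kappa> nz by auto
  \<comment> \<open>Coplanar triangles with normals of the same direction would lie on the same side
    of the edge and overlap.\<close>
  have "~ 0 < \<kappa>"
  proof
   assume kpos: "0 < \<kappa>"
   have "cross3 e (w2 - \<kappa> *\<^sub>R w1) = 0"
    using \<kappa> unfolding n1w n2w by (simp add: Cross3.right_diff_distrib cross_mult_right)
   moreover have "e ~= 0" using dist by (simp add: e_def)
   ultimately obtain \<mu> where \<mu>: "w2 - \<kappa> *\<^sub>R w1 = \<mu> *\<^sub>R e"
    unfolding cross_eq_0 collinear_lemma by (metis scaleR_zero_left)
   \<comment> \<open>Small enough for \<open>m + r w2\<close>, an interior point of the second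
     triangle, to have nonnegative coordinates in the first.\<close>
   define r where "r = min (1/2) (1 / (2 * (\<kappa> + 2 * \<bar>\<mu>\<bar> + 1)))"
   have rp: "0 < r" "r < 1" using kpos by (auto simp: r_def)
   have rpos: "0 < 2 * (\<kappa> + 2 * \<bar>\<mu>\<bar> + 1)" using kpos by simp
   have "r <= 1 / (2 * (\<kappa> + 2 * \<bar>\<mu>\<bar> + 1))" by (simp add: r_def)
   then have "r * (2 * (\<kappa> + 2 * \<bar>\<mu>\<bar> + 1)) <= 1" unfolding pos_le_divide_eq[OF rpos] .
   then have rk: "r * \<kappa> + 2 * (r * \<bar>\<mu>\<bar>) <= 1" using rp by (simp add: algebra_simps)
   have "r * \<bar>\<mu>\<bar> = \<bar>r * \<mu>\<bar>" using rp by (simp add: abs_mult)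
   then have rmu: "- (r * \<bar>\<mu>\<bar>) <= r * \<mu>" "r * \<mu> <= r * \<bar>\<mu>\<bar>" by linarith+
   define z where "z = m + r *\<^sub>R w2"
   have w2: "w2 = \<kappa> *\<^sub>R w1 + \<mu> *\<^sub>R e" using \<mu> by (simp add: algebra_simps)
   have z1: "z = ((1 - r * \<kappa>)/2 - r * \<mu>) *\<^sub>R a + ((1 - r * \<kappa>)/2 + r * \<mu>) *\<^sub>R b + (r * \<kappa>) *\<^sub>R c"
    unfolding z_def w2 by (simp add: w1_def m_def e_def vec_eq_iff field_simps)
   have half_ge: "0 <= (1 - k)/2 - x & 0 <= (1 - k)/2 + x" if "k + 2 * y <= 1" "- y <= x" "x <= y"
    for k x y :: real using that by (simp add: field_simps)
   from half_ge[OF rk rmu]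
   have "0 <= (1 - r * \<kappa>)/2 - r * \<mu>" "0 <= (1 - r * \<kappa>)/2 + r * \<mu>" by blast+
   moreover have "0 <= r * \<kappa>" using rp kpos by simp
   moreover have "((1 - r * \<kappa>)/2 - r * \<mu>) + ((1 - r * \<kappa>)/2 + r * \<mu>) + r * \<kappa> = 1"
    by (simp add: field_simps)
   ultimately have "z : conv {a,b,c}"
    unfolding convex_hull_3 using z1 by blast
   moreover have "z = ((1 - r)/2) *\<^sub>R a + ((1 - r)/2) *\<^sub>R b + r *\<^sub>R d"
    by (simp add: z_def w2_def m_def vec_eq_iff field_simps)
   then have z2: "z : rel_interior (conv {a,b,d})"
    using triple_rel_interior[OF t2, of "(1 - r)/2" "(1 - r)/2" r] rp by (simp add: field_simps)
   ultimately show False using rel_interior_disjoint[OF t2 t1] tne by blast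
  qed
  then have kneg: "\<kappa> < 0" using \<kappa>0 by simp
  let ?Q = "{x. 0 < n1 \<bullet> (x - m)} Int ball m \<rho>"
  have Q: "open ?Q" "convex ?Q" by (intro open_Int convex_Int half open_ball convex_ball)+
  have Qb: "?Q Int body = {}"
  proof -
   have "x ~: body" if "x : ?Q" for x using avoid[of x] that \<kappa>0 unfolding \<kappa> by simp
   then show ?thesis by blast
  qed
  have "\<forall>\<^sub>F eps in at_right (0::real). side a b c \<longleftrightarrow> ~ side a b d"
   using S1 S2 evpos ball(1)[of n1] ball(2)[of "- n2"]
  proof eventually_elim
   case (elim eps)
   have "n1 \<bullet> ((q1 + eps *\<^sub>R n1) - m) = eps * (n1 \<bullet> n1)" "n1 \<bullet> ((q2 - eps *\<^sub>R n2) - m) = eps * (- \<kappa>) * (n1 \<bullet> n1)"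
    using iq 3 by (simp_all add: inner_diff_right inner_add_right \<kappa>)
   then have "0 < n1 \<bullet> ((q1 + eps *\<^sub>R n1) - m)" "0 < n1 \<bullet> ((q2 - eps *\<^sub>R n2) - m)"
    using n11 elim(3) kneg by (simp_all add: mult_pos_neg mult_neg_pos)
   then have "q1 + eps *\<^sub>R n1 : ?Q" "q2 - eps *\<^sub>R n2 : ?Q" using elim by simp_all
   then have "inside (q1 + eps *\<^sub>R n1) \<longleftrightarrow> inside (q2 - eps *\<^sub>R n2)" by (rule inside_convex[OF Q Qb])
   then show ?case using elim(1,2) by blast
  qed
  then show ?thesis by simp
 qed
qed

theorem chi_even:
 assumes cl: "closed_surface S" and links: "!!v. v : \<Union>S ==> vertex_linked S v"
 shows "even (chi S)"
proof -
 interpret oriented_surface S side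
 proof
  fix a b c d assume t: "{a,b,c} : S" "{a,b,d} : S" "c ~= d"
  have "a ~= b" using card3[OF t(1)] card_3_distinct[of a b c] by auto
  then have "{a,b} : edges_of S" using t(1) by (auto simp: edges_of_def)
  then have "card {t:S. {a,b} \<subseteq> t} = 2" using cl by (auto simp: closed_surface_def)
  then show "side a b c \<longleftrightarrow> ~ side a b d" by (rule side_coherent[OF t])
 qed (use cl links side_rot side_flip in auto)
 show ?thesis by (rule chi_even)
qed

end

subsection \<open>Intersections with the anchor line\<close>

text \<open>The function \<open>b\<close> changes its value at the points of \<open>P\<close> and
  nowhere else. The induction removes a point by negating \<open>b\<close> to the right of it, which
  also negates the final value \<open>d\<close>.\<close>

lemma far_right_of_flips:
 fixes b :: "real => bool"
 assumes "finite P"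
  and "!!s. s ~: P ==> EX eps>0. ALL s'. \<bar>s' - s\<bar> < eps --> b s' = b s"
  and "!!p. p : P ==> EX eps>0. EX c. ALL s. 0 < s --> s < eps --> b (p + s) = c & b (p - s) = (~ c)"
  and "!!s. s < - R ==> ~ b s" and "!!s. s > R ==> b s = d"
 shows "d \<longleftrightarrow> odd (card P)"
 using assms
proof (induction P arbitrary: b d R rule: finite_induct)
 case empty
 have "b (- \<bar>R\<bar> - 1) = b (\<bar>R\<bar> + 1)"
 proof (rule connected_local_const[where A = UNIV and f = b])
  show "ALL a:UNIV. \<forall>\<^sub>F s in at a within UNIV. b a = b s"
  proof
   fix a
   obtain e where e: "e > 0" "ALL s'. \<bar>s' - a\<bar> < e --> b s' = b a" using empty(1)[of a] by blast
   show "\<forall>\<^sub>F s in at a within UNIV. b a = b s"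
    unfolding eventually_at dist_real_def
   proof (intro exI conjI ballI impI)
    fix s assume "s ~= a & \<bar>s - a\<bar> < e"
    then have "b s = b a" using e(2) by blast
    then show "b a = b s" by (rule sym)
   qed (rule e(1))
  qed
 qed auto
 moreover have "~ b (- \<bar>R\<bar> - 1)" "b (\<bar>R\<bar> + 1) = d" using empty(3)[of "- \<bar>R\<bar> - 1"] empty(4)[of "\<bar>R\<bar> + 1"] by auto
 ultimately show ?case by simp
next
 case (insert p P)
 obtain e0 c where e0: "e0 > 0" "!!s. 0 < s ==> s < e0 ==> b (p + s) = c & b (p - s) = (~ c)"
  using insert.prems(2)[of p] by blast
 \<comment> \<open>At \<open>p\<close> itself the value just to the left is used, so that the new
   function is locally constant there.\<close>
 define b' where "b' s = (if s < p then b s else if s = p then ~ c else ~ b s)" for s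
 have "(~ d) \<longleftrightarrow> odd (card P)"
 proof (rule insert.IH)
  fix s assume sP: "s ~: P"
  show "EX eps>0. ALL s'. \<bar>s' - s\<bar> < eps --> b' s' = b' s"
  proof (cases "s = p")
   case True
   have "b' s' = b' s" if "\<bar>s' - s\<bar> < e0" for s'
    using that True e0(2)[of "s' - p"] e0(2)[of "p - s'"] by (auto simp: b'_def)
   then show ?thesis using e0(1) by blast
  next
   case False
   obtain e where e: "e > 0" "ALL s'. \<bar>s' - s\<bar> < e --> b s' = b s" using insert.prems(1)[of s] sP False by blast
   have "b' s' = b' s" if "\<bar>s' - s\<bar> < min e \<bar>s - p\<bar>" for s'
   proof -
    have "b s' = b s" using e(2) that by simp
    moreover have "s' < p \<longleftrightarrow> s < p" "s' ~= p" using that by linarith+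
    ultimately show ?thesis using False unfolding b'_def by simp
   qed
   moreover have "min e \<bar>s - p\<bar> > 0" using e False by simp
   ultimately show ?thesis by blast
  qed
 next
  fix q assume q: "q : P"
  then have qp: "q ~= p" using insert.hyps by auto
  obtain e c' where e: "e > 0" "!!s. 0 < s ==> s < e ==> b (q + s) = c' & b (q - s) = (~ c')"
   using insert.prems(2)[of q] q by blast
  have "b' (q + s) = (if q < p then c' else ~ c') & b' (q - s) = (~ (if q < p then c' else ~ c'))"
   if s: "0 < s" "s < min e \<bar>q - p\<bar>" for s
  proof -
   have "b (q + s) = c' & b (q - s) = (~ c')" using e(2) s by simp
   moreover have "q + s < p \<longleftrightarrow> q < p" "q - s < p \<longleftrightarrow> q < p" "q + s ~= p" "q - s ~= p" using s by linarith+
   ultimately show ?thesis unfolding b'_def by simp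
  qed
  moreover have "min e \<bar>q - p\<bar> > 0" using e(1) qp by simp
  ultimately show "EX eps>0. EX c. ALL s. 0 < s --> s < eps --> b' (q + s) = c & b' (q - s) = (~ c)" by blast
 next
  show "~ b' s" if "s < - (\<bar>R\<bar> + \<bar>p\<bar>)" for s
   using that insert.prems(3)[of s] by (auto simp: b'_def)
  show "b' s = (~ d)" if "s > \<bar>R\<bar> + \<bar>p\<bar>" for s
   using that insert.prems(4)[of s] by (auto simp: b'_def)
 qed
 then show ?case using insert.hyps by auto
qed

text \<open>The affine pieces serve only to prove continuity; everywhere below a PL chart is just a
  homeomorphism of compact sets.\<close>

lemma pl_homeomorphism_homeo:
 assumes "pl_homeomorphism N N' f"
 obtains g where "compact N" "homeomorphism N N' f g"
proof -
 obtain T where T: "simplicial_complex T" "\<Union>T = N" "ALL \<sigma>:T. EX A b. linear A & (ALL x:\<sigma>. f x = A x + b)"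
  and bij: "bij_betw f N N'" using assms unfolding pl_homeomorphism_def by blast
 have fin: "finite T" and comp: "!!\<sigma>. \<sigma> : T ==> compact \<sigma>"
  using T(1) compact_simplex unfolding simplicial_complex_def by blast+
 have N: "compact N" using compact_Union[OF fin] comp T(2) by blast
 have "continuous_on (\<Union>\<sigma>\<in>T. \<sigma>) f"
 proof (rule continuous_on_closed_Union[OF fin])
  fix \<sigma> assume \<sigma>: "\<sigma> : T"
  then show "closed \<sigma>" using comp compact_imp_closed by blast
  obtain A b where A: "linear A" "!!x. x : \<sigma> ==> f x = A x + b" using T(3) \<sigma> by blast
  have "continuous_on \<sigma> (%x. A x + b)" by (intro continuous_intros linear_continuous_on A(1)) (simp add: A(1) linear_conv_bounded_linear[symmetric])
  then show "continuous_on \<sigma> f" using A(2) continuous_on_cong[of \<sigma> \<sigma> f "%x. A x + b"] by blast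
 qed
 then have "continuous_on N f" using T(2) by simp
 then obtain g where "homeomorphism N N' f g"
  using homeomorphism_compact[OF N, of f N'] bij unfolding bij_betw_def by blast
 then show ?thesis using that N by blast
qed

context mod2_cycle
begin

text \<open>The chart is only a homeomorphism, so sides cannot be compared through normals. Instead
  each half \<open>V1\<close>, \<open>V2\<close> of the chart is connected and misses the body,
  hence has one value of \<open>inside\<close>; a triangle near \<open>p\<close> shows that the two
  values differ, and the two directions of the anchor line enter different halves.\<close>

lemma anchor_flip:
 assumes tr: "transverse_to_anchor_line_at F p" and bF: "body \<subseteq> F" and pb: "p : body"
  and r: "0 < r" "F Int ball p r \<subseteq> body"
 defines "e3 \<equiv> axis 3 1 :: real^3"
 shows "EX eps>0. EX c. ALL s. 0 < s --> s < eps --> inside (p + s *\<^sub>R e3) = c & inside (p - s *\<^sub>R e3) = (~ c)"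
proof -
 obtain N N' f where f: "p : interior N" "0 : interior N'" "pl_homeomorphism N N' f" "f p = 0"
   "f ` (N Int F) = N' Int {x. x $ 3 = 0}" "f ` (N Int anchor_line) = N' Int {x. x $ 1 = 0 & x $ 2 = 0}"
  using tr unfolding transverse_to_anchor_line_at_def by blast
 obtain g where g: "homeomorphism N N' f g" using pl_homeomorphism_homeo[OF f(3)] by blast
 have gf: "!!x. x : N ==> g (f x) = x" and fg: "!!y. y : N' ==> f (g y) = y"
  and fN: "!!x. x : N ==> f x : N'" and gN: "!!y. y : N' ==> g y : N"
  and cf: "continuous_on N f" and cg: "continuous_on N' g"
  using g by (auto simp: homeomorphism_def)
 have pN: "p : N" "0 : N'" using f(1,2) interior_subset by blast+
 have g0: "g 0 = p" using gf[OF pN(1)] f(4) by simp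
 obtain \<delta> where \<delta>: "\<delta> > 0" "ball 0 \<delta> \<subseteq> N'" using f(2) mem_interior by blast
 have inF: "x : F \<longleftrightarrow> f x $ 3 = 0" if "x : N" for x
 proof
  assume "x : F" then show "f x $ 3 = 0" using f(5) that by blast
 next
  assume "f x $ 3 = 0"
  then have "f x : f ` (N Int F)" using f(5) fN[OF that] by blast
  then obtain y where "y : N" "y : F" "f x = f y" by blast
  then show "x : F" using gf that by metis
 qed
 have inL: "x : anchor_line \<longleftrightarrow> f x $ 1 = 0 & f x $ 2 = 0" if "x : N" for x
 proof
  assume "x : anchor_line" then show "f x $ 1 = 0 & f x $ 2 = 0" using f(6) that by blast
 next
  assume "f x $ 1 = 0 & f x $ 2 = 0"
  then have "f x : f ` (N Int anchor_line)" using f(6) fN[OF that] by blast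
  then obtain y where "y : N" "y : anchor_line" "f x = f y" by blast
  then show "x : anchor_line" using gf that by metis
 qed
 define V1 where "V1 = ball 0 \<delta> Int {x::real^3. 0 < x $ 3}"
 define V2 where "V2 = ball 0 \<delta> Int {x::real^3. x $ 3 < 0}"
 have h: "open {x::real^3. 0 < x $ 3}" "convex {x::real^3. 0 < x $ 3}" "open {x::real^3. x $ 3 < 0}" "convex {x::real^3. x $ 3 < 0}"
  using open_halfspace_gt[of 0 e3] convex_halfspace_gt[of 0 e3] open_halfspace_lt[of e3 0] convex_halfspace_lt[of e3 0]
  by (simp_all add: e3_def inner_axis')
 have V: "open V1" "convex V1" "open V2" "convex V2" unfolding V1_def V2_def
  by (intro open_Int convex_Int open_ball convex_ball h)+
 have VN: "V1 \<subseteq> N'" "V2 \<subseteq> N'" using \<delta>(2) by (auto simp: V1_def V2_def)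
 have con: "connected (g ` V1)" "connected (g ` V2)"
  using connected_continuous_image[OF continuous_on_subset[OF cg VN(1)] convex_connected[OF V(2)]]
   connected_continuous_image[OF continuous_on_subset[OF cg VN(2)] convex_connected[OF V(4)]] by blast+
 have gVF: "g ` V1 Int body = {}" "g ` V2 Int body = {}"
  using inF gN fg VN bF by (fastforce simp: V1_def V2_def)+
 obtain e1 where e1: "e1 > 0" "ball p e1 \<subseteq> N" using f(1) mem_interior by blast
 obtain e2 where e2: "e2 > 0" "!!x. x : N ==> dist x p < e2 ==> dist (f x) (f p) < \<delta>"
  using cf pN(1) \<delta>(1) unfolding continuous_on_iff by blast
 define r' where "r' = min r (min e1 e2)"
 have r': "r' > 0" "ball p r' \<subseteq> N" "ball p r' \<subseteq> ball p r" "!!x. x : ball p r' ==> f x : ball 0 \<delta>"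
 proof -
  show "r' > 0" using r e1 e2 by (simp add: r'_def)
  show bN: "ball p r' \<subseteq> N" using e1(2) by (auto simp: r'_def)
  show "ball p r' \<subseteq> ball p r" by (auto simp: r'_def)
  fix x assume x: "x : ball p r'"
  then have "dist x p < e2" by (simp add: r'_def dist_commute)
  then have "dist (f x) (f p) < \<delta>" using e2(2) x bN by blast
  then show "f x : ball 0 \<delta>" using f(4) by (simp add: dist_commute)
 qed
 have cases: "f x : V1 \<or> f x : V2" if "x : ball p r'" "x ~: F" for x
  using r'(4)[OF that(1)] inF[of x] r'(2) that by (auto simp: V1_def V2_def)
 have gim: "x : g ` V" if "x : N" "f x : V" for x V using gf[OF that(1)] that(2) by force
 have const: "inside x = inside y" if "x : ball p r'" "y : ball p r'" "f x : V1 & f y : V1 \<or> f x : V2 & f y : V2" for x y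
 proof -
  have xy: "x : N" "y : N" using that(1,2) r'(2) by blast+
  from that(3) show ?thesis
  proof (elim disjE conjE)
   assume "f x : V1" "f y : V1"
   then show ?thesis by (intro inside_connected[OF con(1) gVF(1)] gim xy)
  next
   assume "f x : V2" "f y : V2"
   then show ?thesis by (intro inside_connected[OF con(2) gVF(2)] gim xy)
  qed
 qed
 \<comment> \<open>a triangle close to \<open>p\<close> separates the two sides of the chart\<close>
  obtain t where t: "t : S" "p : conv t" using pb by (auto simp: body_def)
 have "p : closure (relint t)"
  using t(2) closure_subset convex_closure_rel_interior[of "conv t"] by auto
 then obtain q where q: "q : relint t" "q : ball p r'"
  unfolding closure_approachable using r'(1) by (auto simp: dist_commute)
 obtain a b c where abc: "t = {a,b,c}" using card_3_iff[THEN iffD1, OF card3[OF t(1)]] by blast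
 define n where "n = cross3 (b - a) (c - a)"
 have n: "!!x. x : affine hull t \<longleftrightarrow> n \<bullet> (x - q) = 0" "n ~= 0"
  using normal_at[of a b c q] triangle_normal(1)[of a b c] t(1) q(1) card3[OF t(1)] indep[OF t(1)]
  unfolding abc n_def by blast+
 obtain \<beta> where \<beta>: "\<forall>\<^sub>F eps in at_right 0. (inside (q + eps *\<^sub>R n) \<longleftrightarrow> \<beta>) & (inside (q - eps *\<^sub>R n) \<longleftrightarrow> ~ \<beta>)"
  using side_limit[OF t(1) q(1) n] by blast
 obtain \<rho> where \<rho>: "\<rho> > 0" "!!x. x : ball q \<rho> ==> n \<bullet> (x - q) ~= 0 ==> x ~: body"
  using flip[OF t(1) q(1) n(1)] by metis
 obtain \<rho>2 where \<rho>2: "\<rho>2 > 0" "ball q \<rho>2 \<subseteq> ball p r'" using q(2) open_ball openE by blast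
 define e4 where "e4 = min \<rho> \<rho>2 / norm n"
 have e4: "e4 > 0" using \<rho>(1) \<rho>2(1) n(2) by (simp add: e4_def)
 have "\<forall>\<^sub>F eps in at_right 0. eps < e4" using e4 by (simp add: eventually_at_right_field) blast
 moreover have "\<forall>\<^sub>F eps in at_right (0::real). 0 < eps" by (simp add: eventually_at_right_less)
 ultimately have "\<forall>\<^sub>F eps in at_right 0. (0 < eps & eps < e4) & inside (q + eps *\<^sub>R n) ~= inside (q - eps *\<^sub>R n)"
  using \<beta> by eventually_elim blast
 then obtain eps where eps: "0 < eps" "eps < e4" "inside (q + eps *\<^sub>R n) ~= inside (q - eps *\<^sub>R n)"
  using eventually_happens[of _ "at_right (0::real)"] trivial_limit_at_right_real by blast
 have "eps * norm n < min \<rho> \<rho>2" using eps n(2) by (simp add: e4_def pos_less_divide_eq)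
 then have "q + eps *\<^sub>R n : ball q \<rho> Int ball q \<rho>2" "q - eps *\<^sub>R n : ball q \<rho> Int ball q \<rho>2"
  using eps(1) by (simp_all add: dist_norm)
 then have nb: "q + eps *\<^sub>R n : ball q \<rho>" "q - eps *\<^sub>R n : ball q \<rho>" "q + eps *\<^sub>R n : ball p r'" "q - eps *\<^sub>R n : ball p r'"
  using \<rho>2(2) by blast+
 have "n \<bullet> ((q + eps *\<^sub>R n) - q) ~= 0" "n \<bullet> ((q - eps *\<^sub>R n) - q) ~= 0" using eps(1) n(2) by simp_all
 then have "q + eps *\<^sub>R n ~: body" "q - eps *\<^sub>R n ~: body" using \<rho>(2) nb by blast+
 then have nF: "q + eps *\<^sub>R n ~: F" "q - eps *\<^sub>R n ~: F" using r(2) nb r'(3) by blast+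
 obtain x1 x2 where x12: "x1 : ball p r'" "x2 : ball p r'" "f x1 : V1" "f x2 : V2" "inside x1 ~= inside x2"
 proof (cases "f (q + eps *\<^sub>R n) : V1")
  case True
  then have "f (q - eps *\<^sub>R n) : V2" using const[OF nb(3,4)] cases[OF nb(4) nF(2)] eps(3) by blast
  then show ?thesis using that[OF nb(3,4) True] eps(3) by blast
 next
  case False
  then have 2: "f (q + eps *\<^sub>R n) : V2" using cases[OF nb(3) nF(1)] by blast
  then have "f (q - eps *\<^sub>R n) : V1" using const[OF nb(3,4)] cases[OF nb(4) nF(2)] eps(3) by blast
  then show ?thesis using that[OF nb(4,3) _ 2] eps(3) by blast
 qed
 define c where "c = inside x1"
 have V1c: "inside x = c" if "x : ball p r'" "f x : V1" for x using const[OF that(1) x12(1)] that(2) x12(3) by (simp add: c_def)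
 have V2c: "inside x = (~ c)" if "x : ball p r'" "f x : V2" for x
  using const[OF that(1) x12(2)] that(2) x12(4,5) by (auto simp: c_def)
 \<comment> \<open>the two halves of the anchor line lie on different sides of the chart\<close>
  have pL: "p : anchor_line" using inL[OF pN(1)] f(4) by simp
 have on_line: "p + s *\<^sub>R e3 : anchor_line" for s using pL by (simp add: anchor_line_def e3_def axis_def)
 have inb: "p + s *\<^sub>R e3 : ball p r'" if "\<bar>s\<bar> < r'" for s using that by (simp add: dist_norm e3_def)
 have line_cases: "f (p + s *\<^sub>R e3) : V1 \<or> f (p + s *\<^sub>R e3) : V2" if "\<bar>s\<bar> < r'" "s ~= 0" for s
 proof (rule cases[OF inb[OF that(1)]])
  have sN: "p + s *\<^sub>R e3 : N" using inb[OF that(1)] r'(2) by blast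
  show "p + s *\<^sub>R e3 ~: F"
  proof
   assume "p + s *\<^sub>R e3 : F"
   then have "f (p + s *\<^sub>R e3) = 0"
    using inF[OF sN] inL[OF sN] on_line by (simp add: vec_eq_iff forall_3)
   then have "p + s *\<^sub>R e3 = p" using gf[OF sN] g0 by simp
   then show False using that(2) by (simp add: e3_def)
  qed
 qed
 have disj: "V1 Int V2 = {}" by (auto simp: V1_def V2_def)
 have half: "(ALL s:I. f (p + s *\<^sub>R e3) : V1) \<or> (ALL s:I. f (p + s *\<^sub>R e3) : V2)"
  if I: "connected I" "I \<subseteq> {-r'<..<r'}" "0 ~: I" for I
 proof -
  have "continuous_on I (%s. f (p + s *\<^sub>R e3))"
  proof (rule continuous_on_compose2[OF cf])
   show "(%s. p + s *\<^sub>R e3) ` I \<subseteq> N" using inb r'(2) I(2) by (force simp: abs_less_iff)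
  qed (intro continuous_intros)
  then have "connected ((%s. f (p + s *\<^sub>R e3)) ` I)" using I(1) by (rule connected_continuous_image)
  moreover have "(%s. f (p + s *\<^sub>R e3)) ` I \<subseteq> V1 Un V2" using line_cases I(2,3) by (force simp: abs_less_iff)
  ultimately have "V1 Int (%s. f (p + s *\<^sub>R e3)) ` I = {} \<or> V2 Int (%s. f (p + s *\<^sub>R e3)) ` I = {}"
   using connectedD[of _ V1 V2] V disj by blast
  then show ?thesis using \<open>(%s. f (p + s *\<^sub>R e3)) ` I \<subseteq> V1 Un V2\<close> by blast
 qed
 have right: "(ALL s:{0<..<r'}. f (p + s *\<^sub>R e3) : V1) \<or> (ALL s:{0<..<r'}. f (p + s *\<^sub>R e3) : V2)"
  by (rule half) auto
 have left: "(ALL s:{-r'<..<0}. f (p + s *\<^sub>R e3) : V1) \<or> (ALL s:{-r'<..<0}. f (p + s *\<^sub>R e3) : V2)"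
  by (rule half) auto
 \<comment> \<open>Points of the vertical axis in the chart come from the anchor line, so the line
   reaches both halves arbitrarily close to \<open>p\<close>.\<close>
 have hit: "EX s. \<bar>s\<bar> < r' & s ~= 0 & 0 < \<sigma> * f (p + s *\<^sub>R e3) $ 3" if \<sigma>: "\<bar>\<sigma>\<bar> = 1" for \<sigma>
 proof -
  obtain e5 where e5: "e5 > 0" "!!y. y : N' ==> dist y 0 < e5 ==> dist (g y) (g 0) < r'"
   using cg pN(2) r'(1) unfolding continuous_on_iff by blast
  define \<tau> where "\<tau> = min e5 \<delta> / 2"
  have \<tau>: "0 < \<tau>" "\<tau> < e5" "\<tau> < \<delta>" using e5 \<delta> by (auto simp: \<tau>_def)
  define y where "y = (\<sigma> * \<tau>) *\<^sub>R e3"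
  have ny: "norm y = \<tau>" using \<tau> \<sigma> by (simp add: y_def e3_def abs_mult)
  have y3: "y $ 3 = \<sigma> * \<tau>" "y $ 1 = 0" "y $ 2 = 0" by (simp_all add: y_def e3_def axis_def)
  have "\<sigma> * \<sigma> = 1" using \<sigma> by (metis abs_mult_self_eq mult_1)
  then have sst: "\<sigma> * (\<sigma> * \<tau>) = \<tau>" by (simp add: mult.assoc[symmetric])
  have yV: "0 < \<sigma> * y $ 3" unfolding y3(1) sst by (rule \<tau>(1))
  have yN: "y : N'" using ny \<tau> \<delta>(2) by auto
  have "dist (g y) p < r'" using e5(2)[OF yN] ny \<tau> g0 by simp
  have gL: "g y : anchor_line" using inL[OF gN[OF yN]] fg[OF yN] y3 by simp
  define s where "s = g y $ 3 - p $ 3"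
  have gy: "g y = p + s *\<^sub>R e3"
   using gL pL by (simp add: anchor_line_def s_def e3_def vec_eq_iff forall_3 axis_def)
  have "\<bar>s\<bar> < r'" using \<open>dist (g y) p < r'\<close> by (simp add: gy dist_norm e3_def)
  moreover have "s ~= 0"
  proof
   assume "s = 0"
   then have "f (g y) = 0" using gy f(4) by simp
   then show False using fg[OF yN] ny \<tau> by simp
  qed
  ultimately show ?thesis using fg[OF yN] yV gy by metis
 qed
 have opp: "(ALL s:{0<..<r'}. f (p + s *\<^sub>R e3) : V1) & (ALL s:{-r'<..<0}. f (p + s *\<^sub>R e3) : V2) \<or>
   (ALL s:{0<..<r'}. f (p + s *\<^sub>R e3) : V2) & (ALL s:{-r'<..<0}. f (p + s *\<^sub>R e3) : V1)"
 proof -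
  obtain s1 where s1: "\<bar>s1\<bar> < r'" "s1 ~= 0" "0 < 1 * f (p + s1 *\<^sub>R e3) $ 3" using hit[of 1] by auto
  obtain s2 where s2: "\<bar>s2\<bar> < r'" "s2 ~= 0" "0 < - 1 * f (p + s2 *\<^sub>R e3) $ 3" using hit[of "- 1"] by auto
  have s1: "\<bar>s1\<bar> < r'" "s1 ~= 0" "f (p + s1 *\<^sub>R e3) : V1"
   using s1 line_cases[OF s1(1,2)] by (auto simp: V2_def)
  have s2: "\<bar>s2\<bar> < r'" "s2 ~= 0" "f (p + s2 *\<^sub>R e3) : V2"
   using s2 line_cases[OF s2(1,2)] by (auto simp: V1_def)
  have "s1 : {0<..<r'} \<or> s1 : {-r'<..<0}" "s2 : {0<..<r'} \<or> s2 : {-r'<..<0}" using s1 s2 by auto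
  then show ?thesis using right left s1(3) s2(3) disj by blast
 qed
 have val: "inside (p + s *\<^sub>R e3) = d" if "\<bar>s\<bar> < r'" "f (p + s *\<^sub>R e3) : V1 & d = c \<or> f (p + s *\<^sub>R e3) : V2 & d = (~ c)" for s d
  using V1c V2c inb[OF that(1)] that(2) by blast
 show ?thesis
 proof (rule exI[of _ r'], intro conjI r'(1), cases "ALL s:{0<..<r'}. f (p + s *\<^sub>R e3) : V1")
  case True
  have "r' / 2 : {0<..<r'}" using r'(1) by simp
  then have "~ (ALL s:{0<..<r'}. f (p + s *\<^sub>R e3) : V2)" using True disj by blast
  then have lf: "ALL s:{-r'<..<0}. f (p + s *\<^sub>R e3) : V2" using opp by blast
  have "inside (p + s *\<^sub>R e3) = c & inside (p - s *\<^sub>R e3) = (~ c)" if "0 < s" "s < r'" for s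
  proof -
   have "f (p + (- s) *\<^sub>R e3) : V2"
    using bspec[OF lf, of "- s"] that by simp
   then show ?thesis using val[of s c] val[of "- s" "~ c"] True that by simp
  qed
  then show "EX c. ALL s. 0 < s --> s < r' --> inside (p + s *\<^sub>R e3) = c & inside (p - s *\<^sub>R e3) = (~ c)" by blast
 next
  case False
  then have rl: "ALL s:{0<..<r'}. f (p + s *\<^sub>R e3) : V2" "ALL s:{-r'<..<0}. f (p + s *\<^sub>R e3) : V1" using opp by blast+
  have "inside (p + s *\<^sub>R e3) = (~ c) & inside (p - s *\<^sub>R e3) = (~ (~ c))" if "0 < s" "s < r'" for s
  proof -
   have "f (p + (- s) *\<^sub>R e3) : V1" using bspec[OF rl(2), of "- s"] that by simp
   then show ?thesis using val[of s "~ c"] val[of "- s" c] rl(1) that by simp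
  qed
  then show "EX c. ALL s. 0 < s --> s < r' --> inside (p + s *\<^sub>R e3) = c & inside (p - s *\<^sub>R e3) = (~ c)" by blast
 qed
qed

text \<open>\<open>inside\<close> is false far out in both directions of the line and changes
  exactly at the points of the body. Transversality is given for the whole foam \<open>F\<close>;
  \<open>loc\<close> makes it usable for the body.\<close>

theorem anchor_points_even:
 assumes fin: "finite (body Int anchor_line)" and bF: "body \<subseteq> F"
  and tr: "!!p. p : body Int anchor_line ==> transverse_to_anchor_line_at F p"
  and loc: "!!p. p : body Int anchor_line ==> EX r>0. F Int ball p r \<subseteq> body"
 shows "even (card (body Int anchor_line))"
proof -
 let ?e = "axis 3 1 :: real^3"
 define P where "P = {s. s *\<^sub>R ?e : body}"
 have bij: "bij_betw (%s. s *\<^sub>R ?e) P (body Int anchor_line)"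
 proof (rule bij_betw_imageI)
  show "inj_on (%s. s *\<^sub>R ?e) P" by (auto simp: inj_on_def)
  show "(%s. s *\<^sub>R ?e) ` P = body Int anchor_line"
  proof
   show "(%s. s *\<^sub>R ?e) ` P \<subseteq> body Int anchor_line" by (auto simp: P_def anchor_line_def axis_def)
   show "body Int anchor_line \<subseteq> (%s. s *\<^sub>R ?e) ` P"
   proof
    fix x assume x: "x : body Int anchor_line"
    then have "x = (x $ 3) *\<^sub>R ?e" by (simp add: anchor_line_def vec_eq_iff forall_3 axis_def)
    then show "x : (%s. s *\<^sub>R ?e) ` P" using x unfolding P_def by (metis (mono_tags, lifting) IntD1 image_eqI mem_Collect_eq)
   qed
  qed
 qed
 have finP: "finite P" using bij fin bij_betw_finite by blast
 obtain R where R: "!!x. norm x > R ==> ~ inside x" using not_inside_far by blast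
 have "False \<longleftrightarrow> odd (card P)"
 proof (rule far_right_of_flips[OF finP, where b = "%s. inside (s *\<^sub>R ?e)" and R = "\<bar>R\<bar>"])
  fix s assume "s ~: P"
  then have "s *\<^sub>R ?e : - body" by (simp add: P_def)
  then obtain e where e: "e > 0" "ball (s *\<^sub>R ?e) e \<subseteq> - body" using closed_body openE open_Compl by blast
  have "inside (s' *\<^sub>R ?e) = inside (s *\<^sub>R ?e)" if "\<bar>s' - s\<bar> < e" for s'
  proof (rule inside_convex[of "ball (s *\<^sub>R ?e) e"])
   have "s *\<^sub>R ?e - s' *\<^sub>R ?e = (s - s') *\<^sub>R ?e" by (simp add: algebra_simps)
   then show "s' *\<^sub>R ?e : ball (s *\<^sub>R ?e) e" using that by (simp add: dist_norm abs_minus_commute)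
  qed (use e in auto)
  then show "EX eps>0. ALL s'. \<bar>s' - s\<bar> < eps --> inside (s' *\<^sub>R ?e) = inside (s *\<^sub>R ?e)" using e(1) by blast
 next
  fix p assume "p : P"
  then have p: "p *\<^sub>R ?e : body Int anchor_line" using bij by (auto simp: bij_betw_def)
  obtain r where r: "r > 0" "F Int ball (p *\<^sub>R ?e) r \<subseteq> body" using loc[OF p] by blast
  have "p *\<^sub>R ?e : body" using p by blast
  from anchor_flip[OF tr[OF p] bF this r]
  show "EX eps>0. EX c. ALL s. 0 < s --> s < eps --> inside ((p + s) *\<^sub>R ?e) = c & inside ((p - s) *\<^sub>R ?e) = (~ c)"
   by (simp add: scaleR_left_distrib scaleR_left_diff_distrib)
 next
  show "~ inside (s *\<^sub>R ?e)" if "s < - \<bar>R\<bar>" for s using R[of "s *\<^sub>R ?e"] that by simp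
  show "inside (s *\<^sub>R ?e) = False" if "s > \<bar>R\<bar>" for s using R[of "s *\<^sub>R ?e"] that by simp
 qed
 then show ?thesis using bij_betw_same_card[OF bij] by simp
qed

end

section \<open>Points with a planar neighborhood and germs of homeomorphisms\<close>

definition loc_plane :: "'a::euclidean_space set => 'a => bool" where
 "loc_plane X x \<longleftrightarrow> (EX U (V::complex set). openin (top_of_set X) U & x : U & open V & U homeomorphic V)"

lemma openin_homeomorphism_image:
 assumes "homeomorphism U V f g" "openin (top_of_set U) W"
 shows "openin (top_of_set V) (f ` W)"
 using homeomorphism_imp_open_map[OF assms] .

lemma openin_Int_subset:
 assumes "openin (top_of_set X) U" "S \<subseteq> X"
 shows "openin (top_of_set S) (S Int U)"
proof -
 obtain T where "open T" "U = X Int T" using assms(1) by (auto simp: openin_open)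
 then show ?thesis using assms(2) unfolding openin_open by blast
qed

text \<open>Invariance of domain, transported by a planar chart of \<open>X\<close>: an injective
  continuous image of a plane domain covers a neighborhood of any planar point on it.\<close>

lemma disc_interior:
 fixes X :: "'a::euclidean_space set" and \<psi> :: "complex => 'a"
 assumes lp: "loc_plane X (\<psi> z0)" and V: "open V" "z0 : V" and \<psi>: "continuous_on V \<psi>" "inj_on \<psi> V" "\<psi> ` V \<subseteq> X"
 obtains W where "openin (top_of_set X) W" "\<psi> z0 : W" "W \<subseteq> \<psi> ` V"
proof -
 obtain U and V0 :: "complex set" where U: "openin (top_of_set X) U" "\<psi> z0 : U" "open V0" "U homeomorphic V0"
  using lp unfolding loc_plane_def by blast
 obtain f g where fg: "homeomorphism U V0 f g" using U(4) unfolding homeomorphic_def by blast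
 define V' where "V' = V Int \<psi> -` U"
 have oV': "open V'"
 proof -
  have "openin (top_of_set V) V'"
   unfolding V'_def by (rule continuous_openin_preimage[OF \<psi>(1) _ U(1)]) (use \<psi>(3) in auto)
  then show ?thesis using V(1) by (simp add: openin_open_eq)
 qed
 have sub: "\<psi> ` V' \<subseteq> U" by (auto simp: V'_def)
 have cf: "continuous_on U f" and injf: "!!a. a : U ==> g (f a) = a" and fU: "f ` U = V0"
  using fg by (auto simp: homeomorphism_def)
 have cont: "continuous_on V' (f \<circ> \<psi>)"
 proof (rule continuous_on_compose)
  show "continuous_on V' \<psi>" using \<psi>(1) by (rule continuous_on_subset) (auto simp: V'_def)
  show "continuous_on (\<psi> ` V') f" using cf sub by (rule continuous_on_subset)
 qed
 have inj: "inj_on (f \<circ> \<psi>) V'"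
 proof (rule inj_onI)
  fix a b assume ab: "a : V'" "b : V'" "(f \<circ> \<psi>) a = (f \<circ> \<psi>) b"
  then have "\<psi> a : U" "\<psi> b : U" using sub by auto
  then have "\<psi> a = \<psi> b" using ab(3) injf by (metis comp_apply)
  then show "a = b" using \<psi>(2) ab(1,2) unfolding inj_on_def V'_def by blast
 qed
 have "open ((f \<circ> \<psi>) ` V')" by (rule invariance_of_domain[OF cont oV' inj])
 then have "openin (top_of_set V0) ((f \<circ> \<psi>) ` V')" using fU sub U(3) by (subst openin_open_eq) auto
 then have "openin (top_of_set U) (g ` (f \<circ> \<psi>) ` V')"
  using openin_homeomorphism_image[OF homeomorphism_symD[OF fg]] by blast
 moreover have "g ` (f \<circ> \<psi>) ` V' = \<psi> ` V'"
 proof -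
  have "g ((f \<circ> \<psi>) a) = \<psi> a" if "a : V'" for a using that sub injf by auto
  then show ?thesis by (simp add: image_image)
 qed
 ultimately have "openin (top_of_set U) (\<psi> ` V')" by simp
 then have "openin (top_of_set X) (\<psi> ` V')" using U(1) by (rule openin_trans)
 moreover have "\<psi> z0 : \<psi> ` V'" using V U(2) by (auto simp: V'_def)
 moreover have "\<psi> ` V' \<subseteq> \<psi> ` V" by (auto simp: V'_def)
 ultimately show ?thesis by (rule that)
qed

text \<open>The obstruction used at seams: a disc through the point together with further points of
  \<open>X\<close> accumulating there.\<close>

lemma not_loc_planeI:
 fixes X :: "'a::euclidean_space set" and \<psi> :: "complex => 'a"
 assumes V: "open V" "z0 : V" and \<psi>: "continuous_on V \<psi>" "inj_on \<psi> V" "\<psi> ` V \<subseteq> X"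
  and cl: "\<psi> z0 : closure (X - \<psi> ` V)"
 shows "~ loc_plane X (\<psi> z0)"
proof
 assume "loc_plane X (\<psi> z0)"
 then obtain W where W: "openin (top_of_set X) W" "\<psi> z0 : W" "W \<subseteq> \<psi> ` V"
  by (rule disc_interior[OF _ V \<psi>])
 obtain O' where O': "open O'" "W = X Int O'" using W(1) by (auto simp: openin_open)
 have "\<psi> z0 : O'" using W(2) O'(2) by simp
 then have "O' Int (X - \<psi> ` V) ~= {}" using cl O'(1) open_Int_closure_eq_empty[of O' "X - \<psi> ` V"] by auto
 then show False using W(3) O'(2) by blast
qed

lemma loc_plane_chart:
 fixes X :: "'a::euclidean_space set" and \<psi> :: "complex => 'a"
 assumes Z: "compact Z" "z0 : interior Z" and \<psi>: "continuous_on Z \<psi>" "inj_on \<psi> Z" "\<psi> ` Z \<subseteq> X"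
  and W: "openin (top_of_set X) W" "\<psi> z0 : W" "W \<subseteq> \<psi> ` Z"
 shows "loc_plane X (\<psi> z0)"
proof -
 obtain \<rho> where h: "homeomorphism Z (\<psi> ` Z) \<psi> \<rho>" using homeomorphism_compact[OF Z(1) \<psi>(1) refl \<psi>(2)] by blast
 have cr: "continuous_on (\<psi> ` Z) \<rho>" and rz: "!!z. z : Z ==> \<rho> (\<psi> z) = z" using h by (auto simp: homeomorphism_def)
 have "continuous_on W \<rho>" using cr W(3) by (rule continuous_on_subset)
 then have op: "openin (top_of_set W) (W Int \<rho> -` interior Z)"
  by (rule continuous_openin_preimage_gen) simp
 define U where "U = W Int \<rho> -` interior Z"
 have U: "openin (top_of_set X) U" unfolding U_def using op W(1) by (rule openin_trans)
 have "\<psi> z0 : U" using W(2) Z(2) rz[of z0] interior_subset[of Z] by (auto simp: U_def)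
 moreover have "open (\<rho> ` U)"
 proof -
  have "openin (top_of_set (\<psi> ` Z)) U"
   by (rule openin_subset_trans[OF U _ \<psi>(3)]) (use W(3) U_def in auto)
  then have "openin (top_of_set Z) (\<rho> ` U)" by (rule openin_homeomorphism_image[OF homeomorphism_symD[OF h]])
  then obtain O' where O': "open O'" "\<rho> ` U = Z Int O'" by (auto simp: openin_open)
  have "\<rho> ` U = interior Z Int O'"
  proof -
   have "\<rho> ` U \<subseteq> interior Z" by (auto simp: U_def)
   then show ?thesis using O'(2) interior_subset[of Z] by blast
  qed
  then show ?thesis using open_Int[OF open_interior O'(1)] by metis
 qed
 moreover have "U homeomorphic \<rho> ` U"
 proof -
  have "U \<subseteq> \<psi> ` Z" using W(3) U_def by auto
  moreover have "\<psi> ` \<rho> ` U = U"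
  proof -
   have "\<psi> (\<rho> a) = a" if "a : U" for a using that \<open>U \<subseteq> \<psi> ` Z\<close> h by (auto simp: homeomorphism_def)
   then show ?thesis by (simp add: image_image)
  qed
  ultimately have "homeomorphism U (\<rho> ` U) \<rho> \<psi>"
   by (intro homeomorphism_of_subsets[OF homeomorphism_symD[OF h]]) (use U_def rz W(3) in \<open>force+\<close>)
  then show ?thesis unfolding homeomorphic_def by blast
 qed
 ultimately show ?thesis unfolding loc_plane_def using U by blast
qed

text \<open>Much weaker than \<open>loc_plane\<close>: some injective open disc passes through
  \<open>x\<close>. It holds at every point of a foam, including seams, and excludes free edges and
  parts of dimension below two.\<close>

definition disc_at :: "'a::euclidean_space set => 'a => bool" where
 "disc_at X x \<longleftrightarrow> (EX V (\<psi>::complex => 'a) z0. open V & z0 : V & continuous_on V \<psi> & inj_on \<psi> V & \<psi> ` V \<subseteq> X & \<psi> z0 = x)"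

text \<open>Through \<open>\<rho>\<close> a disc in \<open>Y\<close> would become an open subset of
  the plane contained in a closed half plane and touching its boundary.\<close>

lemma not_disc_at:
 fixes X :: "'a::euclidean_space set" and \<rho> :: "'a => complex"
 assumes e: "e > 0" "X Int ball x e \<subseteq> Y" and \<rho>: "continuous_on Y \<rho>" "inj_on \<rho> Y"
  and pos: "!!y. y : Y ==> Re (\<rho> y) >= 0" and x: "Re (\<rho> x) = 0"
 shows "~ disc_at X x"
proof
 assume "disc_at X x"
 then obtain V and \<psi> :: "complex => 'a" and z0 where V: "open V" "z0 : V" "continuous_on V \<psi>" "inj_on \<psi> V" "\<psi> ` V \<subseteq> X" "\<psi> z0 = x"
  unfolding disc_at_def by blast
 define V' where "V' = V Int \<psi> -` ball x e"
 have oV': "open V'" unfolding V'_def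
  using continuous_open_preimage[OF V(3,1) open_ball[of x e]] .
 have sub: "\<psi> ` V' \<subseteq> Y" using V(5) e(2) by (auto simp: V'_def)
 have "open ((\<rho> \<circ> \<psi>) ` V')"
 proof (rule invariance_of_domain[OF _ oV'])
  show "continuous_on V' (\<rho> \<circ> \<psi>)"
  proof (rule continuous_on_compose)
   show "continuous_on V' \<psi>" using V(3) by (rule continuous_on_subset) (auto simp: V'_def)
   show "continuous_on (\<psi> ` V') \<rho>" using \<rho>(1) sub by (rule continuous_on_subset)
  qed
  show "inj_on (\<rho> \<circ> \<psi>) V'"
  proof (rule comp_inj_on)
   show "inj_on \<psi> V'" using V(4) by (rule inj_on_subset) (auto simp: V'_def)
   show "inj_on \<rho> (\<psi> ` V')" using \<rho>(2) sub by (rule inj_on_subset)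
  qed
 qed
 moreover have "\<rho> x : (\<rho> \<circ> \<psi>) ` V'" using V e(1) by (force simp: V'_def)
 ultimately obtain d where d: "d > 0" "ball (\<rho> x) d \<subseteq> (\<rho> \<circ> \<psi>) ` V'" by (rule openE)
 have "\<rho> x - complex_of_real (d / 2) : ball (\<rho> x) d" using d(1) by (simp add: dist_norm)
 then have "\<rho> x - complex_of_real (d / 2) : (\<rho> \<circ> \<psi>) ` V'" using d(2) by blast
 then obtain a where a: "a : V'" "\<rho> (\<psi> a) = \<rho> x - complex_of_real (d / 2)" unfolding image_def comp_apply mem_Collect_eq by metis
 have "Re (\<rho> (\<psi> a)) >= 0" by (rule pos) (use a(1) sub in auto)
 then show False using a(2) x d(1) by simp
qed

text \<open>A homeomorphism between open neighborhoods of corresponding points; all that is retained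
  of a chart between the foam and a local model.\<close>

locale germ =
 fixes X :: "'a::euclidean_space set" and x :: 'a and Y :: "'a set" and y :: 'a and U U' :: "'a set" and g g' :: "'a => 'a"
 assumes openU: "openin (top_of_set X) U" and openU': "openin (top_of_set Y) U'" and xU: "x : U"
  and homeo: "homeomorphism U U' g g'" and gx: "g x = y"
begin

lemma sym: "germ Y y X x U' U g' g"
 using openU openU' xU homeomorphism_symD[OF homeo] gx homeo unfolding germ_def homeomorphism_def by auto

lemma gg: "q : U ==> g' (g q) = q" "q : U ==> g q : U'" "r : U' ==> g (g' r) = r" "r : U' ==> g' r : U"
 and yU: "y : U'" and UX: "U \<subseteq> X" and UY: "U' \<subseteq> Y" and cont: "continuous_on U g" "continuous_on U' g'"
 using homeo xU gx openin_imp_subset[OF openU] openin_imp_subset[OF openU'] by (auto simp: homeomorphism_def)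

lemma g'y: "g' y = x" using gg(1)[OF xU] gx by simp

lemma lp_imp:
 assumes q: "q : U" and lp: "loc_plane X q"
 shows "loc_plane Y (g q)"
proof -
 obtain W and V :: "complex set" where W: "openin (top_of_set X) W" "q : W" "open V" "W homeomorphic V"
  using lp unfolding loc_plane_def by blast
 obtain f f' where f: "homeomorphism W V f f'" using W(4) unfolding homeomorphic_def by blast
 define W' where "W' = W Int U"
 have oW: "openin (top_of_set W) W'" "openin (top_of_set U) W'"
  using openin_Int_subset[OF openU openin_imp_subset[OF W(1)]] openin_Int_subset[OF W(1) UX]
  unfolding W'_def by (simp_all add: Int_commute)
 have "openin (top_of_set V) (f ` W')" by (rule openin_homeomorphism_image[OF f oW(1)])
 then have 1: "open (f ` W')" using W(3) by (simp add: openin_open_eq)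
 have "homeomorphism W' (f ` W') f f'" by (rule homeomorphism_of_subsets[OF f]) (auto simp: W'_def)
 then have 2: "W' homeomorphic f ` W'" unfolding homeomorphic_def by blast
 have "homeomorphism W' (g ` W') g g'" by (rule homeomorphism_of_subsets[OF homeo]) (auto simp: W'_def)
 then have "W' homeomorphic g ` W'" unfolding homeomorphic_def by blast
 then have 3: "g ` W' homeomorphic f ` W'" using 2 homeomorphic_sym homeomorphic_trans by blast
 have "openin (top_of_set Y) (g ` W')"
  using openin_trans[OF openin_homeomorphism_image[OF homeo oW(2)] openU'] .
 moreover have "g q : g ` W'" using q W(2) by (auto simp: W'_def)
 ultimately show ?thesis unfolding loc_plane_def using 1 3 by blast
qed

lemma lp_iff: "q : U ==> loc_plane X q \<longleftrightarrow> loc_plane Y (g q)"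
 using lp_imp germ.lp_imp[OF sym, of "g q"] gg by auto

lemma small:
 assumes "d > 0"
 obtains e where "e > 0" "!!q. q : X ==> dist x q < e ==> q : U & g q : U' & dist y (g q) < d"
proof -
 obtain O' where O': "open O'" "U = X Int O'" using openU by (auto simp: openin_open)
 have "openin (top_of_set U) (U Int g -` ball y d)" by (rule continuous_openin_preimage_gen[OF cont(1)]) simp
 then have "openin (top_of_set X) (U Int g -` ball y d)" using openU by (rule openin_trans)
 then obtain O2 where O2: "open O2" "U Int g -` ball y d = X Int O2" by (auto simp: openin_open)
 have "x : U Int g -` ball y d" using xU gx assms by simp
 then have "x : O2" unfolding O2(2) by simp
 with O2(1) obtain e where e: "e > 0" "ball x e \<subseteq> O2" by (rule openE)
 have sub: "X Int ball x e \<subseteq> U Int g -` ball y d" unfolding O2(2) using e(2) by auto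
 show ?thesis
 proof (rule that[OF e(1)])
  fix q assume "q : X" "dist x q < e"
  then have "q : U Int g -` ball y d" by (intro subsetD[OF sub]) simp
  then show "q : U & g q : U' & dist y (g q) < d" using gg(2) by simp
 qed
qed

lemma at_point:
 assumes "q : U" shows "germ X q Y (g q) U U' g g'"
 using assms openU openU' homeo unfolding germ_def by auto

lemma closure_imp:
 assumes "q : U" "S \<subseteq> X" "q : closure S"
 shows "g q : closure (g ` (S Int U))"
 unfolding closure_approachable
proof (intro allI impI)
 fix d :: real assume d: "d > 0"
 interpret q: germ X q Y "g q" U U' g g' by (rule at_point[OF assms(1)])
 obtain e where e: "e > 0" "!!s. s : X ==> dist q s < e ==> s : U & g s : U' & dist (g q) (g s) < d"
  using q.small[OF d] by blast
 obtain s where s: "s : S" "dist s q < e" using assms(3) e(1) unfolding closure_approachable by blast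
 then have "s : U" "dist (g s) (g q) < d" using e(2)[of s] assms(2) by (auto simp: dist_commute)
 then show "EX y:g ` (S Int U). dist y (g q) < d" using s(1) by blast
qed

lemma connected_image:
 assumes "connected S" "S \<subseteq> U'"
 shows "connected (g' ` S)"
 using connected_continuous_image[OF continuous_on_subset[OF cont(2) assms(2)] assms(1)] .

text \<open>Near corresponding points, each sector of the second family meets at most one sector of the first.\<close>

lemma card_sectors_le:
 assumes P: "finite \<P>" "disjoint \<P>" "!!P. P : \<P> ==> openin (top_of_set (\<Union>\<P>)) P" "!!P. P : \<P> ==> x : closure P" "\<Union>\<P> \<subseteq> X"
  and Q: "finite \<Q>" "!!Q d. Q : \<Q> ==> connected (Q Int ball y d)" "\<Union>\<Q> \<subseteq> Y"
  and e: "e > 0" "!!q. q : X Int ball x e ==> q : U ==> q : \<Union>\<P> \<longleftrightarrow> g q : \<Union>\<Q>"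
 shows "card \<P> <= card \<Q>"
proof -
 obtain d where d: "d > 0" "!!c. c : Y ==> dist y c < d ==> c : U' & g' c : U & dist x (g' c) < e"
  using germ.small[OF sym e(1)] by blast
 obtain e' where e': "e' > 0" "!!q. q : X ==> dist x q < e' ==> q : U & g q : U' & dist y (g q) < d"
  using small[OF d(1)] by blast
 have "EX Q q. Q : \<Q> & q : P & q : U & g q : Q Int ball y d" if PP: "P : \<P>" for P
 proof -
  have "min e e' > 0" using e(1) e'(1) by simp
  then obtain q where q: "q : P" "dist q x < min e e'" using P(4)[OF PP] unfolding closure_approachable by blast
  have qX: "q : X Int ball x e" "q : X" "dist x q < e'" using q P(5) PP by (auto simp: dist_commute)
  then have "q : U" "g q : ball y d" using e'(2)[of q] by simp_all
  moreover have "g q : \<Union>\<Q>" using e(2)[OF qX(1) \<open>q : U\<close>] q(1) PP by blast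
  ultimately show ?thesis using q(1) by blast
 qed
 then obtain \<phi> pt where \<phi>: "!!P. P : \<P> ==> \<phi> P : \<Q> & pt P : P & pt P : U & g (pt P) : \<phi> P Int ball y d"
  by metis
 have "inj_on \<phi> \<P>"
 proof (rule inj_onI, rule ccontr)
  fix P P' assume PP: "P : \<P>" "P' : \<P>" "\<phi> P = \<phi> P'" "P ~= P'"
  define C where "C = \<phi> P Int ball y d"
  have \<phi>P: "\<phi> P : \<Q>" using \<phi>[OF PP(1)] by blast
  have CY: "c : Y" "dist y c < d" if "c : C" for c using that Q(3) \<phi>P unfolding C_def by auto
  have CU: "C \<subseteq> U'" using d(2) CY by blast
  have con: "connected (g' ` C)" by (rule connected_image[OF Q(2)[OF \<phi>P, of d, folded C_def] CU])
  have sub: "g' ` C \<subseteq> \<Union>\<P>"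
  proof
   fix q assume "q : g' ` C"
   then obtain c where c: "c : C" "q = g' c" by blast
   have "q : U" "q : ball x e" using d(2)[OF CY[OF c(1)]] c(2) by simp_all
   moreover have "g q : \<Union>\<Q>" 
   proof
    show "g q : \<phi> P" using c gg(3) CU by (auto simp: C_def)
   qed (rule \<phi>P)
   ultimately show "q : \<Union>\<P>" using e(2)[of q] UX by auto
  qed
  have in1: "pt P : g' ` C" 
   using \<phi>[OF PP(1)] gg(1) unfolding C_def by (metis imageI)
  have in2: "pt P' : g' ` C" 
   using \<phi>[OF PP(2)] PP(3) gg(1) unfolding C_def by (metis imageI)
  have o1: "openin (top_of_set (g' ` C)) (g' ` C Int P)" 
   by (rule openin_Int_subset[OF P(3)[OF PP(1)] sub])
  have o2: "openin (top_of_set (g' ` C)) (g' ` C Int \<Union>(\<P> - {P}))"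
  proof -
   have "openin (top_of_set (\<Union>\<P>)) (\<Union>(\<P> - {P}))" by (rule openin_Union) (use P(3) in auto)
   then show ?thesis using sub by (rule openin_Int_subset)
  qed
  have "g' ` C Int P Int (g' ` C Int \<Union>(\<P> - {P})) = {}" 
   using P(2) PP(1) unfolding pairwise_def disjnt_def by blast
  moreover have "g' ` C \<subseteq> (g' ` C Int P) Un (g' ` C Int \<Union>(\<P> - {P}))" using sub PP(1) by blast
  moreover have "g' ` C Int P ~= {}" using in1 \<phi>[OF PP(1)] by blast
  moreover have "g' ` C Int \<Union>(\<P> - {P}) ~= {}" using in2 \<phi>[OF PP(2)] PP(2,4) by blast
  ultimately show False using con o1 o2 unfolding connected_openin by blast
 qed
 moreover have "\<phi> ` \<P> \<subseteq> \<Q>" using \<phi> by blast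
 ultimately show ?thesis using Q(1) card_inj_on_le by blast
qed

lemma disc_at_transfer:
 assumes "disc_at X x" shows "disc_at Y y"
proof -
 obtain V and \<psi> :: "complex => 'a" and z0 where V: "open V" "z0 : V" "continuous_on V \<psi>" "inj_on \<psi> V" "\<psi> ` V \<subseteq> X" "\<psi> z0 = x"
  using assms unfolding disc_at_def by blast
 define V' where "V' = V Int \<psi> -` U"
 have "openin (top_of_set V) V'"
  unfolding V'_def by (rule continuous_openin_preimage[OF V(3) _ openU]) (use V(5) in auto)
 then have oV': "open V'" using V(1) by (simp add: openin_open_eq)
 have sub: "\<psi> ` V' \<subseteq> U" by (auto simp: V'_def)
 have c: "continuous_on V' (g \<circ> \<psi>)"
 proof (rule continuous_on_compose)
  show "continuous_on V' \<psi>" using V(3) by (rule continuous_on_subset) (auto simp: V'_def)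
  show "continuous_on (\<psi> ` V') g" using cont(1) sub by (rule continuous_on_subset)
 qed
 have i: "inj_on (g \<circ> \<psi>) V'"
 proof (rule comp_inj_on)
  show "inj_on \<psi> V'" using V(4) by (rule inj_on_subset) (auto simp: V'_def)
  show "inj_on g (\<psi> ` V')" using sub gg(1) by (metis inj_on_inverseI subset_iff)
 qed
 have "(g \<circ> \<psi>) ` V' \<subseteq> Y" using sub gg(2) UY by auto
 moreover have "z0 : V'" "(g \<circ> \<psi>) z0 = y" using V xU gx by (auto simp: V'_def)
 ultimately show ?thesis unfolding disc_at_def using oV' c i by blast
qed

text \<open>Invariance of domain in the ambient space. It serves to exclude solid tetrahedra from a
  foam, as the local models have empty interior.\<close>

lemma interior_transfer:
 assumes "x : interior X"
 shows "y : closure (interior Y)" 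
proof -
 obtain e where e: "e > 0" "ball x e \<subseteq> X" using assms mem_interior by blast
 have "openin (top_of_set (ball x e)) (U Int ball x e)" 
  using openin_Int_subset[OF openU e(2)] by (simp add: Int_commute)
 then have o: "open (U Int ball x e)" by (simp add: openin_open_eq)
 have "open (g ` (U Int ball x e))"
 proof (rule invariance_of_domain[OF _ o])
  show "continuous_on (U Int ball x e) g" using cont(1) by (rule continuous_on_subset) auto
  show "inj_on g (U Int ball x e)" using gg(1) by (metis inj_on_inverseI IntD1)
 qed
 moreover have "g ` (U Int ball x e) \<subseteq> Y" using gg(2) UY by auto
 moreover have "y : g ` (U Int ball x e)" using xU gx e(1) by auto
 ultimately show ?thesis by (meson closure_subset interior_maximal subsetD)
qed

end

lemma loc_plane_near:
 assumes "loc_plane X x"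
 obtains e where "e > 0" "!!q. q : X ==> dist x q < e ==> loc_plane X q"
proof -
 obtain U and V :: "complex set" where U: "openin (top_of_set X) U" "x : U" "open V" "U homeomorphic V"
  using assms unfolding loc_plane_def by blast
 obtain e where e: "e > 0" "!!q. q : X ==> dist q x < e ==> q : U"
  using U(1,2) unfolding openin_euclidean_subtopology_iff by metis
 show ?thesis
 proof (rule that[OF e(1)])
  fix q assume "q : X" "dist x q < e"
  then have "q : U" using e(2)[of q] by (simp add: dist_commute)
  then show "loc_plane X q" unfolding loc_plane_def using U by blast
 qed
qed

text \<open>What the three local models share. \<open>H\<close> is the set of open sectors, and
  apart from the origin the remaining points are seam points, each in the closure of exactly three
  sectors. The last clause is the source of connected vertex links: if the sectors along each seam
  have distinct colors, those of two given colors together with the seams form a connected set in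
  every ball, although the origin is removed.\<close>

definition star_model :: "(real^3) set => (real^3) set set => bool" where
 "star_model M H \<longleftrightarrow> finite H & 0 : M & disc_at M 0 & interior M = {} &
  (ALL h:H. h \<subseteq> M - {0} & (ALL d. connected (h Int ball 0 d)) & (ALL y:h. loc_plane M y)) &
  (ALL y:M - {0} - \<Union>H. ~ loc_plane M y & card {h:H. y : closure h} = 3) &
  (ALL (col :: _ => nat) i j d. i ~= j --> i : {1,2,3} --> j : {1,2,3} --> col : H \<rightarrow> {1,2,3} -->
    (ALL y:M - {0} - \<Union>H. dist 0 y < d --> inj_on col {h:H. y : closure h}) -->
    connected ((\<Union>{h:H. col h : {i,j}} Un (M - {0} - \<Union>H)) Int ball 0 d))"

lemma interior_empty_of_planes:
 fixes M :: "(real^3) set"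
 assumes "finite A" "0 ~: A" "M \<subseteq> (\<Union>a\<in>A. {x. a \<bullet> x = 0})"
 shows "interior M = {}"
proof (rule ccontr)
 assume "interior M ~= {}"
 then have "~ negligible (interior M)" by (simp add: open_not_negligible)
 moreover have "negligible (\<Union>a\<in>A. {x. a \<bullet> x = 0})"
  by (rule negligible_Union) (use assms(1,2) in \<open>auto intro!: negligible_hyperplane\<close>)
 moreover have "interior M \<subseteq> (\<Union>a\<in>A. {x. a \<bullet> x = 0})" using interior_subset assms(3) by (rule order_trans)
 ultimately show False using negligible_subset by blast
qed

lemma connected_with_limits:
 assumes "connected (S Int ball 0 d)" "R \<subseteq> closure S"
 shows "connected ((S Un R) Int ball (0::'a::real_normed_vector) d)"
proof (rule connected_intermediate_closure[OF assms(1)])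
 have "ball 0 d Int closure S \<subseteq> closure (ball 0 d Int S)" by (rule open_Int_closure_subset) simp
 then show "(S Un R) Int ball 0 d \<subseteq> closure (S Int ball 0 d)"
  using assms(2) closure_subset[of "S Int ball 0 d"] by (auto simp: Int_commute)
qed auto

lemma inj_three_surj:
 assumes "inj_on (c :: _ => nat) A" "card A = 3" "c ` A \<subseteq> {1,2,3}"
 shows "c ` A = {1,2,3}"
 using assms by (intro card_seteq) (auto simp: card_image)

subsection \<open>The disk\<close>

lemma disk_loc_plane:
 assumes "y : disk_model"
 shows "loc_plane disk_model y"
proof -
 have "homeomorphism disk_model (UNIV::complex set) (%x. Complex (x$1) (x$2)) (%z. \<chi> i. if i = 1 then Re z else if i = 2 then Im z else 0)"
  unfolding homeomorphism_def
 proof (intro conjI ballI)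
  show "continuous_on disk_model (%x. Complex (x$1) (x$2))" by (intro continuous_intros)
  have "continuous_on UNIV (%z. if i = 1 then Re z else if i = 2 then Im z else 0)" for i :: 3
   by (cases "i = 1"; cases "i = 2") (auto intro: continuous_intros)
  then show "continuous_on UNIV (%z. (\<chi> i. if i = 1 then Re z else if i = 2 then Im z else 0)::real^3)"
   by (rule continuous_on_vec_lambda)
  show "(%x. Complex (x$1) (x$2)) ` disk_model = UNIV"
  proof (intro equalityI subsetI)
   fix z :: complex
   have "(\<chi> i. if i = 1 then Re z else if i = 2 then Im z else 0) : disk_model" by (simp add: disk_model_def)
   then show "z : (%x. Complex (x$1) (x$2)) ` disk_model" by (force intro: image_eqI)
  qed simp
  show "(%z. (\<chi> i. if i = 1 then Re z else if i = 2 then Im z else 0)) ` UNIV = disk_model"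
  proof (intro equalityI subsetI)
   fix x assume "x : disk_model"
   then show "x : (%z. (\<chi> i. if i = 1 then Re z else if i = 2 then Im z else 0)) ` UNIV"
    by (intro image_eqI[of _ _ "Complex (x$1) (x$2)"]) (auto simp: vec_eq_iff forall_3 disk_model_def)
  qed (auto simp: disk_model_def)
 qed (auto simp: vec_eq_iff forall_3 disk_model_def)
 then have "disk_model homeomorphic (UNIV::complex set)" unfolding homeomorphic_def by blast
 then show ?thesis unfolding loc_plane_def using assms openin_topspace[of "top_of_set disk_model"] by (metis open_UNIV topspace_euclidean_subtopology)
qed

lemma disc_at_of_loc_plane:
 assumes "loc_plane X x"
 shows "disc_at X x"
proof -
 obtain U and V :: "complex set" where U: "openin (top_of_set X) U" "x : U" "open V" "U homeomorphic V"
  using assms unfolding loc_plane_def by blast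
 obtain f g where fg: "homeomorphism U V f g" using U(4) unfolding homeomorphic_def by blast
 have "continuous_on V g" "inj_on g V" "g ` V \<subseteq> X" "f x : V" "g (f x) = x"
  using fg U(2) openin_imp_subset[OF U(1)] by (auto simp: homeomorphism_def intro: inj_on_inverseI)
 then show ?thesis unfolding disc_at_def using U(3) by blast
qed

lemma subspace_disk: "subspace disk_model"
 unfolding disk_model_def by (auto simp: subspace_def)

text \<open>A punctured disc is a single connected sector and there are no seams, so the clause on
  colorings concerns either this sector or the empty set.\<close>

lemma star_model_disk: "star_model disk_model {disk_model - {0}}"
proof -
 have 0: "0 : disk_model" by (simp add: disk_model_def)
 have con: "connected ((disk_model - {0}) Int ball 0 d)" for d
 proof (cases "d > 0")
  case True
  have cv: "convex (disk_model Int ball 0 d)" by (intro convex_Int subspace_imp_convex[OF subspace_disk] convex_ball)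
  have "aff_dim (disk_model Int ball 0 d) = aff_dim disk_model"
   by (rule aff_dim_convex_Int_open[OF subspace_imp_convex[OF subspace_disk]]) (use 0 True in auto)
  also have "aff_dim disk_model = int (dim disk_model)" using subspace_disk by (rule aff_dim_subspace)
  also have "dim disk_model = 2"
  proof -
   have "disk_model = {x. axis 3 1 \<bullet> x = 0}" by (auto simp: disk_model_def inner_axis')
   then show ?thesis using dim_hyperplane[of "axis 3 1 :: real^3"] by (simp add: axis_eq_0_iff)
  qed
  finally have "aff_dim (disk_model Int ball 0 d) ~= 1" by simp
  then have "connected (disk_model Int ball 0 d - {0})" by (rule connected_punctured_convex[OF cv])
  moreover have "disk_model Int ball 0 d - {0} = (disk_model - {0}) Int ball 0 d" by auto
  ultimately show ?thesis by simp
 qed (simp add: ball_empty)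
 have int: "interior disk_model = {}"
 proof (rule interior_empty_of_planes)
  show "disk_model \<subseteq> (\<Union>a\<in>{axis 3 1}. {x. a \<bullet> x = 0})" by (auto simp: disk_model_def inner_axis')
 qed (auto simp: axis_eq_0_iff)
 have con2: "connected ((\<Union>{h:{disk_model - {0}}. col h : {i,j}} Un (disk_model - {0} - \<Union>{disk_model - {0}})) Int ball 0 d)" for col :: "_ => nat" and i j d
  by (cases "col (disk_model - {0}) : {i,j}") (use con[of d] in \<open>simp_all add: Collect_conv_if\<close>)
 show ?thesis unfolding star_model_def
 proof (intro conjI)
  show "disc_at disk_model 0" by (rule disc_at_of_loc_plane[OF disk_loc_plane[OF 0]])
  show "ALL h:{disk_model - {0}}. h \<subseteq> disk_model - {0} & (ALL d. connected (h Int ball 0 d)) & (ALL y:h. loc_plane disk_model y)"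
   using con disk_loc_plane by blast
  show "ALL y:disk_model - {0} - \<Union> {disk_model - {0}}. ~ loc_plane disk_model y & card {h : {disk_model - {0}}. y : closure h} = 3"
   by simp
 qed (use 0 int con2 in blast)+
qed

subsection \<open>The tripod\<close>

definition tc :: "(nat => real) => real => real^3" where
 "tc f s = (\<chi> i. if i = 1 then f 1 - f 0 else if i = 2 then f 2 - f 0 else s)"

text \<open>Coordinates along the three legs: their directions add up to zero, so a horizontal
  vector has a unique expression with nonnegative coefficients of which the least is 0. Leg 0 points
  in the direction opposite to the sum of the other two; \<open>tc\<close> recovers the point from
  the coefficients and the height.\<close>

definition tq :: "nat => real^3 => real" where
 "tq a x = (if a = 1 then x$1 else if a = 2 then x$2 else 0) - min 0 (min (x$1) (x$2))"

abbreviation "I3 \<equiv> {0,1,2::nat}"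

lemma tq_tc:
 assumes "!!a. a : I3 ==> f a >= 0" "b : I3" "f b = 0" "a : I3"
 shows "tq a (tc f s) = f a"
 using assms(1)[of 0] assms(1)[of 1] assms(1)[of 2] assms(2-4) by (auto simp: tq_def tc_def min_def)

lemma tc_3 [simp]: "tc f s $ 3 = s" by (simp add: tc_def)

lemma tc_tq: "tc (%a. tq a x) (x$3) = x"
 by (simp add: vec_eq_iff forall_3 tc_def tq_def)

lemma tq_nonneg: "tq a x >= 0" by (auto simp: tq_def)

lemma tc_cong: "(!!a. a : I3 ==> f a = f' a) ==> tc f s = tc f' s"
 by (simp add: tc_def vec_eq_iff)

lemma tq_cong:
 assumes "!!a. a : I3 ==> tq a x = tq a y" "x$3 = y$3"
 shows "x = y"
proof -
 have "tc (%a. tq a x) (x$3) = tc (%a. tq a y) (y$3)" unfolding assms(2) by (rule tc_cong) (rule assms(1))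
 then show ?thesis by (simp only: tc_tq)
qed

lemma tc_zero:
 assumes "!!b. b : I3 ==> tq b y = 0"
 shows "tc (%_. 0) (y$3) = y"
proof -
 have "tc (%_. 0) (y$3) = tc (%a. tq a y) (y$3)" by (rule tc_cong) (simp add: assms)
 then show ?thesis by (simp only: tc_tq)
qed

lemma cont_tq: "continuous_on S (tq a)"
 unfolding tq_def by (cases "a = 1"; cases "a = 2") (auto intro!: continuous_intros)

lemma cont_tc:
 assumes "!!a. a : I3 ==> continuous_on S (%z. f z a)" "continuous_on S s"
 shows "continuous_on S (%z. tc (f z) (s z))"
 unfolding tc_def
proof (rule continuous_on_vec_lambda)
 fix i :: 3
 show "continuous_on S (%z. if i = 1 then f z 1 - f z 0 else if i = 2 then f z 2 - f z 0 else s z)"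
  by (cases "i = 1"; cases "i = 2") (use assms in \<open>auto intro!: continuous_intros\<close>)
qed

definition th :: "nat => (real^3) set" where
 "th a = {x. tq a x > 0 & (ALL b:I3 - {a}. tq b x = 0)}"

lemma tripod_eq: "tripod_model = {x. EX a:I3. ALL b:I3 - {a}. tq b x = 0}"
proof (intro equalityI subsetI)
 fix x assume "x : tripod_model"
 then obtain r v s where x: "x = r *\<^sub>R v + s *\<^sub>R axis 3 1" "0 <= r" "v : {axis 1 1, axis 2 1, - axis 1 1 - axis 2 1}"
  unfolding tripod_model_def by blast
 then show "x : {x. EX a:I3. ALL b:I3 - {a}. tq b x = 0}"
  by (auto simp: tq_def axis_def)
next
 fix x assume "x : {x. EX a:I3. ALL b:I3 - {a}. tq b x = 0}"
 then obtain a where a: "a : I3" "ALL b:I3 - {a}. tq b x = 0" by blast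
 define v :: "real^3" where "v = (if a = 1 then axis 1 1 else if a = 2 then axis 2 1 else - axis 1 1 - axis 2 1)"
 have "x = tq a x *\<^sub>R v + (x$3) *\<^sub>R axis 3 1"
  using a tc_tq[of x] by (auto simp: vec_eq_iff forall_3 tc_def v_def axis_def)
 moreover have "v : {axis 1 1, axis 2 1, - axis 1 1 - axis 2 1}" by (simp add: v_def)
 ultimately show "x : tripod_model" unfolding tripod_model_def using tq_nonneg by blast
qed

lemma I3_other: "a : I3 ==> EX b:I3. b ~= a" by auto

lemma tripod_not_th: "y : tripod_model ==> y ~: \<Union>(th ` I3) ==> a : I3 ==> tq a y = 0"
proof (rule ccontr)
 assume y: "y : tripod_model" "y ~: \<Union>(th ` I3)" "a : I3" "tq a y ~= 0"
 then have p: "tq a y > 0" using tq_nonneg[of a y] by linarith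
 obtain b where b: "b : I3" "ALL c:I3 - {b}. tq c y = 0" using y(1) unfolding tripod_eq by blast
 then have "a = b" using y(3) p by (cases "a = b") auto
 then have "y : th a" using p b(2) unfolding th_def by simp
 then show False using y(2,3) by blast
qed

lemma tc_mem:
 assumes "a : I3" "t > 0"
 shows "tc (%b. if b = a then t else 0) s : th a" "tc (%b. if b = a then t else 0) s $ 3 = s"
proof -
 obtain b where b: "b : I3" "b ~= a" using I3_other[OF assms(1)] by blast
 have "tq c (tc (%b. if b = a then t else 0) s) = (if c = a then t else 0)" if "c : I3" for c
  using tq_tc[of "%b. if b = a then t else 0" b c s] b that assms(2) by simp
 then show "tc (%b. if b = a then t else 0) s : th a" using assms by (auto simp: th_def)
qed simp

lemma th_closure:
 assumes a: "a : I3" and y: "!!b. b : I3 ==> tq b y = 0"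
 shows "y : closure (th a)"
proof -
 define f where "f n = tc (%b. if b = a then inverse (real (Suc n)) else 0) (y$3)" for n
 have "f \<longlonglongrightarrow> tc (%b. 0) (y$3)"
  unfolding f_def tc_def
 proof (rule tendsto_vec_lambda)
  fix i :: 3
  show "(%n. if i = 1 then (if 1 = a then inverse (real (Suc n)) else 0) - (if 0 = a then inverse (real (Suc n)) else 0)
   else if i = 2 then (if 2 = a then inverse (real (Suc n)) else 0) - (if 0 = a then inverse (real (Suc n)) else 0) else y $ 3)
   \<longlonglongrightarrow> (if i = 1 then 0 - 0 else if i = 2 then 0 - 0 else y $ 3)"
   using LIMSEQ_inverse_real_of_nat tendsto_minus[OF LIMSEQ_inverse_real_of_nat] by (cases "i = 1"; cases "i = 2"; cases "a = 0"; cases "a = 1"; cases "a = 2") auto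
 qed
 moreover have "tc (%b. 0) (y$3) = y" by (rule tc_zero[OF y])
 moreover have "ALL n. f n : th a" unfolding f_def using tc_mem[OF a] by simp
 ultimately show ?thesis unfolding closure_sequential by auto
qed

lemma th_convex: assumes a: "a : I3" shows "convex (th a)"
proof (rule convexI)
 fix x y and u v :: real assume xy: "x : th a" "y : th a" and uv: "0 <= u" "0 <= v" "u + v = 1"
 obtain b where b: "b : I3" "b ~= a" using I3_other[OF a] by blast
 define f where "f c = u * tq c x + v * tq c y" for c
 have eq: "u *\<^sub>R x + v *\<^sub>R y = tc f (u * x$3 + v * y$3)"
  unfolding f_def by (subst (1) tc_tq[of x, symmetric], subst (1) tc_tq[of y, symmetric]) (simp add: vec_eq_iff forall_3 tc_def algebra_simps)
 have "tq c (u *\<^sub>R x + v *\<^sub>R y) = f c" if "c : I3" for c unfolding eq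
  by (rule tq_tc[of f b]) (use b that xy uv tq_nonneg in \<open>auto simp: f_def th_def\<close>)
 moreover have "f a > 0"
 proof (cases "u = 0")
  case False
  then have "u * tq a x > 0" using uv xy by (auto simp: th_def)
  then show ?thesis unfolding f_def using tq_nonneg[of a y] uv by (simp add: add_pos_nonneg)
 qed (use uv xy in \<open>auto simp: f_def th_def\<close>)
 moreover have "f c = 0" if "c : I3 - {a}" for c using that xy by (auto simp: f_def th_def)
 ultimately show "u *\<^sub>R x + v *\<^sub>R y : th a" using a by (simp add: th_def)
qed

lemma th_loc_plane:
 assumes a: "a : I3" and y: "y : th a"
 shows "loc_plane tripod_model y"
proof -
 have sub: "th a \<subseteq> tripod_model" using a by (auto simp: tripod_eq th_def)
 have "th a = tripod_model Int (tq a) -` {0<..}" 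
  using a tq_nonneg unfolding tripod_eq th_def by (auto; metis insertCI less_irrefl DiffI singletonD)
 moreover have "openin (top_of_set tripod_model) (tripod_model Int (tq a) -` {0<..})"
  by (rule continuous_openin_preimage_gen[OF cont_tq]) simp
 ultimately have op: "openin (top_of_set tripod_model) (th a)" by simp
 let ?V = "{z::complex. 0 < Re z}"
 let ?g = "%z. tc (%b. if b = a then Re z else 0) (Im z)"
 have g: "?g z : th a" "tq a (?g z) = Re z" if "z : ?V" for z
 proof -
  obtain b where b: "b : I3" "b ~= a" using I3_other[OF a] by blast
  show "?g z : th a" using tc_mem[OF a] that by simp
  show "tq a (?g z) = Re z" using tq_tc[of "%b. if b = a then Re z else 0" b a] b a that by simp
 qed
 have f: "?g (Complex (tq a x) (x$3)) = x" if "x : th a" for x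
 proof (rule tq_cong)
  obtain b where b: "b : I3" "b ~= a" using I3_other[OF a] by blast
  fix c assume c: "c : I3"
  have "tq c (tc (%b. if b = a then tq a x else 0) (x$3)) = (if c = a then tq a x else 0)"
   by (rule tq_tc[of _ b]) (use b c tq_nonneg[of a x] in auto)
  then show "tq c (?g (Complex (tq a x) (x$3))) = tq c x"
   unfolding complex.sel using c that by (cases "c = a") (simp_all add: th_def)
 qed simp
 have "homeomorphism (th a) ?V (%x. Complex (tq a x) (x$3)) ?g"
  unfolding homeomorphism_def
 proof (intro conjI ballI)
  show "continuous_on (th a) (%x. Complex (tq a x) (x$3))" by (intro continuous_intros cont_tq)
  have "continuous_on ?V (%z. if b = a then Re z else 0)" for b by (cases "b = a") (auto intro: continuous_intros)
  then show "continuous_on ?V ?g" by (intro cont_tc continuous_intros)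
  show "(%x. Complex (tq a x) (x$3)) ` th a = ?V"
  proof (intro equalityI subsetI)
   fix z assume "z : ?V" then show "z : (%x. Complex (tq a x) (x$3)) ` th a" 
    by (intro image_eqI[of _ _ "?g z"]) (use g in auto)
  qed (auto simp: th_def)
  show "?g ` ?V = th a"
  proof (intro equalityI subsetI)
   fix x assume "x : th a" then show "x : ?g ` ?V" 
    by (intro image_eqI[of _ _ "Complex (tq a x) (x$3)"]) (use f in \<open>auto simp: th_def\<close>)
  qed (use g in auto)
 qed (use f g in auto)
 then have "th a homeomorphic ?V" unfolding homeomorphic_def by blast
 moreover have "open ?V" by (intro open_Collect_less continuous_intros)
 ultimately show ?thesis unfolding loc_plane_def using op y by blast
qed

lemma two_page:
 fixes z z' :: complex
 assumes "max (Re z) 0 = max (Re z') 0" "max (- Re z) 0 = max (- Re z') 0" "Im z = Im z'"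
 shows "z = z'"
 using assms by (auto simp: complex_eq_iff max_def split: if_splits)

text \<open>The legs 1 and 2 form an embedded plane through the axis that misses leg 0. It provides
  the disc at the origin and, since leg 0 accumulates on the axis, the obstruction to
  planarity.\<close>

lemma tripod_pages:
 obtains \<psi> :: "complex => real^3" where "continuous_on UNIV \<psi>" "inj \<psi>" "range \<psi> \<subseteq> tripod_model - th 0"
  "!!s. \<psi> (Complex 0 s) = tc (%_. 0) s"
proof -
 define f :: "complex => nat => real" where "f z b = (if b = 1 then max (Re z) 0 else if b = 2 then max (- Re z) 0 else 0)" for z b
 define \<psi> where "\<psi> z = tc (f z) (Im z)" for z
 have q: "tq a (\<psi> z) = f z a" if "a : I3" for a z
  unfolding \<psi>_def by (rule tq_tc[of _ 0]) (use that in \<open>auto simp: f_def\<close>)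
 have "continuous_on UNIV (%z. f z a)" for a
  unfolding f_def by (cases "a = 1"; cases "a = 2") (auto intro!: continuous_intros)
 then have c: "continuous_on UNIV \<psi>" unfolding \<psi>_def by (intro cont_tc continuous_intros) 
 have i: "inj \<psi>"
 proof (rule injI)
  fix z z' assume e: "\<psi> z = \<psi> z'"
  have "Im z = Im z'" using arg_cong[OF e, of "%x. x$3"] by (simp add: \<psi>_def)
  then show "z = z'" using q[of 1 z] q[of 1 z'] q[of 2 z] q[of 2 z'] e by (intro two_page) (auto simp: f_def)
 qed
 have r: "\<psi> z : tripod_model - th 0" for z
  using q[of 0 z] q[of 1 z] q[of 2 z] by (auto simp: tripod_eq th_def f_def max_def)
 have z: "\<psi> (Complex 0 s) = tc (%_. 0) s" for s
  unfolding \<psi>_def by (simp only: complex.sel) (rule tc_cong, simp add: f_def)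
 from r have r': "range \<psi> \<subseteq> tripod_model - th 0" by blast
 show ?thesis by (rule that[OF c i r' z])
qed

lemma tripod_not_loc_plane:
 assumes y: "!!b. b : I3 ==> tq b y = 0"
 shows "~ loc_plane tripod_model y"
proof -
 obtain \<psi> where \<psi>: "continuous_on UNIV \<psi>" "inj \<psi>" "range \<psi> \<subseteq> tripod_model - th 0" "!!s. \<psi> (Complex 0 s) = tc (%_. 0) s"
  using tripod_pages by blast
 have eq: "\<psi> (Complex 0 (y$3)) = y" using \<psi>(4)[of "y$3"] tc_zero[OF y] by simp
 have "~ loc_plane tripod_model (\<psi> (Complex 0 (y$3)))"
 proof (rule not_loc_planeI[OF open_UNIV _ \<psi>(1,2)])
  have "th 0 \<subseteq> tripod_model - range \<psi>" using \<psi>(3) by (auto simp: tripod_eq th_def)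
  then show "\<psi> (Complex 0 (y $ 3)) : closure (tripod_model - range \<psi>)"
   unfolding eq using th_closure[of 0 y] y closure_mono by blast
 qed (use \<psi>(3) in auto)
 then show ?thesis by (simp add: eq)
qed

lemma tq_0: "tq a 0 = 0" by (simp add: tq_def)

lemma th_sub: "a : I3 ==> th a \<subseteq> tripod_model - {0}"
 using tq_0 by (force simp: tripod_eq th_def)

lemma inj_th: "inj_on th I3"
proof (rule inj_onI)
 fix a b assume ab: "a : I3" "b : I3" "th a = th b"
 have "tc (%b. if b = a then 1 else 0) 0 : th a" using tc_mem(1)[OF ab(1), of 1 0] by simp
 then have "tq a (tc (%b. if b = a then 1 else 0) 0) > 0" "tc (%b. if b = a then 1 else 0) 0 : th b" 
  unfolding ab(3)[symmetric] by (simp_all add: th_def)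
 then show "a = b" using ab(1) unfolding th_def by (cases "a = b") auto
qed

lemma tripod_facts:
 "card (th ` I3) = 3"
 "0 : tripod_model"
 "!!y. y : tripod_model ==> y ~: \<Union>(th ` I3) ==> ~ loc_plane tripod_model y"
 "!!y h. y : tripod_model ==> y ~: \<Union>(th ` I3) ==> h : th ` I3 ==> y : closure h"
 "0 ~: \<Union>(th ` I3)"
 "disjoint (th ` I3)"
proof -
 show "card (th ` I3) = 3" using card_image[OF inj_th] by simp
 show "0 : tripod_model" by (simp add: tripod_eq tq_0)
 show "~ loc_plane tripod_model y" if "y : tripod_model" "y ~: \<Union>(th ` I3)" for y
  by (rule tripod_not_loc_plane) (rule tripod_not_th[OF that])
 show "y : closure h" if "y : tripod_model" "y ~: \<Union>(th ` I3)" "h : th ` I3" for y h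
  using that(3) th_closure tripod_not_th[OF that(1,2)] by blast
 show "0 ~: \<Union>(th ` I3)" using th_sub by blast
 show "disjoint (th ` I3)"
  unfolding pairwise_def disjnt_def th_def by force
qed

lemma star_model_tripod: "star_model tripod_model (th ` I3)"
proof -
 let ?H = "th ` I3" and ?R = "tripod_model - {0} - \<Union>(th ` I3)"
 have con: "connected (th a Int ball 0 d)" if "a : I3" for a d
  by (intro convex_connected convex_Int th_convex[OF that] convex_ball)
 have cl: "{h:?H. y : closure h} = ?H" if "y : ?R" for y using tripod_facts(4)[of y] that by blast
 have con2: "connected ((\<Union>{h:?H. col h : {i,j}} Un ?R) Int ball 0 d)"
  if ij: "i ~= j" "i : {1,2,3}" "j : {1,2,3}" and col: "col : ?H \<rightarrow> {1,2,3}"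
   and inj: "ALL y:?R. dist 0 y < d --> inj_on col {h:?H. y : closure h}" for col :: "_ => nat" and i j d
 proof (cases "d > 0")
  case True
  \<comment> \<open>A seam point in the ball. All three legs meet there, so the coloring takes all
    three values, and the pieces glued below have this point in common.\<close>
  define y0 :: "real^3" where "y0 = tc (%_. 0) (d/2)"
  have q0: "tq a y0 = 0" if "a : I3" for a unfolding y0_def by (rule tq_tc[of _ 0]) (use that in auto)
  have y03: "y0 = (d/2) *\<^sub>R axis 3 1" by (simp add: y0_def tc_def vec_eq_iff forall_3 axis_def)
  then have n0: "dist 0 y0 < d" "y0 ~= 0" using True by (auto simp: axis_eq_0_iff)
  have y0: "y0 : ?R" using q0 n0 by (force simp: tripod_eq th_def)
  have "inj_on col ?H" using inj[rule_format, OF y0 n0(1)] unfolding cl[OF y0] .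
  then have surj: "col ` ?H = {1,2,3}" 
  proof (rule inj_three_surj[OF _ tripod_facts(1)])
   show "col ` ?H \<subseteq> {1,2,3}" using col by blast
  qed
  have "i : col ` ?H" unfolding surj by (rule ij(2))
  then obtain h0 where "h0 : ?H" "i = col h0" by (rule imageE)
  then have h0: "h0 : {h:?H. col h : {i,j}}" by simp
  have eq: "(\<Union>{h:?H. col h : {i,j}} Un ?R) Int ball 0 d = \<Union>((%h. (h Un ?R) Int ball 0 d) ` {h:?H. col h : {i,j}})"
   using h0 by blast
  show ?thesis unfolding eq
  proof (rule connected_Union)
   fix s assume "s : (%h. (h Un ?R) Int ball 0 d) ` {h:?H. col h : {i,j}}"
   then obtain a where s: "s = (th a Un ?R) Int ball 0 d" "a : I3" by blast
   have "?R \<subseteq> closure (th a)" using tripod_facts(4) s(2) by blast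
   then show "connected s" unfolding s(1) by (rule connected_with_limits[OF con[OF s(2)]])
  next
   have "y0 : (h Un ?R) Int ball 0 d" for h using y0 n0(1) by simp
   then have "y0 : \<Inter>((%h. (h Un ?R) Int ball 0 d) ` {h:?H. col h : {i,j}})" by blast
   then show "\<Inter>((%h. (h Un ?R) Int ball 0 d) ` {h:?H. col h : {i,j}}) ~= {}" by blast
  qed
 qed (simp add: ball_empty)
 have int: "interior tripod_model = {}"
 proof (rule interior_empty_of_planes)
  show "tripod_model \<subseteq> (\<Union>a\<in>{axis 1 1, axis 2 1, axis 1 1 - axis 2 1}. {x. a \<bullet> x = 0})"
  proof
   fix x assume "x : tripod_model"
   then obtain a where a: "a : I3" "ALL b:I3 - {a}. tq b x = 0" unfolding tripod_eq by blast
   have f: "b ~= a ==> tq b x = 0" if "b : I3" for b using a(2) that by blast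
   have "(tq 1 x = 0 & tq 2 x = 0) \<or> (tq 0 x = 0 & tq 2 x = 0) \<or> (tq 0 x = 0 & tq 1 x = 0)"
    using f[of 0] f[of 1] f[of 2] by (cases "a = 0"; cases "a = 1") simp_all
   then have "x$1 = x$2 \<or> x$2 = 0 \<or> x$1 = 0" unfolding tq_def by simp linarith
   then show "x : (\<Union>a\<in>{axis 1 1, axis 2 1, axis 1 1 - axis 2 1}. {x. a \<bullet> x = 0})"
    by (elim disjE) (simp_all add: inner_diff_left inner_axis')
  qed
 qed (auto simp: axis_eq_0_iff axis_eq_axis)
 have disc: "disc_at tripod_model 0"
 proof -
  obtain \<psi> where \<psi>: "continuous_on UNIV \<psi>" "inj \<psi>" "range \<psi> \<subseteq> tripod_model - th 0" "!!s. \<psi> (Complex 0 s) = tc (%_. 0) s"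
   using tripod_pages by blast
  have "\<psi> (Complex 0 0) = 0" unfolding \<psi>(4) by (simp add: tc_def vec_eq_iff)
  then show ?thesis unfolding disc_at_def using \<psi>(1-3) by (intro exI[of _ UNIV] exI[of _ \<psi>] exI[of _ "Complex 0 0"]) auto
 qed
 show ?thesis unfolding star_model_def
 proof (intro conjI)
  show "ALL h:?H. h \<subseteq> tripod_model - {0} & (ALL d. connected (h Int ball 0 d)) & (ALL y:h. loc_plane tripod_model y)"
   using con th_sub th_loc_plane by blast
  show "ALL y:?R. ~ loc_plane tripod_model y & card {h : ?H. y : closure h} = 3"
   using cl tripod_facts(1,3) by simp
  show "ALL (col :: _ => nat) i j d. i ~= j --> i : {1,2,3} --> j : {1,2,3} --> col : ?H \<rightarrow> {1,2,3} -->
    (ALL y:?R. dist 0 y < d --> inj_on col {h:?H. y : closure h}) -->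
    connected ((\<Union>{h:?H. col h : {i,j}} Un ?R) Int ball 0 d)"
   using con2 by blast
 qed (use int disc tripod_facts(2) in auto)
qed

subsection \<open>The cone over the 1-skeleton of a tetrahedron\<close>

definition kc :: "(nat => real) => real^3" where
 "kc f = (\<chi> i. if i = 1 then f 1 - f 0 else if i = 2 then f 2 - f 0 else f 3 - f 0)"

definition km :: "real^3 => real" where
 "km x = min 0 (min (x$1) (min (x$2) (x$3)))"

text \<open>Coordinates along the four rays through the vertices of the tetrahedron: their
  directions add up to zero, and the least coefficient is normalized to 0. In these terms the cone
  over the 1-skeleton is the set of points with at most two nonzero coefficients.\<close>

definition kq :: "nat => real^3 => real" where
 "kq a x = (if a = 1 then x$1 else if a = 2 then x$2 else if a = 3 then x$3 else 0) - km x"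

definition I4 :: "nat set" where "I4 = {0,1,2,3}"

lemma I4_simps [simp]: "0 : I4" "1 : I4" "Suc 0 : I4" "2 : I4" "3 : I4" "finite I4" "card I4 = 4"
 by (simp_all add: I4_def)

lemma kq_kc:
 assumes "!!a. a : I4 ==> f a >= 0" "b : I4" "f b = 0" "a : I4"
 shows "kq a (kc f) = f a"
proof -
 have "min 0 (min (f 1 - f 0) (min (f 2 - f 0) (f 3 - f 0))) = - f 0"
 proof -
  have "f 0 = 0 \<or> f 1 = 0 \<or> f 2 = 0 \<or> f 3 = 0" using assms(2,3) unfolding I4_def by (elim insertE emptyE) simp_all
  moreover have "f 0 >= 0" "f 1 >= 0" "f 2 >= 0" "f 3 >= 0" using assms(1) by simp_all
  ultimately show ?thesis unfolding min_def by (elim disjE) simp_all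
 qed
 then have "km (kc f) = - f 0" by (simp add: km_def kc_def)
 then show ?thesis using assms(4) unfolding I4_def by (elim insertE emptyE) (simp_all add: kq_def kc_def)
qed

lemma kc_kq: "kc (%a. kq a x) = x"
proof -
 have d: "kq 1 x - kq 0 x = x$1" "kq 2 x - kq 0 x = x$2" "kq 3 x - kq 0 x = x$3" by (simp_all add: kq_def)
 have "kc (%a. kq a x) $ i = x $ i" for i
  using exhaust_3[of i] by (elim disjE) (simp_all add: kc_def d[simplified])
 then show ?thesis by (simp add: vec_eq_iff)
qed

lemma kq_nonneg: "kq a x >= 0" by (auto simp: kq_def km_def)

lemma kq_0: "kq a 0 = 0" by (simp add: kq_def km_def)

lemma kc_cong:
 assumes "!!a. a : I4 ==> f a = f' a"
 shows "kc f = kc f'"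
proof -
 have "f 0 = f' 0" "f 1 = f' 1" "f 2 = f' 2" "f 3 = f' 3" by (rule assms, simp)+
 then show ?thesis unfolding kc_def by (simp only:)
qed

lemma kc_lin: "u *\<^sub>R kc f + v *\<^sub>R kc g = kc (%a. u * f a + v * g a)"
 unfolding vec_eq_iff
proof
 fix i :: 3
 show "(u *\<^sub>R kc f + v *\<^sub>R kc g) $ i = kc (%a. u * f a + v * g a) $ i"
  by (cases "i = 1"; cases "i = 2") (simp_all add: kc_def right_diff_distrib)
qed

lemma kq_cong:
 assumes "!!a. a : I4 ==> kq a x = kq a y"
 shows "x = y"
proof -
 have "kc (%a. kq a x) = kc (%a. kq a y)" by (rule kc_cong) (rule assms(1))
 then show ?thesis by (simp only: kc_kq)
qed

lemma cont_kq: "continuous_on S (kq a)"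
 unfolding kq_def km_def by (cases "a = 1"; cases "a = 2"; cases "a = 3") (auto intro!: continuous_intros)

lemma cont_kc:
 assumes "!!a. a : I4 ==> continuous_on S (%z. f z a)"
 shows "continuous_on S (%z. kc (f z))"
 unfolding kc_def
proof (rule continuous_on_vec_lambda)
 fix i :: 3
 show "continuous_on S (%z. if i = 1 then f z 1 - f z 0 else if i = 2 then f z 2 - f z 0 else f z 3 - f z 0)"
  by (cases "i = 1"; cases "i = 2") (use assms in \<open>auto intro!: continuous_intros\<close>)
qed

definition kw :: "nat => real^3" where "kw a = kc (%b. if b = a then 1 else 0)"

lemma tetrahedron_vertices_eq: "tetrahedron_vertices = kw ` I4"
proof -
 have "kw 1 = axis 1 1" "kw 2 = axis 2 1" "kw 3 = axis 3 1" "kw 0 = - axis 1 1 - axis 2 1 - axis 3 1"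
  by (simp_all add: kw_def kc_def vec_eq_iff forall_3 axis_def)
 then show ?thesis unfolding tetrahedron_vertices_def I4_def by auto
qed

definition ks :: "nat => nat => (real^3) set" where
 "ks a b = {x. kq a x > 0 & kq b x > 0 & (ALL c:I4 - {a,b}. kq c x = 0)}"

definition kr :: "nat => (real^3) set" where
 "kr a = {x. kq a x > 0 & (ALL c:I4 - {a}. kq c x = 0)}"

definition pt :: "nat => nat => real => real => real^3" where
 "pt a b s t = kc (%c. if c = a then s else if c = b then t else 0)"

lemma I4_third: "a : I4 ==> b : I4 ==> EX c:I4. c ~= a & c ~= b"
 unfolding I4_def by (elim insertE emptyE) simp_all

lemma I4_fourth:
 obtains d where "d : I4" "d ~= a" "d ~= b" "d ~= c"
proof -
 have "~ I4 \<subseteq> {a,b,c}"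
 proof
  assume "I4 \<subseteq> {a,b,c}"
  then have "card I4 <= card {a,b,c}" by (rule card_mono[rotated]) simp
  moreover have "card {a,b,c} <= 3" by (simp add: card_insert_if)
  moreover have "card I4 = 4" by simp
  ultimately show False by simp
 qed
 then obtain d where d: "d : I4" "d ~: {a,b,c}" unfolding subset_iff by metis
 show thesis by (rule that[OF d(1)]) (use d(2) in simp_all)
qed

lemma kq_pt:
 assumes "a : I4" "b : I4" "s >= 0" "t >= 0" "c : I4"
 shows "kq c (pt a b s t) = (if c = a then s else if c = b then t else 0)"
proof -
 obtain d where "d : I4" "d ~= a" "d ~= b" using I4_third[OF assms(1,2)] by blast
 then show ?thesis unfolding pt_def by (intro kq_kc[of _ d]) (use assms in auto)
qed

lemma pt_kq:
 assumes "!!c. c : I4 - {a,b} ==> kq c x = 0" "a ~= b"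
 shows "pt a b (kq a x) (kq b x) = x"
proof -
 have "pt a b (kq a x) (kq b x) = kc (%c. kq c x)" unfolding pt_def by (rule kc_cong) (use assms in auto)
 then show ?thesis by (simp only: kc_kq)
qed

lemma tetra_eq: "tetrahedron_cone_model = {x. EX a:I4. EX b:I4. a ~= b & (ALL c:I4 - {a,b}. kq c x = 0)}"
proof (intro equalityI subsetI)
 fix x assume "x : tetrahedron_cone_model"
 then obtain r y u v where x: "x = r *\<^sub>R y" "0 <= r" "u : kw ` I4" "v : kw ` I4" "u ~= v" "y : closed_segment u v"
  unfolding tetrahedron_cone_model_def tetrahedron_vertices_eq by blast
 from x(3) obtain a where a: "u = kw a" "a : I4" by (rule imageE)
 from x(4) obtain b where b: "v = kw b" "b : I4" by (rule imageE)
 obtain t where t: "0 <= t" "t <= 1" "y = (1 - t) *\<^sub>R u + t *\<^sub>R v" using x(6) unfolding in_segment by blast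
 have ab: "a ~= b" using x(5) a b by blast
 have "x = (r * (1 - t)) *\<^sub>R kw a + (r * t) *\<^sub>R kw b" using x(1) t(3) a b by (simp add: algebra_simps)
 also have "\<dots> = pt a b (r * (1 - t)) (r * t)" unfolding kw_def kc_lin pt_def by (rule kc_cong) (use ab in auto)
 finally have "kq c x = 0" if "c : I4 - {a,b}" for c
  using kq_pt[OF a(2) b(2), of "r * (1 - t)" "r * t" c] t x(2) that by auto
 then show "x : {x. EX a:I4. EX b:I4. a ~= b & (ALL c:I4 - {a,b}. kq c x = 0)}"
  by (intro CollectI bexI[OF _ a(2)] bexI[OF _ b(2)] conjI ballI ab)
next
 fix x assume "x : {x. EX a:I4. EX b:I4. a ~= b & (ALL c:I4 - {a,b}. kq c x = 0)}"
 then obtain a b where ab': "a : I4" "b : I4" "a ~= b" "ALL c:I4 - {a,b}. kq c x = 0" by (elim CollectE bexE conjE) (rule that)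
 note ab = ab'(1-3) bspec[OF ab'(4)]
 define s t where "s = kq a x" and "t = kq b x"
 have st: "s >= 0" "t >= 0" using kq_nonneg by (auto simp: s_def t_def)
 have "x = pt a b s t" unfolding s_def t_def by (rule pt_kq[OF ab(4,3), symmetric])
 also have "\<dots> = s *\<^sub>R kw a + t *\<^sub>R kw b" unfolding kw_def kc_lin pt_def by (rule kc_cong) (use ab(3) in auto)
 finally have x: "x = s *\<^sub>R kw a + t *\<^sub>R kw b" .
 have ne: "kw a ~= kw b"
 proof
  assume e: "kw a = kw b"
  have "kw a = pt a b 1 0" "kw b = pt a b 0 1" unfolding kw_def pt_def by (rule kc_cong; use ab(3) in auto)+
  then show False using e kq_pt[OF ab(1,2), of 1 0 a] kq_pt[OF ab(1,2), of 0 1 a] ab(1) by simp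
 qed
 define y where "y = (if s + t = 0 then kw a else (1 - t / (s + t)) *\<^sub>R kw a + (t / (s + t)) *\<^sub>R kw b)"
 have "y : closed_segment (kw a) (kw b)"
  using st unfolding y_def in_segment by (auto intro!: exI[of _ "t / (s + t)"] simp: divide_le_eq_1)
 moreover have "x = (s + t) *\<^sub>R y"
 proof (cases "s + t = 0")
  case True
  then have "s = 0" "t = 0" using st by linarith+
  then show ?thesis using x by simp
 next
  case False
  have "(s + t) *\<^sub>R y = ((s + t) * (1 - t / (s + t))) *\<^sub>R kw a + ((s + t) * (t / (s + t))) *\<^sub>R kw b"
   using False by (simp add: y_def scaleR_right_distrib)
  moreover have "(s + t) * (t / (s + t)) = t" "(s + t) * (1 - t / (s + t)) = s" using False by (simp_all add: field_simps)
  ultimately show ?thesis using x by simp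
 qed
 ultimately show "x : tetrahedron_cone_model"
  unfolding tetrahedron_cone_model_def tetrahedron_vertices_eq using st
  by (intro CollectI exI[of _ "s + t"] exI[of _ y] exI[of _ "kw a"] exI[of _ "kw b"] conjI imageI ab ne) simp_all
qed

lemma ks_sub:
 assumes "a : I4" "b : I4" "a ~= b"
 shows "ks a b \<subseteq> tetrahedron_cone_model - {0}"
proof
 fix x assume x: "x : ks a b"
 have "x : tetrahedron_cone_model" unfolding tetra_eq
  by (intro CollectI bexI[OF _ assms(1)] bexI[OF _ assms(2)] conjI assms(3)) (use x in \<open>simp add: ks_def\<close>)
 moreover have "kq a x ~= kq a 0" using x by (simp add: ks_def kq_0)
 ultimately show "x : tetrahedron_cone_model - {0}" by blast
qed

lemma kr_sub:
 assumes a: "a : I4"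
 shows "kr a \<subseteq> tetrahedron_cone_model - {0}"
proof
 fix x assume x: "x : kr a"
 obtain b where b: "b : I4" "b ~= a" using I4_third[OF a a] by blast
 have "x : tetrahedron_cone_model" unfolding tetra_eq
  by (intro CollectI bexI[OF _ a] bexI[OF _ b(1)] conjI b(2)[symmetric]) (use x in \<open>simp add: kr_def\<close>)
 moreover have "kq a x ~= kq a 0" using x by (simp add: kr_def kq_0)
 ultimately show "x : tetrahedron_cone_model - {0}" by blast
qed

lemma ks_commute: "ks a b = ks b a"
proof -
 have e: "I4 - {a, b} = I4 - {b, a}" by (simp only: insert_commute)
 show ?thesis unfolding ks_def e by (rule Collect_cong) (rule conj_left_commute)
qed

lemma kq_same:
 assumes "x : ks a b" "x : ks c d" "c : I4" "d : I4"
 shows "{c, d} \<subseteq> {a, b}"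
proof -
 have "kq c x > 0" "kq d x > 0" using assms(2) by (simp_all add: ks_def)
 moreover have "ALL e:I4 - {a,b}. kq e x = 0" using assms(1) by (simp add: ks_def)
 ultimately have "~ (c : I4 - {a,b})" "~ (d : I4 - {a,b})" by (metis less_irrefl)+
 then show ?thesis using assms(3,4) by blast
qed

lemma tetra_cases:
 assumes "x : tetrahedron_cone_model" "x ~= 0"
 obtains a b where "a : I4" "b : I4" "a ~= b" "x : ks a b" | a where "a : I4" "x : kr a"
proof -
 obtain a b where ab': "a : I4" "b : I4" "a ~= b" "ALL c:I4 - {a,b}. kq c x = 0"
  using assms(1) unfolding tetra_eq by (elim CollectE bexE conjE) (rule that)
 note ab = ab'(1-3) bspec[OF ab'(4)]
 have "kq a x > 0 \<or> kq a x = 0" "kq b x > 0 \<or> kq b x = 0" using kq_nonneg[of a x] kq_nonneg[of b x] by linarith+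
 moreover have "kq a x ~= 0 \<or> kq b x ~= 0"
 proof (rule ccontr)
  assume "~ ?thesis"
  then have "kq c x = kq c 0" if "c : I4" for c using ab(4)[of c] that kq_0[of c] by (cases "c = a"; cases "c = b") auto
  then show False using kq_cong assms(2) by blast
 qed
 moreover have "x : ks a b" if "kq a x > 0" "kq b x > 0" using that ab(4) by (simp add: ks_def)
 moreover have "x : kr a" if "kq a x > 0" "kq b x = 0"
  unfolding kr_def mem_Collect_eq
 proof (intro conjI ballI that(1))
  fix c assume "c : I4 - {a}"
  then show "kq c x = 0" using ab(4)[of c] that(2) by (cases "c = b") simp_all
 qed
 moreover have "x : kr b" if "kq a x = 0" "kq b x > 0"
  unfolding kr_def mem_Collect_eq
 proof (intro conjI ballI that(2))
  fix c assume "c : I4 - {b}"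
  then show "kq c x = 0" using ab(4)[of c] that(1) by (cases "c = a") simp_all
 qed
 ultimately consider "x : ks a b" | "x : kr a" | "x : kr b" by blast
 then show ?thesis
  by cases (rule that(1)[OF ab(1-3)] that(2)[OF ab(1)] that(2)[OF ab(2)]; assumption)+
qed

lemma ks_closure:
 assumes ab: "a : I4" "b : I4" "a ~= b" and y: "y : kr a"
 shows "y : closure (ks a b)"
proof -
 define f where "f n = pt a b (kq a y) (inverse (real (Suc n)))" for n
 have "f \<longlonglongrightarrow> pt a b (kq a y) 0"
  unfolding f_def pt_def kc_def
 proof (rule tendsto_vec_lambda)
  fix i :: 3
  have l: "(%n. if c = a then kq a y else if c = b then inverse (real (Suc n)) else 0) \<longlonglongrightarrow> (if c = a then kq a y else if c = b then 0 else 0)" for c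
   using LIMSEQ_inverse_real_of_nat by (cases "c = a"; cases "c = b") auto
  show "(%n. if i = 1 then (if 1 = a then kq a y else if 1 = b then inverse (real (Suc n)) else 0) - (if 0 = a then kq a y else if 0 = b then inverse (real (Suc n)) else 0)
   else if i = 2 then (if 2 = a then kq a y else if 2 = b then inverse (real (Suc n)) else 0) - (if 0 = a then kq a y else if 0 = b then inverse (real (Suc n)) else 0)
   else (if 3 = a then kq a y else if 3 = b then inverse (real (Suc n)) else 0) - (if 0 = a then kq a y else if 0 = b then inverse (real (Suc n)) else 0))
   \<longlonglongrightarrow> (if i = 1 then (if 1 = a then kq a y else if 1 = b then 0 else 0) - (if 0 = a then kq a y else if 0 = b then 0 else 0)
   else if i = 2 then (if 2 = a then kq a y else if 2 = b then 0 else 0) - (if 0 = a then kq a y else if 0 = b then 0 else 0)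
   else (if 3 = a then kq a y else if 3 = b then 0 else 0) - (if 0 = a then kq a y else if 0 = b then 0 else 0))"
   using tendsto_diff[OF l l] by (cases "i = 1"; cases "i = 2") (simp_all only: if_True if_False simp_thms)
 qed
 moreover have "pt a b (kq a y) 0 = y"
  using pt_kq[of a b y] ab y unfolding kr_def by simp
 moreover have "f n : ks a b" for n 
  unfolding ks_def f_def mem_Collect_eq using kq_pt[OF ab(1,2), of "kq a y" "inverse (real (Suc n))"] kq_nonneg[of a y] ab y
  unfolding kr_def by auto
 ultimately show ?thesis unfolding closure_sequential by auto
qed

lemma ks_not_closure:
 assumes y: "y : kr a" and a: "a : I4" "a ~= b" "a ~= c"
 shows "y ~: closure (ks b c)"
proof -
 have "closed {x. kq a x = 0}" by (intro closed_Collect_eq cont_kq continuous_on_const)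
 moreover have "ks b c \<subseteq> {x. kq a x = 0}" unfolding ks_def using a by auto
 ultimately have "closure (ks b c) \<subseteq> {x. kq a x = 0}" by (simp add: closure_minimal)
 then show ?thesis using y unfolding kr_def by auto
qed

lemma ks_convex: assumes ab: "a : I4" "b : I4" "a ~= b" shows "convex (ks a b)"
proof (rule convexI)
 fix x y and u v :: real assume xy: "x : ks a b" "y : ks a b" and uv: "0 <= u" "0 <= v" "u + v = 1"
 obtain d where d: "d : I4" "d ~= a" "d ~= b" using I4_third[OF ab(1,2)] by blast
 define f where "f c = u * kq c x + v * kq c y" for c
 have eq: "u *\<^sub>R x + v *\<^sub>R y = kc f"
  unfolding f_def by (subst (1) kc_kq[of x, symmetric], subst (1) kc_kq[of y, symmetric]) (rule kc_lin)
 have "kq c (u *\<^sub>R x + v *\<^sub>R y) = f c" if "c : I4" for c unfolding eq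
  by (rule kq_kc[of f d]) (use d that xy uv kq_nonneg in \<open>auto simp: f_def ks_def\<close>)
 moreover have "f c > 0" if "c : {a, b}" for c
 proof (cases "u = 0")
  case False
  then have "u * kq c x > 0" using uv xy that by (auto simp: ks_def)
  then show ?thesis unfolding f_def using kq_nonneg[of c y] uv by (simp add: add_pos_nonneg)
 qed (use uv xy that in \<open>auto simp: f_def ks_def\<close>)
 moreover have "f c = 0" if "c : I4 - {a,b}" for c using that xy by (auto simp: f_def ks_def)
 ultimately show "u *\<^sub>R x + v *\<^sub>R y : ks a b" using ab unfolding ks_def by simp
qed

lemma kr_convex_ball_point:
 assumes "a : I4" "d > 0"
 obtains y where "y : kr a" "dist 0 y < d"
proof -
 define t where "t = d / (2 * (norm (kw a) + 1))"
 have t: "t > 0" using assms(2) by (simp add: t_def add_nonneg_pos)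
 have e: "t *\<^sub>R kw a = pt a a t t" unfolding kw_def pt_def
  by (simp add: kc_def vec_eq_iff)
 have "t *\<^sub>R kw a : kr a" unfolding kr_def e using kq_pt[OF assms(1) assms(1), of t t] t assms(1) by auto
 moreover have "dist 0 (t *\<^sub>R kw a) < d"
 proof -
  have "t * norm (kw a) <= t * (norm (kw a) + 1)" using t by simp
  also have "\<dots> = d / 2"
  proof -
   have "norm (kw a) + 1 ~= 0" using norm_ge_zero[of "kw a"] by linarith
   then show ?thesis unfolding t_def by (simp add: divide_simps)
  qed
  finally show ?thesis using t assms(2) by simp
 qed
 ultimately show ?thesis by (rule that)
qed

lemma ks_openin:
 assumes ab: "a : I4" "b : I4" "a ~= b"
 shows "openin (top_of_set tetrahedron_cone_model) (ks a b)"
proof -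
 have "ks a b = tetrahedron_cone_model Int ({x. 0 < kq a x} Int {x. 0 < kq b x})"
 proof (intro equalityI subsetI)
  fix x assume x: "x : tetrahedron_cone_model Int ({x. 0 < kq a x} Int {x. 0 < kq b x})"
  then obtain a' b' where ab': "ALL c:I4 - {a',b'}. kq c x = 0" unfolding tetra_eq by (elim IntE CollectE bexE conjE) (rule that)
  have pos: "kq a x > 0" "kq b x > 0" using x by simp_all
  have "~ (a : I4 - {a',b'})" "~ (b : I4 - {a',b'})" using ab' pos by (metis less_irrefl)+
  then have "{a',b'} = {a,b}" using ab by blast
  then show "x : ks a b" unfolding ks_def using ab' pos by simp
 qed (use ks_sub[OF ab] in \<open>auto simp: ks_def\<close>)
 moreover have "open ({x. 0 < kq a x} Int {x. 0 < kq b x})"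
  by (intro open_Int open_Collect_less cont_kq continuous_on_const)
 ultimately show ?thesis by (simp add: openin_open_Int)
qed

lemma ks_loc_plane:
 assumes ab: "a : I4" "b : I4" "a ~= b" and y: "y : ks a b"
 shows "loc_plane tetrahedron_cone_model y"
proof -
 let ?V = "{z::complex. 0 < Re z} Int {z. 0 < Im z}"
 let ?g = "%z. pt a b (Re z) (Im z)" and ?f = "%x. Complex (kq a x) (kq b x)"
 have g: "?g z : ks a b" "?f (?g z) = z" if "z : ?V" for z
  using kq_pt[OF ab(1,2), of "Re z" "Im z"] that ab unfolding ks_def by (auto simp: complex_eq_iff)
 have f: "?g (?f x) = x" "?f x : ?V" if "x : ks a b" for x
  using pt_kq[of a b x] that ab(3) unfolding ks_def by auto
 have "homeomorphism (ks a b) ?V ?f ?g"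
  unfolding homeomorphism_def
 proof (intro conjI ballI)
  show "continuous_on (ks a b) ?f" by (intro continuous_intros cont_kq)
  have "continuous_on ?V (%z. if c = a then Re z else if c = b then Im z else 0)" for c 
   by (cases "c = a"; cases "c = b") (auto intro: continuous_intros)
  then show "continuous_on ?V ?g" unfolding pt_def by (intro cont_kc)
  show "?f ` ks a b = ?V"
  proof (intro equalityI subsetI)
   fix z assume "z : ?V" then show "z : ?f ` ks a b" by (intro image_eqI[of _ _ "?g z"] g(2)[symmetric] g(1))
  next
   fix z assume "z : ?f ` ks a b" then show "z : ?V" using f(2) by (elim imageE) simp
  qed
  show "?g ` ?V = ks a b"
  proof (intro equalityI subsetI)
   fix x assume "x : ks a b" then show "x : ?g ` ?V" by (intro image_eqI[of _ _ "?f x"] f(1)[symmetric] f(2))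
  next
   fix x assume "x : ?g ` ?V" then show "x : ks a b" by (elim imageE) (simp only: g)
  qed
 qed (simp_all only: f g)
 then have "ks a b homeomorphic ?V" unfolding homeomorphic_def by blast
 moreover have "open ?V" by (intro open_Int open_Collect_less continuous_intros)
 ultimately show ?thesis unfolding loc_plane_def using ks_openin[OF ab] y by blast
qed

text \<open>Three sectors meet along a ray. Two of them form a disc around its point, and the third
  accumulates there.\<close>

lemma kr_not_loc_plane:
 assumes a: "a : I4" and y: "y : kr a"
 shows "~ loc_plane tetrahedron_cone_model y"
proof -
 have "EX b:I4. EX c:I4. EX d:I4. b ~= a & c ~= a & d ~= a & b ~= c & b ~= d & c ~= d"
  by (metis I4_fourth)
 then obtain b c d where I: "b : I4" "c : I4" "d : I4" "b ~= a" "c ~= a" "d ~= a" "b ~= c" "b ~= d" "c ~= d" by blast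
 define f :: "complex => nat => real" where
  "f z e = (if e = a then Im z else if e = b then max (Re z) 0 else if e = c then max (- Re z) 0 else 0)" for z e
 define V where "V = {z::complex. 0 < Im z}"
 have fa: "f w a = Im w" for w by (simp add: f_def)
 have fb: "f w b = max (Re w) 0" for w unfolding f_def using I(4) by simp
 have fc: "f w c = max (- Re w) 0" for w unfolding f_def using I(5,7) by simp
 have fd: "f w d = 0" for w unfolding f_def using I(6,8,9) by simp
 have f0: "f w e >= 0" if "w : V" for w e using that by (simp add: f_def V_def)
 have q: "kq e (kc (f z)) = f z e" if "e : I4" "z : V" for e z
  by (rule kq_kc[where f = "f z" and b = d and a = e]) (rule f0[OF that(2)] I(3) fd that(1))+
 define z0 where "z0 = Complex 0 (kq a y)"
 have z0: "z0 : V" using y by (simp add: V_def z0_def kr_def)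
 have eq: "kc (f z0) = y"
 proof (rule kq_cong)
  fix e assume e: "e : I4"
  have "f z0 e = (if e = a then kq a y else 0)" by (simp add: f_def z0_def)
  also have "\<dots> = kq e y"
  proof (cases "e = a")
   case False
   then have "e : I4 - {a}" using e by blast
   then show ?thesis using y False unfolding kr_def by simp
  qed simp
  finally show "kq e (kc (f z0)) = kq e y" unfolding q[OF e z0] .
 qed
 have "~ loc_plane tetrahedron_cone_model (kc (f z0))"
 proof (rule not_loc_planeI[OF _ z0])
  show "open V" unfolding V_def by (intro open_Collect_less continuous_intros)
  have "continuous_on V (%z. f z e)" for e
   unfolding f_def by (cases "e = a"; cases "e = b"; cases "e = c") (auto intro!: continuous_intros)
  then show "continuous_on V (%z. kc (f z))" by (rule cont_kc)
  show "inj_on (%z. kc (f z)) V"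
  proof (rule inj_onI)
   fix z z' assume zz: "z : V" "z' : V" "kc (f z) = kc (f z')"
   have e: "f z e = f z' e" if "e : I4" for e using q[OF that zz(1)] q[OF that zz(2)] zz(3) by simp
   show "z = z'" using e[OF I(1)] e[OF I(2)] e[OF a] unfolding fa fb fc by (rule two_page)
  qed
  show "(%z. kc (f z)) ` V \<subseteq> tetrahedron_cone_model"
  proof (rule image_subsetI)
   fix z assume z: "z : V"
   show "kc (f z) : tetrahedron_cone_model"
   proof (cases "Re z >= 0")
    case True
    then have "f z e = 0" if "e : I4 - {a,b}" for e using that by (simp add: f_def)
    then have "kq e (kc (f z)) = 0" if "e : I4 - {a,b}" for e using q[OF _ z, of e] that by (simp only: Diff_iff)
    then show ?thesis unfolding tetra_eq by (intro CollectI bexI[OF _ a] bexI[OF _ I(1)] conjI ballI I(4)[symmetric])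
   next
    case False
    then have "f z e = 0" if "e : I4 - {a,c}" for e using that by (simp add: f_def)
    then have "kq e (kc (f z)) = 0" if "e : I4 - {a,c}" for e using q[OF _ z, of e] that by (simp only: Diff_iff)
    then show ?thesis unfolding tetra_eq by (intro CollectI bexI[OF _ a] bexI[OF _ I(2)] conjI ballI I(5)[symmetric])
   qed
  qed
  have "ks a d \<subseteq> tetrahedron_cone_model - (%z. kc (f z)) ` V"
  proof
   fix x assume x: "x : ks a d"
   have "x ~= kc (f z)" if "z : V" for z
    using q[OF I(3) that] x unfolding fd ks_def by auto
   then show "x : tetrahedron_cone_model - (%z. kc (f z)) ` V" using ks_sub[OF a I(3) I(6)[symmetric]] x by blast
  qed
  moreover have "y : closure (ks a d)" by (rule ks_closure[OF a I(3) I(6)[symmetric] y])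
  ultimately show "kc (f z0) : closure (tetrahedron_cone_model - (%z. kc (f z)) ` V)"
   unfolding eq using closure_mono by blast
 qed
 then show ?thesis by (simp add: eq)
qed

text \<open>Planarity is an open condition, and the nonplanar points on the rays come arbitrarily
  close to the apex.\<close>

lemma tetra_zero_not_loc_plane: "~ loc_plane tetrahedron_cone_model 0"
proof
 assume "loc_plane tetrahedron_cone_model 0"
 then obtain e where e: "e > 0" "!!q. q : tetrahedron_cone_model ==> dist 0 q < e ==> loc_plane tetrahedron_cone_model q"
  using loc_plane_near by blast
 obtain y where "y : kr 0" "dist 0 y < e" using kr_convex_ball_point[of 0 e] e(1) by auto
 then show False using e(2)[of y] kr_sub[of 0] kr_not_loc_plane[of 0 y] by auto
qed

definition ksec :: "(real^3) set set" where
 "ksec = {ks 0 1, ks 0 2, ks 0 3, ks 1 2, ks 1 3, ks 2 3}"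

lemma ksecI:
 assumes "a : I4" "b : I4" "a ~= b"
 shows "ks a b : ksec"
proof -
 have lt: "ks a b : ksec" if "a : I4" "b : I4" "a < b" for a b
  using that unfolding I4_def by (elim insertE emptyE) (simp_all add: ksec_def)
 show ?thesis using lt[OF assms(1,2)] lt[OF assms(2,1)] assms(3) ks_commute[of a b] by (cases a b rule: linorder_cases) simp_all
qed

lemma ksecE:
 assumes "h : ksec"
 obtains a b where "a : I4" "b : I4" "a ~= b" "h = ks a b"
proof -
 from assms have "h = ks 0 1 \<or> h = ks 0 2 \<or> h = ks 0 3 \<or> h = ks 1 2 \<or> h = ks 1 3 \<or> h = ks 2 3"
  unfolding ksec_def by simp
 then show ?thesis
  by (elim disjE) (rule that[of 0 1] that[of 0 2] that[of 0 3] that[of 1 2] that[of 1 3] that[of 2 3]; simp; fail)+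
qed

lemma tetra_rays: "tetrahedron_cone_model - {0} - \<Union>ksec = \<Union>(kr ` I4)"
proof (intro equalityI subsetI)
 fix x assume "x : tetrahedron_cone_model - {0} - \<Union>ksec"
 then have x: "x : tetrahedron_cone_model" "x ~= 0" "x ~: \<Union>ksec" by simp_all
 from x(1,2) show "x : \<Union>(kr ` I4)"
 proof (rule tetra_cases)
  fix a b assume ab: "a : I4" "b : I4" "a ~= b" "x : ks a b"
  show ?thesis by (rule notE[OF x(3) UnionI[OF ksecI[OF ab(1-3)] ab(4)]])
 qed (rule UN_I)
next
 fix x assume "x : \<Union>(kr ` I4)"
 then obtain a where a: "a : I4" "x : kr a" by (rule UN_E)
 have n: "x ~: ks b c" if bc: "b : I4" "c : I4" "b ~= c" for b c
 proof (cases "b = a")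
  case True
  then have "kq c x = 0" using a(2) bc unfolding kr_def by simp
  then show ?thesis by (simp add: ks_def)
 next
  case False
  then have "kq b x = 0" using a(2) bc unfolding kr_def by simp
  then show ?thesis by (simp add: ks_def)
 qed
 have "x ~: \<Union>ksec"
 proof
  assume "x : \<Union>ksec"
  then obtain h where "h : ksec" "x : h" by (rule UnionE)
  then show False using n by (elim ksecE) simp
 qed
 then show "x : tetrahedron_cone_model - {0} - \<Union>ksec" using subsetD[OF kr_sub[OF a(1)] a(2)] by simp
qed

lemma ks_nonempty:
 assumes ab: "a : I4" "b : I4" "a ~= b"
 shows "pt a b 1 1 : ks a b"
proof -
 have q: "kq c (pt a b 1 1) = (if c = a then 1 else if c = b then 1 else 0)" if "c : I4" for c
  by (rule kq_pt[OF ab(1,2) _ _ that]) simp_all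
 show ?thesis unfolding ks_def mem_Collect_eq
 proof (intro conjI ballI)
  fix c assume c0: "c : I4 - {a,b}"
  have c: "c : I4" by (rule DiffD1[OF c0])
  have "c ~: {a,b}" using c0 by (rule DiffE)
  then have "c ~= a" "c ~= b" by simp_all
  then show "kq c (pt a b 1 1) = 0" unfolding q[OF c] by simp
 qed (simp_all only: q[OF ab(1)] q[OF ab(2)], simp_all)
qed

lemma ks_star:
 assumes a: "a : I4" and y: "y : kr a"
 shows "{h:ksec. y : closure h} = ks a ` (I4 - {a})" "inj_on (ks a) (I4 - {a})"
proof -
 show "{h:ksec. y : closure h} = ks a ` (I4 - {a})"
 proof (intro equalityI subsetI)
  fix h assume "h : {h:ksec. y : closure h}"
  then have hs: "h : ksec" "y : closure h" by simp_all
  from hs(1) obtain b c where h: "b : I4" "c : I4" "b ~= c" "h = ks b c" by (rule ksecE)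
  have "a = b \<or> a = c" using ks_not_closure[OF y a, of b c] hs(2) unfolding h(4) by metis
  then show "h : ks a ` (I4 - {a})"
  proof
   assume "a = b"
   then show ?thesis using h by (intro image_eqI[of _ _ c]) simp_all
  next
   assume "a = c"
   then show ?thesis using h ks_commute[of b c] by (intro image_eqI[of _ _ b]) simp_all
  qed
 next
  fix h assume "h : ks a ` (I4 - {a})"
  then obtain b where b: "h = ks a b" "b : I4 - {a}" by (rule imageE)
  then have b': "b : I4" "a ~= b" by simp_all
  show "h : {h:ksec. y : closure h}" unfolding b(1) using ks_closure[OF a b' y] ksecI[OF a b'] by simp
 qed
 show "inj_on (ks a) (I4 - {a})"
 proof (rule inj_onI)
  fix b c assume bc: "b : I4 - {a}" "c : I4 - {a}" "ks a b = ks a c"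
  have b: "b : I4" "c : I4" "a ~= b" "a ~= c" using bc by simp_all
  have "pt a b 1 1 : ks a b" by (rule ks_nonempty[OF a b(1,3)])
  moreover then have "pt a b 1 1 : ks a c" unfolding bc(3) .
  ultimately have "{a, c} \<subseteq> {a, b}" using a b(2) by (rule kq_same)
  then show "b = c" using b(4) by simp
 qed
qed

text \<open>Consecutive sectors of a 4-cycle share a ray, and this holds in every ball. The cycle
  runs through all four rays, so every seam point is reached.\<close>

lemma ray_cycle_connected:
 assumes I: "a : I4" "b : I4" "c : I4" "e : I4" "a ~= b" "b ~= c" "c ~= e" "e ~= a" "I4 = {a,b,c,e}" and d: "d > 0"
 shows "connected ((ks a b Un ks b c Un ks c e Un ks e a Un \<Union>(kr ` I4)) Int ball 0 d)"
proof -
 define G where "G p q = (ks p q Un (kr p Un kr q)) Int ball 0 d" for p q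
 have con: "connected (G p q)" if "p : I4" "q : I4" "p ~= q" for p q
  unfolding G_def
 proof (rule connected_with_limits)
  show "connected (ks p q Int ball 0 d)" by (intro convex_connected convex_Int ks_convex that convex_ball)
  show "kr p Un kr q \<subseteq> closure (ks p q)"
   using ks_closure[OF that(1,2,3)] ks_closure[OF that(2,1) that(3)[symmetric]] unfolding ks_commute[of q p] by blast
 qed
 have meet: "EX y. y : kr p Int ball 0 d" if "p : I4" for p using kr_convex_ball_point[OF that d] by auto
 obtain yb yc ye where y: "yb : kr b Int ball 0 d" "yc : kr c Int ball 0 d" "ye : kr e Int ball 0 d"
  using meet[OF I(2)] meet[OF I(3)] meet[OF I(4)] by (elim exE) (rule that)
 have 1: "connected (G a b Un G b c)" 
 proof (rule connected_Un[OF con[OF I(1,2,5)] con[OF I(2,3,6)]])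
  have "yb : G a b Int G b c" using y(1) unfolding G_def by blast
  then show "G a b Int G b c ~= {}" by blast
 qed
 have 2: "connected (G a b Un G b c Un G c e)" 
 proof (rule connected_Un[OF 1 con[OF I(3,4,7)]])
  have "yc : (G a b Un G b c) Int G c e" using y(2) unfolding G_def by blast
  then show "(G a b Un G b c) Int G c e ~= {}" by blast
 qed
 have 3: "connected (G a b Un G b c Un G c e Un G e a)" 
 proof (rule connected_Un[OF 2 con[OF I(4,1,8)]])
  have "ye : (G a b Un G b c Un G c e) Int G e a" using y(3) unfolding G_def by blast
  then show "(G a b Un G b c Un G c e) Int G e a ~= {}" by blast
 qed
 have "\<Union>(kr ` I4) = kr a Un kr b Un kr c Un kr e" unfolding I(9) by (simp add: Un_assoc)
 then have "(ks a b Un ks b c Un ks c e Un ks e a Un \<Union>(kr ` I4)) Int ball 0 d = G a b Un G b c Un G c e Un G e a"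
  unfolding G_def by blast
 then show ?thesis using 3 by simp
qed

lemma third_color:
 assumes "a : {1,2,3::nat}" "b : {1,2,3}" "c : {1,2,3}" "x : {1,2,3}" "a ~= b" "a ~= c" "b ~= c" "x ~= a" "x ~= b"
 shows "x = c"
proof -
 have "card {a,b,c} = 3" using assms(5-7) by (simp add: card_insert_if)
 then have "{a,b,c} = {1,2,3}" using assms(1-3) by (intro card_subset_eq) simp_all
 then have "x : {a,b,c}" using assms(4) by simp
 then show ?thesis using assms(8,9) by simp
qed

lemma pair_cases:
 assumes "a : {1,2,3::nat}" "b : {1,2,3}" "c : {1,2,3}" "i : {1,2,3}" "j : {1,2,3}" "a ~= b" "a ~= c" "b ~= c" "i ~= j"
 shows "{i,j} = {a,b} \<or> {i,j} = {a,c} \<or> {i,j} = {b,c}"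
proof -
 have "i = a \<or> i = b \<or> i = c" using third_color[OF assms(1-3,4,6-8)] by blast
 moreover have "j = a \<or> j = b \<or> j = c" using third_color[OF assms(1-3,5,6-8)] by blast
 ultimately show ?thesis using assms(9) by blast
qed

text \<open>The six sectors are the edges of a complete graph on four vertices, and distinct colors
  along each ray make the coloring a proper edge coloring with three colors. Opposite edges must
  then have equal colors, and any two colors form a 4-cycle of sectors.\<close>

lemma star_model_tetra: "star_model tetrahedron_cone_model ksec"
proof -
 let ?M = tetrahedron_cone_model
 have zero: "0 : ?M" unfolding tetra_eq
  by (rule CollectI, rule bexI[of _ 0], rule bexI[of _ 1]) (simp_all add: kq_0)
 have sec: "h \<subseteq> ?M - {0} & (ALL d. connected (h Int ball 0 d)) & (ALL y:h. loc_plane ?M y)" if h: "h : ksec" for h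
 proof -
  obtain a b where ab: "a : I4" "b : I4" "a ~= b" "h = ks a b" using h by (rule ksecE)
  have "connected (h Int ball 0 d)" for d unfolding ab(4)
   by (intro convex_connected convex_Int ks_convex[OF ab(1-3)] convex_ball)
  then show ?thesis using ks_sub[OF ab(1-3)] ks_loc_plane[OF ab(1-3)] unfolding ab(4) by simp
 qed
 have ray: "~ loc_plane ?M y & card {h:ksec. y : closure h} = 3" if y: "y : \<Union>(kr ` I4)" for y
 proof -
  obtain a where a: "a : I4" "y : kr a" using y by (rule UN_E)
  have "card {h:ksec. y : closure h} = card (I4 - {a})" unfolding ks_star(1)[OF a] by (rule card_image[OF ks_star(2)[OF a]])
  also have "\<dots> = 3" using a(1) by (simp add: card_Diff_singleton)
  finally show ?thesis using kr_not_loc_plane[OF a] by blast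
 qed
 have con: "connected ((\<Union>{h:ksec. col h : {i,j}} Un \<Union>(kr ` I4)) Int ball 0 d)"
  if ij: "i ~= j" "i : {1,2,3}" "j : {1,2,3}" and col: "col : ksec \<rightarrow> {1,2,3}"
   and inj: "ALL y:\<Union>(kr ` I4). dist 0 y < d --> inj_on col {h:ksec. y : closure h}" for col :: "_ => nat" and i j d
 proof (cases "d > 0")
  case True
  have v: "col (ks a b) ~= col (ks a c)" if "a : I4" "b : I4 - {a}" "c : I4 - {a}" "b ~= c" for a b c
  proof -
   note aa = that(1)
   obtain y where y: "y : kr a" "dist 0 y < d" by (rule kr_convex_ball_point[OF aa True])
   have "y : \<Union>(kr ` I4)" using that(1) y(1) by (rule UN_I)
   then have "inj_on col {h:ksec. y : closure h}" using inj y(2) by blast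
   then have "inj_on col (ks a ` (I4 - {a}))" unfolding ks_star(1)[OF that(1) y(1)] .
   then have "inj_on (col \<circ> ks a) (I4 - {a})" using ks_star(2)[OF that(1) y(1)] by (rule comp_inj_on[rotated])
   then show ?thesis using inj_onD[OF _ _ that(2,3), of "col \<circ> ks a"] that(4) by auto
  qed
  have r: "col (ks 0 1) : {1,2,3}" "col (ks 0 2) : {1,2,3}" "col (ks 0 3) : {1,2,3}" "col (ks 1 2) : {1,2,3}" "col (ks 1 3) : {1,2,3}" "col (ks 2 3) : {1,2,3}"
   using col unfolding ksec_def Pi_iff by simp_all
  have n: "col (ks 0 1) ~= col (ks 0 2)" "col (ks 0 1) ~= col (ks 0 3)" "col (ks 0 2) ~= col (ks 0 3)"
   using v[of 0 1 2] v[of 0 1 3] v[of 0 2 3] by simp_all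
  have "col (ks 1 2) ~= col (ks 0 1)" "col (ks 1 2) ~= col (ks 0 2)"
   using v[of 1 2 0] v[of 2 1 0] ks_commute[of 0 1] ks_commute[of 0 2] ks_commute[of 1 2] by simp_all
  then have e12: "col (ks 1 2) = col (ks 0 3)" by (rule third_color[OF r(1,2,3,4) n])
  have "col (ks 1 3) ~= col (ks 0 1)" "col (ks 1 3) ~= col (ks 0 3)"
   using v[of 1 3 0] v[of 3 1 0] ks_commute[of 0 1] ks_commute[of 0 3] ks_commute[of 1 3] by simp_all
  then have e13: "col (ks 1 3) = col (ks 0 2)" by (rule third_color[OF r(1,3,2,5) n(2,1) n(3)[symmetric]])
  have "col (ks 2 3) ~= col (ks 0 2)" "col (ks 2 3) ~= col (ks 0 3)"
   using v[of 2 3 0] v[of 3 2 0] ks_commute[of 0 2] ks_commute[of 0 3] ks_commute[of 2 3] by simp_all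
  then have e23: "col (ks 2 3) = col (ks 0 1)" by (rule third_color[OF r(2,3,1,6) n(3) n(1)[symmetric] n(2)[symmetric]])
  have sel: "\<Union>{h:insert x H. col h : S} = (if col x : S then x else {}) Un \<Union>{h:H. col h : S}" for x H S by auto
  consider "{i,j} = {col (ks 0 1), col (ks 0 2)}" | "{i,j} = {col (ks 0 1), col (ks 0 3)}" | "{i,j} = {col (ks 0 2), col (ks 0 3)}"
   using pair_cases[OF r(1,2,3) ij(2,3) n ij(1)] by blast
  then show ?thesis
  proof cases
   case 1
   have "\<Union>{h:ksec. col h : {i,j}} = ks 0 1 Un ks 1 3 Un ks 3 2 Un ks 2 0"
   proof -
    have m: "(col (ks 0 1) : {i,j}) = True" "(col (ks 0 2) : {i,j}) = True" "(col (ks 0 3) : {i,j}) = False"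
     unfolding 1 insert_iff using n n[symmetric] by blast+
    show ?thesis unfolding ksec_def sel e12 e13 e23 m if_True if_False ks_commute[of 3 2] ks_commute[of 2 0] by blast
   qed
   note eq = this
   show ?thesis unfolding eq by (rule ray_cycle_connected[OF _ _ _ _ _ _ _ _ _ True]) (auto simp: I4_def)
  next
   case 2
   have "\<Union>{h:ksec. col h : {i,j}} = ks 0 1 Un ks 1 2 Un ks 2 3 Un ks 3 0"
   proof -
    have m: "(col (ks 0 1) : {i,j}) = True" "(col (ks 0 2) : {i,j}) = False" "(col (ks 0 3) : {i,j}) = True"
     unfolding 2 insert_iff using n n[symmetric] by blast+
    show ?thesis unfolding ksec_def sel e12 e13 e23 m if_True if_False ks_commute[of 3 0] by blast
   qed
   note eq = this
   show ?thesis unfolding eq by (rule ray_cycle_connected[OF _ _ _ _ _ _ _ _ _ True]) (auto simp: I4_def)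
  next
   case 3
   have "\<Union>{h:ksec. col h : {i,j}} = ks 0 2 Un ks 2 1 Un ks 1 3 Un ks 3 0"
   proof -
    have m: "(col (ks 0 1) : {i,j}) = False" "(col (ks 0 2) : {i,j}) = True" "(col (ks 0 3) : {i,j}) = True"
     unfolding 3 insert_iff using n n[symmetric] by blast+
    show ?thesis unfolding ksec_def sel e12 e13 e23 m if_True if_False ks_commute[of 2 1] ks_commute[of 3 0] by blast
   qed
   note eq = this
   show ?thesis unfolding eq by (rule ray_cycle_connected[OF _ _ _ _ _ _ _ _ _ True]) (auto simp: I4_def)
  qed
 qed (simp add: ball_empty)
 have int: "interior ?M = {}"
 proof (rule interior_empty_of_planes)
  show "?M \<subseteq> (\<Union>a\<in>{axis 1 1, axis 2 1, axis 3 1, axis 1 1 - axis 2 1, axis 1 1 - axis 3 1, axis 2 1 - axis 3 1}. {x. a \<bullet> x = 0})"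
  proof
   fix x assume "x : ?M"
   then obtain a b where ab: "a : I4" "b : I4" "a ~= b" "ALL c:I4 - {a,b}. kq c x = 0" unfolding tetra_eq by (elim CollectE bexE conjE) (rule that)
   obtain c where c: "c : I4" "c ~= a" "c ~= b" by (rule I4_fourth)
   obtain e where e: "e : I4" "e ~= a" "e ~= b" "e ~= c" by (rule I4_fourth)
   note ce = c(1) e(1) e(4)[symmetric]
   have "kq c x = 0" by (rule bspec[OF ab(4)], rule DiffI[OF ce(1)]) (use c(2,3) in blast)
   moreover have "kq e x = 0" by (rule bspec[OF ab(4)], rule DiffI[OF ce(2)]) (use e(2,3) in blast)
   ultimately have "kq c x = kq e x" by simp
   then have "x$1 = 0 \<or> x$2 = 0 \<or> x$3 = 0 \<or> x$1 = x$2 \<or> x$1 = x$3 \<or> x$2 = x$3"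
    using ce(1-3) unfolding kq_def I4_def by (elim insertE emptyE) simp_all
   then show "x : (\<Union>a\<in>{axis 1 1, axis 2 1, axis 3 1, axis 1 1 - axis 2 1, axis 1 1 - axis 3 1, axis 2 1 - axis 3 1}. {x. a \<bullet> x = 0})"
    by (elim disjE) (simp_all add: inner_diff_left inner_axis')
  qed
 qed (auto simp: axis_eq_0_iff axis_eq_axis)
 have disc: "disc_at ?M 0"
 proof -
  \<comment> \<open>The disc at the apex is made of the three sectors between the rays 1, 2 and 3:
    coefficient 0 vanishes, and subtracting \<open>m\<close> makes at least one of the other three
    vanish.\<close>
  define m where "m z = min (min (Re z) (Im z)) 0" for z :: complex
  define f :: "complex => nat => real" where
   "f z e = (if e = 1 then Re z - m z else if e = 2 then Im z - m z else if e = 3 then - m z else 0)" for z e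
  have q: "kq e (kc (f z)) = f z e" if "e : I4" for e z
   by (rule kq_kc[of _ 0, OF _ _ _ that]) (simp_all add: f_def m_def min_def)
  have "continuous_on UNIV (%z. f z e)" for e
   unfolding f_def m_def by (cases "e = 1"; cases "e = 2"; cases "e = 3") (auto intro!: continuous_intros)
  then have c: "continuous_on UNIV (%z. kc (f z))" by (rule cont_kc)
  have i: "inj (%z. kc (f z))"
  proof (rule injI)
   fix z z' assume "kc (f z) = kc (f z')"
   then have e: "f z e = f z' e" if "e : I4" for e using q[OF that, of z] q[OF that, of z'] by simp
   show "z = z'" using e[of 1] e[of 2] e[of 3] by (simp add: f_def complex_eq_iff)
  qed
  have s: "kc (f z) : ?M" for z
  proof -
   have M: "kc (f z) : ?M" if "a : I4" "b : I4" "a ~= b" "ALL c:I4 - {a,b}. f z c = 0" for a b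
    unfolding tetra_eq mem_Collect_eq
   proof (rule bexI[OF _ that(1)], rule bexI[OF _ that(2)], intro conjI ballI that(3))
    fix c assume c: "c : I4 - {a,b}"
    show "kq c (kc (f z)) = 0" unfolding q[OF DiffD1[OF c]] by (rule bspec[OF that(4) c])
   qed
   have "Re z = m z \<or> Im z = m z \<or> m z = 0" unfolding m_def min_def by simp
   then consider "Re z = m z" | "Im z = m z" | "m z = 0" by blast
   then show ?thesis
   proof cases
    case 1
    then show ?thesis by (intro M[of 2 3]) (auto simp: f_def I4_def)
   next
    case 2
    then show ?thesis by (intro M[of 1 3]) (auto simp: f_def I4_def)
   next
    case 3
    then show ?thesis by (intro M[of 1 2]) (auto simp: f_def I4_def)
   qed
  qed
  have "kc (f 0) = 0" by (simp add: kc_def f_def m_def vec_eq_iff)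
  then show ?thesis unfolding disc_at_def using c i s by (intro exI[of _ UNIV] exI[of _ "%z. kc (f z)"] exI[of _ 0]) auto
 qed
 show ?thesis unfolding star_model_def tetra_rays
 proof (intro conjI)
  show "finite ksec" by (simp add: ksec_def)
  show "ALL h:ksec. h \<subseteq> ?M - {0} & (ALL d. connected (h Int ball 0 d)) & (ALL y:h. loc_plane ?M y)" using sec by blast
  show "ALL y:\<Union>(kr ` I4). ~ loc_plane ?M y & card {h : ksec. y : closure h} = 3" using ray by blast
  show "ALL (col :: _ => nat) i j d. i ~= j --> i : {1,2,3} --> j : {1,2,3} --> col : ksec \<rightarrow> {1,2,3} -->
    (ALL y:\<Union>(kr ` I4). dist 0 y < d --> inj_on col {h:ksec. y : closure h}) -->
    connected ((\<Union>{h:ksec. col h : {i,j}} Un \<Union>(kr ` I4)) Int ball 0 d)"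
   by (intro allI impI) (rule con)
 qed (rule int disc zero)+
qed

lemma tetra_rays_family:
 "card (kr ` I4) = 4" "disjoint (kr ` I4)" "P : kr ` I4 ==> openin (top_of_set (\<Union>(kr ` I4))) P" "P : kr ` I4 ==> 0 : closure P"
proof -
 have u: "a = b" if "x : kr a" "x : kr b" "a : I4" for x a b using that unfolding kr_def by (cases "a = b") auto
 have "inj_on kr I4"
 proof (rule inj_onI)
  fix a b assume ab: "a : I4" "b : I4" "kr a = kr b"
  obtain y where "y : kr a" using kr_convex_ball_point[OF ab(1), of 1] by auto
  then show "a = b" using u[of y a b] ab by simp
 qed
 then show "card (kr ` I4) = 4" by (simp add: card_image)
 show "disjoint (kr ` I4)" 
  unfolding pairwise_def disjnt_def
 proof (intro ballI impI)
  fix P Q assume "P : kr ` I4" "Q : kr ` I4" and ne: "P ~= Q"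
  then obtain a b where ab: "P = kr a" "a : I4" "Q = kr b" by (elim imageE) (rule that)
  have "~ (x : P & x : Q)" for x using u[of x a b] ab ne by metis
  then show "P Int Q = {}" by blast
 qed
 show "openin (top_of_set (\<Union>(kr ` I4))) P" if P: "P : kr ` I4"
 proof -
  obtain a where a: "P = kr a" "a : I4" using P by (rule imageE)
  note a = a(2,1)
  have "P = \<Union>(kr ` I4) Int {x. 0 < kq a x}" unfolding a(2)
  proof (intro equalityI subsetI)
   fix x assume "x : \<Union>(kr ` I4) Int {x. 0 < kq a x}"
   then obtain b where "x : kr b" "0 < kq a x" by (elim IntE UN_E CollectE) (rule that)
   then show "x : kr a" using a(1) unfolding kr_def by (cases "a = b") simp_all
  next
   fix x assume "x : kr a"
   then show "x : \<Union>(kr ` I4) Int {x. 0 < kq a x}" using UN_I[OF a(1), of x kr] by (simp add: kr_def)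
  qed
  moreover have "open {x. 0 < kq a x}" by (intro open_Collect_less cont_kq continuous_on_const)
  ultimately show ?thesis by (simp add: openin_open_Int)
 qed
 show "0 : closure P" if P: "P : kr ` I4"
 proof -
  obtain a where a: "P = kr a" "a : I4" using P by (rule imageE)
  note a = a(2,1)
  show ?thesis unfolding closure_approachable
  proof (intro allI impI)
   fix e :: real assume "e > 0"
   then obtain y where "y : kr a" "dist 0 y < e" using kr_convex_ball_point[OF a(1)] by blast
   then show "EX y:P. dist y 0 < e" using a(2) by (auto simp: dist_commute)
  qed
 qed
qed

text \<open>The topological trace of a seam vertex: four branches of nonplanar points end there,
  against two at an interior point of an edge of the triangulation.\<close>

lemma tetra_ray_facts:
 obtains R where "card R = 4" "disjoint R" "!!P. P : R ==> openin (top_of_set (\<Union>R)) P" "!!P. P : R ==> 0 : closure P"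
  "\<Union>R \<subseteq> tetrahedron_cone_model" "!!q. q : tetrahedron_cone_model ==> q : \<Union>R \<longleftrightarrow> q ~= 0 & ~ loc_plane tetrahedron_cone_model q"
proof (rule that[OF tetra_rays_family])
 show "\<Union>(kr ` I4) \<subseteq> tetrahedron_cone_model" unfolding tetra_rays[symmetric] by blast
 fix q assume q: "q : tetrahedron_cone_model"
 have "q ~: \<Union>ksec" if "~ loc_plane tetrahedron_cone_model q"
 proof
  assume "q : \<Union>ksec"
  then obtain h where h: "h : ksec" "q : h" by (rule UnionE)
  from h(1) obtain a b where "a : I4" "b : I4" "a ~= b" "h = ks a b" by (rule ksecE)
  then show False using ks_loc_plane[of a b q] h(2) that by simp
 qed
 moreover have "~ loc_plane tetrahedron_cone_model q" if "q : \<Union>(kr ` I4)"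
  using that by (elim UN_E) (rule kr_not_loc_plane)
 ultimately show "q : \<Union>(kr ` I4) \<longleftrightarrow> q ~= 0 & ~ loc_plane tetrahedron_cone_model q"
  using q unfolding tetra_rays[symmetric] by blast
qed

subsection \<open>Local structure of a triangulated foam\<close>

lemma pl_locally_like_germ:
 assumes "pl_locally_like X p M"
 obtains U U' g g' where "germ X p M 0 U U' g g'"
proof -
 obtain N N' f where N: "N \<subseteq> X" "p : top_of_set X interior_of N" "N' \<subseteq> M" "0 : top_of_set M interior_of N'"
  "pl_homeomorphism N N' f" "f p = 0" using assms unfolding pl_locally_like_def by blast
 obtain g where g: "homeomorphism N N' f g" using pl_homeomorphism_homeo[OF N(5)] by blast
 define A B where "A = top_of_set X interior_of N" and "B = top_of_set M interior_of N'"
 have A: "openin (top_of_set X) A" "A \<subseteq> N" and B: "openin (top_of_set M) B" "B \<subseteq> N'"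
  unfolding A_def B_def by (auto intro: interior_of_subset[THEN subsetD])
 have cf: "continuous_on N f" and fN: "f ` N = N'" using g by (auto simp: homeomorphism_def)
 have BN: "openin (top_of_set N') B" by (rule openin_subset_trans[OF B(1,2) N(3)])
 have "openin (top_of_set N) (N Int f -` B)"
  by (rule continuous_openin_preimage[OF cf _ BN]) (use fN in auto)
 then have "openin (top_of_set A) (A Int (N Int f -` B))" using A(2) by (rule openin_Int_subset)
 then have "openin (top_of_set X) (A Int (N Int f -` B))" using A(1) by (rule openin_trans)
 moreover define U where "U = A Int (N Int f -` B)"
 ultimately have U: "openin (top_of_set X) U" by simp
 have "openin (top_of_set N) U" by (rule openin_subset_trans[OF U _ N(1)]) (auto simp: U_def)
 then have "openin (top_of_set N') (f ` U)" by (rule openin_homeomorphism_image[OF g])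
 moreover have fB: "f ` U \<subseteq> B" by (auto simp: U_def)
 ultimately have "openin (top_of_set B) (f ` U)" using B(2) by (meson openin_subset_trans)
 then have fU: "openin (top_of_set M) (f ` U)" using B(1) by (rule openin_trans)
 have h: "homeomorphism U (f ` U) f g" by (rule homeomorphism_of_subsets[OF g]) (use fN in \<open>auto simp: U_def\<close>)
 have "p : U" using N(2,4,6) A(2) by (auto simp: U_def A_def B_def)
 then have "germ X p M 0 U (f ` U) f g" using U fU h N(6) unfolding germ_def by blast
 then show ?thesis by (rule that)
qed

lemma barycentric_unique:
 fixes a b c :: "'a::real_vector"
 assumes i: "~ affine_dependent {a,b,c}" "a ~= b" "a ~= c" "b ~= c"
  and e: "\<alpha> *\<^sub>R (b - a) + \<beta> *\<^sub>R (c - a) = \<alpha>' *\<^sub>R (b - a) + \<beta>' *\<^sub>R (c - a)"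
 shows "\<alpha> = \<alpha>' & \<beta> = \<beta>'"
proof (rule ccontr)
 assume n: "~ ?thesis"
 define U where "U v = (if v = a then (\<alpha>' - \<alpha>) + (\<beta>' - \<beta>) else if v = b then \<alpha> - \<alpha>' else \<beta> - \<beta>')" for v
 have "sum U {a,b,c} = 0" using i(2-4) by (simp add: U_def)
 moreover have "(\<Sum>v\<in>{a,b,c}. U v *\<^sub>R v) = 0"
 proof -
  have "(\<Sum>v\<in>{a,b,c}. U v *\<^sub>R v) = (\<alpha> *\<^sub>R (b - a) + \<beta> *\<^sub>R (c - a)) - (\<alpha>' *\<^sub>R (b - a) + \<beta>' *\<^sub>R (c - a))"
   using i(2-4) by (simp add: U_def algebra_simps)
  then show ?thesis using e by simp
 qed
 moreover have "EX v:{a,b,c}. U v ~= 0"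
 proof (cases "\<alpha> = \<alpha>'")
  case True
  then have "U c ~= 0" using n i by (simp add: U_def)
  then show ?thesis by blast
 next
  case False
  then have "U b ~= 0" using i by (simp add: U_def)
  then show ?thesis by blast
 qed
 ultimately have "affine_dependent {a,b,c}" by (subst affine_dependent_explicit_finite) auto
 then show False using i(1) by simp
qed

text \<open>Two triangles with the common side from \<open>a\<close> to \<open>b\<close>, spread out over one triangle in the plane.\<close>

definition pages :: "'a::real_normed_vector => 'a => 'a => 'a => complex => 'a" where
 "pages a b c d z = a + Im z *\<^sub>R (b - a) + max (Re z) 0 *\<^sub>R (c - a) + max (- Re z) 0 *\<^sub>R (d - a)"

definition pages_dom :: "complex set" where
 "pages_dom = {z. 0 <= Im z & \<bar>Re z\<bar> + Im z <= 1}"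

lemma cont_pages: "continuous_on S (pages a b c d)"
 unfolding pages_def by (intro continuous_intros)

lemma compact_pages_dom: "compact pages_dom"
 unfolding compact_eq_bounded_closed
proof
 have "norm z <= 2" if "z : pages_dom" for z
  using that norm_complex_def[of z] cmod_le[of z] unfolding pages_dom_def by auto
 then show "bounded pages_dom" unfolding bounded_iff by blast
 have "pages_dom = {z. 0 <= Im z} Int {z. \<bar>Re z\<bar> + Im z <= 1}" by (auto simp: pages_dom_def)
 moreover have "closed ({z. 0 <= Im z} Int {z. \<bar>Re z\<bar> + Im z <= 1})" by (intro closed_Int closed_Collect_le continuous_intros)
 ultimately show "closed pages_dom" by simp
qed

lemma pages_dom_interior: "0 < Im z ==> \<bar>Re z\<bar> + Im z < 1 ==> z : interior pages_dom"
proof (rule interiorI[of "{z. 0 < Im z} Int {z. \<bar>Re z\<bar> + Im z < 1}"])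
 show "open ({z. 0 < Im z} Int {z. \<bar>Re z\<bar> + Im z < 1})" by (intro open_Int open_Collect_less continuous_intros)
qed (auto simp: pages_dom_def)

lemma hull3_iff:
 "x : conv {a,b,c} \<longleftrightarrow> (EX v w. 0 <= v & 0 <= w & v + w <= 1 & x = a + v *\<^sub>R (b - a) + w *\<^sub>R (c - a))"
 unfolding convex_hull_3_alt mem_Collect_eq by blast

lemma pages_cases:
 assumes "z : pages_dom"
 shows "Re z >= 0 ==> pages a b c d z = a + Im z *\<^sub>R (b - a) + Re z *\<^sub>R (c - a) & pages a b c d z : conv {a,b,c}"
  "Re z <= 0 ==> pages a b c d z = a + Im z *\<^sub>R (b - a) + (- Re z) *\<^sub>R (d - a) & pages a b c d z : conv {a,b,d}"
proof -
 assume z: "Re z >= 0"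
 then have e: "pages a b c d z = a + Im z *\<^sub>R (b - a) + Re z *\<^sub>R (c - a)" by (simp add: pages_def)
 then show "pages a b c d z = a + Im z *\<^sub>R (b - a) + Re z *\<^sub>R (c - a) & pages a b c d z : conv {a,b,c}"
  unfolding hull3_iff using assms z by (intro conjI exI[of _ "Im z"] exI[of _ "Re z"]) (simp_all add: pages_dom_def)
next
 assume z: "Re z <= 0"
 then have e: "pages a b c d z = a + Im z *\<^sub>R (b - a) + (- Re z) *\<^sub>R (d - a)" by (simp add: pages_def)
 then show "pages a b c d z = a + Im z *\<^sub>R (b - a) + (- Re z) *\<^sub>R (d - a) & pages a b c d z : conv {a,b,d}"
  unfolding hull3_iff using assms z by (intro conjI exI[of _ "Im z"] exI[of _ "- Re z"]) (simp_all add: pages_dom_def)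
qed

lemma pages_range: "pages a b c d ` pages_dom \<subseteq> conv {a,b,c} Un conv {a,b,d}"
proof (rule image_subsetI)
 fix z assume z: "z : pages_dom"
 show "pages a b c d z : conv {a,b,c} Un conv {a,b,d}"
  by (cases "Re z >= 0") (use pages_cases[OF z, of a b c d] in auto)
qed

lemma pages_onto: "x : conv {a,b,c} ==> EX z:pages_dom. Re z >= 0 & pages a b c d z = x"
 "x : conv {a,b,d} ==> EX z:pages_dom. Re z <= 0 & pages a b c d z = x"
proof -
 assume "x : conv {a,b,c}"
 then obtain v w where vw: "0 <= v" "0 <= w" "v + w <= 1" "x = a + v *\<^sub>R (b - a) + w *\<^sub>R (c - a)" unfolding hull3_iff by blast
 then show "EX z:pages_dom. Re z >= 0 & pages a b c d z = x"
  by (intro bexI[of _ "Complex w v"]) (simp_all add: pages_def pages_dom_def)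
next
 assume "x : conv {a,b,d}"
 then obtain v w where vw: "0 <= v" "0 <= w" "v + w <= 1" "x = a + v *\<^sub>R (b - a) + w *\<^sub>R (d - a)" unfolding hull3_iff by blast
 then show "EX z:pages_dom. Re z <= 0 & pages a b c d z = x"
  by (intro bexI[of _ "Complex (- w) v"]) (simp_all add: pages_def pages_dom_def)
qed

text \<open>On either half plane this is uniqueness of barycentric coordinates. Points of different
  pages are kept apart because the two triangles meet only in the common edge.\<close>

lemma pages_inj:
 assumes c: "~ affine_dependent {a,b,c}" "card {a,b,c} = 3" and d: "~ affine_dependent {a,b,d}" "card {a,b,d} = 3"
  and i: "conv {a,b,c} Int conv {a,b,d} \<subseteq> conv {a,b}"
 shows "inj_on (pages a b c d) pages_dom"
proof -
 have nc: "a ~= b" "a ~= c" "b ~= c" and nd: "a ~= d" "b ~= d" using c(2) d(2) by (auto simp: card_insert_if split: if_splits)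
 have mix: False if z: "z : pages_dom" "z' : pages_dom" "Re z > 0" "Re z' < 0" and e: "pages a b c d z = pages a b c d z'" for z z'
 proof -
  have "pages a b c d z : conv {a,b,c}" "pages a b c d z' : conv {a,b,d}"
   using pages_cases(1)[OF z(1), of a b c d] pages_cases(2)[OF z(2), of a b c d] z(3,4) by auto
  then have "pages a b c d z : conv {a,b}" using e i by auto
  then obtain u where u: "pages a b c d z = a + u *\<^sub>R (b - a)" unfolding convex_hull_2_alt by auto
  then have "Im z *\<^sub>R (b - a) + Re z *\<^sub>R (c - a) = u *\<^sub>R (b - a) + 0 *\<^sub>R (c - a)"
   using pages_cases(1)[OF z(1), of a b c d] z(3) by (simp add: add.assoc)
  from barycentric_unique[OF c(1) nc this] show False using z(3) by simp
 qed
 show ?thesis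
 proof (rule inj_onI)
  fix z z' assume z: "z : pages_dom" "z' : pages_dom" and e: "pages a b c d z = pages a b c d z'"
  consider "Re z >= 0" "Re z' >= 0" | "Re z <= 0" "Re z' <= 0" | "Re z > 0" "Re z' < 0" | "Re z < 0" "Re z' > 0" by linarith
  then show "z = z'"
  proof cases
   case 1
   then have "Im z *\<^sub>R (b - a) + Re z *\<^sub>R (c - a) = Im z' *\<^sub>R (b - a) + Re z' *\<^sub>R (c - a)"
    using pages_cases(1)[OF z(1), of a b c d] pages_cases(1)[OF z(2), of a b c d] e by (simp add: add.assoc)
   from barycentric_unique[OF c(1) nc this] show ?thesis by (simp add: complex_eq_iff)
  next
   case 2
   then have "Im z *\<^sub>R (b - a) + (- Re z) *\<^sub>R (d - a) = Im z' *\<^sub>R (b - a) + (- Re z') *\<^sub>R (d - a)"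
    using pages_cases(2)[OF z(1), of a b c d] pages_cases(2)[OF z(2), of a b c d] e by (simp add: add.assoc)
   from barycentric_unique[OF d(1) nc(1) nd this] show ?thesis by (simp add: complex_eq_iff)
  next
   case 3 then show ?thesis using mix[OF z] e by blast
  next
   case 4 then show ?thesis using mix[OF z(2,1)] e by simp
  qed
 qed
qed

locale foam =
 fixes K :: "(real^3) set set"
 assumes foam: "SL3_foam K"
begin

definition F where "F = \<Union>K"
text \<open>Vertex sets in place of simplices, so that faces become subsets; by
  \<open>KV_inj\<close> an affinely independent set is recovered from its hull.\<close>

definition KV :: "(real^3) set set" where "KV = {C. ~ affine_dependent C & conv C : K}"
definition T where "T = {C:KV. card C = 3}"

lemma complex: "simplicial_complex K" using foam by (simp add: SL3_foam_def)

lemma KV_indep: "C : KV ==> ~ affine_dependent C" by (simp add: KV_def)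
lemma KV_finite: "C : KV ==> finite C" using KV_indep aff_independent_finite by blast

lemma KV_cover: "\<sigma> : K ==> EX C:KV. \<sigma> = conv C"
proof -
 assume s: "\<sigma> : K"
 then obtain n where "n simplex \<sigma>" using complex unfolding simplicial_complex_def by blast
 then obtain C where "~ affine_dependent C" "\<sigma> = conv C" unfolding simplex_def by blast
 then show ?thesis using s by (auto simp: KV_def)
qed

lemma KV_F: "C : KV ==> conv C \<subseteq> F" by (auto simp: KV_def F_def)

lemma KV_sub: assumes "C : KV" "C' \<subseteq> C" shows "C' : KV"
proof -
 have "conv C' face_of conv C" using face_of_convex_hull_affine_independent[OF KV_indep[OF assms(1)]] assms(2) by blast
 then have "conv C' : K" using complex assms(1) unfolding simplicial_complex_def KV_def by blast
 then show ?thesis using affine_independent_subset[OF KV_indep[OF assms(1)] assms(2)] by (simp add: KV_def)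
qed

lemma KV_inj: fixes C D :: "(real^3) set" assumes "~ affine_dependent C" "~ affine_dependent D" "conv C = conv D" shows "C = D"
proof -
 have "x : C \<longleftrightarrow> x : D" for x
  using extreme_point_of_convex_hull_affine_independent[OF assms(1), of x] extreme_point_of_convex_hull_affine_independent[OF assms(2), of x]
  unfolding assms(3) by simp
 then show ?thesis by blast
qed

lemma finite_KV: "finite KV"
proof (rule finite_imageD)
 have "(%C. conv C) ` KV \<subseteq> K" by (auto simp: KV_def)
 moreover have "finite K" using complex by (simp add: simplicial_complex_def)
 ultimately show "finite ((%C. conv C) ` KV)" by (rule finite_subset)
 show "inj_on (%C. conv C) KV" using KV_inj KV_indep by (auto intro!: inj_onI)
qed

lemma KV_inter: assumes "C : KV" "D : KV" shows "conv C Int conv D = conv (C Int D)"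
proof -
 have f: "(conv C Int conv D) face_of conv C" "(conv C Int conv D) face_of conv D"
 proof -
  have st: "!!S S'. S : K ==> S' : K ==> (S Int S') face_of S" using complex unfolding simplicial_complex_def by blast
  have k: "conv C : K" "conv D : K" using assms by (simp_all add: KV_def)
  show "(conv C Int conv D) face_of conv C" using st[OF k] .
  show "(conv C Int conv D) face_of conv D" using st[OF k(2,1)] by (simp only: Int_commute)
 qed
 obtain C0 where C0: "C0 \<subseteq> C" "conv C Int conv D = conv C0"
  using f(1) face_of_convex_hull_affine_independent[OF KV_indep[OF assms(1)]] by blast
 obtain D0 where D0: "D0 \<subseteq> D" "conv C Int conv D = conv D0"
  using f(2) face_of_convex_hull_affine_independent[OF KV_indep[OF assms(2)]] by blast
 have "C0 = D0" using KV_inj affine_independent_subset KV_indep assms C0 D0 by metis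
 then have "conv C0 \<subseteq> conv (C Int D)" using C0(1) D0(1) by (intro hull_mono) blast
 moreover have "conv (C Int D) \<subseteq> conv C Int conv D" by (simp add: hull_mono)
 ultimately show ?thesis using C0(2) by blast
qed

lemma carrier_ex: assumes "x : F" obtains C where "C : KV" "x : relint C"
proof -
 have "EX C. C : KV & x : conv C" using assms KV_cover unfolding F_def by blast
 then obtain C where C: "C : KV & x : conv C" "!!D. D : KV & x : conv D ==> card C <= card D"
  using ex_has_least_nat[of "%C. C : KV & x : conv C" _ card] by blast
 have "x : relint C"
 proof (rule ccontr)
  assume "x ~: relint C"
  then have "x : rel_frontier (conv C)" using C(1) closure_subset[of "conv C"] by (auto simp: rel_frontier_def)
  then obtain a where a: "a : C" "x : conv (C - {a})" using rel_frontier_convex_hull_cases[OF KV_indep] C(1) by blast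
  have "card C <= card (C - {a})" by (rule C(2)) (use a(2) KV_sub C(1) in blast)
  moreover have "finite C" using KV_finite C(1) by blast
  ultimately show False using a(1) card_Diff1_less[of C a] by simp
 qed
 then show ?thesis using C(1) that by blast
qed

lemma carrier_sub: assumes "C : KV" "D : KV" "x : relint C" "x : conv D" shows "C \<subseteq> D"
proof -
 have "x : conv (C Int D)" using assms rel_interior_subset[of "conv C"] KV_inter by blast
 then have "C \<subseteq> C Int D" by (intro carrier_subset[OF KV_indep[OF assms(1)] subset_refl _ assms(3)]) auto
 then show ?thesis by blast
qed

lemma star_nbhd: obtains e where "e > 0" "!!C q. C : KV ==> dist x q < e ==> q : conv C ==> x : conv C"
proof -
 have "closed (\<Union>{conv C |C. C : KV & x ~: conv C})"
  by (rule closed_Union) (use finite_KV KV_finite in \<open>auto intro!: compact_imp_closed finite_imp_compact_convex_hull\<close>)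
 then have "open (- \<Union>{conv C |C. C : KV & x ~: conv C})" by (simp add: open_closed)
 moreover have "x : - \<Union>{conv C |C. C : KV & x ~: conv C}" by blast
 ultimately obtain e where e: "e > 0" "ball x e \<subseteq> - \<Union>{conv C |C. C : KV & x ~: conv C}" by (rule openE)
 show ?thesis
 proof (rule that[OF e(1)])
  fix C q assume "C : KV" "dist x q < e" "q : conv C"
  moreover then have "q : ball x e" by simp
  ultimately show "x : conv C" using e(2) by blast
 qed
qed

lemma pts: assumes "x : F"
 obtains "pl_locally_like F x disk_model" | "pl_locally_like F x tripod_model" | "pl_locally_like F x tetrahedron_cone_model"
proof -
 have "regular_point F x \<or> seam_point F x \<or> seam_vertex F x"
  using foam assms unfolding SL3_foam_def F_def by blast
 then show ?thesis using that unfolding regular_point_def seam_point_def seam_vertex_def by argo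
qed

text \<open>The last clause holds because the other two models are not planar at the origin, and
  planarity is invariant under germs.\<close>

lemma model_ex: assumes "x : F" obtains M H U U' g g' where "star_model M H" "germ F x M 0 U U' g g'"
  "loc_plane F x ==> M = disk_model & H = {disk_model - {0}}"
proof -
 from assms show ?thesis
 proof (rule pts)
  assume "pl_locally_like F x disk_model"
  then obtain U U' g g' where "germ F x disk_model 0 U U' g g'" by (rule pl_locally_like_germ)
  then show ?thesis using that[OF star_model_disk] by blast
 next
  assume "pl_locally_like F x tripod_model"
  then obtain U U' g g' where g: "germ F x tripod_model 0 U U' g g'" by (rule pl_locally_like_germ)
  have "~ loc_plane F x" using germ.lp_imp[OF g germ.xU[OF g]] tripod_facts(3)[OF tripod_facts(2,5)] unfolding germ.gx[OF g] by blast
  then show ?thesis using that[OF star_model_tripod g] by blast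
 next
  assume "pl_locally_like F x tetrahedron_cone_model"
  then obtain U U' g g' where g: "germ F x tetrahedron_cone_model 0 U U' g g'" by (rule pl_locally_like_germ)
  have "~ loc_plane F x" using germ.lp_imp[OF g germ.xU[OF g]] tetra_zero_not_loc_plane unfolding germ.gx[OF g] by blast
  then show ?thesis using that[OF star_model_tetra g] by blast
 qed
qed

lemma disc_everywhere: assumes "x : F" shows "disc_at F x"
proof -
 obtain M H U U' g g' where m: "star_model M H" "germ F x M 0 U U' g g'" using model_ex[OF assms] by metis
 show ?thesis by (rule germ.disc_at_transfer[OF germ.sym[OF m(2)]]) (use m(1) in \<open>simp add: star_model_def\<close>)
qed

lemma interior_F: "interior F = {}"
proof (rule ccontr)
 assume "interior F ~= {}"
 then obtain x where x: "x : interior F" by blast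
 then have "x : F" using interior_subset by blast
 then obtain M H U U' g g' where m: "star_model M H" "germ F x M 0 U U' g g'" by (metis model_ex)
 then show False using germ.interior_transfer[OF m(2) x] by (simp add: star_model_def)
qed

lemma card_KV: assumes "C : KV" shows "card C <= 3"
proof (rule ccontr)
 assume c: "~ card C <= 3"
 have "int (card C) = aff_dim C + 1" using aff_dim_affine_independent[OF KV_indep[OF assms]] by simp
 moreover have "aff_dim C <= 3" using aff_dim_le_DIM[of C] by simp
 ultimately have "aff_dim (conv C) = DIM(real^3)" using c by (simp add: aff_dim_convex_hull)
 then have "relint C = interior (conv C)"
  by (intro rel_interior_interior) (simp only: aff_dim_eq_full)
 moreover have "C ~= {}" using c by auto
 then have "relint C ~= {}" by (simp add: rel_interior_eq_empty)
 ultimately show False using interior_mono[OF KV_F[OF assms]] interior_F by blast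
qed

text \<open>If a maximal simplex had fewer than three vertices, the foam near an interior point of
  it would be contained in a segment, where no embedded disc exists.\<close>

lemma pure: assumes "C : KV" "C ~= {}" obtains t where "t : T" "C \<subseteq> t"
proof -
 have "EX D. (D : KV & C \<subseteq> D) & (ALL E. E : KV & C \<subseteq> E --> card E <= card D)"
  by (rule ex_has_greatest_nat[of _ C _ 4]) (use assms card_KV in force)+
 then obtain D where D: "D : KV" "C \<subseteq> D" "!!E. E : KV ==> C \<subseteq> E ==> card E <= card D" by blast
 have "card D = 3"
 proof (rule ccontr)
  assume "card D ~= 3"
  moreover have "card D ~= 0" using D(2) assms(2) KV_finite[OF D(1)] card_0_eq[of D] by blast
  ultimately have "card D = 1 \<or> card D = 2" using card_KV[OF D(1)] by linarith
  \<comment> \<open>One and two vertices are treated together; for a single vertex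
    \<open>a = b\<close> and the segment degenerates to a point.\<close>
  then obtain a b where ab: "D = {a,b}" by (auto simp: card_1_singleton_iff card_2_iff)
  have "D ~= {}" using assms(2) D(2) by blast
  then obtain x where x: "x : relint D" using rel_interior_eq_empty[of "conv D"] by auto
  obtain e where e: "e > 0" "!!C q. C : KV ==> dist x q < e ==> q : conv C ==> x : conv C" using star_nbhd by blast
  have sub: "F Int ball x e \<subseteq> closed_segment a b"
  proof
   fix q assume q: "q : F Int ball x e"
   then obtain E where E: "E : KV" "q : conv E" using KV_cover unfolding F_def by blast
   then have "D \<subseteq> E" using carrier_sub[OF D(1) _ x] e(2)[of E q] q by simp
   then have "D = E" using D(2) D(3)[OF E(1)] KV_finite[OF E(1)] by (metis card_subset_eq card_mono le_antisym order_trans)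
   then show "q : closed_segment a b" using E(2) ab segment_convex_hull by metis
  qed
  have "~ disc_at F x"
  proof (rule not_disc_at[OF e(1) sub, of "%y. Complex 0 ((y - a) \<bullet> (b - a))"])
   show "inj_on (%y. Complex 0 ((y - a) \<bullet> (b - a))) (closed_segment a b)"
   proof (rule inj_onI)
    fix y y' assume y: "y : closed_segment a b" "y' : closed_segment a b" "Complex 0 ((y - a) \<bullet> (b - a)) = Complex 0 ((y' - a) \<bullet> (b - a))"
    obtain u u' where u: "y - a = u *\<^sub>R (b - a)" "y' - a = u' *\<^sub>R (b - a)" using y(1,2) unfolding in_segment by (auto simp: algebra_simps)
    show "y = y'"
    proof (cases "a = b")
     case False
     then have "u = u'" using y(3) by (simp add: u)
     then show ?thesis using u by (metis diff_eq_diff_eq right_minus_eq add_diff_cancel_left' eq_diff_eq)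
    qed (use y in simp)
   qed
  qed (auto intro!: continuous_intros)
  then show False using disc_everywhere[of x] KV_F[OF D(1)] x rel_interior_subset by blast
 qed
 then show ?thesis using that D(1,2) by (simp add: T_def)
qed

lemma T_KV: "t : T ==> t : KV" and T_card: "t : T ==> card t = 3" by (auto simp: T_def)

lemma finT: "finite T" using finite_KV by (simp add: T_def)

lemma F_triangles: assumes "x : F" obtains t where "t : T" "x : conv t"
proof -
 obtain C where C: "C : KV" "x : relint C" using carrier_ex[OF assms] .
 then have "C ~= {}" by auto
 then obtain t where "t : T" "C \<subseteq> t" using pure[OF C(1)] by blast
 then show ?thesis using that C(2) rel_interior_subset hull_mono by blast
qed

lemma T_max: "t : T ==> E : KV ==> t \<subseteq> E ==> E = t"
 using card_seteq[OF KV_finite, of E t] card_KV[of E] T_card[of t] by simp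

lemma closed_hull: "C : KV ==> closed (conv C)"
 using KV_finite by (intro compact_imp_closed finite_imp_compact_convex_hull)

lemma relint_closure: "C : KV ==> x : conv C ==> x : closure (relint C)"
 using convex_closure_rel_interior[of "conv C"] closure_subset by auto

lemma T_distinct_relint: "t : T ==> t' : T ==> x : relint t ==> x : conv t' ==> t = t'"
 using carrier_sub[of t t' x] T_max[of t t'] T_KV by blast

lemma triangle_lp: assumes "t : T" "x : relint t" shows "loc_plane F x"
proof -
 obtain a b c where t: "t = {a,b,c}" "a ~= b" "a ~= c" "b ~= c" using T_card[OF assms(1)] by (auto simp: card_3_iff)
 have i: "~ affine_dependent {a,b,c}" using KV_indep T_KV assms(1) t(1) by blast
 let ?Z = "{z. 0 <= Re z & 0 <= Im z & Re z + Im z <= 1}"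
 let ?P = "%z. a + Im z *\<^sub>R (b - a) + Re z *\<^sub>R (c - a)"
 have Z: "compact ?Z"
 proof -
  have "?Z = pages_dom Int {z. 0 <= Re z}" by (auto simp: pages_dom_def)
  moreover have "closed {z. 0 <= Re z}" by (intro closed_Collect_le continuous_intros)
  ultimately show ?thesis using compact_pages_dom by (simp add: compact_Int_closed)
 qed
 obtain u where u: "ALL v:{a,b,c}. 0 < u v" "sum u {a,b,c} = 1" "(\<Sum>v\<in>{a,b,c}. u v *\<^sub>R v) = x"
  using assms(2) unfolding t(1) rel_interior_convex_hull_explicit[OF i] by blast
 define z0 where "z0 = Complex (u c) (u b)"
 have ua: "u a = 1 - u b - u c" using u(2) t by simp
 have x: "?P z0 = x" using u(3) t(2-4) by (simp add: z0_def ua algebra_simps)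
 have "open ({z. 0 < Re z} Int {z. 0 < Im z} Int {z. Re z + Im z < 1})" by (intro open_Int open_Collect_less continuous_intros)
 then have z0: "z0 : interior ?Z"
  by (rule interiorI) (use u(1) ua in \<open>auto simp: z0_def\<close>)
 obtain e where e: "e > 0" "!!C q. C : KV ==> dist x q < e ==> q : conv C ==> x : conv C" using star_nbhd by blast
 have im: "?P ` ?Z = conv t" unfolding t(1)
 proof (intro equalityI subsetI)
  fix y assume "y : conv {a,b,c}"
  then obtain v w where "0 <= v" "0 <= w" "v + w <= 1" "y = a + v *\<^sub>R (b - a) + w *\<^sub>R (c - a)" unfolding hull3_iff by blast
  then show "y : ?P ` ?Z" by (intro image_eqI[of _ _ "Complex w v"]) auto
 next
  fix y assume "y : ?P ` ?Z"
  then obtain z where "z : ?Z" "y = ?P z" by blast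
  then show "y : conv {a,b,c}" unfolding hull3_iff by (intro exI[of _ "Im z"] exI[of _ "Re z"]) simp
 qed
 have "loc_plane F (?P z0)"
 proof (rule loc_plane_chart[OF Z z0])
  show "continuous_on ?Z ?P" by (intro continuous_intros)
  show "inj_on ?P ?Z"
  proof (rule inj_onI)
   fix z z' assume "?P z = ?P z'"
   then have "Im z *\<^sub>R (b - a) + Re z *\<^sub>R (c - a) = Im z' *\<^sub>R (b - a) + Re z' *\<^sub>R (c - a)" by (simp add: add.assoc)
   from barycentric_unique[OF i t(2-4) this] show "z = z'" by (simp add: complex_eq_iff)
  qed
  show "?P ` ?Z \<subseteq> F" unfolding im using KV_F T_KV assms(1) by blast
  show "openin (top_of_set F) (F Int ball x e)" by (simp add: openin_open_Int)
  show "?P z0 : F Int ball x e" unfolding x using e(1) KV_F[OF T_KV[OF assms(1)]] assms(2) rel_interior_subset by auto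
  show "F Int ball x e \<subseteq> ?P ` ?Z" unfolding im
  proof
   fix q assume q: "q : F Int ball x e"
   then obtain E where E: "E : KV" "q : conv E" using KV_cover unfolding F_def by blast
   then have "t \<subseteq> E" using carrier_sub[OF T_KV[OF assms(1)] _ assms(2)] e(2)[of E q] q by simp
   then show "q : conv t" using T_max[OF assms(1) E(1)] E(2) by simp
  qed
 qed
 then show ?thesis by (simp only: x)
qed

end

lemma pages_inj_half:
 assumes c: "~ affine_dependent {a,b,c}" "card {a,b,c} = 3"
 shows "inj_on (pages a b c d) (pages_dom Int {z. 0 <= Re z})"
proof (rule inj_onI)
 have nc: "a ~= b" "a ~= c" "b ~= c" using c(2) by (auto simp: card_insert_if split: if_splits)
 fix z z' assume z: "z : pages_dom Int {z. 0 <= Re z}" "z' : pages_dom Int {z. 0 <= Re z}" and e: "pages a b c d z = pages a b c d z'"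
 then have "Im z *\<^sub>R (b - a) + Re z *\<^sub>R (c - a) = Im z' *\<^sub>R (b - a) + Re z' *\<^sub>R (c - a)"
  using pages_cases(1)[of z a b c d] pages_cases(1)[of z' a b c d] by (simp add: add.assoc)
 from barycentric_unique[OF c(1) nc this] show "z = z'" by (simp add: complex_eq_iff)
qed

section \<open>Edges of the triangulation have degree two or three\<close>

context foam
begin

lemma simplex_nbhd:
 assumes "C : KV" "x : relint C"
 obtains e where "e > 0" "!!D q. D : KV ==> dist x q < e ==> q : conv D ==> C \<subseteq> D"
proof -
 obtain e where e: "e > 0" "!!D q. D : KV ==> dist x q < e ==> q : conv D ==> x : conv D" using star_nbhd by blast
 show ?thesis by (rule that[OF e(1)]) (use carrier_sub[OF assms(1) _ assms(2)] e(2) in blast)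
qed

definition star :: "(real^3) set => (real^3) set set" where "star e = {t:T. e \<subseteq> t}"

lemma star_KV: "t : star e ==> t : KV" and star_T: "t : star e ==> t : T" and finite_star: "finite (star e)"
 using T_KV finT by (auto simp: star_def)

lemma third_vertex:
 assumes "t : star {a,b}" "a ~= b"
 obtains c where "t = {a,b,c}" "c ~= a" "c ~= b"
proof -
 have t: "card t = 3" "{a,b} \<subseteq> t" using assms T_card by (auto simp: star_def)
 then have "finite t" using card.infinite by fastforce
 then have "card (t - {a,b}) = 1" using t assms(2) by (simp add: card_Diff_subset)
 then obtain c where "t - {a,b} = {c}" using card_1_singletonE by blast
 then have "t = {a,b,c}" "c ~= a" "c ~= b" using t(2) by auto
 then show ?thesis by (rule that)
qed

lemma star_near:
 assumes "C : KV" "x : relint C"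
 obtains e where "e > 0" "F Int ball x e \<subseteq> (\<Union>t\<in>star C. conv t)"
proof -
 obtain e where e: "e > 0" "!!D q. D : KV ==> dist x q < e ==> q : conv D ==> C \<subseteq> D" using simplex_nbhd[OF assms] by blast
 show ?thesis
 proof (rule that[OF e(1)], rule subsetI)
  fix q assume q: "q : F Int ball x e"
  then obtain t where t: "t : T" "q : conv t" using F_triangles[of q] by blast
  then have "C \<subseteq> t" using e(2)[OF T_KV[OF t(1)], of q] q by simp
  then show "q : (\<Union>t\<in>star C. conv t)" using t by (auto simp: star_def)
 qed
qed

lemma edge_point:
 fixes a b x :: "real^3"
 assumes "a ~= b" "x : rel_interior (conv {a,b})"
 obtains s where "0 < s" "s < 1" "!!c d. pages a b c d (Complex 0 s) = x" "Complex 0 s : interior pages_dom"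
proof -
 obtain u where u: "ALL v:{a,b}. 0 < u v" "sum u {a,b} = 1" "(\<Sum>v\<in>{a,b}. u v *\<^sub>R v) = x"
 proof -
  have "x : {y. EX u. (ALL v:{a,b}. 0 < u v) & sum u {a,b} = 1 & (\<Sum>v\<in>{a,b}. u v *\<^sub>R v) = y}"
   using assms(2) unfolding rel_interior_convex_hull_explicit[OF affine_independent_2] .
  then show ?thesis by (elim CollectE exE conjE) (rule that)
 qed
 define s where "s = u b"
 have "u a = 1 - s" using u(2) assms(1) by (simp add: s_def)
 then have s: "0 < s" "s < 1" "x = (1 - s) *\<^sub>R a + s *\<^sub>R b" using u(1,3) assms(1) by (auto simp: s_def)
 show ?thesis
 proof (rule that[OF s(1,2)])
  show "pages a b c d (Complex 0 s) = x" for c d by (simp add: pages_def s(3) algebra_simps)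
  show "Complex 0 s : interior pages_dom" by (rule pages_dom_interior) (use s in simp_all)
 qed
qed

lemma triangle_indep: "{a,b,c} : star e ==> ~ affine_dependent {a,b,c}" "{a,b,c} : star e ==> card {a,b,c} = 3"
 using KV_indep star_KV star_T T_card by blast+

lemma star_pair_inter:
 assumes "{a,b,c} : star {a,b}" "{a,b,d} : star {a,b}" "c ~= d" "c ~= a" "c ~= b"
 shows "conv {a,b,c} Int conv {a,b,d} \<subseteq> conv {a,b}"
proof -
 have "{a,b,c} Int {a,b,d} = {a,b}" using assms(3-5) by auto
 then show ?thesis using KV_inter[of "{a,b,c}" "{a,b,d}"] star_KV assms(1,2) by simp
qed

text \<open>Near an interior point of a free edge the foam lies in one triangle. Flattened into a
  half plane with the edge on its boundary, this contradicts the existence of an embedded disc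
  through the point.\<close>

lemma edge_degree_ne_1:
 assumes ab: "a ~= b" "{a,b} : KV"
 shows "card (star {a,b}) ~= 1"
proof
 assume "card (star {a,b}) = 1"
 then obtain t where t: "star {a,b} = {t}" using card_1_singletonE by blast
 obtain c where c: "t = {a,b,c}" "c ~= a" "c ~= b" using third_vertex[of t a b] ab(1) t by blast
 have tS: "{a,b,c} : star {a,b}" using t c by simp
 obtain x where x: "x : rel_interior (conv {a,b})" using rel_interior_eq_empty[of "conv {a,b}"] by auto
 obtain s where s: "pages a b c c (Complex 0 s) = x" "Complex 0 s : interior pages_dom" using edge_point[OF ab(1) x] by metis
 obtain e where e: "e > 0" "F Int ball x e \<subseteq> (\<Union>t\<in>star {a,b}. conv t)" using star_near[OF ab(2) x] by blast
 have sub: "F Int ball x e \<subseteq> conv {a,b,c}" using e(2) by (simp add: t c(1))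
 define Z where "Z = pages_dom Int {z. 0 <= Re z}"
 have "closed {z. 0 <= Re z}" by (intro closed_Collect_le continuous_intros)
 then have Z: "compact Z" unfolding Z_def by (rule compact_Int_closed[OF compact_pages_dom])
 have im: "pages a b c c ` Z = conv {a,b,c}"
 proof (intro equalityI subsetI)
  fix y assume "y : conv {a,b,c}"
  then obtain z where "z : pages_dom" "Re z >= 0" "pages a b c c z = y" using pages_onto(1) by blast
  then show "y : pages a b c c ` Z" unfolding Z_def by blast
 next
  fix y assume "y : pages a b c c ` Z"
  then show "y : conv {a,b,c}" unfolding Z_def using pages_cases(1)[of _ a b c c] by blast
 qed
 obtain \<rho> where h: "homeomorphism Z (conv {a,b,c}) (pages a b c c) \<rho>"
  using homeomorphism_compact[OF Z cont_pages im] pages_inj_half[OF triangle_indep[OF tS], of c] unfolding Z_def by blast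
 have sZ: "Complex 0 s : Z" using s(2) interior_subset[of pages_dom] by (auto simp: Z_def)
 have "~ disc_at F x"
 proof (rule not_disc_at[OF e(1) sub])
  show "continuous_on (conv {a,b,c}) \<rho>" using h by (simp add: homeomorphism_def)
  show "inj_on \<rho> (conv {a,b,c})" using h unfolding homeomorphism_def by (metis inj_on_inverseI)
  show "0 <= Re (\<rho> y)" if "y : conv {a,b,c}" for y
  proof -
   have "\<rho> y : Z" using h that unfolding homeomorphism_def by blast
   then show ?thesis by (simp add: Z_def)
  qed
  have "\<rho> x = Complex 0 s" using h sZ s(1) unfolding homeomorphism_def by metis
  then show "Re (\<rho> x) = 0" by simp
 qed
 then show False using disc_everywhere[of x] KV_F[OF ab(2)] x rel_interior_subset by blast
qed

lemma edge_lp_2: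
 assumes ab: "a ~= b" "{a,b} : KV" and x: "x : rel_interior (conv {a,b})" and two: "card (star {a,b}) = 2"
 shows "loc_plane F x"
proof -
 obtain t t' where t: "star {a,b} = {t,t'}" "t ~= t'" using two by (auto simp: card_2_iff)
 obtain c where c: "t = {a,b,c}" "c ~= a" "c ~= b" using third_vertex[of t a b] ab(1) t by blast
 obtain d where d: "t' = {a,b,d}" "d ~= a" "d ~= b" using third_vertex[of t' a b] ab(1) t by blast
 have S: "{a,b,c} : star {a,b}" "{a,b,d} : star {a,b}" using t(1) c d by simp_all
 have cd: "c ~= d" using t(2) c d by auto
 obtain s where s: "pages a b c d (Complex 0 s) = x" "Complex 0 s : interior pages_dom" using edge_point[OF ab(1) x] by metis
 obtain e where e: "e > 0" "F Int ball x e \<subseteq> (\<Union>t\<in>star {a,b}. conv t)" using star_near[OF ab(2) x] by blast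
 have "loc_plane F (pages a b c d (Complex 0 s))"
 proof (rule loc_plane_chart[OF compact_pages_dom s(2) cont_pages])
  show "inj_on (pages a b c d) pages_dom"
   by (rule pages_inj[OF triangle_indep[OF S(1)] triangle_indep[OF S(2)] star_pair_inter[OF S cd c(2,3)]])
  show "pages a b c d ` pages_dom \<subseteq> F" using pages_range KV_F[OF star_KV[OF S(1)]] KV_F[OF star_KV[OF S(2)]] by blast
  show "openin (top_of_set F) (F Int ball x e)" by (simp add: openin_open_Int)
  show "pages a b c d (Complex 0 s) : F Int ball x e" unfolding s(1) using e(1) KV_F[OF ab(2)] x rel_interior_subset by auto
  show "F Int ball x e \<subseteq> pages a b c d ` pages_dom"
  proof
   fix q assume "q : F Int ball x e"
   then have "q : conv {a,b,c} \<or> q : conv {a,b,d}" using e(2) t(1) c(1) d(1) by auto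
   then show "q : pages a b c d ` pages_dom" using pages_onto(1)[of q a b c d] pages_onto(2)[of q a b d c] by blast
  qed
 qed
 then show ?thesis by (simp only: s(1))
qed

text \<open>Two triangles at the edge form a disc, and a third accumulates on the edge from outside
  of it.\<close>

lemma edge_not_lp_3:
 assumes ab: "a ~= b" "{a,b} : KV" and x: "x : rel_interior (conv {a,b})" and three: "card (star {a,b}) >= 3"
 shows "~ loc_plane F x"
proof -
 obtain S3 where S3: "S3 \<subseteq> star {a,b}" "card S3 = 3" using obtain_subset_with_card_n[OF three] by blast
 then obtain t t' t'' where t: "S3 = {t,t',t''}" "t ~= t'" "t ~= t''" "t' ~= t''" by (auto simp: card_3_iff)
 have tt: "t : star {a,b}" "t' : star {a,b}" "t'' : star {a,b}" using S3(1) t(1) by auto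
 obtain c where c: "t = {a,b,c}" "c ~= a" "c ~= b" using third_vertex[OF tt(1) ab(1)] by blast
 obtain d where d: "t' = {a,b,d}" "d ~= a" "d ~= b" using third_vertex[OF tt(2) ab(1)] by blast
 have S: "{a,b,c} : star {a,b}" "{a,b,d} : star {a,b}" using tt c d by simp_all
 have cd: "c ~= d" using t(2) c d by auto
 obtain s where s: "pages a b c d (Complex 0 s) = x" "Complex 0 s : interior pages_dom" using edge_point[OF ab(1) x] by metis
 have rng: "pages a b c d ` interior pages_dom \<subseteq> conv t Un conv t'"
  using pages_range[of a b c d] interior_subset[of pages_dom] unfolding c(1) d(1) by blast
 have "~ loc_plane F (pages a b c d (Complex 0 s))"
 proof (rule not_loc_planeI[OF open_interior s(2) cont_pages])
  show "inj_on (pages a b c d) (interior pages_dom)"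
   by (rule inj_on_subset[OF pages_inj[OF triangle_indep[OF S(1)] triangle_indep[OF S(2)] star_pair_inter[OF S cd c(2,3)]] interior_subset])
  show "pages a b c d ` interior pages_dom \<subseteq> F" using rng KV_F[OF star_KV[OF tt(1)]] KV_F[OF star_KV[OF tt(2)]] by blast
  have "relint t'' \<subseteq> F - pages a b c d ` interior pages_dom"
  proof
   fix q assume q: "q : relint t''"
   have "q ~: conv t" "q ~: conv t'" using T_distinct_relint[OF star_T[OF tt(3)] _ q] star_T tt t by blast+
   then show "q : F - pages a b c d ` interior pages_dom" using rng KV_F[OF star_KV[OF tt(3)]] q rel_interior_subset by blast
  qed
  moreover have "x : closure (relint t'')"
  proof (rule relint_closure[OF star_KV[OF tt(3)]])
   have "{a,b} \<subseteq> t''" using tt(3) by (simp add: star_def)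
   then show "x : conv t''" using x rel_interior_subset hull_mono[of "{a,b}" t''] by blast
  qed
  ultimately show "pages a b c d (Complex 0 s) : closure (F - pages a b c d ` interior pages_dom)"
   unfolding s(1) using closure_mono by blast
 qed
 then show ?thesis unfolding s(1) .
qed

lemma edge_near:
 assumes ab: "a ~= b" "{a,b} : KV" and x: "x : rel_interior (conv {a,b})" and three: "card (star {a,b}) >= 3"
 obtains e where "e > 0" "!!q. q : F ==> dist x q < e ==> loc_plane F q \<longleftrightarrow> q : \<Union>((%t. relint t) ` star {a,b})"
  "!!q. q : F ==> dist x q < e ==> ~ loc_plane F q \<longleftrightarrow> q : rel_interior (conv {a,b})"
proof -
 obtain e where e: "e > 0" "!!D q. D : KV ==> dist x q < e ==> q : conv D ==> {a,b} \<subseteq> D" using simplex_nbhd[OF ab(2) x] by blast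
 have c: "(q : rel_interior (conv {a,b}) & ~ loc_plane F q) \<or> (q : \<Union>((%t. relint t) ` star {a,b}) & loc_plane F q)"
  if q: "q : F" "dist x q < e" for q
 proof -
  obtain C where C: "C : KV" "q : relint C" using carrier_ex[OF q(1)] .
  have sub: "{a,b} \<subseteq> C" using e(2)[OF C(1) q(2)] C(2) rel_interior_subset by blast
  then have "2 <= card C" using card_mono[OF KV_finite[OF C(1)] sub] ab(1) by simp
  then have "card C = 2 \<or> card C = 3" using card_KV[OF C(1)] by linarith
  then show ?thesis
  proof
   assume "card C = 2"
   then have "C = {a,b}" using card_seteq[OF KV_finite[OF C(1)] sub] ab(1) by simp
   then show ?thesis using C(2) edge_not_lp_3[OF ab _ three] by blast
  next
   assume "card C = 3"
   then have "C : T" "C : star {a,b}" using C(1) sub by (auto simp: T_def star_def)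
   then show ?thesis using C(2) triangle_lp by blast
  qed
 qed
 have lp: "loc_plane F q" if "q : \<Union>((%t. relint t) ` star {a,b})" for q
  using that triangle_lp star_T by blast
 show ?thesis
 proof (rule that[OF e(1)])
  show "loc_plane F q \<longleftrightarrow> q : \<Union>((%t. relint t) ` star {a,b})" if "q : F" "dist x q < e" for q
   using c[OF that] lp by blast
  show "~ loc_plane F q \<longleftrightarrow> q : rel_interior (conv {a,b})" if "q : F" "dist x q < e" for q
   using c[OF that] edge_not_lp_3[OF ab _ three] by blast
 qed
qed

lemma nlp_models:
 assumes "x : F" "~ loc_plane F x"
 obtains "seam_point F x" | "seam_vertex F x"
proof -
 have "loc_plane F x" if d: "pl_locally_like F x disk_model"
 proof -
  obtain U U' g g' where g: "germ F x disk_model 0 U U' g g'" using d by (rule pl_locally_like_germ)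
  show ?thesis using germ.lp_iff[OF g germ.xU[OF g]] disk_loc_plane[of 0] germ.gx[OF g] by (simp add: disk_model_def)
 qed
 then show ?thesis using pts[OF assms(1)] that assms unfolding seam_point_def seam_vertex_def by blast
qed

text \<open>Near the point the nonplanar points are those of the edge, which has two branches there,
  too few for the four rays of a seam vertex. So the point is a seam point, and comparing the
  triangles at the edge with the three legs of the tripod bounds the degree.\<close>

lemma edge_seam:
 assumes ab: "a ~= b" "{a,b} : KV" and x: "x : rel_interior (conv {a,b})" and three: "card (star {a,b}) >= 3"
 shows "seam_point F x & card (star {a,b}) = 3"
proof -
 have xF: "x : F" using KV_F[OF ab(2)] x rel_interior_subset by blast
 obtain e where e: "e > 0" "!!q. q : F ==> dist x q < e ==> loc_plane F q \<longleftrightarrow> q : \<Union>((%t. relint t) ` star {a,b})"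
  "!!q. q : F ==> dist x q < e ==> ~ loc_plane F q \<longleftrightarrow> q : rel_interior (conv {a,b})"
  using edge_near[OF ab x three] by blast
 have seam: "seam_point F x"
 proof (rule ccontr)
  assume "~ seam_point F x"
  then have "seam_vertex F x" using nlp_models[OF xF edge_not_lp_3[OF ab x three]] by blast
  then obtain U U' g g' where g: "germ F x tetrahedron_cone_model 0 U U' g g'" unfolding seam_vertex_def by (auto elim: pl_locally_like_germ)
  interpret germ F x tetrahedron_cone_model 0 U U' g g' by (rule g)
  obtain R where R: "card R = 4" "disjoint R" "!!P. P : R ==> openin (top_of_set (\<Union>R)) P" "!!P. P : R ==> 0 : closure P"
   "\<Union>R \<subseteq> tetrahedron_cone_model" "!!q. q : tetrahedron_cone_model ==> q : \<Union>R \<longleftrightarrow> q ~= 0 & ~ loc_plane tetrahedron_cone_model q"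
   using tetra_ray_facts by metis
  define E1 where "E1 = rel_interior (conv {a,b}) Int {y. (b - a) \<bullet> y > (b - a) \<bullet> x}"
  define E2 where "E2 = rel_interior (conv {a,b}) Int {y. (b - a) \<bullet> y < (b - a) \<bullet> x}"
  have cE: "connected (E Int ball x d)" if "E : {E1,E2}" for E d
  proof -
   have "convex E1" "convex E2" unfolding E1_def E2_def
    by (intro convex_Int convex_rel_interior convex_convex_hull convex_halfspace_gt convex_halfspace_lt)+
   then show ?thesis using that by (auto intro!: convex_connected convex_Int)
  qed
  have split: "y : \<Union>{E1,E2} \<longleftrightarrow> y : rel_interior (conv {a,b}) & y ~= x" for y
  proof -
   have "y = x" if yr: "y : rel_interior (conv {a,b})" and yx: "(b - a) \<bullet> y = (b - a) \<bullet> x"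
   proof -
    have yh: "y : conv {a,b}" using yr rel_interior_subset by blast
    have xh: "x : conv {a,b}" using x rel_interior_subset by blast
    obtain u u' where u: "y = a + u *\<^sub>R (b - a)" "x = a + u' *\<^sub>R (b - a)" using yh xh unfolding convex_hull_2_alt by blast
    have "(u - u') * ((b - a) \<bullet> (b - a)) = 0" using yx unfolding u by (simp add: algebra_simps)
    then have "u = u'" using ab(1) by simp
    then show ?thesis using u by simp
   qed
   then show ?thesis using rel_interior_subset[of "conv {a,b}"] unfolding E1_def E2_def by (auto simp: not_less_iff_gr_or_eq dest: subsetD)
  qed
  obtain d where d: "d > 0" "!!c. c : tetrahedron_cone_model ==> dist 0 c < d ==> c : U' & g' c : U & dist x (g' c) < e"
   using germ.small[OF sym e(1)] by blast
  have "card R <= card {E1,E2}"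
  proof (rule germ.card_sectors_le[OF sym _ R(2,3,4,5) _ _ _ d(1)])
   show "finite R" using R(1) card.infinite by fastforce
   show "\<Union>{E1,E2} \<subseteq> F" using split KV_F[OF ab(2)] rel_interior_subset by blast
   fix q assume q: "q : tetrahedron_cone_model Int ball 0 d" "q : U'"
   have gq: "g' q : U" "dist x (g' q) < e" using d(2)[of q] q by auto
   then have gF: "g' q : F" using UX by blast
   have "q = 0 \<longleftrightarrow> g' q = x" using g'y gg(3)[OF q(2)] gx by metis
   moreover have "loc_plane tetrahedron_cone_model q \<longleftrightarrow> loc_plane F (g' q)" using lp_iff[OF gq(1)] gg(3)[OF q(2)] by simp
   ultimately show "q : \<Union>R \<longleftrightarrow> g' q : \<Union>{E1,E2}" unfolding split using R(6)[of q] q e(3)[OF gF gq(2)] by blast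
  qed (use cE in auto)
  also have "\<dots> <= 2" by (simp add: card_insert_if)
  finally show False using R(1) by simp
 qed
 then obtain U U' g g' where g: "germ F x tripod_model 0 U U' g g'" unfolding seam_point_def by (auto elim: pl_locally_like_germ)
 interpret germ F x tripod_model 0 U U' g g' by (rule g)
 let ?P = "(%t. relint t) ` star {a,b}"
 have dis: "t = t'" if "t : star {a,b}" "t' : star {a,b}" "y : relint t" "y : relint t'" for t t' y
  using T_distinct_relint[OF star_T[OF that(1)] star_T[OF that(2)] that(3)] that(4) rel_interior_subset by blast
 have "inj_on (%t. relint t) (star {a,b})"
 proof (rule inj_onI)
  fix t t' assume t: "t : star {a,b}" "t' : star {a,b}" "relint t = relint t'"
  have "t ~= {}" using t(1) by (auto simp: star_def)
  then obtain y where "y : relint t" using rel_interior_eq_empty[of "conv t"] by auto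
  then show "t = t'" using dis[OF t(1,2)] t(3) by simp
 qed
 then have "card (star {a,b}) = card ?P" by (simp add: card_image)
 also have "card ?P <= card (th ` I3)"
 proof (rule card_sectors_le[OF _ _ _ _ _ _ _ _ e(1)])
  show "finite ?P" using finite_star by simp
  show "disjoint ?P" unfolding pairwise_def disjnt_def using dis by blast
  show "\<Union>?P \<subseteq> F" using KV_F star_KV rel_interior_subset by blast
  show "finite (th ` I3)" by simp
  show "\<Union>(th ` I3) \<subseteq> tripod_model" using th_sub by blast
  show "connected (Q Int ball 0 d)" if "Q : th ` I3" for Q d
   using that th_convex by (auto intro!: convex_connected convex_Int)
  show "x : closure P" if "P : ?P" for P
  proof -
   obtain t where t: "t : star {a,b}" "P = relint t" using \<open>P : ?P\<close> by blast
   have "{a,b} \<subseteq> t" using t(1) by (simp add: star_def)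
   then have "x : conv t" using x rel_interior_subset hull_mono[of "{a,b}" t] by blast
   then show ?thesis unfolding t(2) by (rule relint_closure[OF star_KV[OF t(1)]])
  qed
  show "openin (top_of_set (\<Union>?P)) P" if PP: "P : ?P" for P
  proof -
   obtain t where t: "t : star {a,b}" "P = relint t" using PP by blast
   have "closed (\<Union>t'\<in>star {a,b} - {t}. conv t')" by (rule closed_UN) (use finite_star closed_hull star_KV in auto)
   then have o: "open (- (\<Union>t'\<in>star {a,b} - {t}. conv t'))" by (simp add: open_closed)
   have "P = \<Union>?P Int - (\<Union>t'\<in>star {a,b} - {t}. conv t')"
   proof (intro equalityI subsetI)
    fix y assume y: "y : P"
    then have "y ~: conv t'" if "t' : star {a,b} - {t}" for t'
     using T_distinct_relint[of t t' y] that star_T t by blast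
    then show "y : \<Union>?P Int - (\<Union>t'\<in>star {a,b} - {t}. conv t')" using y PP by blast
   next
    fix y assume y: "y : \<Union>?P Int - (\<Union>t'\<in>star {a,b} - {t}. conv t')"
    then obtain t' where "t' : star {a,b}" "y : relint t'" by blast
    moreover then have "t' = t" using y rel_interior_subset by blast
    ultimately show "y : P" using t(2) by simp
   qed
   then show ?thesis using o openin_open by blast
  qed
  fix q assume q: "q : F Int ball x e" "q : U"
  have "loc_plane tripod_model (g q) \<longleftrightarrow> g q : \<Union>(th ` I3)"
   using tripod_facts(3)[of "g q"] th_loc_plane gg(2)[OF q(2)] UY by blast
  then show "q : \<Union>?P \<longleftrightarrow> g q : \<Union>(th ` I3)" using e(2)[of q] q lp_iff[OF q(2)] by simp
 qed
 also have "\<dots> = 3" by (rule tripod_facts(1))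
 finally show ?thesis using seam three by simp
qed

lemma edge_ab: assumes "e : edges_of T" obtains a b where "e = {a,b}" "a ~= b" "{a,b} : KV"
proof -
 obtain t where t: "card e = 2" "t : T" "e \<subseteq> t" using assms by (auto simp: edges_of_def)
 obtain a b where "e = {a,b}" "a ~= b" using t(1) by (auto simp: card_2_iff)
 then show ?thesis using that KV_sub[OF T_KV[OF t(2)] t(3)] by blast
qed

lemma star_nonempty: "e : edges_of T ==> star e ~= {}" by (auto simp: edges_of_def star_def)

lemma edge_degree: assumes "e : edges_of T" shows "card (star e) : {2,3}"
proof -
 obtain a b where ab: "e = {a,b}" "a ~= b" "{a,b} : KV" using edge_ab[OF assms] .
 have "card (star e) ~= 0" using star_nonempty[OF assms] finite_star by simp
 moreover have "card (star e) ~= 1" unfolding ab(1) by (rule edge_degree_ne_1[OF ab(2,3)])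
 moreover have "card (star e) = 3" if "card (star e) >= 3"
 proof -
  obtain x where "x : rel_interior (conv {a,b})" using rel_interior_eq_empty[of "conv {a,b}"] by auto
  then show ?thesis using edge_seam[OF ab(2,3)] that unfolding ab(1) by blast
 qed
 ultimately have "card (star e) = 2 \<or> card (star e) = 3" by linarith
 then show ?thesis by blast
qed

lemma edge_2_lp: "e : edges_of T ==> x : relint e ==> card (star e) = 2 ==> loc_plane F x"
 by (erule edge_ab) (simp add: edge_lp_2)

lemma edge_3_seam: "e : edges_of T ==> x : relint e ==> card (star e) = 3 ==> seam_point F x & ~ loc_plane F x"
 by (erule edge_ab) (simp add: edge_seam edge_not_lp_3)

text \<open>Turns the definition by PL models into a topological condition that can be tested on
  open triangles and edges.\<close>

lemma singular_graph_eq: "singular_graph F = {x:F. ~ loc_plane F x}"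
proof (intro equalityI subsetI)
 fix x assume "x : {x:F. ~ loc_plane F x}"
 then show "x : singular_graph F" unfolding singular_graph_def by (auto elim: nlp_models)
next
 fix x assume "x : singular_graph F"
 then consider "x : F" "pl_locally_like F x tripod_model" | "x : F" "pl_locally_like F x tetrahedron_cone_model"
  unfolding singular_graph_def seam_point_def seam_vertex_def by blast
 then show "x : {x:F. ~ loc_plane F x}"
 proof cases
  case 1
  then obtain U U' g g' where g: "germ F x tripod_model 0 U U' g g'" by (auto elim: pl_locally_like_germ)
  have "~ loc_plane F x" using germ.lp_imp[OF g germ.xU[OF g]] tripod_facts(3)[OF tripod_facts(2,5)] unfolding germ.gx[OF g] by blast
  then show ?thesis using 1 by simp
 next
  case 2
  then obtain U U' g g' where g: "germ F x tetrahedron_cone_model 0 U U' g g'" by (auto elim: pl_locally_like_germ)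
  have "~ loc_plane F x" using germ.lp_imp[OF g germ.xU[OF g]] tetra_zero_not_loc_plane unfolding germ.gx[OF g] by blast
  then show ?thesis using 2 by simp
 qed
qed

end

section \<open>Facets, triangles and connected vertex links\<close>

context foam
begin

definition S0 where "S0 = F - singular_graph F"

lemma S0_eq: "S0 = {x:F. loc_plane F x}" unfolding S0_def singular_graph_eq by blast

definition fac :: "(real^3) set => (real^3) set" where
 "fac t = facet_containing F (SOME x. x : relint t)"

lemma relint_ex: assumes "t : T" shows "EX x. x : relint t"
proof -
 have "t ~= {}" using T_card[OF assms] by auto
 then show ?thesis using rel_interior_eq_empty[of "conv t"] by auto
qed

lemma relint_S0: "t : T ==> relint t \<subseteq> S0"
 unfolding S0_eq using triangle_lp KV_F[OF T_KV] rel_interior_subset by blast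

text \<open>Adding a boundary point to the open triangle keeps it connected, so every nonsingular
  point of the triangle lies in the same facet; in particular the choice in \<open>fac\<close> is
  immaterial.\<close>

lemma fac_eq: assumes "t : T" "q : S0" "q : conv t" shows "facet_containing F q = fac t"
proof -
 define x where "x = (SOME x. x : relint t)"
 have x: "x : relint t" unfolding x_def by (rule someI_ex[OF relint_ex[OF assms(1)]])
 have "connected (insert q (relint t))"
 proof (rule connected_intermediate_closure)
  show "connected (relint t)" by (intro convex_connected convex_rel_interior convex_convex_hull)
  show "insert q (relint t) \<subseteq> closure (relint t)"
   using relint_closure[OF T_KV[OF assms(1)] assms(3)] closure_subset by blast
 qed blast
 moreover have "insert q (relint t) \<subseteq> S0" using relint_S0 assms by blast
 ultimately have "connected_component S0 x q" unfolding connected_component_def using x by blast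
 then show ?thesis unfolding facet_containing_def fac_def x_def[symmetric] S0_def[symmetric]
  using connected_component_eq[of q S0 x] by blast
qed

lemma fac_facet: "t : T ==> fac t : facets F"
 unfolding facets_def fac_def facet_containing_def
 by (rule componentsI) (use relint_S0[unfolded S0_def] someI_ex[OF relint_ex] in blast)

lemma relint_fac: assumes "t : T" shows "relint t \<subseteq> fac t"
proof
 fix x assume x: "x : relint t"
 then have s: "x : S0" using relint_S0 assms by blast
 have "facet_containing F x = fac t" using fac_eq[OF assms s] x rel_interior_subset by blast
 moreover have "x : facet_containing F x" unfolding facet_containing_def using s by (simp add: S0_def)
 ultimately show "x : fac t" by simp
qed

lemma facet_point: assumes "f : facets F" "q : f" shows "q : S0 & facet_containing F q = f"
proof -
 obtain y where y: "f = connected_component_set S0 y" using assms(1) unfolding facets_def S0_def[symmetric] components_iff by blast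
 have "q : S0" using assms(2) y connected_component_in by blast
 moreover have "connected_component_set S0 q = f" using connected_component_eq[of q S0 y] assms(2) y by blast
 ultimately show ?thesis by (simp add: facet_containing_def S0_def)
qed

lemma closure_facet: assumes "f : facets F" shows "closure f = (\<Union>t\<in>{t:T. fac t = f}. conv t)"
proof
 have "closed (\<Union>t\<in>{t:T. fac t = f}. conv t)" by (rule closed_UN) (use finT closed_hull T_KV in auto)
 moreover have "f \<subseteq> (\<Union>t\<in>{t:T. fac t = f}. conv t)"
 proof
  fix q assume q: "q : f"
  note p = facet_point[OF assms q]
  then obtain t where t: "t : T" "q : conv t" using F_triangles[of q] by (auto simp: S0_def)
  then have "fac t = f" using fac_eq[OF t(1) _ t(2)] p by metis
  then show "q : (\<Union>t\<in>{t:T. fac t = f}. conv t)" using t by blast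
 qed
 ultimately show "closure f \<subseteq> (\<Union>t\<in>{t:T. fac t = f}. conv t)" by (simp add: closure_minimal)
 show "(\<Union>t\<in>{t:T. fac t = f}. conv t) \<subseteq> closure f"
 proof
  fix q assume "q : (\<Union>t\<in>{t:T. fac t = f}. conv t)"
  then obtain t where t: "t : T" "fac t = f" "q : conv t" by blast
  then show "q : closure f" using relint_closure[OF T_KV[OF t(1)] t(3)] closure_mono[OF relint_fac[OF t(1)]] by blast
 qed
qed

lemma facet_triangle: assumes "f : facets F" obtains t where "t : T" "fac t = f"
proof -
 obtain q where q: "q : f" using in_components_nonempty[of f] assms unfolding facets_def by blast
 note p = facet_point[OF assms q]
 then obtain t where t: "t : T" "q : conv t" using F_triangles[of q] by (auto simp: S0_def)
 show ?thesis by (rule that[OF t(1)]) (use fac_eq[OF t(1) _ t(2)] p in metis)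
qed

text \<open>The triangles with the color of \<open>t\<close> and the others give two closed sets
  that cover \<open>S\<close> and, by hypothesis, do not meet on it.\<close>

lemma mono_connected:
 assumes "connected S" "S \<subseteq> F"
  and m: "!!x t t'. x : S ==> t : T ==> t' : T ==> x : conv t ==> x : conv t' ==> k t = k t'"
  and t: "t : T" "S Int conv t ~= {}" and t': "t' : T" "S Int conv t' ~= {}"
 shows "k t = k t'"
proof (rule ccontr)
 assume n: "k t ~= k t'"
 define A where "A = (\<Union>s\<in>{s:T. k s = k t}. conv s)"
 define B where "B = (\<Union>s\<in>{s:T. k s ~= k t}. conv s)"
 have cl: "closed A" "closed B" unfolding A_def B_def by (rule closed_UN; use finT closed_hull T_KV in auto)+
 have A: "x : A \<longleftrightarrow> (EX s:T. k s = k t & x : conv s)" and B: "x : B \<longleftrightarrow> (EX s:T. k s ~= k t & x : conv s)" for x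
  unfolding A_def B_def by blast+
 have "x ~: A Int B" if "x : S" for x using m[OF that] A B by (metis IntE)
 then have 1: "A Int B Int S = {}" by blast
 have "x : A Un B" if xS: "x : S" for x
 proof -
  obtain s where "s : T" "x : conv s" using F_triangles[of x] xS assms(2) by blast
  then show ?thesis using A[of x] B[of x] by blast
 qed
 then have 2: "S \<subseteq> A Un B" by blast
 obtain x x' where "x : S" "x : conv t" "x' : S" "x' : conv t'" using t t' by blast
 then have "x : A Int S" "x' : B Int S" using A[of x] B[of x'] t(1) t'(1) n by fastforce+
 then show False using connected_closedD[OF assms(1) 1 2 cl] by blast
qed

lemma proper_edge:
 assumes "proper_coloring T k" "e : edges_of T" "t : star e" "t' : star e" "t ~= t'"
 shows "k t = k t' \<longleftrightarrow> card (star e) = 2"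
proof -
 have "ALL e:edges_of T. ALL t:T. ALL t':T. e \<subseteq> t --> e \<subseteq> t' --> t ~= t' --> (k t = k t' \<longleftrightarrow> card {t:T. e \<subseteq> t} = 2)"
  using assms(1) unfolding proper_coloring_def by (rule conjunct2)
 then have "k t = k t' \<longleftrightarrow> card {t:T. e \<subseteq> t} = 2" using assms(2-5) by (simp add: star_def)
 then show ?thesis by (simp add: star_def)
qed

lemma proper_range: "proper_coloring T k ==> t : T ==> k t : {1,2,3}"
 unfolding proper_coloring_def by (auto simp: PiE_iff)

lemma proper_three: assumes "proper_coloring T k" "e : edges_of T" "card (star e) = 3" shows "inj_on k (star e)" "k ` star e = {1,2,3}"
proof -
 show i: "inj_on k (star e)" using proper_edge[OF assms(1,2)] assms(3) unfolding inj_on_def by fastforce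
 show "k ` star e = {1,2,3}" by (rule inj_three_surj[OF i assms(3)]) (use proper_range[OF assms(1)] star_T in blast)
qed

lemma edge_of_KV: assumes "C : KV" "card C = 2" shows "C : edges_of T"
proof -
 have "C ~= {}" using assms(2) by auto
 then obtain t where "t : T" "C \<subseteq> t" using pure[OF assms(1)] by blast
 then show ?thesis using assms(2) by (auto simp: edges_of_def)
qed

lemma mono_lp1:
 assumes k: "proper_coloring T k" and x: "loc_plane F x" and C: "C : KV" "x : relint C" "card C >= 2"
  and t: "t : T" "x : conv t" and t': "t' : T" "x : conv t'"
 shows "k t = k t'"
proof -
 have s: "C \<subseteq> t" "C \<subseteq> t'" using carrier_sub[OF C(1) T_KV C(2)] t t' by blast+
 have "card C = 2 \<or> card C = 3" using C(3) card_KV[OF C(1)] by linarith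
 then show ?thesis
 proof
  assume c: "card C = 2"
  note e = edge_of_KV[OF C(1) c]
  have "card (star C) = 2" using edge_degree[OF e] edge_3_seam[OF e C(2)] x by blast
  then show ?thesis using proper_edge[OF k e, of t t'] s t(1) t'(1) unfolding star_def by blast
 next
  assume "card C = 3"
  then have "C : T" using C(1) by (simp add: T_def)
  then show ?thesis using T_max[of C t] T_max[of C t'] s t t' T_KV by metis
 qed
qed

lemma vertex_carrier: assumes "{v} : KV" "D : KV" "v : conv D" shows "v : D"
 using carrier_sub[OF assms(1,2) _ assms(3)] by simp

lemma not_vertex_relint: assumes "{v} : KV" "t : T" shows "v ~: relint t"
proof
 assume "v : relint t"
 then have "t \<subseteq> {v}" by (rule carrier_sub[OF T_KV[OF assms(2)] assms(1)]) simp
 then have "card t <= 1" using card_mono[of "{v}" t] by simp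
 then show False using T_card[OF assms(2)] by simp
qed

lemma carrier_ge_2:
 assumes "C : KV" "q : relint C" "v : conv C" "q ~= v"
 shows "card C >= 2"
proof (rule ccontr)
 assume "~ 2 <= card C"
 moreover have "card C ~= 0" using assms(2) KV_finite[OF assms(1)] by auto
 ultimately have "card C = 1" by linarith
 then obtain w where "C = {w}" using card_1_singletonE by blast
 then show False using assms(2-4) by simp
qed

text \<open>The delicate case is a planar point that is a vertex of the triangulation. The punctured
  disc of the chart is connected and consists of planar points whose carriers have at least two
  vertices, where \<open>mono_lp1\<close> applies, and every triangle at the vertex meets
  it.\<close>

lemma mono_lp:
 assumes k: "proper_coloring T k" and x: "loc_plane F x" "x : F"
  and t: "t : T" "x : conv t" and t': "t' : T" "x : conv t'"
 shows "k t = k t'"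
proof -
 obtain C where C: "C : KV" "x : relint C" using carrier_ex[OF x(2)] .
 show ?thesis
 proof (cases "card C >= 2")
  case True
  then show ?thesis using mono_lp1[OF k x(1) C] t t' by blast
 next
  case False
  moreover have "card C ~= 0" using C(2) KV_finite[OF C(1)] by auto
  ultimately have "card C = 1" by linarith
  then obtain w where "C = {w}" using card_1_singletonE by blast
  then have V: "{x} : KV" using C by simp
  obtain M H U U' g g' where m: "germ F x M 0 U U' g g'" "M = disk_model & H = {disk_model - {0}}" and sm: "star_model M H" using model_ex[OF x(2)] x(1) by metis
  interpret germ F x disk_model 0 U U' g g' using m by simp
  obtain e where e: "e > 0" "!!C q. C : KV ==> dist x q < e ==> q : conv C ==> x : conv C" using star_nbhd by blast
  obtain d where d: "d > 0" "!!c. c : disk_model ==> dist 0 c < d ==> c : U' & g' c : U & dist x (g' c) < e"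
   using germ.small[OF sym e(1)] by blast
  obtain e' where e': "e' > 0" "!!q. q : F ==> dist x q < e' ==> q : U & g q : U' & dist 0 (g q) < d"
   using small[OF d(1)] by blast
  define S where "S = g' ` ((disk_model - {0}) Int ball 0 d)"
  have "connected ((disk_model - {0}) Int ball 0 d)" using sm m(2) unfolding star_model_def by simp
  then have S: "connected S" unfolding S_def by (rule connected_image) (use d(2) in auto)
  have Sp: "q : F & loc_plane F q & q ~= x & dist x q < e" if qS: "q : S" for q
  proof -
   obtain c where cc: "c : (disk_model - {0}) Int ball 0 d" "q = g' c" using qS unfolding S_def by (elim imageE) blast
   then have c: "c : disk_model" "c ~= 0" "dist 0 c < d" "q = g' c" by simp_all
   note dc = d(2)[OF c(1,3)]
   have "loc_plane F (g' c)" using lp_iff[of "g' c"] dc gg(3)[of c] disk_loc_plane[OF c(1)] by simp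
   moreover have "g' c ~= x" using gg(3)[of c] dc gx c(2) by metis
   ultimately show ?thesis using dc c(4) UX by blast
  qed
  have meets: "S Int conv s ~= {}" if s: "s : T" "x : conv s" for s
  proof -
   obtain q where q: "q : relint s" "dist q x < e'"
    using relint_closure[OF T_KV[OF s(1)] s(2)] e'(1) unfolding closure_approachable by blast
   have qF: "q : F" "q : conv s" using q(1) KV_F[OF T_KV[OF s(1)]] rel_interior_subset by blast+
   have g: "q : U" "g q : U'" "dist 0 (g q) < d" using e'(2)[OF qF(1)] q(2) by (simp_all add: dist_commute)
   have "q ~= x" using not_vertex_relint[OF V s(1)] q(1) by blast
   then have "g q ~= 0" using gg(1)[OF g(1)] g'y by metis
   then have "g q : (disk_model - {0}) Int ball 0 d" using g UY by auto
   then have "q : S" unfolding S_def using gg(1)[OF g(1)] by (metis imageI)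
   then show ?thesis using qF(2) by blast
  qed
  show ?thesis
  proof (rule mono_connected[OF S _ _ t(1) meets[OF t] t'(1) meets[OF t']])
   show "S \<subseteq> F" using Sp by blast
   fix q s s' assume q: "q : S" "s : T" "s' : T" "q : conv s" "q : conv s'"
   note p = Sp[OF q(1)]
   obtain D where D: "D : KV" "q : relint D" using carrier_ex[of q] p by blast
   have "x : conv D" using e(2)[OF D(1), of q] D(2) p rel_interior_subset by blast
   then have "card D >= 2" using carrier_ge_2[OF D] p by blast
   then show "k s = k s'" using mono_lp1[OF k _ D] p q by blast
  qed
 qed
qed

lemma mono_set:
 assumes "proper_coloring T k" "connected S" "S \<subseteq> S0" "t : T" "S Int conv t ~= {}" "t' : T" "S Int conv t' ~= {}"
 shows "k t = k t'"
 by (rule mono_connected[OF assms(2) _ _ assms(4-7)]) (use assms(3) mono_lp[OF assms(1)] S0_eq in blast)+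

text \<open>The sectors of the local model at \<open>v\<close> inherit colors from the triangles
  they meet, and along each seam these are distinct. Hence the part colored \<open>i\<close> or
  \<open>j\<close>, with the seams, is connected by \<open>star_model\<close>. A partition of the
  triangles at \<open>v\<close> covers it by two closed sets, which must share a point other than
  \<open>v\<close>; the triangles through that point have a common edge at \<open>v\<close>.\<close>

lemma linked:
 assumes k: "proper_coloring T k" and ij: "i : {1,2,3}" "j : {1,2,3}" "i ~= j"
 shows "vertex_linked {t:T. k t : {i,j}} v"
 unfolding vertex_linked_def
proof (intro allI impI)
 fix A B assume AB: "A Un B = {t : {t:T. k t : {i,j}}. v : t}" "A ~= {}" "B ~= {}" "A Int B = {}"
 have St: "t : A Un B \<longleftrightarrow> t : T & k t : {i,j} & v : t" for t unfolding AB(1) by simp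
 obtain t0 where "t0 : A" using AB(2) by blast
 then have t0: "t0 : T" "v : t0" using St by blast+
 have V: "{v} : KV" by (rule KV_sub[OF T_KV[OF t0(1)]]) (use t0 in simp)
 have vF: "v : F" using KV_F[OF V] by simp
 obtain M H U U' g g' where sm: "star_model M H" and gm: "germ F v M 0 U U' g g'" using model_ex[OF vF] by metis
 interpret germ F v M 0 U U' g g' by (rule gm)
 have finH: "finite H" and hM: "!!h. h : H ==> h \<subseteq> M - {0}" and hc: "!!h d. h : H ==> connected (h Int ball 0 d)"
  and hlp: "!!h y. h : H ==> y : h ==> loc_plane M y"
  using sm unfolding star_model_def by auto
 define R where "R = M - {0} - \<Union>H"
 have Rp: "~ loc_plane M y" "card {h:H. y : closure h} = 3" if "y : R" for y
  using sm that unfolding star_model_def R_def by auto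
 obtain e where e: "e > 0" "!!C q. C : KV ==> dist v q < e ==> q : conv C ==> v : conv C" using star_nbhd by blast
 obtain d where d: "d > 0" "!!c. c : M ==> dist 0 c < d ==> c : U' & g' c : U & dist v (g' c) < e"
  using germ.small[OF sym e(1)] by blast
 obtain e' where e': "e' > 0" "!!q. q : F ==> dist v q < e' ==> q : U & g q : U' & dist 0 (g q) < d"
  using small[OF d(1)] by blast
 have near: "g' c : F" "c : U'" "g (g' c) = c" "loc_plane F (g' c) \<longleftrightarrow> loc_plane M c" "g' c ~= v \<longleftrightarrow> c ~= 0"
  "!!C. C : KV ==> g' c : conv C ==> v : C"
  if c: "c : M" "dist 0 c < d" for c
 proof -
  note dc = d(2)[OF c]
  show "g' c : F" "c : U'" "g (g' c) = c" using dc UX gg(3) by auto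
  show "loc_plane F (g' c) \<longleftrightarrow> loc_plane M c" using lp_iff[of "g' c"] dc gg(3)[of c] by simp
  show "g' c ~= v \<longleftrightarrow> c ~= 0" using dc gg(3)[of c] gx g'y by metis
  show "v : C" if "C : KV" "g' c : conv C" for C using vertex_carrier[OF V that(1) e(2)[OF that(1) _ that(2)]] dc by blast
 qed
 define hits where "hits h t \<longleftrightarrow> t : T & g' ` (h Int ball 0 d) Int conv t ~= {}" for h t
 \<comment> \<open>The default 1 only keeps the value in range: a sector that meets the ball is hit
   by some triangle.\<close>
 define col where "col h = (if EX t. hits h t then k (SOME t. hits h t) else 1)" for h
 have colh: "k t = col h" if h: "h : H" and t: "hits h t" for h t
 proof -
  have s: "hits h (SOME t. hits h t)" using t by (rule someI)
  have c: "connected (g' ` (h Int ball 0 d))" by (rule connected_image[OF hc[OF h]]) (use near(2) hM[OF h] in auto)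
  have "g' ` (h Int ball 0 d) \<subseteq> S0"
  proof
   fix q assume "q : g' ` (h Int ball 0 d)"
   then obtain c where c: "c : h" "dist 0 c < d" "q = g' c" by auto
   then show "q : S0" using near(1,4)[of c] hM[OF h] hlp[OF h] unfolding S0_eq by blast
  qed
  then have "k t = k (SOME t. hits h t)" using mono_set[OF k c] t s unfolding hits_def by blast
  then show ?thesis using t by (auto simp: col_def)
 qed
 have colr: "col : H \<rightarrow> {1,2,3}"
 proof
  fix h assume "h : H"
  show "col h : {1,2,3}"
  proof (cases "EX t. hits h t")
   case True
   then have "hits h (SOME t. hits h t)" by (rule someI_ex)
   then have "k (SOME t. hits h t) : {1,2,3}" using proper_range[OF k] by (simp add: hits_def)
   then show ?thesis using True by (simp add: col_def)
  qed (simp add: col_def)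
 qed
 have approach: "EX h:H. g q : h & col h = k t & dist 0 (g q) < d"
  if t: "t : T" and q: "q : relint t" "q : U" "dist 0 (g q) < d" for t q
 proof -
  have qS: "q : S0" "q : conv t" using q(1) relint_S0[OF t] rel_interior_subset by blast+
  have "q ~= v" using not_vertex_relint[OF V t] q(1) by blast
  then have "g q ~= 0" using gg(1)[OF q(2)] g'y by metis
  moreover have "loc_plane M (g q)" using lp_iff[OF q(2)] qS(1) S0_eq by blast
  moreover have gM: "g q : M" using gg(2)[OF q(2)] UY by blast
  ultimately obtain h where h: "h : H" "g q : h" using Rp(1)[of "g q"] unfolding R_def by blast
  have "g' (g q) : g' ` (h Int ball 0 d)" using h(2) q(3) by auto
  then have "hits h t" unfolding hits_def using t qS(2) gg(1)[OF q(2)] by auto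
  then show ?thesis using colh[OF h(1)] h q(3) by metis
 qed
 \<comment> \<open>The carrier of a seam point near \<open>v\<close> is an edge of degree 3, whose
   triangles show all three colors. Each of them approaches the point through sectors of its own
   color, and as there are finitely many sectors one of these has the point in its closure.\<close>
 have ray: "EX t:T. k t = n & v : t & g' y : conv t & (EX h:H. y : closure h & col h = n)"
  if y: "y : R" "dist 0 y < d" and n: "n : {1,2,3}" for y n
 proof -
  have yM: "y : M" "y ~= 0" using y(1) by (auto simp: R_def)
  note ny = near[OF yM(1) y(2)]
  have nlp: "~ loc_plane F (g' y)" using ny(4) Rp(1)[OF y(1)] by blast
  obtain D where D: "D : KV" "g' y : relint D" using carrier_ex[OF ny(1)] .
  have hD: "g' y : conv D" using D(2) rel_interior_subset by blast
  have vD: "v : D" by (rule ny(6)[OF D(1) hD])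
  have "card D >= 2" by (rule carrier_ge_2[OF D hull_inc[OF vD]]) (use ny(5) yM(2) in blast)
  moreover have "card D ~= 3" using triangle_lp[of D] D nlp by (auto simp: T_def)
  ultimately have c2: "card D = 2" using card_KV[OF D(1)] by linarith
  note De = edge_of_KV[OF D(1) c2]
  have "card (star D) = 3" using edge_degree[OF De] edge_2_lp[OF De D(2)] nlp by blast
  then obtain t where t: "t : star D" "k t = n" using proper_three(2)[OF k De] n by (metis imageE)
  have tT: "t : T" "D \<subseteq> t" using t(1) by (auto simp: star_def)
  have yt: "g' y : conv t" using hD hull_mono[OF tT(2)] by blast
  have U: "g' y : U" using gg(4)[OF ny(2)] .
  have "relint t \<subseteq> F" using relint_S0[OF tT(1)] by (auto simp: S0_def)
  from closure_imp[OF U this relint_closure[OF T_KV[OF tT(1)] yt]]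
  have "y : closure (g ` (relint t Int U))" unfolding ny(3) .
  then have "y : ball 0 d Int closure (g ` (relint t Int U))" using y(2) by simp
  then have "y : closure (ball 0 d Int g ` (relint t Int U))" using open_Int_closure_subset[OF open_ball] by blast
  moreover have "ball 0 d Int g ` (relint t Int U) \<subseteq> \<Union>{h:H. col h = k t}"
  proof
   fix z assume "z : ball 0 d Int g ` (relint t Int U)"
   then obtain q where "q : relint t" "q : U" "dist 0 (g q) < d" "z = g q" by auto
   then show "z : \<Union>{h:H. col h = k t}" using approach[OF tT(1), of q] by blast
  qed
  ultimately have "y : closure (\<Union>{h:H. col h = k t})" using closure_mono by blast
  also have "closure (\<Union>{h:H. col h = k t}) \<subseteq> \<Union>(closure ` {h:H. col h = k t})"
  proof (rule closure_minimal)
   show "\<Union>{h:H. col h = k t} \<subseteq> \<Union>(closure ` {h:H. col h = k t})" using closure_subset by blast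
   show "closed (\<Union>(closure ` {h:H. col h = k t}))" using finH by (intro closed_Union) auto
  qed
  finally show ?thesis using t(2) tT vD yt by blast
 qed
 have inj: "inj_on col {h:H. y : closure h}" if y: "y : R" "dist 0 y < d" for y
 proof (rule eq_card_imp_inj_on)
  show f: "finite {h:H. y : closure h}" using finH by simp
  have "{1,2,3} \<subseteq> col ` {h:H. y : closure h}"
  proof
   fix n :: nat assume "n : {1,2,3}"
   from ray[OF y this] obtain h where "h : H" "y : closure h" "col h = n" by metis
   then show "n : col ` {h:H. y : closure h}" by (intro image_eqI[of _ _ h]) simp_all
  qed
  then have "3 <= card (col ` {h:H. y : closure h})" using card_mono[OF finite_imageI[OF f], of "{1,2,3}" col] by simp
  moreover have "card (col ` {h:H. y : closure h}) <= 3" using card_image_le[OF f, of col] Rp(2)[OF y(1)] by simp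
  ultimately show "card (col ` {h:H. y : closure h}) = card {h:H. y : closure h}" using Rp(2)[OF y(1)] by simp
 qed
 define Y where "Y = (\<Union>{h:H. col h : {i,j}} Un R) Int ball 0 d"
 have "connected Y"
 proof -
  have "ALL (col :: _ => nat) i j d. i ~= j --> i : {1,2,3} --> j : {1,2,3} --> col : H \<rightarrow> {1,2,3} -->
    (ALL y:R. dist 0 y < d --> inj_on col {h:H. y : closure h}) -->
    connected ((\<Union>{h:H. col h : {i,j}} Un R) Int ball 0 d)"
   using sm unfolding star_model_def R_def[symmetric] by (elim conjE)
  from this[rule_format, OF ij(3,1,2) colr inj] show ?thesis unfolding Y_def .
 qed
 moreover have YM: "y : M & y ~= 0 & dist 0 y < d" if "y : Y" for y using that hM unfolding Y_def R_def by auto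
 ultimately have Z: "connected (g' ` Y)" by (intro connected_image) (use near(2) in blast)+
 have cov: "EX t:A Un B. g' y : conv t" if y: "y : Y" for y
 proof -
  note yM = YM[OF y]
  show ?thesis
  proof (cases "y : R")
   case True
   then show ?thesis using ray[OF True _ ij(1)] yM St by blast
  next
   case False
   then obtain h where h: "h : H" "col h : {i,j}" "y : h" using y unfolding Y_def by blast
   obtain t where t: "t : T" "g' y : conv t" using F_triangles[of "g' y"] near(1)[of y] yM by blast
   have "y : h Int ball 0 d" using h(3) yM by simp
   then have "g' y : g' ` (h Int ball 0 d)" by (rule imageI)
   then have "hits h t" unfolding hits_def using t by blast
   then have "k t : {i,j}" using colh[OF h(1)] h(2) by simp
   moreover have "v : t" using near(6)[of y t] T_KV[OF t(1)] t(2) yM by blast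
   ultimately show ?thesis using St t by blast
  qed
 qed
 have meets: "g' ` Y Int conv t ~= {}" if t: "t : A Un B" for t
 proof -
  have tT: "t : T" "k t : {i,j}" "v : t" using St t by blast+
  obtain q where q: "q : relint t" "dist q v < e'"
   using relint_closure[OF T_KV[OF tT(1)] hull_inc[OF tT(3)]] e'(1) unfolding closure_approachable by blast
  have qF: "q : F" "q : conv t" using q(1) KV_F[OF T_KV[OF tT(1)]] rel_interior_subset by blast+
  have gq: "q : U" "dist 0 (g q) < d" using e'(2)[OF qF(1)] q(2) by (simp_all add: dist_commute)
  obtain h where "h : H" "g q : h" "col h = k t" using approach[OF tT(1) q(1) gq] by blast
  then have "g q : Y" unfolding Y_def using tT(2) gq(2) by auto
  then have "g' (g q) : g' ` Y" by (rule imageI)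
  then show ?thesis using gg(1)[OF gq(1)] qF(2) by auto
 qed
 have fin: "finite A" "finite B" using St finT finite_subset[of "A Un B" T] by auto
 have cl: "closed (\<Union>t\<in>A. conv t)" "closed (\<Union>t\<in>B. conv t)"
  by (rule closed_UN; use fin closed_hull T_KV St in auto)+
 have "g' ` Y \<subseteq> (\<Union>t\<in>A. conv t) Un (\<Union>t\<in>B. conv t)" using cov by blast
 moreover have "(\<Union>t\<in>A. conv t) Int g' ` Y ~= {}" "(\<Union>t\<in>B. conv t) Int g' ` Y ~= {}"
  using AB(2,3) meets by blast+
 ultimately have "(\<Union>t\<in>A. conv t) Int (\<Union>t\<in>B. conv t) Int g' ` Y ~= {}"
  using connected_closedD[OF Z _ _ cl] by blast
 then obtain y t t' where y: "y : Y" and t: "t : A" "g' y : conv t" "t' : B" "g' y : conv t'" by blast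
 have tt: "t : T" "v : t" "t' : T" "v : t'" using St t by blast+
 have ne: "t ~= t'" using AB(4) t by blast
 have yi: "g' y : conv (t Int t')" using KV_inter[OF T_KV[OF tt(1)] T_KV[OF tt(3)]] t by blast
 \<comment> \<open>The common face contains \<open>v\<close> and a further point, and it is not a
   whole triangle, so it is an edge.\<close>
 have "g' y ~= v" using near(5)[of y] YM[OF y] by blast
 have fint: "finite t" "card t = 3" using KV_finite T_KV T_card tt(1) by blast+
 have "card (t Int t') ~= 0" using tt(2,4) fint by auto
 moreover have "card (t Int t') ~= 1"
 proof
  assume "card (t Int t') = 1"
  then obtain w where "t Int t' = {w}" using card_1_singletonE by blast
  moreover have "v : t Int t'" using tt by blast
  ultimately have e: "t Int t' = {v}" by simp
  show False using yi \<open>g' y ~= v\<close> unfolding e by simp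
 qed
 moreover have "card (t Int t') < 3"
 proof (rule ccontr)
  assume "~ card (t Int t') < 3"
  then have "t Int t' = t" using card_seteq[OF fint(1), of "t Int t'"] fint(2) by simp
  then have "t \<subseteq> t'" by blast
  then show False using T_max[OF tt(1) T_KV[OF tt(3)]] ne by simp
 qed
 ultimately have "card (t Int t') = 2" by linarith
 then show "EX t:A. EX t':B. card (t Int t') = 2 & v : t Int t'" using t tt by blast
qed

end

section \<open>Carriers of points, closed subsurfaces and admissible colorings\<close>

context foam
begin

definition car :: "real^3 => (real^3) set" where
 "car p = (SOME C. C : KV & p : relint C)"

lemma car: assumes "p : F" shows "car p : KV" "p : rel_interior (conv (car p))"
proof -
 have "EX C. C : KV & p : relint C" using carrier_ex[OF assms] by metis
 from someI_ex[OF this] show "car p : KV" "p : rel_interior (conv (car p))" by (simp_all add: car_def)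
qed

lemma car_iff: assumes "p : F" "t : T" shows "car p \<subseteq> t \<longleftrightarrow> p : conv t"
proof
 assume "car p \<subseteq> t"
 then show "p : conv t" using car[OF assms(1)] hull_mono[of "car p" t] rel_interior_subset by blast
next
 assume "p : conv t"
 then show "car p \<subseteq> t" using carrier_sub[OF car(1)[OF assms(1)] T_KV[OF assms(2)] car(2)[OF assms(1)]] by blast
qed

lemma car_ne: "p : F ==> car p ~= {}" using car(2) by fastforce

lemma car_cells: assumes "p : F" shows "car p : cells T"
 using pure[OF car(1)[OF assms] car_ne[OF assms]] car_ne[OF assms] unfolding cells_def by blast

lemma star_car_ne: assumes "p : F" shows "star (car p) ~= {}"
 using pure[OF car(1)[OF assms] car_ne[OF assms]] unfolding star_def by blast

lemma car_fac: assumes "p : S0" "t : star (car p)" shows "fac t = facet_containing F p"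
proof -
 have "p : F" "t : T" "car p \<subseteq> t" using assms by (auto simp: S0_def star_def)
 then show ?thesis using fac_eq[OF _ assms(1)] car_iff by metis
qed

lemma surf_closed:
 assumes k: "proper_coloring T k" and ij: "i : {1,2,3}" "j : {1,2,3}" "i ~= j"
 shows "closed_surface {t:T. k t : {i,j}}"
 unfolding closed_surface_def
proof (intro conjI ballI)
 fix e assume e: "e : edges_of {t:T. k t : {i,j}}"
 then obtain t where t: "card e = 2" "t : T" "k t : {i,j}" "e \<subseteq> t" by (auto simp: edges_of_def)
 have eT: "e : edges_of T" using t by (auto simp: edges_of_def)
 have ts: "t : star e" using t by (simp add: star_def)
 have eq: "{t : {t:T. k t : {i,j}}. e \<subseteq> t} = {t:star e. k t : {i,j}}" by (auto simp: star_def)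
 have "card {t:star e. k t : {i,j}} = 2"
 proof (cases "card (star e) = 2")
  case True
  have "k t' : {i,j}" if "t' : star e" for t' using proper_edge[OF k eT ts that] t(3) True by (cases "t = t'") auto
  then have "{t:star e. k t : {i,j}} = star e" by blast
  then show ?thesis using True by simp
 next
  case False
  then have c3: "card (star e) = 3" using edge_degree[OF eT] by blast
  note p3 = proper_three[OF k eT c3]
  have "k ` {t:star e. k t : {i,j}} = {i,j} Int k ` star e" by blast
  also have "\<dots> = {i,j}" unfolding p3(2) using ij by blast
  finally have "card (k ` {t:star e. k t : {i,j}}) = 2" using ij(3) by simp
  moreover have "inj_on k {t:star e. k t : {i,j}}" using p3(1) by (rule inj_on_subset) blast
  ultimately show ?thesis by (simp add: card_image)
 qed
 then show "card {t : {t:T. k t : {i,j}}. e \<subseteq> t} = 2" unfolding eq .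
qed (use finT T_card in auto)

lemma mod2: assumes "C \<subseteq> T" "closed_surface C" shows "mod2_cycle C"
proof
 show "finite C" using finT assms(1) finite_subset by blast
 fix t assume t: "t : C"
 then show "card t = 3" "~ affine_dependent t" using assms(1) T_card KV_indep T_KV by blast+
 fix t' assume "t' : C"
 then show "conv t Int conv t' = conv (t Int t')" using KV_inter T_KV t assms(1) by blast
next
 fix e assume "e : edges_of C"
 then have "card {t:C. e \<subseteq> t} = 2" using assms(2) by (simp add: closed_surface_def)
 then show "even (card {t:C. e \<subseteq> t})" by simp
qed

text \<open>At an edge, \<open>C\<close> and the whole bicolored surface both have two triangles, so
  \<open>C\<close> is closed under adjacency; connected links extend this to vertices. Since all
  triangles at a planar point have the same color, \<open>C\<close> contains the whole foam near
  such a point.\<close>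

lemma closed_star:
 assumes k: "proper_coloring T k" and ij: "i : {1,2,3}" "j : {1,2,3}" "i ~= j"
  and C: "C \<subseteq> {t:T. k t : {i,j}}" "closed_surface C"
  and p: "p : S0" and t: "t : C" "p : conv t" and t': "t' : T" "p : conv t'"
 shows "t' : C"
proof (rule ccontr)
 assume n: "t' ~: C"
 define S where "S = {t:T. k t : {i,j}}"
 have S: "closed_surface S" unfolding S_def by (rule surf_closed[OF k ij])
 have lp: "loc_plane F p" "p : F" using p S0_eq by auto
 have step: "s' : C" if "s : C" "s' : S" "e \<subseteq> s" "e \<subseteq> s'" "card e = 2" for s s' e
 proof -
  have CS: "C \<subseteq> S" using C(1) S_def by simp
  have "e : edges_of C" "e : edges_of S" using that CS by (auto simp: edges_of_def)
  then have c: "card {t:C. e \<subseteq> t} = 2" "card {t:S. e \<subseteq> t} = 2" using C(2) S by (auto simp: closed_surface_def)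
  have "finite S" using S by (simp add: closed_surface_def)
  then have f: "finite {t:S. e \<subseteq> t}" by simp
  have "{t:C. e \<subseteq> t} \<subseteq> {t:S. e \<subseteq> t}" using CS by blast
  from card_subset_eq[OF f this] have "{t:C. e \<subseteq> t} = {t:S. e \<subseteq> t}" using c by linarith
  moreover have "s' : {t:S. e \<subseteq> t}" using that by simp
  ultimately show ?thesis by blast
 qed
 have tT: "t : T" "k t : {i,j}" using t C(1) by auto
 have same: "k s = k t" if "s : T" "p : conv s" for s using mono_lp[OF k lp that tT(1) t(2)] .
 have t'S: "t' : S" using same[OF t'] t'(1) tT(2) by (simp add: S_def)
 have sub: "car p \<subseteq> t" "car p \<subseteq> t'" using car_iff[OF lp(2)] tT(1) t(2) t' by blast+
 have "card (car p) ~= 0" using car_ne[OF lp(2)] KV_finite[OF car(1)[OF lp(2)]] by simp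
 then consider "card (car p) = 1" | "card (car p) = 2" | "card (car p) = 3" using card_KV[OF car(1)[OF lp(2)]] by linarith
 then show False
 proof cases
  case 1
  then obtain v where v: "car p = {v}" using card_1_singletonE by blast
  then have vt: "v : t" "v : t'" using sub by auto
  have "vertex_linked S v" unfolding S_def by (rule linked[OF k ij])
  moreover have "{s:C. v : s} Un {s:S - C. v : s} = {s:S. v : s}" using C(1) S_def by blast
  moreover have "{s:C. v : s} ~= {}" "{s:S - C. v : s} ~= {}" using t(1) t'S n vt by blast+
  moreover have "{s:C. v : s} Int {s:S - C. v : s} = {}" by blast
  ultimately obtain s s' where s: "s : {s:C. v : s}" "s' : {s:S - C. v : s}" "card (s Int s') = 2"
   unfolding vertex_linked_def by meson
  then show False using step[of s s' "s Int s'"] by auto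
 next
  case 2
  then show False using step[OF t(1) t'S sub] n by blast
 next
  case 3
  then have "car p : T" using car(1)[OF lp(2)] by (simp add: T_def)
  then have "t = t'" using T_max[of "car p" t] T_max[of "car p" t'] sub tT(1) t'(1) T_KV by metis
  then show False using n t(1) by simp
 qed
qed

lemma edge_facets: assumes e: "e : edges_of T" and x: "x : relint e"
 shows "{f : facets F. x : closure f} = fac ` star e"
proof -
 obtain t0 where t0: "t0 : T" "e \<subseteq> t0" using e by (auto simp: edges_of_def)
 have eK: "e : KV" by (rule KV_sub[OF T_KV[OF t0(1)] t0(2)])
 have xe: "x : conv e" using x rel_interior_subset by blast
 have xt: "x : conv t \<longleftrightarrow> t : star e" if "t : T" for t
  using carrier_sub[OF eK T_KV[OF that] x] hull_mono[of e t] xe that unfolding star_def by blast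
 have "x : closure f \<longleftrightarrow> f : fac ` star e" if f: "f : facets F" for f
  unfolding closure_facet[OF f] using xt star_T by blast
 then show ?thesis using fac_facet star_T by blast
qed

lemma adm_proper:
 assumes c: "c : admissible_colorings F l"
 shows "proper_coloring T (\<lambda>t\<in>T. c (fac t))"
 unfolding proper_coloring_def
proof (intro conjI ballI impI)
 show "(\<lambda>t\<in>T. c (fac t)) : T \<rightarrow>\<^sub>E {1,2,3}"
  using c fac_facet unfolding admissible_colorings_def by (auto simp: PiE_iff)
 fix e t t' assume e: "e : edges_of T" and t: "t : T" "t' : T" "e \<subseteq> t" "e \<subseteq> t'" "t ~= t'"
 have st: "t : star e" "t' : star e" using t by (auto simp: star_def)
 have e0: "e ~= {}" using e by (auto simp: edges_of_def)
 then obtain x where x: "x : relint e" using rel_interior_eq_empty[of "conv e"] by auto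
 have xh: "x : conv s" if "e \<subseteq> s" for s using x rel_interior_subset hull_mono[OF that] by blast
 show "((\<lambda>t\<in>T. c (fac t)) t = (\<lambda>t\<in>T. c (fac t)) t') = (card {t:T. e \<subseteq> t} = 2)"
 proof (cases "card (star e) = 2")
  case True
  have "loc_plane F x" by (rule edge_2_lp[OF e x True])
  then have "x : S0" using KV_F[OF T_KV[OF t(1)]] xh[OF t(3)] S0_eq by blast
  then have "fac t = fac t'" using fac_eq[OF t(1)] fac_eq[OF t(2)] xh t(3,4) by metis
  then show ?thesis using True t by (simp add: star_def)
 next
  case False
  then have c3: "card (star e) = 3" using edge_degree[OF e] by blast
  have "bij_betw c {f : facets F. x : closure f} {1,2,3}"
   using c edge_3_seam[OF e x c3] unfolding admissible_colorings_def by blast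
  then have b: "c ` fac ` star e = {1,2,3}" unfolding edge_facets[OF e x] by (simp add: bij_betw_def)
  have "inj_on (%t. c (fac t)) (star e)"
   by (rule eq_card_imp_inj_on[OF finite_star]) (use b c3 in \<open>simp add: image_image\<close>)
  then have "c (fac t) ~= c (fac t')" using st t(5) by (auto dest: inj_onD)
  then show ?thesis using c3 t by (simp add: star_def)
 qed
qed

text \<open>A seam point may be a vertex of the triangulation, so the edge is taken from a nearby
  point on the axis of its tripod chart. The two points lie in the closures of the same facets,
  namely those that contain a leg of the chart.\<close>

lemma seam_edge:
 assumes p: "seam_point F p"
 obtains e where "e : edges_of T" "card (star e) = 3" "{f : facets F. p : closure f} = fac ` star e"
proof -
 have pF: "p : F" using p by (simp add: seam_point_def)
 obtain U U' g g' where gm: "germ F p tripod_model 0 U U' g g'" using p unfolding seam_point_def by (auto elim: pl_locally_like_germ)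
 interpret germ F p tripod_model 0 U U' g g' by (rule gm)
 let ?H = "th ` I3"
 obtain e where e: "e > 0" "!!C q. C : KV ==> dist p q < e ==> q : conv C ==> p : conv C" using star_nbhd by blast
 obtain d where d: "d > 0" "!!c. c : tripod_model ==> dist 0 c < d ==> c : U' & g' c : U & dist p (g' c) < e"
  using germ.small[OF sym e(1)] by blast
 have hp: "connected (h Int ball 0 d)" "h \<subseteq> tripod_model" "!!y. y : h ==> loc_plane tripod_model y" if h: "h : ?H" for h
 proof -
  obtain a where a: "h = th a" "a : I3" using h by (rule imageE)
  show "connected (h Int ball 0 d)" unfolding a(1) by (intro convex_connected convex_Int th_convex[OF a(2)] convex_ball)
  show "h \<subseteq> tripod_model" "!!y. y : h ==> loc_plane tripod_model y" unfolding a(1) using th_sub[OF a(2)] th_loc_plane[OF a(2)] by blast+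
 qed
 \<comment> \<open>The right-hand side does not mention \<open>w\<close>, so all axis points in the
   ball, the origin included, see the same facets.\<close>
 have key: "{f : facets F. g' w : closure f} = {f : facets F. EX h:?H. g' ` (h Int ball 0 d) Int f ~= {}}"
  if w: "w : tripod_model" "w ~: \<Union>?H" "dist 0 w < d" for w
 proof -
  note dw = d(2)[OF w(1,3)]
  have "g' w : closure f \<longleftrightarrow> (EX h:?H. g' ` (h Int ball 0 d) Int f ~= {})" if f: "f : facets F" for f
  proof
   assume cl: "g' w : closure f"
   interpret w: germ F "g' w" tripod_model w U U' g g' using at_point[of "g' w"] dw gg(3)[of w] by simp
   obtain r where r: "r > 0" "!!q. q : F ==> dist (g' w) q < r ==> q : U & g q : U' & dist w (g q) < d - dist 0 w"
    using w.small[of "d - dist 0 w"] w(3) by (metis diff_gt_0_iff_gt)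
   obtain q where q: "q : f" "dist q (g' w) < r" using cl r(1) unfolding closure_approachable by blast
   have qS: "q : S0" using facet_point[OF f q(1)] by blast
   then have qq: "q : U" "g q : U'" "dist w (g q) < d - dist 0 w" using r(2)[of q] q(2) by (auto simp: dist_commute S0_def)
   have "loc_plane tripod_model (g q)" using lp_iff[OF qq(1)] qS S0_eq by blast
   then obtain h where h: "h : ?H" "g q : h" using tripod_facts(3)[of "g q"] qq(2) UY by blast
   have "dist 0 (g q) < d" using qq(3) dist_triangle[of 0 "g q" w] by linarith
   then have "g' (g q) : g' ` (h Int ball 0 d)" using h(2) by (intro imageI) simp
   then show "EX h:?H. g' ` (h Int ball 0 d) Int f ~= {}" using h(1) q(1) gg(1)[OF qq(1)] by auto
  next
   assume "EX h:?H. g' ` (h Int ball 0 d) Int f ~= {}"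
   then obtain h where h: "h : ?H" "f Int g' ` (h Int ball 0 d) ~= {}" by blast
   have hU: "c : U' & g' c : U" if "c : h Int ball 0 d" for c using d(2)[of c] hp(2)[OF h(1)] that by auto
   have "connected (g' ` (h Int ball 0 d))" by (rule connected_image[OF hp(1)[OF h(1)]]) (use hU in blast)
   moreover have "g' ` (h Int ball 0 d) \<subseteq> F - singular_graph F"
   proof (rule image_subsetI)
    fix c assume c: "c : h Int ball 0 d"
    have "loc_plane F (g' c)" using lp_iff[of "g' c"] gg(3)[of c] hU[OF c] hp(3)[OF h(1)] c by simp
    then show "g' c : F - singular_graph F" using hU[OF c] UX unfolding singular_graph_eq by blast
   qed
   ultimately have sub: "g' ` (h Int ball 0 d) \<subseteq> f" using components_maximal[OF f[unfolded facets_def]] h(2) by blast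
   have "w : ball 0 d Int closure h" using tripod_facts(4)[OF w(1,2) h(1)] w(3) by simp
   then have "w : closure (ball 0 d Int h)" using open_Int_closure_subset[OF open_ball] by blast
   then have "w : closure (h Int ball 0 d)" by (simp add: Int_commute)
   then have "g' w : closure (g' ` (h Int ball 0 d Int U'))"
    using germ.closure_imp[OF sym, of w "h Int ball 0 d"] dw hp(2)[OF h(1)] by blast
   then show "g' w : closure f" using closure_mono[of "g' ` (h Int ball 0 d Int U')" f] sub by blast
  qed
  then show ?thesis by blast
 qed
 \<comment> \<open>An axis point other than the origin. Its carrier has at least two vertices,
   because the whole simplex through \<open>p\<close> near it cannot be a single point, and
   nonplanarity rules out a triangle.\<close>
 define w :: "real^3" where "w = tc (%_. 0) (d/2)"
 have q0: "tq a w = 0" if "a : I3" for a unfolding w_def by (rule tq_tc[of _ 0]) (use that in auto)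
 have w3: "w = (d/2) *\<^sub>R axis 3 1" by (simp add: w_def tc_def vec_eq_iff forall_3 axis_def)
 then have w: "dist 0 w < d" "w ~= 0" using d(1) by (auto simp: axis_eq_0_iff)
 have wM: "w : tripod_model" "w ~: \<Union>?H" using q0 by (force simp: tripod_eq th_def)+
 note dw = d(2)[OF wM(1) w(1)]
 have nlp: "~ loc_plane F (g' w)" using lp_iff[of "g' w"] dw gg(3)[of w] tripod_facts(3)[OF wM] by simp
 have ne: "g' w ~= p" using gg(3)[of w] dw gx w(2) by metis
 have gF: "g' w : F" using dw UX by blast
 obtain C where C: "C : KV" "g' w : relint C" using carrier_ex[OF gF] .
 have "p : conv C" using e(2)[OF C(1), of "g' w"] dw C(2) rel_interior_subset by blast
 then have "card C >= 2" using carrier_ge_2[OF C _ ne] by blast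
 moreover have "card C ~= 3" using triangle_lp[of C] C nlp by (auto simp: T_def)
 ultimately have "card C = 2" using card_KV[OF C(1)] by linarith
 note Ce = edge_of_KV[OF C(1) this]
 have "card (star C) = 3" using edge_degree[OF Ce] edge_2_lp[OF Ce C(2)] nlp by blast
 moreover have "{f : facets F. p : closure f} = fac ` star C"
  using key[OF tripod_facts(2,5)] key[OF wM w(1)] edge_facets[OF Ce C(2)] d(1) g'y by simp
 ultimately show ?thesis by (rule that[OF Ce])
qed

text \<open>A simplex of \<open>K\<close> inside a union of triangles is a face of one of them, as
  its relative interior meets that triangle. With n vertices it has dimension n - 1, which explains
  the shift in the exponent of the sign.\<close>

lemma euler_surface:
 assumes "S \<subseteq> T"
 shows "euler_characteristic (subcomplex_of K (\<Union>t\<in>S. conv t)) = chi S"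
proof -
 have cK: "C : KV" "C ~= {}" if "C : cells S" for C
  using that KV_sub T_KV assms unfolding cells_def by blast+
 have eq: "subcomplex_of K (\<Union>t\<in>S. conv t) - {{}} = (%C. conv C) ` cells S"
 proof (intro equalityI subsetI)
  fix \<sigma> assume "\<sigma> : subcomplex_of K (\<Union>t\<in>S. conv t) - {{}}"
  then have s: "\<sigma> : K" "\<sigma> \<subseteq> (\<Union>t\<in>S. conv t)" "\<sigma> ~= {}" by (auto simp: subcomplex_of_def)
  obtain C where C: "C : KV" "\<sigma> = conv C" using KV_cover[OF s(1)] by blast
  have ne: "C ~= {}" using s(3) C(2) by auto
  then obtain x where x: "x : relint C" using rel_interior_eq_empty[of "conv C"] by auto
  then have "x : \<sigma>" using C(2) rel_interior_subset by blast
  then obtain t where t: "t : S" "x : conv t" using s(2) by blast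
  then have "C \<subseteq> t" using carrier_sub[OF C(1) T_KV x] assms by blast
  then have "C : cells S" using ne t(1) by (auto simp: cells_def)
  then show "\<sigma> : (%C. conv C) ` cells S" using C(2) by blast
 next
  fix \<sigma> assume "\<sigma> : (%C. conv C) ` cells S"
  then obtain C where C: "C : cells S" "\<sigma> = conv C" by blast
  then obtain t where "t : S" "C \<subseteq> t" by (auto simp: cells_def)
  then have "\<sigma> \<subseteq> (\<Union>t\<in>S. conv t)" using C(2) hull_mono[of C t] by blast
  moreover have "\<sigma> : K" "\<sigma> ~= {}" using cK[OF C(1)] C(2) by (auto simp: KV_def)
  ultimately show "\<sigma> : subcomplex_of K (\<Union>t\<in>S. conv t) - {{}}" by (simp add: subcomplex_of_def)
 qed
 have inj: "inj_on (%C. conv C) (cells S)" using KV_inj KV_indep cK by (auto intro!: inj_onI)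
 have "euler_characteristic (subcomplex_of K (\<Union>t\<in>S. conv t)) = (\<Sum>C\<in>cells S. (-1) ^ nat (aff_dim (conv C)))"
  unfolding euler_characteristic_def eq by (simp add: sum.reindex[OF inj])
 also have "\<dots> = (\<Sum>C\<in>cells S. (-1) ^ (card C + 1))"
 proof (rule sum.cong[OF refl])
  fix C assume C: "C : cells S"
  have "int (card C) = aff_dim C + 1" using aff_dim_affine_independent[OF KV_indep[OF cK(1)[OF C]]] by simp
  moreover have "card C ~= 0" using cK[OF C] KV_finite by simp
  ultimately have "card C = Suc (nat (aff_dim (conv C)))" by (simp add: aff_dim_convex_hull)
  then show "(-1::int) ^ nat (aff_dim (conv C)) = (-1) ^ (card C + 1)" by simp
 qed
 also have "\<dots> = chi S"
  by (rule chi_eq_sum_cells[symmetric]) (use assms finT T_card finite_subset in blast)+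
 finally show ?thesis .
qed

end

section \<open>Transfer to the evaluation of an anchored foam\<close>

locale anchored = foam +
 fixes D :: "(real^3) set" and l :: "real^3 => nat"
 assumes anch: "anchored_foam K D l"
begin

abbreviation "P \<equiv> anchor_points F"

lemma finite_P: "finite P" and finite_D: "finite D" and P_S0: "P \<subseteq> S0" and D_S0: "D \<subseteq> S0"
 and l_P: "p : P ==> l p : {1,2,3}" and trans_P: "p : P ==> transverse_to_anchor_line_at F p"
 using anch unfolding anchored_foam_def S0_def F_def[symmetric] by (auto simp: anchor_points_def)

lemma P_F: "p : P ==> p : F" and D_F: "q : D ==> q : F"
 using P_S0 D_S0 by (auto simp: S0_def)

lemma mono_card:
 assumes "p : S0" "proper_coloring T k"
 shows "card (k ` {t:T. car p \<subseteq> t}) = 1"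
proof -
 have p: "p : F" "loc_plane F p" using assms(1) S0_eq by auto
 obtain t where t: "t : star (car p)" using star_car_ne[OF p(1)] by blast
 have "k s = k t" if "s : star (car p)" for s
  using mono_lp[OF assms(2) p(2,1), of s t] car_iff[OF p(1)] that t unfolding star_def by blast
 then have "k ` star (car p) = {k t}" using t by blast
 then show ?thesis by (simp add: star_def)
qed

text \<open>Anchor points are planar, so \<open>closed_star\<close> shows that near them the foam
  coincides with the body of \<open>C\<close>; this is the local hypothesis of the parity statement
  for the line.\<close>

lemma anchors_even:
 assumes k: "proper_coloring T k" and ij: "i : {1,2,3}" "j : {1,2,3}" "i ~= j"
  and C: "C \<subseteq> {t:T. k t : {i,j}}" "closed_surface C"
 shows "even (card {p:P. car p : cells C})"
proof -
 have CT: "C \<subseteq> T" using C(1) by blast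
 interpret m: mod2_cycle C by (rule mod2[OF CT C(2)])
 have bF: "m.body \<subseteq> F" unfolding m.body_def using KV_F T_KV CT by blast
 have eq: "{p:P. car p : cells C} = m.body Int anchor_line"
 proof (intro equalityI subsetI)
  fix p assume "p : {p:P. car p : cells C}"
  then obtain t where t: "p : P" "t : C" "car p \<subseteq> t" by (auto simp: cells_def)
  then have "p : conv t" using car_iff[OF P_F] CT by blast
  then show "p : m.body Int anchor_line" using t by (auto simp: m.body_def anchor_points_def)
 next
  fix p assume p: "p : m.body Int anchor_line"
  then have pP: "p : P" using bF by (auto simp: anchor_points_def)
  obtain t where "t : C" "p : conv t" using p by (auto simp: m.body_def)
  then have "t : C" "car p \<subseteq> t" using car_iff[OF P_F[OF pP]] CT by blast+
  then show "p : {p:P. car p : cells C}" using pP car_ne[OF P_F[OF pP]] by (auto simp: cells_def)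
 qed
 show ?thesis unfolding eq
 proof (rule m.anchor_points_even[OF _ bF])
  show "finite (m.body Int anchor_line)" unfolding eq[symmetric] using finite_P by simp
  fix p assume "p : m.body Int anchor_line"
  then have p: "p : P" "p : m.body" unfolding eq[symmetric] using eq \<open>p : m.body Int anchor_line\<close> by auto
  show "transverse_to_anchor_line_at F p" by (rule trans_P[OF p(1)])
  obtain t where t: "t : C" "p : conv t" using p(2) by (auto simp: m.body_def)
  obtain e where e: "e > 0" "!!C q. C : KV ==> dist p q < e ==> q : conv C ==> p : conv C" using star_nbhd by blast
  have pS: "p : S0" using p(1) P_S0 by blast
  have "F Int ball p e \<subseteq> m.body"
  proof
   fix q assume q: "q : F Int ball p e"
   then obtain s where s: "s : T" "q : conv s" using F_triangles[of q] by blast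
   have "p : conv s" using e(2)[OF T_KV[OF s(1)] _ s(2)] q by simp
   then have "s : C" by (rule closed_star[OF k ij C pS t s(1)])
   then show "q : m.body" using s(2) by (auto simp: m.body_def)
  qed
  then show "EX r>0. F Int ball p r \<subseteq> m.body" using e(1) by blast
 qed
qed

lemma colored: "colored_complex T P car l D car"
proof
 show "card {t:T. e \<subseteq> t} : {2,3}" if "e : edges_of T" for e using edge_degree[OF that] by (simp add: star_def)
 fix k and i j :: nat assume kij: "proper_coloring T k" "i : {1,2,3}" "j : {1,2,3}" "i ~= j"
 show l: "vertex_linked {t:T. k t : {i,j}} v" for v by (rule linked[OF kij])
 have "{t:T. k t : {i,j}} \<subseteq> T" by blast
 from mod2_cycle.chi_even[OF mod2[OF this surf_closed[OF kij]] surf_closed[OF kij] l]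
 show "even (chi {t:T. k t : {i,j}})" .
qed (use finT T_card finite_P finite_D car_cells P_F D_F mono_card P_S0 D_S0 anchors_even l_P in blast)+

sublocale cc: colored_complex T P car l D car by (rule colored)

definition tri :: "((real^3) set => nat) => (real^3) set => nat" where
 "tri c = (\<lambda>t\<in>T. c (fac t))"

lemma tri_star: assumes "p : S0" shows "tri c ` {t:T. car p \<subseteq> t} = {c (facet_containing F p)}"
proof -
 have "tri c t = c (facet_containing F p)" if "t : {t:T. car p \<subseteq> t}" for t
  using car_fac[OF assms, of t] that by (simp add: tri_def star_def)
 moreover have "{t:T. car p \<subseteq> t} ~= {}" using star_car_ne[of p] assms by (simp add: star_def S0_def)
 ultimately show ?thesis by (auto simp: image_def)
qed

text \<open>A facet is connected and consists of planar points, so by \<open>mono_set\<close> a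
  proper coloring is constant on its triangles.\<close>

lemma proper_lift:
 assumes k: "proper_coloring T k"
 obtains c where "c : facets F \<rightarrow>\<^sub>E {1,2,3}" "tri c = k"
proof -
 define c where "c = (\<lambda>f\<in>facets F. k (SOME t. t : T & fac t = f))"
 have ck: "c (fac t) = k t" if t: "t : T" for t
 proof -
  define s where "s = (SOME s. s : T & fac s = fac t)"
  have "EX s. s : T & fac s = fac t" using t by blast
  then have s: "s : T" "fac s = fac t" using someI_ex[of "%s. s : T & fac s = fac t"] by (simp_all add: s_def)
  have m: "fac t Int conv u ~= {}" if "u : T" "fac u = fac t" for u
   using relint_ex[OF that(1)] relint_fac[OF that(1)] rel_interior_subset[of "conv u"] that(2) by blast
  have f: "fac t : components S0" using fac_facet[OF t] by (simp add: facets_def S0_def)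
  have "k s = k t" by (rule mono_set[OF k in_components_connected[OF f] in_components_subset[OF f] s(1) m[OF s] t m[OF t refl]])
  then show ?thesis using fac_facet[OF t] by (simp add: c_def s_def)
 qed
 have "c : facets F \<rightarrow>\<^sub>E {1,2,3}"
 proof (rule PiE_I)
  fix f assume "f : facets F"
  then obtain t where "t : T" "fac t = f" by (rule facet_triangle)
  then show "c f : {1,2,3}" using ck proper_range[OF k] by metis
 qed (simp add: c_def)
 moreover have "tri c = k"
 proof
  fix t show "tri c t = k t" using ck[of t] k unfolding proper_coloring_def tri_def by (cases "t : T") (auto simp: PiE_iff extensional_def)
 qed
 ultimately show ?thesis by (rule that)
qed

text \<open>The seam condition also demands three different facets at a seam point. For a lifted
  proper coloring this follows by counting: at most three facets occur at the corresponding edge,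
  and they take three colors.\<close>

lemma tri_bij: "bij_betw tri (admissible_colorings F l) cc.colorings"
proof (rule bij_betw_imageI)
 show "inj_on tri (admissible_colorings F l)"
 proof (rule inj_onI)
  fix c c' assume c: "c : admissible_colorings F l" "c' : admissible_colorings F l" "tri c = tri c'"
  have e: "c : facets F \<rightarrow>\<^sub>E {1,2,3}" "c' : facets F \<rightarrow>\<^sub>E {1,2,3}" using c by (auto simp: admissible_colorings_def)
  show "c = c'"
  proof (rule PiE_ext[OF e])
   fix f assume "f : facets F"
   then obtain t where "t : T" "fac t = f" by (rule facet_triangle)
   then show "c f = c' f" using fun_cong[OF c(3), of t] by (simp add: tri_def)
  qed
 qed
 show "tri ` admissible_colorings F l = cc.colorings"
 proof (intro equalityI subsetI)
  fix k assume "k : tri ` admissible_colorings F l"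
  then obtain c where c: "c : admissible_colorings F l" "k = tri c" by blast
  have "proper_coloring T k" unfolding c(2) tri_def by (rule adm_proper[OF c(1)])
  moreover have "k ` {t:T. car p \<subseteq> t} = {l p}" if "p : P" for p
   using tri_star[of p c] c that P_S0 unfolding admissible_colorings_def by auto
  ultimately show "k : cc.colorings" by (simp add: cc.colorings_def)
 next
  fix k assume "k : cc.colorings"
  then have k: "proper_coloring T k" "!!p. p : P ==> k ` {t:T. car p \<subseteq> t} = {l p}" by (auto simp: cc.colorings_def)
  obtain c where c: "c : facets F \<rightarrow>\<^sub>E {1,2,3}" "tri c = k" by (rule proper_lift[OF k(1)])
  have "bij_betw c {f : facets F. p : closure f} {1,2,3}" if p: "seam_point F p" for p
  proof -
   obtain e where e: "e : edges_of T" "card (star e) = 3" "{f : facets F. p : closure f} = fac ` star e" using seam_edge[OF p] .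
   have "c (fac t) = k t" if "t : star e" for t using c(2) star_T[OF that] by (auto simp: tri_def)
   then have "c ` fac ` star e = k ` star e" by (simp add: image_image)
   then have im: "c ` fac ` star e = {1,2,3}" using proper_three(2)[OF k(1) e(1,2)] by simp
   have "card (fac ` star e) <= 3" using card_image_le[OF finite_star, of fac e] e(2) by simp
   moreover have "card (c ` fac ` star e) <= card (fac ` star e)" using finite_star by (intro card_image_le) simp
   ultimately have "card (c ` fac ` star e) = card (fac ` star e)" unfolding im by simp
   then have "inj_on c (fac ` star e)" using finite_star by (intro eq_card_imp_inj_on) simp_all
   then show ?thesis unfolding e(3) bij_betw_def using im by simp
  qed
  moreover have "c (facet_containing F p) = l p" if "p : P" for p
   using tri_star[of p c] k(2)[OF that] P_S0 that unfolding c(2) by auto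
  ultimately have "c : admissible_colorings F l" using c(1) by (simp add: admissible_colorings_def)
  then show "k : tri ` admissible_colorings F l" using c(2) by blast
 qed
qed

lemma dots_tri: "dots_of_color F D c i = cc.dots (tri c) i"
proof -
 have "{q:D. c (facet_containing F q) = i} = {q:D. tri c ` {t:T. car q \<subseteq> t} = {i}}"
  using tri_star D_S0 by auto
 then show ?thesis by (simp add: dots_of_color_def cc.dots_def)
qed

lemma euler_tri: "euler_characteristic (subcomplex_of K (bicolored_surface F c i j)) = chi (cc.surf (tri c) i j)"
proof -
 have "bicolored_surface F c i j = (\<Union>t\<in>cc.surf (tri c) i j. conv t)"
 proof (intro equalityI subsetI)
  fix x assume "x : bicolored_surface F c i j"
  then obtain f where f: "f : facets F" "c f : {i,j}" "x : closure f" by (auto simp: bicolored_surface_def)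
  then obtain t where "t : T" "fac t = f" "x : conv t" using closure_facet by blast
  then show "x : (\<Union>t\<in>cc.surf (tri c) i j. conv t)" using f(2) by (auto simp: cc.surf_def tri_def)
 next
  fix x assume "x : (\<Union>t\<in>cc.surf (tri c) i j. conv t)"
  then obtain t where t: "t : T" "c (fac t) : {i,j}" "x : conv t" by (auto simp: cc.surf_def tri_def)
  then have "x : closure (fac t)" using closure_facet[OF fac_facet[OF t(1)]] by blast
  then show "x : bicolored_surface F c i j" using t fac_facet[OF t(1)] by (auto simp: bicolored_surface_def)
 qed
 then show ?thesis using euler_surface[of "cc.surf (tri c) i j"] by (simp add: cc.surf_def)
qed

lemma anchor_product:
 fixes x :: "nat => 'a::comm_ring_1"
 shows "(\<Prod>p\<in>P. \<Prod>j\<in>{1,2,3} - {l p}. x (l p) + x j) =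
  (x 1 + x 2) ^ cc.nlab 1 2 * (x 1 + x 3) ^ cc.nlab 1 3 * (x 2 + x 3) ^ cc.nlab 2 3"
proof -
 let ?g = "%i j p. if l p : {i,j} then x i + x j else 1"
 have pw: "(\<Prod>p\<in>P. ?g i j p) = (x i + x j) ^ cc.nlab i j" for i j
  using finite_P by (simp add: cc.nlab_def prod.If_cases Int_def)
 have "(\<Prod>j\<in>{1,2,3} - {l p}. x (l p) + x j) = ?g 1 2 p * ?g 1 3 p * ?g 2 3 p" if pP: "p : P" for p
 proof -
  have s: "{1,2,3::nat} - {1} = {2,3}" "{1,2,3::nat} - {2} = {1,3}" "{1,2,3::nat} - {3} = {1,2}" by auto
  consider "l p = 1" | "l p = 2" | "l p = 3" using l_P[OF pP] by blast
  then show ?thesis by cases (simp_all only: s, simp_all add: add.commute)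
 qed
 then have "(\<Prod>p\<in>P. \<Prod>j\<in>{1,2,3} - {l p}. x (l p) + x j) = (\<Prod>p\<in>P. ?g 1 2 p * ?g 1 3 p * ?g 2 3 p)"
  by (rule prod.cong[OF refl])
 also have "\<dots> = (\<Prod>p\<in>P. ?g 1 2 p) * (\<Prod>p\<in>P. ?g 1 3 p) * (\<Prod>p\<in>P. ?g 2 3 p)" by (simp only: prod.distrib)
 finally show ?thesis unfolding pw .
qed

lemma evaluation_tri:
 assumes two: "(1::'k::field) + 1 = 0" and c: "c : admissible_colorings F l"
 shows "(colored_evaluation K D l c :: 'k ratfun) = (\<Prod>i\<in>{1,2,3}. var_x i ^ cc.dots (tri c) i) *
  ((var_x 1 + var_x 2) powi cc.expo (tri c) 1 2 * (var_x 1 + var_x 3) powi cc.expo (tri c) 1 3 * (var_x 2 + var_x 3) powi cc.expo (tri c) 2 3)"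
proof -
 let ?x = "var_x :: nat => 'k ratfun"
 let ?n = "%i j. cc.nlab i j div 2"
 have kc: "tri c : cc.colorings" using tri_bij c by (auto simp: bij_betw_def)
 have ev: "even (cc.nlab 1 2)" "even (cc.nlab 1 3)" "even (cc.nlab 2 3)" by (rule cc.nlab_even[OF kc]; simp)+
 have two': "(1::'k ratfun) + 1 = 0"
 proof -
  have "(1::'k poly poly poly) + 1 = 0" by (intro poly_two two)
  then have "Fract (1 + 1) 1 = (0 :: 'k ratfun)" by (simp only: Zero_fract_def)
  then show ?thesis by (simp add: One_fract_def)
 qed
 have sq: "a ^ n = (a ^ (n div 2))\<^sup>2" if "even n" for a :: "'k ratfun" and n
  using that by (simp flip: power_mult)
 \<comment> \<open>The square root can be written down, because the number of anchor points with a
   label in each pair is even.\<close>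
 define r where "r = (?x 1 + ?x 2) ^ ?n 1 2 * (?x 1 + ?x 3) ^ ?n 1 3 * (?x 2 + ?x 3) ^ ?n 2 3"
 have "(\<Prod>p\<in>P. \<Prod>j\<in>{1,2,3} - {l p}. ?x (l p) + ?x j) = r\<^sup>2"
  unfolding anchor_product r_def power_mult_distrib using ev by (simp only: sq[symmetric])
 then have s: "sqrt_char2 (\<Prod>p\<in>P. \<Prod>j\<in>{1,2,3} - {l p}. ?x (l p) + ?x j) = r" by (simp only: sqrt_char2_square[OF two'])
 have q: "(?x i + ?x j) powi cc.expo (tri c) i j = (?x i + ?x j) ^ ?n i j / (?x i + ?x j) powi (chi (cc.surf (tri c) i j) div 2)"
  if "i : {1,2,3}" "j : {1,2,3}" "i ~= j" for i j
 proof -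
  have "int (cc.nlab i j) div 2 = int (?n i j)" by (simp add: zdiv_int)
  then show ?thesis unfolding cc.expo_def by (simp add: power_int_diff[OF disjI1[OF var_x_sum_nonzero[OF two that]]])
 qed
 have pr: "(\<Prod>(i, j)\<in>{(1,2), (1,3), (2,3)}. (?x i + ?x j) powi (euler_characteristic (subcomplex_of K (bicolored_surface F c i j)) div 2)) =
  (?x 1 + ?x 2) powi (chi (cc.surf (tri c) 1 2) div 2) * (?x 1 + ?x 3) powi (chi (cc.surf (tri c) 1 3) div 2) * (?x 2 + ?x 3) powi (chi (cc.surf (tri c) 2 3) div 2)"
  unfolding euler_tri by (simp add: mult.assoc)
 have "colored_evaluation K D l c = (\<Prod>i\<in>{1,2,3}. ?x i ^ cc.dots (tri c) i) * r /
  ((?x 1 + ?x 2) powi (chi (cc.surf (tri c) 1 2) div 2) * (?x 1 + ?x 3) powi (chi (cc.surf (tri c) 1 3) div 2) * (?x 2 + ?x 3) powi (chi (cc.surf (tri c) 2 3) div 2))"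
  unfolding colored_evaluation_def F_def[symmetric] s pr dots_tri ..
 moreover have "(?x 1 + ?x 2) powi cc.expo (tri c) 1 2 * (?x 1 + ?x 3) powi cc.expo (tri c) 1 3 * (?x 2 + ?x 3) powi cc.expo (tri c) 2 3 =
  r / ((?x 1 + ?x 2) powi (chi (cc.surf (tri c) 1 2) div 2) * (?x 1 + ?x 3) powi (chi (cc.surf (tri c) 1 3) div 2) * (?x 2 + ?x 3) powi (chi (cc.surf (tri c) 2 3) div 2))"
  using q[of 1 2] q[of 1 3] q[of 2 3] by (simp add: r_def)
 ultimately show ?thesis by (simp only: times_divide_eq_right)
qed

theorem evaluation_in_polynomial_ring:
 assumes "(1::'k::field) + 1 = 0"
 shows "(evaluation K D l :: 'k ratfun) : polynomial_ring_x"
proof -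
 let ?g = "%k. (\<Prod>i\<in>{1,2,3}. var_x i ^ cc.dots k i) *
  ((var_x 1 + var_x 2) powi cc.expo k 1 2 * (var_x 1 + var_x 3) powi cc.expo k 1 3 * (var_x 2 + var_x 3) powi cc.expo k 2 3) :: 'k ratfun"
 have "(evaluation K D l :: 'k ratfun) = (\<Sum>c\<in>admissible_colorings F l. ?g (tri c))"
  unfolding evaluation_def F_def[symmetric] using evaluation_tri[OF assms] by (intro sum.cong) simp_all
 also have "\<dots> = (\<Sum>k\<in>cc.colorings. ?g k)" by (rule sum.reindex_bij_betw[OF tri_bij])
 finally show ?thesis using cc.evaluation_polynomial[OF assms] by simp
qed

end

theorem proposition3p9:
  fixes K :: "(real^3) set set" and D :: "(real^3) set" and l :: "real^3 \<Rightarrow> nat"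
  assumes "CHAR('k::field) = 2"
    and "anchored_foam K D l"
  shows "(evaluation K D l :: 'k ratfun) \<in> polynomial_ring_x"
proof -
 interpret anchored K D l
  by unfold_locales (use assms(2) in \<open>simp_all add: anchored_foam_def\<close>)
 show ?thesis by (rule evaluation_in_polynomial_ring[OF two_eq_0_field[OF assms(1)]])
qed

end
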